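(* There is a randomized algorithm that takes as input an integer $n$, an array $f$ of length $n$ (accessed by queries) and an error parameter $\overline{\tau}\in(0,1)$, runs in time $(\log n)^{O(1/\overline{\tau})}$, and outputs a value that, with probability at least $1-n^{-\Omega(\log n)}$, is a $\left(\overline{\tau},\frac{5}{\overline{\tau}\log n}\right)$-approximation to $\mathrm{lis}_f$.
   Context: The array is a function $f:\{1,\dots,n\}\to\{1,\dots,\mathrm{valbound}\}$, where $\mathrm{valbound}$ is a known upper bound on the values. An increasing subsequence of $f$ is a sequence of indices $i_1<\cdots<i_k$ with $f(i_1)\le\cdots\le f(i_k)$; $\mathrm{lis}_f$ is the maximum length of an increasing subsequence and $\mathrm{loss}_f=n-\mathrm{lis}_f$. For $\tau,\delta\in(0,1)$ (or $\delta>0$), a number $A$ is a $(\tau,\delta)$-approximation to $\mathrm{lis}_f$ if $|A-\mathrm{lis}_f|\le \tau\,\mathrm{loss}_f+\delta n$. *)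

theory Defs
  imports "HOL-Probability.Probability"
begin

section \<open>Longest increasing subsequences\<close>

text \<open>An array of length \<open>n\<close> with values bounded by \<open>vb\<close> is a function on \<open>nat\<close> of which
  only the restriction to \<open>{1..n}\<close> matters.\<close>

definition is_array :: "nat \<Rightarrow> nat \<Rightarrow> (nat \<Rightarrow> nat) \<Rightarrow> bool" where
  "is_array n vb f \<longleftrightarrow> f ` {1..n} \<subseteq> {1..vb}"

definition increasing_subseq :: "nat \<Rightarrow> (nat \<Rightarrow> nat) \<Rightarrow> nat list \<Rightarrow> bool" where
  "increasing_subseq n f js \<longleftrightarrow>
     set js \<subseteq> {1..n} \<and> sorted_wrt (<) js \<and> sorted_wrt (\<le>) (map f js)"

definition lis :: "nat \<Rightarrow> (nat \<Rightarrow> nat) \<Rightarrow> nat" where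
  "lis n f = Max {length js |js. increasing_subseq n f js}"

definition loss :: "nat \<Rightarrow> (nat \<Rightarrow> nat) \<Rightarrow> nat" where
  "loss n f = n - lis n f"

definition is_lis_approx :: "nat \<Rightarrow> (nat \<Rightarrow> nat) \<Rightarrow> real \<Rightarrow> real \<Rightarrow> real \<Rightarrow> bool" where
  "is_lis_approx n f \<tau> \<delta> A \<longleftrightarrow>
     \<bar>A - real (lis n f)\<bar> \<le> \<tau> * real (loss n f) + \<delta> * real n"

section \<open>Randomized algorithms with query access\<close>

text \<open>
  The machine model is the unit-cost random access machine in structured form: memory cells,
  addressed by integers, hold integers. A program is a finite syntactic object that does not depend
  on the input. Its expressions have fixed size, so evaluating one takes a constant number of
  elementary operations; a step executes one command or one test.

  Arithmetic is restricted to addition, subtraction and halving. Without a unit-cost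
  multiplication, a step can add only a constant number of bits (depending on the program) to the
  largest number in memory, so that unit cost is a realistic measure of time.

  The real parameter \<open>\<tau>\<close> cannot be stored in a cell. It is accessed by comparing it with
  fractions: \<open>Param_less p q\<close> tests \<open>p < q * \<tau>\<close>.
\<close>

datatype exp =
    Num int
  | Load exp
  | Add exp exp
  | Sub exp exp
  | Half exp

datatype test =
    Less exp exp
  | Param_less exp exp

datatype com =
    Skip
  | Store exp exp
  | Query exp exp
  | Random exp exp
  | Seq com com
  | If test com com
  | While test com

type_synonym mem = "int \<Rightarrow> int"

primrec eval_exp :: "mem \<Rightarrow> exp \<Rightarrow> int" where
  "eval_exp m (Num k) = k"
| "eval_exp m (Load a) = m (eval_exp m a)"
| "eval_exp m (Add a b) = eval_exp m a + eval_exp m b"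
| "eval_exp m (Sub a b) = eval_exp m a - eval_exp m b"
| "eval_exp m (Half a) = eval_exp m a div 2"

primrec eval_test :: "real \<Rightarrow> mem \<Rightarrow> test \<Rightarrow> bool" where
  "eval_test \<tau> m (Less a b) \<longleftrightarrow> eval_exp m a < eval_exp m b"
| "eval_test \<tau> m (Param_less p q) \<longleftrightarrow> of_int (eval_exp m p) < of_int (eval_exp m q) * \<tau>"

definition query :: "nat \<Rightarrow> (nat \<Rightarrow> nat) \<Rightarrow> int \<Rightarrow> int" where
  "query n f i = (if 1 \<le> i \<and> i \<le> int n then int (f (nat i)) else 0)"

text \<open>Uniform on \<open>{0..<k}\<close> for positive \<open>k\<close>, and constantly \<open>0\<close> otherwise.\<close>

definition uniform_below :: "int \<Rightarrow> int pmf" where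
  "uniform_below k = pmf_of_set {0..<max 1 k}"

text \<open>A configuration consists of the stack of commands still to be executed and the memory;
  the machine has halted when the stack is empty. The commands \<open>Store a e\<close>, \<open>Query a e\<close> and
  \<open>Random a e\<close> all write to the cell with address \<open>a\<close>.\<close>

type_synonym config = "com list \<times> mem"

fun step :: "nat \<Rightarrow> (nat \<Rightarrow> nat) \<Rightarrow> real \<Rightarrow> config \<Rightarrow> config pmf" where
  "step n f \<tau> ([], m) = return_pmf ([], m)"
| "step n f \<tau> (Skip # cs, m) = return_pmf (cs, m)"
| "step n f \<tau> (Store a e # cs, m) = return_pmf (cs, m(eval_exp m a := eval_exp m e))"
| "step n f \<tau> (Query a e # cs, m) =
     return_pmf (cs, m(eval_exp m a := query n f (eval_exp m e)))"
| "step n f \<tau> (Random a e # cs, m) =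
     map_pmf (\<lambda>x. (cs, m(eval_exp m a := x))) (uniform_below (eval_exp m e))"
| "step n f \<tau> (Seq c d # cs, m) = return_pmf (c # d # cs, m)"
| "step n f \<tau> (If b c d # cs, m) =
     return_pmf ((if eval_test \<tau> m b then c else d) # cs, m)"
| "step n f \<tau> (While b c # cs, m) =
     return_pmf (if eval_test \<tau> m b then c # While b c # cs else cs, m)"

primrec steps :: "nat \<Rightarrow> (nat \<Rightarrow> nat) \<Rightarrow> real \<Rightarrow> nat \<Rightarrow> config \<Rightarrow> config pmf" where
  "steps n f \<tau> 0 cfg = return_pmf cfg"
| "steps n f \<tau> (Suc t) cfg = bind_pmf (step n f \<tau> cfg) (steps n f \<tau> t)"

text \<open>At the start, cells \<open>0\<close> and \<open>1\<close> contain the length of the array and the known bound on its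
  values. The array itself is accessible only through \<open>Query\<close>.\<close>

definition run :: "com \<Rightarrow> nat \<Rightarrow> nat \<Rightarrow> (nat \<Rightarrow> nat) \<Rightarrow> real \<Rightarrow> nat \<Rightarrow> config pmf" where
  "run P n vb f \<tau> t = steps n f \<tau> t ([P], (\<lambda>_. 0)(0 := int n, 1 := int vb))"

text \<open>Worst-case running time: the bound holds for all outcomes of the random choices.\<close>

definition halts_within :: "com \<Rightarrow> nat \<Rightarrow> nat \<Rightarrow> (nat \<Rightarrow> nat) \<Rightarrow> real \<Rightarrow> nat \<Rightarrow> bool" where
  "halts_within P n vb f \<tau> t \<longleftrightarrow> (\<forall>cfg \<in> set_pmf (run P n vb f \<tau> t). fst cfg = [])"

text \<open>The output is a rational number, with numerator in cell \<open>0\<close> and denominator in cell \<open>1\<close>.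
  A halted configuration is never left, so the distribution of the output is the same for all
  \<open>t\<close> within which the program halts.\<close>

definition output_value :: "config \<Rightarrow> real" where
  "output_value cfg = of_int (snd cfg 0) / of_int (snd cfg 1)"

definition output_dist :: "com \<Rightarrow> nat \<Rightarrow> nat \<Rightarrow> (nat \<Rightarrow> nat) \<Rightarrow> real \<Rightarrow> nat \<Rightarrow> real pmf" where
  "output_dist P n vb f \<tau> t = map_pmf output_value (run P n vb f \<tau> t)"

end

theory Submission
  imports Defs
begin

text \<open>The estimator is a simplified form of the algorithm of Saks and Seshadhri. A box, given by an index
  interval and a value interval, is split recursively at points that few of its points violate; the
  leaves of this splitting tree carry almost all of a longest increasing subsequence, or else many
  points are lost anyway. A leaf is estimated by the best chain of cells in a sampled grid, where the
  cells are estimated with one level of recursion less, and the estimates of the leaves are averaged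
  over a sample of the indices. Each level improves the factor of the loss from \<open>320 / (t + 320)\<close> to
  \<open>320 / (t + 321)\<close>, so that \<open>320 / \<tau>\<close> levels suffice; the additive errors sum up to at most
  \<open>O(1 / (\<tau> log n))\<close>. All random choices are made in advance, and a union bound over Hoeffding's
  inequality shows that all samples are accurate. The recursion is unfolded into an array whose
  polylogarithmic branching factor, raised to the number of levels, bounds the running time.\<close>


section \<open>Covering\<close>

text \<open>The obstacle is the depth of the splitting tree, which is of order \<open>log n\<close>.
  A longest increasing subset may lose points at every split, and a loss proportional to the points
  of each box would be paid once per layer. The points lost at a safe corner are therefore confined
  to an interval of indices ending at the corner, in which they are a small fraction of all points.
  The intervals of all splits together are thinned to a cover that meets each index at most twice,
  so this relative loss is paid twice in total; only absolute errors grow with the depth, and these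
  are inverse powers of \<open>log n\<close>. The same covering argument turns unsafe corners into
  many points outside of any chain of cells. The number 320 is 16 * 20. With
  \<open>g = t + 321\<close>, safety tolerates a fraction \<open>16 / g\<close> of violating points,
  and the account of gains and losses closes if this fraction is at most \<open>\<tau> / 20\<close>.
  A level gains the factor \<open>1 - 1 / g\<close>, which turns \<open>320 / (t + 320)\<close> into
  \<open>320 / (t + 321)\<close>.\<close>

lemma interval_subcover:
  fixes \<F> :: "int set set"
  assumes fin: "finite \<F>" and int: "\<And>J. J \<in> \<F> ==> \<exists>l r. J = {l..r}"
  obtains \<G> where "\<G> \<subseteq> \<F>" "\<Union>\<G> = \<Union>\<F>" "\<And>x. card {J \<in> \<G>. x \<in> J} <= 2"
proof -
  define P where "P \<G> \<longleftrightarrow> \<G> \<subseteq> \<F> \<and> \<Union>\<G> = \<Union>\<F>" for \<G>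
  have "P \<F>" by (simp add: P_def)
  then obtain \<G> where G: "P \<G>" and min: "\<And>\<H>. P \<H> ==> card \<G> <= card \<H>"
    using ex_has_least_nat[of P \<F> card] by auto
  have finG: "finite \<G>" using G fin finite_subset unfolding P_def by blast
  have "card {J \<in> \<G>. x \<in> J} <= 2" for x
  proof (rule ccontr)
    assume "\<not> card {J \<in> \<G>. x \<in> J} <= 2"
    then have "3 <= card {J \<in> \<G>. x \<in> J}" by simp
    then obtain \<T> where T: "\<T> \<subseteq> {J \<in> \<G>. x \<in> J}" "card \<T> = 3"
      using obtain_subset_with_card_n by metis
    then obtain A B C where ABC: "\<T> = {A,B,C}" "A \<noteq> B" "A \<noteq> C" "B \<noteq> C"
      by (metis card_3_iff)
    have mem: "A \<in> \<G>" "B \<in> \<G>" "C \<in> \<G>" "x \<in> A" "x \<in> B" "x \<in> C" using T ABC by auto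
    obtain a a' where A: "A = {a..a'}" using int mem G unfolding P_def by blast
    obtain b b' where B: "B = {b..b'}" using int mem G unfolding P_def by blast
    obtain c c' where C: "C = {c..c'}" using int mem G unfolding P_def by blast
    have x: "a <= x" "x <= a'" "b <= x" "x <= b'" "c <= x" "x <= c'" using mem A B C by auto
    \<comment> \<open>Of three intervals through \<open>x\<close>, one with the smallest left end
      and one with the largest right end cover the third, because both contain
      \<open>x\<close>.\<close>
    have "A \<subseteq> B \<union> C \<or> B \<subseteq> A \<union> C \<or> C \<subseteq> A \<union> B"
      unfolding A B C using x by (auto simp: subset_iff; linarith)
    then obtain D where D: "D \<in> \<G>" "D \<subseteq> \<Union>(\<G> - {D})"
      using mem ABC by blast
    have "\<Union>(\<G> - {D}) = \<Union>\<G>" using D by blast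
    then have "P (\<G> - {D})" using G unfolding P_def by auto
    then show False using min[of "\<G> - {D}"] D finG card_Diff1_less[OF finG D(1)] by simp
  qed
  then show ?thesis using that G unfolding P_def by blast
qed

lemma sum_card_Int_le:
  fixes S :: "'a set"
  assumes "finite \<G>" "finite S" and mult: "\<And>x. card {J \<in> \<G>. x \<in> J} <= k"
  shows "(\<Sum>J\<in>\<G>. card (S \<inter> J)) <= k * card (S \<inter> \<Union>\<G>)"
proof -
  have "(\<Sum>J\<in>\<G>. card (S \<inter> J)) = (\<Sum>J\<in>\<G>. \<Sum>x\<in>S \<inter> \<Union>\<G>. if x \<in> J then 1 else 0)"
  proof (rule sum.cong[OF refl])
    fix J assume "J \<in> \<G>"
    then have "S \<inter> J = {x \<in> S \<inter> \<Union>\<G>. x \<in> J}" by auto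
    then show "card (S \<inter> J) = (\<Sum>x\<in>S \<inter> \<Union>\<G>. if x \<in> J then 1 else 0)"
      using assms(2) by (simp add: sum.If_cases Int_def)
  qed
  also have "\<dots> = (\<Sum>x\<in>S \<inter> \<Union>\<G>. \<Sum>J\<in>\<G>. if x \<in> J then 1 else 0)" by (rule sum.swap)
  also have "\<dots> = (\<Sum>x\<in>S \<inter> \<Union>\<G>. card {J \<in> \<G>. x \<in> J})"
    using assms(1) by (simp add: sum.If_cases Int_def)
  also have "\<dots> <= (\<Sum>x\<in>S \<inter> \<Union>\<G>. k)" by (intro sum_mono mult)
  finally show ?thesis by (simp add: mult.commute)
qed

lemma card_cover_le:
  assumes "finite \<G>" "finite S"
  shows "card (S \<inter> \<Union>\<G>) <= (\<Sum>J\<in>\<G>. card (S \<inter> J))"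
proof -
  have "S \<inter> \<Union>\<G> = (\<Union>J\<in>\<G>. S \<inter> J)" by auto
  then show ?thesis using card_UN_le[OF assms(1), of "\<lambda>J. S \<inter> J"] by simp
qed

text \<open>The factor is the multiplicity of an irredundant cover by intervals.\<close>

lemma sparse_on_Union:
  fixes \<F> :: "int set set" and c :: real
  assumes fin: "finite \<F>" and int: "\<And>J. J \<in> \<F> ==> \<exists>l r. J = {l..r}"
    and "finite A" "finite B" "0 <= c"
    and le: "\<And>J. J \<in> \<F> ==> real (card (A \<inter> J)) <= c * real (card (B \<inter> J))"
  shows "real (card (A \<inter> \<Union>\<F>)) <= 2 * c * real (card (B \<inter> \<Union>\<F>))"
proof -
  obtain \<G> where G: "\<G> \<subseteq> \<F>" "\<Union>\<G> = \<Union>\<F>" "\<And>x. card {J \<in> \<G>. x \<in> J} <= 2"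
    using interval_subcover[OF fin int] by blast
  have finG: "finite \<G>" using G(1) fin finite_subset by blast
  have "real (card (A \<inter> \<Union>\<G>)) <= (\<Sum>J\<in>\<G>. real (card (A \<inter> J)))"
    using card_cover_le[OF finG \<open>finite A\<close>] by (simp flip: of_nat_sum)
  also have "\<dots> <= (\<Sum>J\<in>\<G>. c * real (card (B \<inter> J)))" by (intro sum_mono le) (use G in blast)
  also have "\<dots> = c * real (\<Sum>J\<in>\<G>. card (B \<inter> J))" by (simp add: sum_distrib_left)
  also have "\<dots> <= c * real (2 * card (B \<inter> \<Union>\<G>))"
    using sum_card_Int_le[OF finG \<open>finite B\<close> G(3)] \<open>0 <= c\<close>
    by (intro mult_left_mono) (simp_all only: of_nat_le_iff)
  finally show ?thesis using G(2) by (simp add: mult_ac)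
qed

section \<open>Increasing subsets of a box\<close>

type_synonym box = "int \<times> int \<times> int \<times> int"

text \<open>Boxes are half-open in the index and closed in the value: consecutive boxes of a chain
  have disjoint index ranges, but may share a boundary value, which a weakly increasing subsequence
  may take on both sides.\<close>

definition pts :: "(int => int) => box => int set" where
  "pts F = (\<lambda>(a, b, lo, hi). {x. a < x \<and> x <= b \<and> lo <= F x \<and> F x <= hi})"

definition width :: "box => int" where
  "width = (\<lambda>(a, b, lo, hi). b - a)"

text \<open>Subsequences are represented by their index sets, so that unions and intersections of
  sets replace operations on lists.\<close>

definition lisb :: "(int => int) => box => nat" where
  "lisb F B = Max (card ` {S. S \<subseteq> pts F B \<and> mono_on S F})"

lemma finite_pts [simp]: "finite (pts F B)"
proof -
  obtain a b lo hi where "B = (a, b, lo, hi)" by (cases B)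
  then have "pts F B \<subseteq> {a<..b}" by (auto simp: pts_def)
  then show ?thesis using finite_subset by blast
qed

lemma card_pts_le_width: "width B \<ge> 0 ==> card (pts F B) <= width B"
proof -
  assume w: "width B \<ge> 0"
  obtain a b lo hi where B: "B = (a, b, lo, hi)" by (cases B)
  have "pts F B \<subseteq> {a<..b}" by (auto simp: pts_def B)
  then have "card (pts F B) <= card {a<..b}" by (intro card_mono) auto
  then show ?thesis using w by (simp add: B width_def)
qed

lemma lisb_ge: "S \<subseteq> pts F B ==> mono_on S F ==> card S <= lisb F B"
  unfolding lisb_def by (intro Max_ge) (auto intro: finite_imageI)

lemma lisb_attained: obtains S where "S \<subseteq> pts F B" "mono_on S F" "card S = lisb F B"
proof -
  have "lisb F B \<in> card ` {S. S \<subseteq> pts F B \<and> mono_on S F}"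
    unfolding lisb_def by (intro Max_in) (auto intro: finite_imageI monotone_onI)
  then show ?thesis using that by auto
qed

lemma lisb_le_card: "lisb F B <= card (pts F B)"
  by (metis lisb_attained finite_pts card_mono)

lemma mono_on_Un:
  fixes F :: "int => int"
  assumes "mono_on S F" "mono_on S' F"
    "\<And>x y. x \<in> S ==> y \<in> S' ==> x < y \<and> F x <= F y"
  shows "mono_on (S \<union> S') F"
  using assms by (intro mono_onI) (auto simp: mono_on_def dest: less_imp_le, fastforce)

lemma lisb_split:
  assumes "a <= c" "c <= b" "lo <= y" "y <= hi"
  shows "lisb F (a, c, lo, y) + lisb F (c, b, y, hi) <= lisb F (a, b, lo, hi)"
proof -
  obtain S where S: "S \<subseteq> pts F (a, c, lo, y)" "mono_on S F" "card S = lisb F (a, c, lo, y)"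
    by (rule lisb_attained)
  obtain S' where S': "S' \<subseteq> pts F (c, b, y, hi)" "mono_on S' F" "card S' = lisb F (c, b, y, hi)"
    by (rule lisb_attained)
  have "mono_on (S \<union> S') F"
    by (rule mono_on_Un[OF S(2) S'(2)]) (use S(1) S'(1) in \<open>auto simp: pts_def subset_iff; force\<close>)
  moreover have "S \<union> S' \<subseteq> pts F (a, b, lo, hi)" using S(1) S'(1) assms by (fastforce simp: pts_def)
  moreover have "card (S \<union> S') = card S + card S'"
    using S(1) S'(1) by (intro card_Un_disjoint) (auto intro: finite_subset, fastforce simp: pts_def)
  ultimately show ?thesis using lisb_ge S(3) S'(3) by metis
qed

lemma lisb_chain:
  fixes c h :: "nat => int"
  assumes "\<And>i. i < K ==> c i <= c (Suc i)" "\<And>i. i < K ==> h i <= h (Suc i)"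
  shows "(\<Sum>i<K. lisb F (c i, c (Suc i), h i, h (Suc i))) <= lisb F (c 0, c K, h 0, h K)"
  using assms
proof (induction K)
  case (Suc K)
  have *: "g 0 <= g K" if "\<And>i. i < Suc K ==> g i <= g (Suc i)" for g :: "nat => int"
    using that by (induction K) (auto intro: order_trans less_SucI)
  have "c 0 <= c K" "h 0 <= h K" using *[of c] *[of h] Suc.prems by auto
  then show ?case using Suc.IH Suc.prems lisb_split[of "c 0" "c K" "c (Suc K)" "h 0" "h K" "h (Suc K)" F]
    by force
qed simp

section \<open>Maxima and monotone chains\<close>

text \<open>Because of the initial value 0, this is the true maximum as soon as one of the arguments
  is nonnegative.\<close>

primrec bmax :: "nat => (nat => int) => int" where
  "bmax 0 g = 0"
| "bmax (Suc k) g = max (bmax k g) (g k)"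

lemma bmax_ge: "i < k ==> g i <= bmax k g"
  by (induction k) (auto simp: less_Suc_eq le_max_iff_disj)

lemma bmax_nonneg: "0 <= bmax k g" by (induction k) auto

lemma bmax_attained: "0 < k ==> (\<And>i. i < k ==> 0 <= g i) ==> \<exists>i<k. bmax k g = g i"
proof (induction k)
  case (Suc k)
  then show ?case by (cases "k = 0") (force simp: max_def less_Suc_eq)+
qed simp

text \<open>The default 0 is also a possible result. The ambiguity does no harm to
  \<open>isel\<close> below, since column 0 is never safe when \<open>0 < E1\<close>.\<close>

primrec last_index :: "nat => (nat => bool) => nat" where
  "last_index 0 P = 0"
| "last_index (Suc k) P = (if P k then k else last_index k P)"

lemma last_indexI: "\<exists>i<k. P i ==> P (last_index k P) \<and> last_index k P < k"
  by (induction k) (auto simp: less_Suc_eq)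

lemma last_index_none: "\<not> (\<exists>i<k. P i) ==> last_index k P = 0"
  by (induction k) (auto simp: less_Suc_eq)

text \<open>The best chain of \<open>i\<close> cells ending in row \<open>q\<close>, where
  \<open>V i p q\<close> is the value of the cell of column \<open>i\<close> between the rows
  \<open>p\<close> and \<open>q\<close>. A forbidden step counts as 0 instead of minus infinity; for
  nonnegative \<open>V\<close> this creates no spurious value, since row \<open>q\<close> may always
  follow itself.\<close>

primrec dp :: "nat => (nat => int) => (nat => nat => nat => int) => nat => nat => int" where
  "dp R y V 0 q = 0"
| "dp R y V (Suc i) q = bmax R (\<lambda>p. if y p <= y q then dp R y V i p + V i p q else 0)"

lemma dp_nonneg: "0 <= dp R y V i q" by (cases i) (auto intro: bmax_nonneg)

lemma dp_ge:
  assumes "\<And>i. i <= K ==> r i < R" "\<And>i. i < K ==> y (r i) <= y (r (Suc i))"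
  shows "(\<Sum>i<K. V i (r i) (r (Suc i))) <= dp R y V K (r K)"
  using assms
proof (induction K)
  case (Suc K)
  have "dp R y V K (r K) + V K (r K) (r (Suc K)) <= dp R y V (Suc K) (r (Suc K))"
    using bmax_ge[of "r K" R "\<lambda>p. if y p <= y (r (Suc K)) then dp R y V K p + V K p (r (Suc K)) else 0"]
      Suc.prems by simp
  then show ?case using Suc by force
qed simp

lemma dp_attained:
  assumes "q < R" "\<And>i p q. i < K ==> p < R ==> q < R ==> y p <= y q ==> 0 <= V i p q"
  shows "\<exists>r. (\<forall>i\<le>K. r i < R) \<and> (\<forall>i<K. y (r i) <= y (r (Suc i))) \<and> r K = q \<and>
     dp R y V K q = (\<Sum>i<K. V i (r i) (r (Suc i)))"
  using assms
proof (induction K arbitrary: q)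
  case 0
  then show ?case by (auto intro!: exI[of _ "\<lambda>_. q"])
next
  case (Suc K)
  let ?g = "\<lambda>p. if y p <= y q then dp R y V K p + V K p q else 0"
  have nn: "0 <= ?g p" if "p < R" for p using Suc.prems that by (auto intro!: add_nonneg_nonneg dp_nonneg)
  have "\<exists>p<R. y p <= y q \<and> bmax R ?g = ?g p"
  proof -
    obtain p where p: "p < R" "bmax R ?g = ?g p" using bmax_attained[of R ?g] nn Suc.prems(1) by auto
    show ?thesis
    proof (cases "y p <= y q")
      \<comment> \<open>The maximum is attained at a forbidden predecessor and hence equals 0. Row
        \<open>q\<close> is an allowed predecessor of itself with a nonnegative value, so it attains
        the maximum as well.\<close>
      case False
      have "?g q <= bmax R ?g" by (rule bmax_ge) (rule Suc.prems(1))
      moreover have "bmax R ?g = 0" using p False by simp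
      ultimately have "bmax R ?g = ?g q" using nn[OF Suc.prems(1)] by simp
      then show ?thesis using Suc.prems(1) by auto
    qed (use p in auto)
  qed
  then obtain p where p: "p < R" "y p <= y q" "bmax R ?g = ?g p" by blast
  obtain r where r: "\<forall>i\<le>K. r i < R" "\<forall>i<K. y (r i) <= y (r (Suc i))" "r K = p"
    "dp R y V K p = (\<Sum>i<K. V i (r i) (r (Suc i)))"
    using Suc.IH[OF p(1)] Suc.prems(2) by (metis less_SucI)
  let ?r = "r(Suc K := q)"
  have "(\<Sum>i<K. V i (?r i) (?r (Suc i))) = (\<Sum>i<K. V i (r i) (r (Suc i)))"
    by (intro sum.cong) auto
  then show ?case using r p Suc.prems(1)
    by (intro exI[of _ ?r]) (auto simp: less_Suc_eq le_Suc_eq)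
qed

definition best_chain :: "nat => nat => (nat => int) => (nat => nat => nat => int) => int" where
  "best_chain K R y V = bmax R (dp R y V K)"

lemma best_chain_ge:
  assumes "\<And>i. i <= K ==> r i < R" "\<And>i. i < K ==> y (r i) <= y (r (Suc i))"
  shows "(\<Sum>i<K. V i (r i) (r (Suc i))) <= best_chain K R y V"
proof -
  have "dp R y V K (r K) <= best_chain K R y V"
    unfolding best_chain_def using assms by (intro bmax_ge) auto
  then show ?thesis using dp_ge[of K r R y V] assms by force
qed

lemma best_chain_attained:
  assumes "0 < R" "\<And>i p q. i < K ==> p < R ==> q < R ==> y p <= y q ==> 0 <= V i p q"
  shows "\<exists>r. (\<forall>i\<le>K. r i < R) \<and> (\<forall>i<K. y (r i) <= y (r (Suc i))) \<and>
     best_chain K R y V = (\<Sum>i<K. V i (r i) (r (Suc i)))"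
proof -
  obtain q where "q < R" "best_chain K R y V = dp R y V K q"
    using bmax_attained[of R "dp R y V K"] assms(1) dp_nonneg unfolding best_chain_def by blast
  then show ?thesis using dp_attained[of q R K y V] assms(2) by metis
qed

section \<open>Sampled grids\<close>

definition clog :: "int => nat" where "clog w = (LEAST k. w <= 2 ^ k)"

lemma le_two_power_clog: "w <= 2 ^ clog w"
  unfolding clog_def
proof (rule LeastI)
  have "int (nat w) < int (2 ^ nat w)" by (simp only: of_nat_less_iff less_exp)
  then show "w <= 2 ^ nat w" by (auto split: if_splits)
qed

lemma clog_le: "w <= 2 ^ k ==> clog w <= k"
  unfolding clog_def by (rule Least_le)

lemma two_power_clog_le: "1 <= w ==> 2 ^ clog w <= 2 * w"
proof (cases "clog w")
  case (Suc k)
  then have "\<not> w <= 2 ^ k" using clog_le[of w k] by auto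
  then show ?thesis using Suc by simp
qed auto

text \<open>The width of a column when a box is cut into at most \<open>2 ^ \<kappa>\<close>
  columns. Truncated subtraction makes it 1 for boxes with at most \<open>2 ^ \<kappa>\<close>
  indices.\<close>

definition cw :: "nat => int => int" where "cw \<kappa> w = 2 ^ (clog w - \<kappa>)"

text \<open>\<open>s k j\<close> is the offset of the \<open>j\<close>-th sample at scale
  \<open>k\<close>, shared by all boxes whose width rounds up to \<open>2 ^ k\<close>; this sharing
  keeps the number of events in the union bound polynomial in the length of the array.
  \<open>E1\<close> and \<open>E2\<close> are thresholds in numbers of samples.\<close>

locale grid =
  fixes F :: "int => int" and s :: "nat => nat => int" and J \<kappa> :: nat and E1 E2 :: int
begin

definition col :: "box => nat => int" where
  "col = (\<lambda>(a, b, lo, hi) i. min b (a + int i * cw \<kappa> (b - a)))"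

text \<open>Offsets range below a power of two, so a sample may lie beyond \<open>b\<close>; the
  membership tests then discard it.\<close>

definition smp :: "box => nat => int" where
  "smp = (\<lambda>(a, b, lo, hi) j. a + 1 + s (clog (b - a)) j)"

text \<open>Rows through sampled points leave few points between neighbouring rows. A sample outside
  of the box repeats \<open>lo\<close>, so that the number of rows is always \<open>J + 2\<close>;
  this fixes the branching factor of the recursion.\<close>

definition rowv :: "box => nat => int" where
  "rowv = (\<lambda>(a, b, lo, hi) q.
     if q < J then (if smp (a, b, lo, hi) q \<in> pts F (a, b, lo, hi) then F (smp (a, b, lo, hi) q) else lo)
     else if q = J then lo else hi)"

text \<open>Counts use the value band \<open>bl\<close>, \<open>bh\<close> of the box at which the
  splitting started, not that of \<open>T\<close>. Points in the index range of \<open>T\<close>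
  whose values leave \<open>T\<close> thus count among those that are lost.\<close>

definition mc :: "int => int => box => nat => nat => nat" where
  "mc bl bh T i i' = card {j. j < J \<and> smp T j \<in> pts F (col T i, col T i', bl, bh)}"

text \<open>The points that cannot belong to an increasing subsequence running through the corner
  \<open>(c, y)\<close>: those above \<open>y\<close> on its left and below \<open>y\<close> on its
  right.\<close>

definition violates :: "int => int => int => bool" where
  "violates c y x \<longleftrightarrow> (if x <= c then y < F x else F x < y)"

definition vc :: "int => int => box => nat => int => nat => nat => nat" where
  "vc bl bh T i y i' i'' = card {j. j < J \<and> smp T j \<in> pts F (col T i', col T i'', bl, bh) \<and>
     violates (col T i) y (smp T j)}"

text \<open>Violating points have to be sparse on every interval of columns around the corner,
  because the interval on which a subsequence misses the corner is not known in advance. The other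
  conditions make the test meaningful: the box is wider than the number of columns, the sample is
  large enough to be trusted, and a quarter of it lies on either side. The latter bounds the depth
  of the splitting tree.\<close>

definition safe :: "int => int => int => box => nat => int => bool" where
  "safe g bl bh T i y \<longleftrightarrow> \<kappa> < clog (width T) \<and> E1 <= mc bl bh T 0 (2 ^ \<kappa>) \<and>
     mc bl bh T 0 (2 ^ \<kappa>) <= 4 * mc bl bh T 0 i \<and>
     mc bl bh T 0 (2 ^ \<kappa>) <= 4 * mc bl bh T i (2 ^ \<kappa>) \<and>
     (\<forall>i'<Suc (2 ^ \<kappa>). \<forall>i''<Suc (2 ^ \<kappa>). i' < i \<and> i < i'' -->
        g * int (vc bl bh T i y i' i'') <= 16 * int (mc bl bh T i' i'') + E2)"

definition isel :: "int => int => int => box => nat" where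
  "isel g bl bh T = last_index (2 ^ \<kappa>) (\<lambda>i. \<exists>q<J + 2. safe g bl bh T i (rowv T q))"

definition qsel :: "int => int => int => box => nat" where
  "qsel g bl bh T = last_index (J + 2) (\<lambda>q. safe g bl bh T (isel g bl bh T) (rowv T q))"

definition lower :: "int => int => int => box => box" where
  "lower g bl bh T = (case T of (a, b, lo, hi) =>
     (a, col T (isel g bl bh T), lo, rowv T (qsel g bl bh T)))"

definition upper :: "int => int => int => box => box" where
  "upper g bl bh T = (case T of (a, b, lo, hi) =>
     (col T (isel g bl bh T), b, rowv T (qsel g bl bh T), hi))"

definition descend :: "int => int => int => int => box => box" where
  "descend g bl bh x T =
     (if isel g bl bh T = 0 then T
      else if x <= col T (isel g bl bh T) then lower g bl bh T else upper g bl bh T)"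

definition cell :: "box => nat => nat => nat => box" where
  "cell T i p q = (col T i, col T (Suc i), rowv T p, rowv T q)"

definition est :: "(box => int) => box => int" where
  "est V T = best_chain (2 ^ \<kappa>) (J + 2) (rowv T) (\<lambda>i p q. V (cell T i p q))"

primrec tree_est :: "(box => int) => int => int => int => nat => box => int" where
  "tree_est V g bl bh 0 T = est V T"
| "tree_est V g bl bh (Suc d) T =
     (if isel g bl bh T = 0 then est V T
      else tree_est V g bl bh d (lower g bl bh T) + tree_est V g bl bh d (upper g bl bh T))"

lemma col_0: "a <= b ==> col (a, b, lo, hi) 0 = a" by (simp add: col_def)

lemma cw_pos: "0 < cw \<kappa> w" by (simp add: cw_def)

lemma power_clog_le_cw: "2 ^ clog w <= 2 ^ \<kappa> * cw \<kappa> w"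
  by (simp add: cw_def flip: power_add)

lemma col_last: "col (a, b, lo, hi) (2 ^ \<kappa>) = b"
  using power_clog_le_cw[of "b - a"] le_two_power_clog[of "b - a"] by (auto simp: col_def min_def)

lemma col_mono: "i <= j ==> col T i <= col T j"
  using cw_pos by (cases T) (auto simp: col_def min_def mult_right_mono intro: order_trans)

lemma col_le: "col (a, b, lo, hi) i <= b" by (simp add: col_def)
lemma col_ge: "a <= b ==> a <= col (a, b, lo, hi) i"
  using cw_pos[of "b - a"] by (simp add: col_def)

lemma col_Suc_le: "col (a, b, lo, hi) (Suc i) <= col (a, b, lo, hi) i + cw \<kappa> (b - a)"
proof -
  have "min b (a + (1 + t) * c) <= min b (a + t * c) + c" if "0 < c" for t c :: int
    using that by (simp add: min_def distrib_right)
  from this[OF cw_pos, of "int i" "b - a"] show ?thesis by (simp add: col_def)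
qed

lemma column_exists:
  assumes "a < x" "x <= col (a, b, lo, hi) i" "a <= b"
  obtains i' where "i' < i" "col (a, b, lo, hi) i' < x" "x <= col (a, b, lo, hi) (Suc i')"
proof -
  define m where "m = (LEAST i. x <= col (a, b, lo, hi) i)"
  have m: "x <= col (a, b, lo, hi) m" unfolding m_def using assms(2) by (rule LeastI)
  have "m <= i" unfolding m_def using assms(2) by (rule Least_le)
  have "m \<noteq> 0" using m assms by (auto simp: col_0 intro: ccontr)
  then obtain i' where i': "m = Suc i'" using not0_implies_Suc by blast
  have "\<not> x <= col (a, b, lo, hi) i'" using not_less_Least[of i' "\<lambda>i. x <= col (a, b, lo, hi) i"] i'
    by (simp add: m_def)
  then show ?thesis using that[of i'] m \<open>m <= i\<close> i' by auto
qed

lemma column_unique: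
  assumes "col T i < x" "x <= col T (Suc i)" "col T i' < x" "x <= col T (Suc i')"
  shows "i = i'"
proof (rule ccontr)
  assume "i \<noteq> i'"
  then have "Suc i <= i' \<or> Suc i' <= i" by auto
  then show False using col_mono[of "Suc i" i' T] col_mono[of "Suc i'" i T] assms by auto
qed

lemma row_bounds:
  assumes "lo <= hi"
  shows "lo <= rowv (a, b, lo, hi) q" "rowv (a, b, lo, hi) q <= hi"
  using assms unfolding rowv_def pts_def by (simp_all split: if_split)

lemma row_low: "rowv (a, b, lo, hi) J = lo" by (simp add: rowv_def)

lemma mc_add:
  assumes "i <= i'" "i' <= i''"
  shows "mc bl bh T i i'' = mc bl bh T i i' + mc bl bh T i' i''"
proof -
  have *: "col T i <= col T i'" "col T i' <= col T i''" using assms by (auto intro: col_mono)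
  have "{j. j < J \<and> smp T j \<in> pts F (col T i, col T i'', bl, bh)} =
    {j. j < J \<and> smp T j \<in> pts F (col T i, col T i', bl, bh)} \<union>
    {j. j < J \<and> smp T j \<in> pts F (col T i', col T i'', bl, bh)}"
    using * by (auto simp: pts_def)
  then show ?thesis unfolding mc_def by (simp only:) (rule card_Un_disjoint; force simp: pts_def)
qed

lemma mc_same: "mc bl bh T i i = 0" by (auto simp: mc_def pts_def)

lemma isel_safe:
  assumes "isel g bl bh T \<noteq> 0"
  shows "isel g bl bh T < 2 ^ \<kappa>" "safe g bl bh T (isel g bl bh T) (rowv T (qsel g bl bh T))"
proof -
  let ?P = "\<lambda>i. \<exists>q<J + 2. safe g bl bh T i (rowv T q)"
  have "\<exists>i<2 ^ \<kappa>. ?P i"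
    using assms last_index_none[of "2 ^ \<kappa>" ?P] unfolding isel_def by metis
  from last_indexI[OF this] have *: "?P (isel g bl bh T)" "isel g bl bh T < 2 ^ \<kappa>"
    unfolding isel_def by auto
  show "isel g bl bh T < 2 ^ \<kappa>" by fact
  show "safe g bl bh T (isel g bl bh T) (rowv T (qsel g bl bh T))"
    using last_indexI[OF *(1)] unfolding qsel_def by blast
qed

text \<open>A true hit at index 0 is impossible: no sample lies to the left of column 0, so balance
  would force the total count, which is at least \<open>E1\<close>, to be 0.\<close>

lemma isel_0_not_safe:
  assumes "isel g bl bh T = 0" "0 < E1" "i < 2 ^ \<kappa>" "q < J + 2"
  shows "\<not> safe g bl bh T i (rowv T q)"
proof
  assume s: "safe g bl bh T i (rowv T q)"
  let ?P = "\<lambda>i. \<exists>q<J + 2. safe g bl bh T i (rowv T q)"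
  have "?P 0" using last_indexI[of "2 ^ \<kappa>" ?P] s assms unfolding isel_def by auto
  then show False using assms(2) by (auto simp: safe_def mc_same)
qed

end

section \<open>Accuracy of the sampled counts\<close>

text \<open>The randomness of the grids enters only through \<open>accurate\<close>: every rectangle
  within the index range of a box is counted up to a fraction \<open>\<epsilon>\<close> of the
  rounded width. The parameters \<open>bl\<close>, \<open>bh\<close> and \<open>g\<close> stay fixed
  within one splitting tree.\<close>

locale sampled_grid = grid +
  fixes n :: int and \<epsilon> :: real and bl bh g :: int
  assumes J_pos: "0 < J" and E1_pos: "0 < E1" and eps_pos: "0 < \<epsilon>" and g_pos: "16 <= g"
    and accurate: "\<And>a l r u v. 0 <= a ==> a <= n ==> a <= l ==> r <= b ==> a <= b ==> b <= n ==>
      \<bar>2 ^ clog (b - a) / real J * real (card {j. j < J \<and> a + 1 + s (clog (b - a)) j \<in> pts F (l, r, u, v)})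
       - real (card (pts F (l, r, u, v)))\<bar> <= \<epsilon> * 2 ^ clog (b - a)"
begin

definition valid :: "box => bool" where
  "valid = (\<lambda>(a, b, lo, hi). 0 <= a \<and> a <= b \<and> b <= n \<and> bl <= lo \<and> lo <= hi \<and> hi <= bh)"

definition G :: "int set" where "G = {x. bl <= F x \<and> F x <= bh}"

definition mu :: "int => int => real" where "mu l r = real (card (G \<inter> {l<..r}))"

abbreviation X :: "box => real" where "X T \<equiv> 2 ^ clog (width T)"

definition viol :: "box => nat => int => nat => nat => int set" where
  "viol T i y i' i'' = {x \<in> G \<inter> {col T i'<..col T i''}. violates (col T i) y x}"

lemma G_Int_pts: "G \<inter> {l<..r} = pts F (l, r, bl, bh)"
  by (auto simp: G_def pts_def)

lemma finite_viol [simp]: "finite (viol T i y i' i'')" unfolding viol_def by (rule finite_subset[of _ "{col T i'<..col T i''}"]) auto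

lemma mu_add: "l <= m ==> m <= r ==> mu l r = mu l m + mu m r"
proof -
  assume "l <= m" "m <= r"
  then have "G \<inter> {l<..r} = (G \<inter> {l<..m}) \<union> (G \<inter> {m<..r})" by auto
  moreover have "card ((G \<inter> {l<..m}) \<union> (G \<inter> {m<..r})) = card (G \<inter> {l<..m}) + card (G \<inter> {m<..r})"
    by (rule card_Un_disjoint) auto
  ultimately show ?thesis by (simp add: mu_def)
qed

lemma mu_nonneg: "0 <= mu l r" by (simp add: mu_def)

lemma mu_le: "l <= r ==> mu l r <= r - l"
proof -
  assume "l <= r"
  have "card (G \<inter> {l<..r}) <= card {l<..r}" by (intro card_mono) auto
  then show ?thesis using \<open>l <= r\<close> by (simp add: mu_def)
qed

lemma X_le: "valid T ==> 1 <= width T ==> X T <= 2 * width T"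
  using two_power_clog_le[of "width T"] of_int_le_iff[of "2 ^ clog (width T)" "2 * width T", where 'a = real]
  by simp

lemma mc_accurate:
  assumes "valid T"
  shows "\<bar>X T / J * mc bl bh T i i' - mu (col T i) (col T i')\<bar> <= \<epsilon> * X T"
proof -
  obtain a b lo hi where T: "T = (a, b, lo, hi)" by (cases T)
  have "mu (col T i) (col T i') = card (pts F (col T i, col T i', bl, bh))"
    by (simp add: mu_def G_Int_pts)
  then show ?thesis
    using accurate[of a "col T i" "col T i'" b bl bh] assms
    by (simp add: T valid_def width_def mc_def smp_def col_le col_ge)
qed

text \<open>The violating points form two rectangles, left of the corner above \<open>y\<close> and
  right of it below \<open>y\<close>. Each is counted with error \<open>\<epsilon> * X T\<close>,
  hence the factor 2.\<close>

lemma vc_accurate: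
  assumes "valid T" "i' <= i" "i <= i''"
  shows "\<bar>X T / J * vc bl bh T i y i' i'' - card (viol T i y i' i'')\<bar> <= 2 * \<epsilon> * X T"
proof -
  obtain a b lo hi where T: "T = (a, b, lo, hi)" by (cases T)
  let ?A = "pts F (col T i', col T i, max bl (y + 1), bh)"
  let ?B = "pts F (col T i, col T i'', bl, min bh (y - 1))"
  have c: "col T i' <= col T i" "col T i <= col T i''" using assms by (auto intro: col_mono)
  have "viol T i y i' i'' = ?A \<union> ?B"
    using c by (auto simp: viol_def G_def pts_def violates_def)
  moreover have "card (?A \<union> ?B) = card ?A + card ?B"
    by (rule card_Un_disjoint[OF finite_pts finite_pts]) (auto simp: pts_def)
  ultimately have 1: "card (viol T i y i' i'') = card ?A + card ?B" by simp
  have "{j. j < J \<and> smp T j \<in> pts F (col T i', col T i'', bl, bh) \<and> violates (col T i) y (smp T j)}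
    = {j. j < J \<and> smp T j \<in> ?A} \<union> {j. j < J \<and> smp T j \<in> ?B}"
    using c by (auto simp: pts_def violates_def split: if_splits)
  moreover have "card ({j. j < J \<and> smp T j \<in> ?A} \<union> {j. j < J \<and> smp T j \<in> ?B}) =
     card {j. j < J \<and> smp T j \<in> ?A} + card {j. j < J \<and> smp T j \<in> ?B}"
    by (rule card_Un_disjoint) (auto simp: pts_def)
  ultimately have 2: "vc bl bh T i y i' i'' =
     card {j. j < J \<and> smp T j \<in> ?A} + card {j. j < J \<and> smp T j \<in> ?B}"
    by (simp add: vc_def)
  have 3: "\<bar>X T / J * card {j. j < J \<and> smp T j \<in> ?A} - card ?A\<bar> <= \<epsilon> * X T"
    using accurate[of a "col T i'" "col T i" b "max bl (y + 1)" bh] assms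
    by (simp add: T valid_def width_def smp_def col_le col_ge)
  have 4: "\<bar>X T / J * card {j. j < J \<and> smp T j \<in> ?B} - card ?B\<bar> <= \<epsilon> * X T"
    using accurate[of a "col T i" "col T i''" b bl "min bh (y - 1)"] assms
    by (simp add: T valid_def width_def smp_def col_le col_ge)
  show ?thesis using 3 4 unfolding 1 2 of_nat_add distrib_left by linarith
qed

text \<open>A sample in the strip would itself create a row there. So no sample hits the strip, and
  accuracy of the count 0 bounds its size.\<close>

lemma strip_sparse:
  assumes T: "T = (a, b, lo, hi)" and "valid T"
    and no: "\<And>q. q < J + 2 ==> \<not> (u < rowv T q \<and> rowv T q <= v)" and "lo <= u" "v <= hi"
  shows "real (card (pts F (a, b, u + 1, v))) <= \<epsilon> * X T"
proof -
  have "{j. j < J \<and> smp T j \<in> pts F (a, b, u + 1, v)} = {}"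
  proof (safe, goal_cases)
    case (1 j)
    then have "smp T j \<in> pts F T" using assms by (auto simp: pts_def T)
    then have "rowv T j = F (smp T j)" using 1 by (simp add: rowv_def T)
    then show ?case using no[of j] 1 by (auto simp: pts_def)
  qed
  then have 0: "{j. j < J \<and> a + 1 + s (clog (b - a)) j \<in> pts F (a, b, u + 1, v)} = {}"
    by (simp add: smp_def T)
  show ?thesis
    using accurate[of a a b b "u + 1" v] assms(2) unfolding 0 by (simp add: T valid_def width_def)
qed

text \<open>The chain follows \<open>S\<close> from below: \<open>r i\<close> is the highest row
  that does not exceed the largest value \<open>v i\<close> of \<open>S\<close> up to column
  \<open>i\<close>. A point of \<open>S\<close> can be missed only between row
  \<open>r (Suc i)\<close> and the value \<open>v (Suc i)\<close>, a strip without rows.\<close>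

lemma row_chain_for:
  assumes T: "T = (a, b, lo, hi)" and "valid T" and S: "S \<subseteq> pts F T" "mono_on S F"
  obtains r where "\<And>i. r i < J + 2" "\<And>i. rowv T (r i) <= rowv T (r (Suc i))"
    "real (card (S - (\<Union>i<2 ^ \<kappa>. pts F (cell T i (r i) (r (Suc i)))))) <= 2 ^ \<kappa> * (\<epsilon> * X T)"
proof -
  have ord: "0 <= a" "a <= b" "b <= n" "lo <= hi" using assms by (auto simp: T valid_def)
  have finS: "finite S" using S finite_subset finite_pts by blast
  define v where "v i = Max (insert lo (F ` {x \<in> S. x <= col T i}))" for i
  have fin: "finite (insert lo (F ` {x \<in> S. x <= col T i}))" for i using finS by simp
  have lo_v: "lo <= v i" for i unfolding v_def using fin by (intro Max_ge) auto
  have v_hi: "v i <= hi" for i unfolding v_def using fin S(1) ord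
    by (subst Max_le_iff) (auto simp: T pts_def)
  have v_mono: "v i <= v (Suc i)" for i unfolding v_def
    using fin[of i] fin[of "Suc i"] col_mono[of i "Suc i" T] by (intro Max_mono) auto
  have "\<exists>q<J + 2. rowv T q <= v i \<and> (\<forall>q'<J + 2. rowv T q' <= v i --> rowv T q' <= rowv T q)" for i
  proof -
    let ?A = "{rowv T q |q. q < J + 2 \<and> rowv T q <= v i}"
    have "finite ?A" by simp
    moreover have "rowv T J \<in> ?A" using lo_v[of i] by (auto simp: T row_low intro!: exI[of _ J])
    ultimately have "Max ?A \<in> ?A" "\<forall>y\<in>?A. y <= Max ?A" using Max_in[of ?A] by (blast, simp)
    then obtain q where "q < J + 2" "rowv T q <= v i" "Max ?A = rowv T q" by auto
    moreover have "rowv T q' <= Max ?A" if "q' < J + 2" "rowv T q' <= v i" for q'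
      using that \<open>\<forall>y\<in>?A. y <= Max ?A\<close> by blast
    ultimately show ?thesis by metis
  qed
  then obtain r where r: "\<And>i. r i < J + 2" "\<And>i. rowv T (r i) <= v i"
    "\<And>i q'. q' < J + 2 ==> rowv T q' <= v i ==> rowv T q' <= rowv T (r i)" by metis
  have mono: "rowv T (r i) <= rowv T (r (Suc i))" for i
    using r(3)[of "r i" "Suc i"] r(1)[of i] order_trans[OF r(2)[of i] v_mono[of i]] by auto
  let ?Z = "\<lambda>i. pts F (a, b, rowv T (r (Suc i)) + 1, v (Suc i))"
  have "S - (\<Union>i<2 ^ \<kappa>. pts F (cell T i (r i) (r (Suc i)))) \<subseteq> (\<Union>i<2 ^ \<kappa>. ?Z i)"
  proof
    fix x assume x: "x \<in> S - (\<Union>i<2 ^ \<kappa>. pts F (cell T i (r i) (r (Suc i))))"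
    then have xS: "x \<in> S" and xT: "a < x" "x <= b" "lo <= F x" using S(1) by (auto simp: T pts_def)
    obtain i where i: "i < 2 ^ \<kappa>" "col T i < x" "x <= col T (Suc i)"
      using column_exists[of a x b lo hi "2 ^ \<kappa>"] xT ord T by (auto simp: col_last)
    have "v i <= F x" unfolding v_def using fin[of i] xT xS i S(2)
      by (subst Max_le_iff) (auto simp: mono_on_def)
    then have "rowv T (r i) <= F x" using r(2)[of i] by simp
    then have "rowv T (r (Suc i)) < F x" using x i by (auto simp: cell_def pts_def)
    moreover have "F x <= v (Suc i)" unfolding v_def using fin[of "Suc i"] xS i by (intro Max_ge) auto
    ultimately show "x \<in> (\<Union>i<2 ^ \<kappa>. ?Z i)" using i xT by (auto simp: pts_def intro!: bexI[of _ i])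
  qed
  then have "card (S - (\<Union>i<2 ^ \<kappa>. pts F (cell T i (r i) (r (Suc i))))) <= card (\<Union>i<2 ^ \<kappa>. ?Z i)"
    by (intro card_mono) auto
  also have "\<dots> <= (\<Sum>i<2 ^ \<kappa>. card (?Z i))" by (rule card_UN_le) simp
  finally have "real (card (S - (\<Union>i<2 ^ \<kappa>. pts F (cell T i (r i) (r (Suc i)))))) <= (\<Sum>i<2 ^ \<kappa>. real (card (?Z i)))"
    by (simp flip: of_nat_sum)
  also have "\<dots> <= (\<Sum>i<(2::nat) ^ \<kappa>. \<epsilon> * X T)"
  proof (rule sum_mono)
    fix i
    show "real (card (?Z i)) <= \<epsilon> * X T"
      using r(3)[of _ "Suc i"] row_bounds[OF ord(4)] v_hi
      by (intro strip_sparse[OF T \<open>valid T\<close>]) (auto simp: T not_le[symmetric])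
  qed
  finally show ?thesis by (intro that[of r, OF r(1) mono]) simp
qed

end

context sampled_grid begin

section \<open>Safe corners\<close>

text \<open>A maximum increasing subset that passes above a safe corner violates it on a whole interval
  ending there; safety makes this interval sparse.\<close>

definition overshoot :: "int set => box => int set" where
  "overshoot L = (\<lambda>(a, b, lo, hi). {x. a < x \<and> x <= b \<and> (\<exists>x'\<in>L. x' <= x \<and> hi < F x')})"

definition undershoot :: "int set => box => int set" where
  "undershoot L = (\<lambda>(a, b, lo, hi). {x. a < x \<and> x <= b \<and> (\<exists>x'\<in>L. x <= x' \<and> F x' < lo)})"

text \<open>Two columns lost by rounding, three sampling errors (two for \<open>vc\<close>, one for
  \<open>mc\<close>) and the slack \<open>E2\<close> of the safety test, all relative to the rounded
  width.\<close>

definition sigma :: real where "sigma = 2 / 2 ^ \<kappa> + 3 * \<epsilon> + E2 / J"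

lemma safe_viol_le:
  assumes "valid T" "safe g bl bh T i y" "i' < i" "i < i''" "i'' <= 2 ^ \<kappa>" "0 <= E2"
  shows "real (card (viol T i y i' i'')) <= 16 / g * mu (col T i') (col T i'') + (3 * \<epsilon> + E2 / J) * X T"
proof -
  let ?e = "X T / J"
  have g: "0 < real_of_int g" "16 / real_of_int g <= 1" using g_pos by auto
  have "g * int (vc bl bh T i y i' i'') <= 16 * int (mc bl bh T i' i'') + E2"
    using assms unfolding safe_def by (meson less_Suc_eq_le less_trans order_less_imp_le order_trans)
  then have "real_of_int (g * int (vc bl bh T i y i' i'')) <= real_of_int (16 * int (mc bl bh T i' i'') + E2)"
    by (simp only: of_int_le_iff)
  then have "real_of_int g * vc bl bh T i y i' i'' <= 16 * mc bl bh T i' i'' + E2" by simp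
  then have "?e * (real_of_int g * vc bl bh T i y i' i'') <= ?e * (16 * mc bl bh T i' i'' + E2)"
    by (intro mult_left_mono) auto
  then have "real_of_int g * (?e * vc bl bh T i y i' i'') <= 16 * (?e * mc bl bh T i' i'') + E2 / J * X T"
    by (simp add: algebra_simps)
  moreover have "real_of_int g * (card (viol T i y i' i'') - 2 * \<epsilon> * X T) <= real_of_int g * (?e * vc bl bh T i y i' i'')"
    using vc_accurate[of T i' i i'' y] assms g by (intro mult_left_mono) auto
  moreover have "16 * (?e * mc bl bh T i' i'') <= 16 * (mu (col T i') (col T i'') + \<epsilon> * X T)"
    using mc_accurate[OF \<open>valid T\<close>, of i' i''] by auto
  ultimately have "real_of_int g * (card (viol T i y i' i'') - 2 * \<epsilon> * X T)
      <= 16 * (mu (col T i') (col T i'') + \<epsilon> * X T) + E2 / J * X T" by linarith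
  then have "card (viol T i y i' i'') - 2 * \<epsilon> * X T
      <= (16 * (mu (col T i') (col T i'') + \<epsilon> * X T) + E2 / J * X T) / g"
    using g by (simp add: field_simps)
  also have "\<dots> = 16 / g * mu (col T i') (col T i'') + 16 / g * (\<epsilon> * X T) + 1 / g * (E2 / J * X T)"
    using g by (simp add: field_simps)
  also have "\<dots> <= 16 / g * mu (col T i') (col T i'') + 1 * (\<epsilon> * X T) + 1 * (E2 / J * X T)"
    using g g_pos eps_pos \<open>0 <= E2\<close> by (intro add_mono mult_right_mono) (auto simp: mu_nonneg)
  finally show ?thesis by (simp add: algebra_simps)
qed

lemma cw_eq: "\<kappa> < clog (width T) ==> real_of_int (cw \<kappa> (width T)) = X T / 2 ^ \<kappa>"
  by (simp add: cw_def power_diff[of "2 :: real"])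

text \<open>The sum of a relative and an absolute error is at most twice the larger one. The two
  kinds have to be separated because they accumulate differently: relative errors over a cover of
  multiplicity 2, absolute ones over the layers of the tree.\<close>

lemma sparse_dichotomy:
  assumes "real l <= 16 / g * m + sigma * X T" "0 <= m" "X T <= 2 * w"
    "0 <= E2" "0 <= w"
  shows "real l <= 32 / g * m \<or> real l <= 4 * sigma * w"
proof -
  have "0 <= sigma" unfolding sigma_def using eps_pos assms by auto
  then have "sigma * X T <= sigma * (2 * w)" using assms by (intro mult_left_mono)
  then have "sigma * X T <= 2 * (sigma * w)" by (simp add: algebra_simps)
  moreover have "32 / g * m = 16 / g * m + 16 / g * m" by simp
  ultimately show ?thesis using assms(1) by linarith
qed

text \<open>Once \<open>L\<close> has risen above \<open>y\<close> it stays there, so the overshoot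
  is an interval ending at the corner and all points of \<open>L\<close> in it violate the corner.
  Safety, applied to the surrounding columns, bounds their number.\<close>

lemma overshoot_sparse:
  assumes T: "T = (a, b, lo, hi)" and "valid T" and safe: "safe g bl bh T i y" and i: "i < 2 ^ \<kappa>"
    and L: "L \<subseteq> G" "mono_on L F" and "0 <= E2" "1 <= width T"
  defines "I \<equiv> overshoot L (a, col T i, lo, y)"
  shows "(\<exists>l r. I = {l..r}) \<and>
    (real (card (L \<inter> I)) <= 32 / g * real (card (G \<inter> I)) \<or> real (card (L \<inter> I)) <= 4 * sigma * width T)"
proof (cases "I = {}")
  case True
  moreover have "\<exists>l r. {} = {l..r::int}" by (intro exI[of _ 1] exI[of _ 0]) simp
  ultimately show ?thesis by simp
next
  case False
  let ?c = "col T i"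
  have fI: "finite I" by (rule finite_subset[of _ "{a<..?c}"]) (auto simp: I_def overshoot_def)
  define l where "l = Min I"
  have lI: "l \<in> I" using Min_in[OF fI False] by (simp add: l_def)
  then have l: "a < l" "l <= ?c" by (auto simp: I_def overshoot_def)
  have I: "I = {l..?c}"
  proof
    show "I \<subseteq> {l..?c}" using Min_le[OF fI] by (fastforce simp: l_def I_def overshoot_def)
    obtain x' where "x' \<in> L" "x' <= l" "y < F x'" using lI by (auto simp: I_def overshoot_def)
    then show "{l..?c} \<subseteq> I" using l by (auto simp: I_def overshoot_def intro!: bexI[of _ x'])
  qed
  have ab: "a <= b" using \<open>valid T\<close> by (auto simp: valid_def T)
  obtain i' where i': "i' < i" "col T i' < l" "l <= col T (Suc i')"
    using column_exists[of a l b lo hi i] l ab by (auto simp: T)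
  have "L \<inter> I \<subseteq> viol T i y i' (Suc i)"
  proof
    fix x assume x: "x \<in> L \<inter> I"
    then obtain x' where "x' \<in> L" "x' <= x" "y < F x'" by (auto simp: I_def overshoot_def)
    then have "y < F x" using L(2) x by (fastforce simp: mono_on_def)
    then show "x \<in> viol T i y i' (Suc i)"
      using x I i' L(1) col_mono[of i "Suc i" T] by (auto simp: viol_def violates_def)
  qed
  then have "real (card (L \<inter> I)) <= real (card (viol T i y i' (Suc i)))"
    by (intro of_nat_mono card_mono) auto
  also have "\<dots> <= 16 / g * mu (col T i') (col T (Suc i)) + (3 * \<epsilon> + E2 / J) * X T"
    using i i' assms by (intro safe_viol_le) auto
  finally have 1: "real (card (L \<inter> I)) <= 16 / g * mu (col T i') (col T (Suc i)) + (3 * \<epsilon> + E2 / J) * X T" .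
  \<comment> \<open>The interval ends at column \<open>i\<close>, but safety only speaks of column
    intervals that reach beyond it. This adds one column on the right, and rounding adds part of a
    column on the left.\<close>
  have 2: "mu (col T i') (col T (Suc i)) <= card (G \<inter> I) + 2 * (X T / 2 ^ \<kappa>)"
  proof -
    have "mu (col T i') (col T (Suc i)) = mu (col T i') (l - 1) + mu (l - 1) ?c + mu ?c (col T (Suc i))"
      using i' l col_mono[of i "Suc i" T] mu_add[of "col T i'" "l - 1" "col T (Suc i)"]
        mu_add[of "l - 1" ?c "col T (Suc i)"] by simp
    moreover have "mu (col T i') (l - 1) <= X T / 2 ^ \<kappa>"
      using mu_le[of "col T i'" "l - 1"] i' col_Suc_le[of a b lo hi i'] cw_eq[of T] safe
      by (simp add: T safe_def width_def)
    moreover have "mu ?c (col T (Suc i)) <= X T / 2 ^ \<kappa>"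
      using mu_le[of ?c "col T (Suc i)"] col_Suc_le[of a b lo hi i] cw_eq[of T] safe col_mono[of i "Suc i" T]
      by (simp add: T safe_def width_def)
    moreover have "{l - 1<..?c} = I" unfolding I by auto
    ultimately show ?thesis by (simp add: mu_def)
  qed
  have "16 / g * mu (col T i') (col T (Suc i)) <= 16 / real_of_int g * (card (G \<inter> I) + 2 * (X T / 2 ^ \<kappa>))"
    using g_pos by (intro mult_left_mono 2) auto
  also have "\<dots> <= 16 / g * card (G \<inter> I) + 1 * (2 * (X T / 2 ^ \<kappa>))"
    unfolding distrib_left using g_pos by (intro add_left_mono mult_right_mono) auto
  finally have "real (card (L \<inter> I)) <= 16 / g * card (G \<inter> I) + (2 * (X T / 2 ^ \<kappa>) + (3 * \<epsilon> + E2 / J) * X T)"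
    using 1 by linarith
  also have "2 * (X T / 2 ^ \<kappa>) + (3 * \<epsilon> + E2 / J) * X T = sigma * X T"
    by (simp add: sigma_def distrib_right)
  finally have "real (card (L \<inter> I)) <= 16 / g * card (G \<inter> I) + sigma * X T" .
  then show ?thesis
    using sparse_dichotomy[of _ "card (G \<inter> I)" T "width T"] X_le[OF \<open>valid T\<close>] assms(7,8) I by auto
qed

lemma undershoot_sparse:
  assumes T: "T = (a, b, lo, hi)" and "valid T" and safe: "safe g bl bh T i y" and i: "i < 2 ^ \<kappa>"
    and L: "L \<subseteq> G" "mono_on L F" and "0 <= E2" "1 <= width T"
  defines "I \<equiv> undershoot L (col T i, b, y, hi)"
  shows "(\<exists>l r. I = {l..r}) \<and>
    (real (card (L \<inter> I)) <= 32 / g * real (card (G \<inter> I)) \<or> real (card (L \<inter> I)) <= 4 * sigma * width T)"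
proof (cases "I = {}")
  case True
  moreover have "\<exists>l r. {} = {l..r::int}" by (intro exI[of _ 1] exI[of _ 0]) simp
  ultimately show ?thesis using g_pos by simp
next
  case False
  let ?c = "col T i"
  have ab: "a <= b" using \<open>valid T\<close> by (auto simp: valid_def T)
  have fI: "finite I" by (rule finite_subset[of _ "{?c<..b}"]) (auto simp: I_def undershoot_def)
  define r where "r = Max I"
  have rI: "r \<in> I" using Max_in[OF fI False] by (simp add: r_def)
  then have r: "?c < r" "r <= b" by (auto simp: I_def undershoot_def)
  have I: "I = {?c<..r}"
  proof
    show "I \<subseteq> {?c<..r}" using Max_ge[OF fI] by (fastforce simp: r_def I_def undershoot_def)
    obtain x' where "x' \<in> L" "r <= x'" "F x' < y" using rI by (auto simp: I_def undershoot_def)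
    then show "{?c<..r} \<subseteq> I" using r by (auto simp: I_def undershoot_def intro!: bexI[of _ x'])
  qed
  obtain m where m: "m < 2 ^ \<kappa>" "col T m < r" "r <= col T (Suc m)"
    using column_exists[of a r b lo hi "2 ^ \<kappa>"] r ab col_ge[OF ab, of lo hi i] by (auto simp: T col_last)
  have "i <= m" using m r col_mono[of "Suc m" i T] by (auto intro: ccontr)
  \<comment> \<open>The safety test needs a column to the left of the corner; it exists because an
    empty left side cannot be balanced.\<close>
  have "i \<noteq> 0"
  proof
    assume "i = 0"
    then show False using safe E1_pos by (simp add: safe_def mc_same)
  qed
  then obtain i' where i': "i = Suc i'" using not0_implies_Suc by blast
  have "L \<inter> I \<subseteq> viol T i y i' (Suc m)"
  proof
    fix x assume x: "x \<in> L \<inter> I"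
    then obtain x' where "x' \<in> L" "x <= x'" "F x' < y" by (auto simp: I_def undershoot_def)
    then have "F x < y" using L(2) x by (fastforce simp: mono_on_def)
    then show "x \<in> viol T i y i' (Suc m)"
      using x I i' m L(1) col_mono[of i' i T] by (auto simp: viol_def violates_def)
  qed
  then have "real (card (L \<inter> I)) <= real (card (viol T i y i' (Suc m)))"
    by (intro of_nat_mono card_mono) auto
  also have "\<dots> <= 16 / g * mu (col T i') (col T (Suc m)) + (3 * \<epsilon> + E2 / J) * X T"
    using i i' m \<open>i <= m\<close> assms by (intro safe_viol_le) auto
  finally have 1: "real (card (L \<inter> I)) <= 16 / g * mu (col T i') (col T (Suc m)) + (3 * \<epsilon> + E2 / J) * X T" .
  have 2: "mu (col T i') (col T (Suc m)) <= card (G \<inter> I) + 2 * (X T / 2 ^ \<kappa>)"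
  proof -
    have "mu (col T i') (col T (Suc m)) = mu (col T i') ?c + mu ?c r + mu r (col T (Suc m))"
      using i' r m col_mono[of i' i T] mu_add[of "col T i'" ?c "col T (Suc m)"]
        mu_add[of ?c r "col T (Suc m)"] by simp
    moreover have "mu (col T i') ?c <= X T / 2 ^ \<kappa>"
      using mu_le[of "col T i'" ?c] i' col_Suc_le[of a b lo hi i'] cw_eq[of T] safe col_mono[of i' i T]
      by (simp add: T safe_def width_def)
    moreover have "mu r (col T (Suc m)) <= X T / 2 ^ \<kappa>"
      using mu_le[of r "col T (Suc m)"] m col_Suc_le[of a b lo hi m] cw_eq[of T] safe
      by (simp add: T safe_def width_def)
    ultimately show ?thesis by (simp add: mu_def I)
  qed
  have "16 / g * mu (col T i') (col T (Suc m)) <= 16 / real_of_int g * (card (G \<inter> I) + 2 * (X T / 2 ^ \<kappa>))"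
    using g_pos by (intro mult_left_mono 2) auto
  also have "\<dots> <= 16 / g * card (G \<inter> I) + 1 * (2 * (X T / 2 ^ \<kappa>))"
    unfolding distrib_left using g_pos by (intro add_left_mono mult_right_mono) auto
  finally have "real (card (L \<inter> I)) <= 16 / g * card (G \<inter> I) + (2 * (X T / 2 ^ \<kappa>) + (3 * \<epsilon> + E2 / J) * X T)"
    using 1 by linarith
  also have "2 * (X T / 2 ^ \<kappa>) + (3 * \<epsilon> + E2 / J) * X T = sigma * X T"
    by (simp add: sigma_def distrib_right)
  finally have "real (card (L \<inter> I)) <= 16 / g * card (G \<inter> I) + sigma * X T" .
  moreover have "I = {?c + 1..r}" unfolding I by auto
  ultimately show ?thesis
    using sparse_dichotomy[of _ "card (G \<inter> I)" T "width T"] X_le[OF \<open>valid T\<close>] assms(7,8) by auto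
qed

text \<open>Let \<open>M\<close> be the rescaled count of the whole box. Each side has a count of at
  least \<open>M / 4\<close>, and every counting error is at most \<open>M / 24\<close>. So each
  side has at least \<open>5 / 24 * M\<close> points, which is one fifth of the largest possible
  total \<open>25 / 24 * M\<close>.\<close>

lemma safe_balanced:
  assumes T: "T = (a, b, lo, hi)" and "valid T" and "safe g bl bh T i y" and i: "i < 2 ^ \<kappa>"
    and E1: "24 * \<epsilon> <= E1 / J"
  shows "mu a (col T i) <= 4 / 5 * mu a b" "mu (col T i) b <= 4 / 5 * mu a b" "1 <= mu a b" "1 <= width T"
proof -
  let ?e = "X T / J"
  let ?M = "mc bl bh T 0 (2 ^ \<kappa>)"
  have ab: "a <= b" using \<open>valid T\<close> by (auto simp: valid_def T)
  have s: "E1 <= ?M" "?M <= 4 * mc bl bh T 0 i" "?M <= 4 * mc bl bh T i (2 ^ \<kappa>)"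
    using assms by (auto simp: safe_def)
  have e: "0 < ?e" using J_pos by simp
  have M: "24 * \<epsilon> * X T <= ?e * ?M"
  proof -
    have "24 * \<epsilon> * X T <= E1 / J * X T" using E1 by (intro mult_right_mono) auto
    also have "\<dots> = ?e * E1" by simp
    also have "\<dots> <= ?e * ?M" using s(1) e
      by (intro mult_left_mono) (metis of_int_le_iff of_int_of_nat_eq, simp)
    finally show ?thesis .
  qed
  have q4: "?e * ?M <= 4 * (?e * k)" if "?M <= 4 * k" for k :: nat
  proof -
    have "?e * real ?M <= ?e * real (4 * k)" using that e by (intro mult_left_mono) (simp_all only: of_nat_le_iff)
    then show ?thesis by (simp only: of_nat_mult mult.left_commute of_nat_numeral)
  qed
  note q = q4[OF s(2)] q4[OF s(3)]
  have ends: "col T 0 = a" "col T (2 ^ \<kappa>) = b" using ab by (simp_all add: T col_0 col_last)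
  have c: "a <= col T i" "col T i <= b" using ab by (simp_all add: T col_ge col_le)
  have "0 < \<epsilon> * X T" using eps_pos by simp
  then show "mu a (col T i) <= 4 / 5 * mu a b" "mu (col T i) b <= 4 / 5 * mu a b"
    using mc_accurate[OF \<open>valid T\<close>, of 0 i] mc_accurate[OF \<open>valid T\<close>, of i "2 ^ \<kappa>"]
      mc_accurate[OF \<open>valid T\<close>, of 0 "2 ^ \<kappa>"] mu_add[OF c] q M unfolding ends by linarith+
  have "0 < mu a b" using mc_accurate[OF \<open>valid T\<close>, of 0 "2 ^ \<kappa>"] M \<open>0 < \<epsilon> * X T\<close> unfolding ends by linarith
  then show "1 <= mu a b" by (simp add: mu_def)
  then show "1 <= width T" using mu_le[OF ab] by (simp add: T width_def)
qed

section \<open>Points outside of a chain without safe corners\<close>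

definition chain_pts :: "box => (nat => nat) => int set" where
  "chain_pts T r = (\<Union>i<2 ^ \<kappa>. pts F (cell T i (r i) (r (Suc i))))"

lemma unsafe_corner:
  assumes "valid T" "\<kappa> < clog (width T)" "E1 <= mc bl bh T 0 (2 ^ \<kappa>)"
    "mc bl bh T 0 (2 ^ \<kappa>) <= 4 * mc bl bh T 0 i" "mc bl bh T 0 (2 ^ \<kappa>) <= 4 * mc bl bh T i (2 ^ \<kappa>)"
    "\<not> safe g bl bh T i y" and E2: "(16 + 2 * g) * \<epsilon> <= E2 / J"
  obtains i' i'' where "i' < i" "i < i''" "i'' <= 2 ^ \<kappa>"
    "mu (col T i') (col T i'') <= g / 16 * card (viol T i y i' i'')"
proof -
  let ?e = "X T / J"
  obtain i' i'' where i: "i' < i" "i < i''" "i'' <= 2 ^ \<kappa>"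
    and "\<not> g * int (vc bl bh T i y i' i'') <= 16 * int (mc bl bh T i' i'') + E2"
    using assms unfolding safe_def by (auto simp: less_Suc_eq_le)
  then have "real_of_int (16 * int (mc bl bh T i' i'') + E2) <= real_of_int (g * int (vc bl bh T i y i' i''))"
    by (simp only: of_int_le_iff)
  then have "?e * (16 * mc bl bh T i' i'' + E2) <= ?e * (g * vc bl bh T i y i' i'')"
    by (intro mult_left_mono) auto
  then have "16 * (?e * mc bl bh T i' i'') + E2 / J * X T <= g * (?e * vc bl bh T i y i' i'')"
    by (simp add: algebra_simps)
  moreover have "g * (?e * vc bl bh T i y i' i'') <= g * (card (viol T i y i' i'') + 2 * \<epsilon> * X T)"
    using vc_accurate[of T i' i i'' y] assms i g_pos by (intro mult_left_mono) auto
  moreover have "16 * (mu (col T i') (col T i'') - \<epsilon> * X T) <= 16 * (?e * mc bl bh T i' i'')"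
    using mc_accurate[OF \<open>valid T\<close>, of i' i''] by auto
  moreover have "(16 + 2 * g) * \<epsilon> * X T <= E2 / J * X T" using E2 by (intro mult_right_mono) auto
  ultimately have "16 * mu (col T i') (col T i'') <= g * card (viol T i y i' i'')"
    by (simp add: algebra_simps)
  then show ?thesis using that[OF i] by simp
qed

text \<open>The chain passes through the corner given by its own row at column \<open>i\<close>:
  earlier cells lie weakly below this row, later ones weakly above it.\<close>

lemma viol_outside_chain:
  assumes r: "\<And>i. i < 2 ^ \<kappa> ==> rowv T (r i) <= rowv T (r (Suc i))" and "i <= 2 ^ \<kappa>"
  shows "viol T i (rowv T (r i)) i' i'' \<inter> chain_pts T r = {}"
proof (rule ccontr)
  assume "viol T i (rowv T (r i)) i' i'' \<inter> chain_pts T r \<noteq> {}"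
  then obtain x m where x: "x \<in> viol T i (rowv T (r i)) i' i''" "m < 2 ^ \<kappa>"
    "x \<in> pts F (cell T m (r m) (r (Suc m)))" by (auto simp: chain_pts_def)
  have up: "rowv T (r p) <= rowv T (r q)" if "p <= q" "q <= 2 ^ \<kappa>" for p q
    using that by (induction q rule: dec_induct) (auto intro: order_trans[OF _ r])
  show False
  proof (cases "m < i")
    case True
    then have "x <= col T i" using x(3) col_mono[of "Suc m" i T] by (auto simp: cell_def pts_def)
    then show False using x True up[of "Suc m" i] \<open>i <= 2 ^ \<kappa>\<close>
      by (auto simp: cell_def pts_def viol_def violates_def)
  next
    case False
    then have "col T i < x" using x(3) col_mono[of i m T] by (auto simp: cell_def pts_def)
    then show False using x False up[of i m]
      by (auto simp: cell_def pts_def viol_def violates_def)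
  qed
qed

text \<open>A chain passes through a corner at each column boundary, and all these corners are
  unsafe. Each boundary with a quarter of the samples on either side yields an interval of columns
  in which the violating points, all outside of the chain, make up a fraction of at least
  \<open>16 / g\<close>. A cover of multiplicity 2 costs a factor 2, and the restriction to the
  middle columns a factor 4; what remains is \<open>16 / (2 * 4 * g) = 2 / g\<close>.\<close>

lemma many_outside_chain:
  assumes T: "T = (a, b, lo, hi)" and "valid T" "\<kappa> < clog (width T)" "E1 <= mc bl bh T 0 (2 ^ \<kappa>)"
    and unsafe: "\<And>i q. i < 2 ^ \<kappa> ==> q < J + 2 ==> \<not> safe g bl bh T i (rowv T q)"
    and r: "\<And>i. i <= 2 ^ \<kappa> ==> r i < J + 2" "\<And>i. i < 2 ^ \<kappa> ==> rowv T (r i) <= rowv T (r (Suc i))"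
    and E2: "(16 + 2 * g) * \<epsilon> <= E2 / J" and E1: "10 * \<epsilon> <= E1 / J" "8 * (1 / 2 ^ \<kappa> + \<epsilon>) <= E1 / J"
  shows "2 / g * mu a b <= card (G \<inter> {a<..b} - chain_pts T r)"
proof -
  let ?e = "X T / J" and ?K = "2 ^ \<kappa> :: nat" and ?O = "G \<inter> {a<..b} - chain_pts T r"
  let ?m = "mc bl bh T"
  let ?M = "?m 0 ?K"
  have ab: "a <= b" using \<open>valid T\<close> by (auto simp: valid_def T)
  have ends: "col T 0 = a" "col T ?K = b" using ab by (simp_all add: T col_0 col_last)
  have e: "0 < ?e" using J_pos by simp
  have M: "E1 / J * X T <= ?e * ?M"
    using mult_left_mono[of "real_of_int E1" "real ?M" ?e] assms(4) e
    by (simp add: mult.commute)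
  have Mpos: "0 < ?M" using assms(4) E1_pos by linarith
  define p where "p = (LEAST i. ?M <= 4 * ?m 0 (Suc i))"
  define q where "q = (LEAST i. 4 * ?m (Suc i) ?K < ?M)"
  have SK: "Suc (?K - 1) = ?K" by simp
  have p: "?M <= 4 * ?m 0 (Suc p)" unfolding p_def by (rule LeastI[of _ "?K - 1"]) (simp add: SK)
  have q: "4 * ?m (Suc q) ?K < ?M" unfolding q_def by (rule LeastI[of _ "?K - 1"]) (simp add: SK mc_same Mpos)
  have "p <= ?K - 1" unfolding p_def by (rule Least_le) (simp add: SK)
  moreover have "q <= ?K - 1" unfolding q_def by (rule Least_le) (simp add: SK mc_same Mpos)
  moreover have "?K - 1 < ?K" by simp
  ultimately have pK: "p < ?K" "q < ?K" by (meson order_le_less_trans)+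
  have before: "4 * ?m 0 p < ?M"
  proof (cases p)
    case (Suc p')
    then show ?thesis using not_less_Least[of p' "\<lambda>i. ?M <= 4 * ?m 0 (Suc i)"] by (simp add: p_def)
  qed (simp add: mc_same Mpos)
  have cand: "?M <= 4 * ?m 0 (Suc i)" "?M <= 4 * ?m (Suc i) ?K" if "p <= i" "i < q" for i
  proof -
    show "?M <= 4 * ?m 0 (Suc i)" using p mc_add[of 0 "Suc p" "Suc i" bl bh T] that by simp
    show "?M <= 4 * ?m (Suc i) ?K" using not_less_Least[of i "\<lambda>i. 4 * ?m (Suc i) ?K < ?M"] that
      by (simp add: q_def)
  qed
  \<comment> \<open>A single column holds at most an eighth of the samples. Hence the columns
    between \<open>p\<close> and \<open>q\<close> hold at least 1 - 1/4 - 1/4 - 1/8 = 3/8 of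
    them.\<close>
  have column: "?e * ?m q (Suc q) <= ?e * ?M / 8"
  proof -
    have "mu (col T q) (col T (Suc q)) <= X T / 2 ^ \<kappa>"
      using mu_le[of "col T q" "col T (Suc q)"] col_Suc_le[of a b lo hi q] cw_eq[of T] assms(3)
        col_mono[of q "Suc q" T]
      by (simp add: T width_def)
    then have "?e * ?m q (Suc q) <= X T / 2 ^ \<kappa> + \<epsilon> * X T"
      using mc_accurate[OF \<open>valid T\<close>, of q "Suc q"] by linarith
    also have "\<dots> = (1 / 2 ^ \<kappa> + \<epsilon>) * X T" by (simp add: algebra_simps)
    also have "\<dots> <= (E1 / J / 8) * X T" using E1(2) by (intro mult_right_mono) auto
    also have "E1 / J / 8 * X T = (E1 / J * X T) / 8" by simp
    also have "\<dots> <= ?e * ?M / 8" using M by (intro divide_right_mono) auto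
    finally show ?thesis .
  qed
  have total: "?M = ?m 0 p + ?m p ?K" "?m q ?K = ?m q (Suc q) + ?m (Suc q) ?K"
    using pK by (auto intro!: mc_add)
  have "8 * ?m q (Suc q) <= ?M"
  proof -
    have "?e * (8 * ?m q (Suc q)) = 8 * (?e * ?m q (Suc q))"
      by (simp only: of_nat_mult of_nat_numeral mult.left_commute)
    moreover have "8 * u <= v" if "u <= v / 8" for u v :: real using that by linarith
    note this[OF column]
    ultimately have "?e * (8 * ?m q (Suc q)) <= ?e * ?M" by (simp only:)
    then have "real (8 * ?m q (Suc q)) <= ?M" using e by (simp only: mult_le_cancel_left_pos of_nat_mult)
    then show ?thesis by (simp only: of_nat_le_iff)
  qed
  have pq: "p <= q"
  proof (rule ccontr)
    assume "\<not> p <= q"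
    then have "?m p ?K <= ?m q ?K" using mc_add[of q p ?K bl bh T] pK by simp
    then show False using total before q \<open>8 * ?m q (Suc q) <= ?M\<close> by linarith
  qed
  have "3 * ?M <= 8 * ?m p q"
    using total before q \<open>8 * ?m q (Suc q) <= ?M\<close> mc_add[of p q ?K bl bh T] pq pK by linarith
  then have "?e * real (3 * ?M) <= ?e * real (8 * ?m p q)"
    using e by (intro mult_left_mono) (simp_all only: of_nat_le_iff)
  then have "3 * (?e * ?M) <= 8 * (?e * ?m p q)"
    by (simp only: of_nat_mult of_nat_numeral mult.left_commute)
  moreover have "10 * (\<epsilon> * X T) <= E1 / J * X T" using mult_right_mono[OF E1(1), of "X T"] by simp
  \<comment> \<open>The counting errors reduce 3/8 of the samples to a quarter of the points; this
    is where \<open>10 * \<epsilon> <= E1 / J\<close> is used.\<close>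
  ultimately have quarter: "mu a b <= 4 * mu (col T p) (col T q)"
    using M mc_accurate[OF \<open>valid T\<close>, of p q] mc_accurate[OF \<open>valid T\<close>, of 0 ?K] unfolding ends by linarith
  have "\<forall>i\<in>{p..<q}. \<exists>i' i''. i' < Suc i \<and> Suc i < i'' \<and> i'' <= ?K \<and>
      mu (col T i') (col T i'') <= g / 16 * card (viol T (Suc i) (rowv T (r (Suc i))) i' i'')"
  proof
    fix i assume i: "i \<in> {p..<q}"
    then have "\<not> safe g bl bh T (Suc i) (rowv T (r (Suc i)))" using pK unsafe r(1) by auto
    then show "\<exists>i' i''. i' < Suc i \<and> Suc i < i'' \<and> i'' <= ?K \<and>
      mu (col T i') (col T i'') <= g / 16 * card (viol T (Suc i) (rowv T (r (Suc i))) i' i'')"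
      using unsafe_corner[OF assms(2-4) cand _ E2] i by (metis atLeastLessThan_iff)
  qed
  then obtain f1 f2 where f: "\<And>i. i \<in> {p..<q} ==> f1 i < Suc i \<and> Suc i < f2 i \<and> f2 i <= ?K \<and>
      mu (col T (f1 i)) (col T (f2 i)) <= g / 16 * card (viol T (Suc i) (rowv T (r (Suc i))) (f1 i) (f2 i))"
    by metis
  define \<F> where "\<F> = (\<lambda>i. {col T (f1 i)<..col T (f2 i)}) ` {p..<q}"
  have "real (card (G \<inter> {a<..b} \<inter> \<Union>\<F>)) <= 2 * (g / 16) * real (card (?O \<inter> \<Union>\<F>))"
  proof (rule sparse_on_Union)
    show "\<exists>l r. I = {l..r}" if "I \<in> \<F>" for I
    proof -
      obtain i where "I = {col T (f1 i)<..col T (f2 i)}" using \<open>I \<in> \<F>\<close> by (auto simp: \<F>_def)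
      then have "I = {col T (f1 i) + 1..col T (f2 i)}" by auto
      then show ?thesis by blast
    qed
    show "real (card (G \<inter> {a<..b} \<inter> I)) <= g / 16 * real (card (?O \<inter> I))" if "I \<in> \<F>" for I
    proof -
      obtain i where i: "i \<in> {p..<q}" "I = {col T (f1 i)<..col T (f2 i)}" using \<open>I \<in> \<F>\<close> by (auto simp: \<F>_def)
      have "I \<subseteq> {a<..b}" using ab by (auto simp: i T) (meson ab col_ge order_le_less_trans, meson col_le order_trans)
      then have "G \<inter> {a<..b} \<inter> I = G \<inter> I" by auto
      then have "real (card (G \<inter> {a<..b} \<inter> I)) <= g / 16 * card (viol T (Suc i) (rowv T (r (Suc i))) (f1 i) (f2 i))"
        using f[OF i(1)] by (simp add: mu_def i)
      also have "\<dots> <= g / 16 * card (?O \<inter> I)"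
      proof -
        have "viol T (Suc i) (rowv T (r (Suc i))) (f1 i) (f2 i) \<subseteq> ?O \<inter> I"
          using viol_outside_chain[of T r "Suc i" "f1 i" "f2 i"] r(2) i pK \<open>I \<subseteq> {a<..b}\<close>
          by (fastforce simp: viol_def)
        then show ?thesis using g_pos by (intro mult_left_mono of_nat_mono card_mono) auto
      qed
      finally show ?thesis .
    qed
  qed (use g_pos in \<open>auto simp: \<F>_def\<close>)
  moreover have "{col T p<..col T q} \<subseteq> {a<..b} \<inter> \<Union>\<F>"
  proof
    fix x assume x: "x \<in> {col T p<..col T q}"
    have "a < x" "x <= b" using x col_ge[OF ab, of lo hi p] col_le[of a b lo hi q] by (auto simp: T)
    obtain i where i: "i < q" "col T i < x" "x <= col T (Suc i)"
      using column_exists[of a x b lo hi q] x ab \<open>a < x\<close> by (auto simp: T)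
    have "p <= i" using i x col_mono[of "Suc i" p T] by (auto intro: ccontr)
    then have "i \<in> {p..<q}" using i by simp
    then have "x \<in> {col T (f1 i)<..col T (f2 i)}"
      using f[of i] i col_mono[of "f1 i" i T] col_mono[of "Suc i" "f2 i" T] by force
    then show "x \<in> {a<..b} \<inter> \<Union>\<F>" using \<open>i \<in> {p..<q}\<close> \<open>a < x\<close> \<open>x <= b\<close> by (auto simp: \<F>_def)
  qed
  then have "mu (col T p) (col T q) <= card (G \<inter> {a<..b} \<inter> \<Union>\<F>)"
    unfolding mu_def by (intro of_nat_mono card_mono) auto
  moreover have "real (card (?O \<inter> \<Union>\<F>)) <= card ?O" by (intro of_nat_mono card_mono) auto
  then have "2 * (g / 16) * real (card (?O \<inter> \<Union>\<F>)) <= 2 * (g / 16) * card ?O"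
    using g_pos by (intro mult_left_mono) auto
  ultimately have "mu a b <= g / 2 * card ?O" using quarter by linarith
  then show ?thesis using g_pos by (simp add: field_simps)
qed

end

section \<open>One level of the recursion\<close>

text \<open>One level of the recursion: \<open>V\<close> is the estimator of the previous level in
  units of \<open>1 / U\<close>, with error \<open>\<tau>\<close> per lost point and
  \<open>\<delta>\<close> per index. It is applied only to boxes whose value bounds are values of
  \<open>F\<close> or bounds of the current box; confining them to the set \<open>Vals\<close> keeps
  the union bound small.\<close>

locale lis_level = sampled_grid +
  fixes V :: "box => int" and U \<tau> \<delta> :: real and Vals :: "int set"
  assumes U_pos: "0 < U" and tau_pos: "0 < \<tau>" and tau_le_1: "\<tau> <= 1" and delta_nonneg: "0 <= \<delta>"
    and g_tau: "16 / g <= \<tau> / 20"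
    and Vals: "\<And>x. 0 < x ==> x <= n ==> F x \<in> Vals"
    and V_nonneg: "\<And>a b lo hi. 0 <= a ==> a <= b ==> b <= n ==> lo <= hi ==> lo \<in> Vals ==> hi \<in> Vals ==>
      0 <= V (a, b, lo, hi)"
    and V_approx: "\<And>a b lo hi. 0 <= a ==> a <= b ==> b <= n ==> lo <= hi ==> lo \<in> Vals ==> hi \<in> Vals ==>
      \<bar>V (a, b, lo, hi) / U - lisb F (a, b, lo, hi)\<bar> \<le>
        \<tau> * (real (card (pts F (a, b, lo, hi))) - lisb F (a, b, lo, hi)) + \<delta> * (b - a)"
    and E2_margin: "(16 + 2 * g) * \<epsilon> <= E2 / J"
    and E1_margin: "24 * \<epsilon> <= E1 / J" "8 * (1 / 2 ^ \<kappa> + \<epsilon>) <= E1 / J"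
begin

text \<open>The gain of the level. Without safe corners, a fraction of order \<open>1 / g\<close> of
  the points lies outside of the chain; these points are certainly lost, so that the error
  \<open>\<tau>\<close> applies to the others only.\<close>

definition tau' :: real where "tau' = \<tau> * (1 - 1 / g)"

definition good :: "box => bool" where
  "good T \<longleftrightarrow> valid T \<and> (case T of (a, b, lo, hi) => lo \<in> Vals \<and> hi \<in> Vals)"

abbreviation K :: nat where "K \<equiv> 2 ^ \<kappa>"

text \<open>The overshoot is a final segment of the index range and the undershoot an initial one,
  so this set is an interval.\<close>

definition middle :: "int set => box => int set" where
  "middle L T = (case T of (a, b, lo, hi) => {a<..b} - overshoot L T - undershoot L T)"

definition sparse_err :: real where "sparse_err = 2 * (E1 / J) + 2 * \<epsilon>"
definition leaf_err :: real where "leaf_err = 4 * K * \<epsilon> + 4 / K + sparse_err"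

lemma g_real: "16 <= real_of_int g" using g_pos by simp

lemma tau'_bounds: "0 < tau'" "tau' <= \<tau>" "\<tau> / 2 <= tau'" "tau' <= 1"
proof -
  have "1 / real_of_int g <= 1 / 16" "0 <= 1 / real_of_int g" using g_real by (auto simp: field_simps)
  then have *: "\<tau> * (15 / 16) <= tau'" "tau' <= \<tau> * 1" unfolding tau'_def
    using tau_pos by (auto intro!: mult_left_mono)
  then show "0 < tau'" "tau' <= \<tau>" "\<tau> / 2 <= tau'" "tau' <= 1" using tau_pos tau_le_1 by auto
qed

lemma row_in_Vals: "good (a, b, lo, hi) ==> rowv (a, b, lo, hi) q \<in> Vals"
  using Vals by (auto simp: rowv_def good_def valid_def pts_def)

lemma cell_cases:
  assumes "good T" "rowv T p <= rowv T q"
  obtains a b lo hi where "cell T i p q = (a, b, lo, hi)" "0 <= a" "a <= b" "b <= n" "lo <= hi"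
    "lo \<in> Vals" "hi \<in> Vals" "b - a = col T (Suc i) - col T i"
proof -
  obtain a b lo hi where T: "T = (a, b, lo, hi)" by (cases T)
  have ab: "0 <= a" "a <= b" "b <= n" using assms by (auto simp: T good_def valid_def)
  then have "0 <= col T i" "col T (Suc i) <= n"
    using col_ge[OF ab(2), of lo hi i] col_le[of a b lo hi "Suc i"] by (auto simp: T)
  then show ?thesis using that assms col_mono[of i "Suc i" T] row_in_Vals[of a b lo hi]
    by (simp add: cell_def T)
qed

lemma V_cell_nonneg: "good T ==> rowv T p <= rowv T q ==> 0 <= V (cell T i p q)"
  by (rule cell_cases[of T p q i]) (auto intro: V_nonneg)

lemma V_cell_approx:
  assumes "good T" "rowv T p <= rowv T q"
  shows "\<bar>V (cell T i p q) / U - lisb F (cell T i p q)\<bar> \<le>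
    \<tau> * (real (card (pts F (cell T i p q))) - lisb F (cell T i p q)) + \<delta> * (col T (Suc i) - col T i)"
proof (rule cell_cases[OF assms, of i])
  fix a b lo hi assume *: "cell T i p q = (a, b, lo, hi)" "0 <= a" "a <= b" "b <= n" "lo <= hi"
    "lo \<in> Vals" "hi \<in> Vals" "b - a = col T (Suc i) - col T i"
  have "real_of_int b - real_of_int a = real_of_int (col T (Suc i)) - real_of_int (col T i)"
    using arg_cong[OF *(8), of real_of_int] by simp
  then show ?thesis using V_approx[OF *(2-7)] unfolding *(1) by simp
qed

lemma lisb_width_1: "a <= b ==> b <= a + 1 ==> lisb F (a, b, lo, hi) = card (pts F (a, b, lo, hi))"
proof (rule antisym[OF lisb_le_card lisb_ge[OF subset_refl]])
  assume "a <= b" "b <= a + 1"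
  then have "x = y" if "x \<in> pts F (a, b, lo, hi)" "y \<in> pts F (a, b, lo, hi)" for x y
    using that by (auto simp: pts_def)
  then show "mono_on (pts F (a, b, lo, hi)) F" by (metis monotone_onI order_refl)
qed

lemma sum_col: "(\<Sum>i<K. col T (Suc i) - col T i) = width T" if "good T"
proof -
  obtain a b lo hi where T: "T = (a, b, lo, hi)" by (cases T)
  have "a <= b" using that by (auto simp: T good_def valid_def)
  then show ?thesis
    by (simp add: sum_lessThan_telescope T col_0 col_last width_def)
qed

lemma card_column: "card {col T i<..col T (Suc i)} <= nat (cw \<kappa> (width T))"
  using col_Suc_le[of "fst T" "fst (snd T)" "fst (snd (snd T))" "snd (snd (snd T))" i]
  by (cases T) (simp add: width_def)

text \<open>Subtracting 1 makes the bound hold for narrow boxes, too, whose columns have width 1. It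
  can be subtracted because each column to which this is applied contains an index that is
  kept.\<close>

lemma cw_minus_1_le:
  assumes "valid T" "1 <= width T"
  shows "real_of_int (cw \<kappa> (width T)) - 1 <= 2 * width T / K"
proof (cases "\<kappa> < clog (width T)")
  case True
  then show ?thesis using cw_eq[OF True] divide_right_mono[OF X_le[OF assms], of "real K"] by simp
next
  case False
  then show ?thesis using assms by (simp add: cw_def)
qed

lemma chain_cells_disjoint:
  "finite I ==> card (\<Union>i\<in>I. pts F (cell T i (r i) (r (Suc i)))) = (\<Sum>i\<in>I. card (pts F (cell T i (r i) (r (Suc i)))))"
  by (rule card_UN_disjoint) (simp, simp, fastforce simp: cell_def pts_def dest: column_unique)

text \<open>The estimate is compared with the chain that follows \<open>L\<close> on its middle
  part. \<open>B\<close> adds up the longest increasing subsets of the cells of this chain, and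
  \<open>r\<close> counts all their points; cells of columns that miss \<open>middle\<close> are
  dropped, since their points would only add to the loss. In a narrow box every cell has at most one
  index and is increasing, so that \<open>r = B\<close>.\<close>

lemma est_ge:
  assumes T: "T = (a, b, lo, hi)" and good: "good T" and L: "L \<subseteq> G" "mono_on L F" and w: "1 <= width T"
  defines "M \<equiv> middle L T"
  shows "\<exists>r' B r. (\<forall>i. r' i < J + 2) \<and> (\<forall>i. rowv T (r' i) <= rowv T (r' (Suc i))) \<and>
    real (card (L \<inter> M)) - 2 * real K * \<epsilon> * real_of_int (width T) <= B \<and>
    (1 + \<tau>) * B - \<tau> * r - \<delta> * real_of_int (width T) <= est V T / U \<and>
    r <= real (card (G \<inter> M)) - real (card (G \<inter> M - chain_pts T r')) + 4 * real_of_int (width T) / real K \<and>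
    (clog (width T) <= \<kappa> --> r = B)"
proof -
  have valid: "valid T" and ab: "0 <= a" "a <= b" "b <= n"
    using good by (auto simp: good_def valid_def T)
  have MX: "M \<subseteq> {a<..b}" by (auto simp: M_def middle_def T)
  have fM: "finite M" using MX finite_subset by blast
  let ?S = "L \<inter> M"
  have S: "?S \<subseteq> pts F T"
    using MX by (force simp: T pts_def M_def middle_def overshoot_def undershoot_def)
  have Smono: "mono_on ?S F" using L(2) by (auto intro: mono_on_subset)
  obtain r where r: "\<And>i. r i < J + 2" "\<And>i. rowv T (r i) <= rowv T (r (Suc i))"
    and lost: "real (card (?S - chain_pts T r)) <= 2 ^ \<kappa> * (\<epsilon> * X T)"
    by (rule row_chain_for[OF T valid S Smono, folded chain_pts_def]) blast
  let ?C = "\<lambda>i. cell T i (r i) (r (Suc i))"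
  define I where "I = {i. i < K \<and> M \<inter> {col T i<..col T (Suc i)} \<noteq> {}}"
  have I: "finite I" "I \<subseteq> {..<K}" by (auto simp: I_def)
  define B where "B = (\<Sum>i\<in>I. real (lisb F (?C i)))"
  define c where "c = (\<Sum>i\<in>I. real (card (pts F (?C i))))"
  have "(\<Sum>i\<in>I. V (?C i)) <= (\<Sum>i<K. V (?C i))"
    using V_cell_nonneg[OF good] r(2) by (intro sum_mono2 I) auto
  also have "\<dots> <= est V T"
    unfolding est_def using r by (intro best_chain_ge) auto
  finally have "(\<Sum>i\<in>I. real_of_int (V (?C i))) <= est V T" by (simp flip: of_int_sum)
  then have est: "(\<Sum>i\<in>I. V (?C i) / U) <= est V T / U"
    using U_pos by (simp add: divide_right_mono flip: sum_divide_distrib)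
  have "(\<Sum>i\<in>I. (1 + \<tau>) * lisb F (?C i) - \<tau> * card (pts F (?C i)) - \<delta> * (col T (Suc i) - col T i)) <= (\<Sum>i\<in>I. V (?C i) / U)"
  proof (rule sum_mono)
    fix i
    show "(1 + \<tau>) * lisb F (?C i) - \<tau> * card (pts F (?C i)) - \<delta> * (col T (Suc i) - col T i) <= V (?C i) / U"
      using V_cell_approx[OF good r(2), of i i] by (simp add: algebra_simps abs_le_iff)
  qed
  moreover have "(\<Sum>i\<in>I. real_of_int (col T (Suc i) - col T i)) <= width T"
  proof -
    have "(\<Sum>i\<in>I. col T (Suc i) - col T i) <= (\<Sum>i<K. col T (Suc i) - col T i)"
      using col_mono by (intro sum_mono2 I) auto
    then show ?thesis unfolding sum_col[OF good] by (simp only: of_int_le_iff flip: of_int_sum)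
  qed
  then have "\<delta> * (\<Sum>i\<in>I. real_of_int (col T (Suc i) - col T i)) <= \<delta> * width T"
    using delta_nonneg by (rule mult_left_mono)
  ultimately have lower: "(1 + \<tau>) * B - \<tau> * c - \<delta> * width T <= est V T / U"
    using est by (simp add: B_def c_def sum_subtractf flip: sum_distrib_left)
  have "card (?S \<inter> chain_pts T r) <= card (\<Union>i\<in>I. ?S \<inter> pts F (?C i))"
  proof (intro card_mono)
    show "?S \<inter> chain_pts T r \<subseteq> (\<Union>i\<in>I. ?S \<inter> pts F (?C i))"
    proof
      fix x assume x: "x \<in> ?S \<inter> chain_pts T r"
      then obtain i where i: "i < K" "x \<in> pts F (?C i)" by (auto simp: chain_pts_def)
      then have "x \<in> M \<inter> {col T i<..col T (Suc i)}" using x by (auto simp: cell_def pts_def)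
      then have "i \<in> I" using i(1) unfolding I_def by blast
      then show "x \<in> (\<Union>i\<in>I. ?S \<inter> pts F (?C i))" using x i by blast
    qed
  qed (rule finite_subset[OF _ fM], auto)
  also have "\<dots> <= (\<Sum>i\<in>I. card (?S \<inter> pts F (?C i)))" by (rule card_UN_le[OF I(1)])
  also have "\<dots> <= (\<Sum>i\<in>I. lisb F (?C i))"
    using Smono by (intro sum_mono lisb_ge) (auto intro: mono_on_subset)
  finally have "real (card (?S \<inter> chain_pts T r)) <= B" by (simp add: B_def flip: of_nat_sum)
  moreover have "card ?S = card (?S \<inter> chain_pts T r) + card (?S - chain_pts T r)"
    using fM by (subst card_Un_disjoint[symmetric]) (auto intro!: arg_cong[of _ _ card])
  moreover have "2 ^ \<kappa> * (\<epsilon> * X T) <= 2 * K * \<epsilon> * width T"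
  proof -
    have "(K * \<epsilon>) * X T <= (K * \<epsilon>) * (2 * width T)"
      using eps_pos X_le[OF valid w] by (intro mult_left_mono) auto
    then show ?thesis by (simp add: mult_ac)
  qed
  ultimately have AB: "real (card ?S) - 2 * K * \<epsilon> * width T <= B" using lost by linarith
  \<comment> \<open>Every column of \<open>I\<close> meets the interval \<open>M\<close>, so only
    those containing the first or the last index of \<open>M\<close> can stick out of it. The
    surplus is therefore at most two columns, less one index each.\<close>
  let ?Y = "\<Union>i\<in>I. {col T i<..col T (Suc i)}"
  have "?Y - M \<subseteq> (\<Union>x\<in>{Min M, Max M}. \<Union>i\<in>{i\<in>I. x \<in> {col T i<..col T (Suc i)}}. {col T i<..col T (Suc i)} - {x})"
  proof
    fix x assume x: "x \<in> ?Y - M"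
    then obtain i where i1: "i \<in> I" "x \<in> {col T i<..col T (Suc i)}" by blast
    then obtain m where "m \<in> M" "m \<in> {col T i<..col T (Suc i)}" unfolding I_def by blast
    note i = i1 this
    have "M \<noteq> {}" using i by blast
    then have m: "Min M <= m" "m <= Max M" "Min M \<in> M" "Max M \<in> M" using fM i by auto
    have "x \<notin> {Min M..Max M}"
    proof
      assume "x \<in> {Min M..Max M}"
      moreover have "x \<in> M" if "y \<in> M" "z \<in> M" "y <= x" "x <= z" for y z
        using that by (auto simp: M_def middle_def T overshoot_def undershoot_def)
      ultimately show False using x m by auto
    qed
    then have "x < Min M \<or> Max M < x" by auto
    then have "Min M \<in> {col T i<..col T (Suc i)} \<and> x \<noteq> Min M \<or> Max M \<in> {col T i<..col T (Suc i)} \<and> x \<noteq> Max M"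
      using i m by auto
    then show "x \<in> (\<Union>x\<in>{Min M, Max M}. \<Union>i\<in>{i\<in>I. x \<in> {col T i<..col T (Suc i)}}. {col T i<..col T (Suc i)} - {x})"
      using i by blast
  qed
  moreover have bound: "card (\<Union>i\<in>{i\<in>I. x \<in> {col T i<..col T (Suc i)}}. {col T i<..col T (Suc i)} - {x}) <= nat (cw \<kappa> (width T)) - 1" for x
  proof (cases "\<exists>i\<in>I. x \<in> {col T i<..col T (Suc i)}")
    case True
    then obtain i where i: "i \<in> I" "x \<in> {col T i<..col T (Suc i)}" by blast
    then have "{i\<in>I. x \<in> {col T i<..col T (Suc i)}} = {i}" by (auto dest: column_unique)
    then show ?thesis using i card_column[of T i] by simp
  next
    case False
    then have "{i\<in>I. x \<in> {col T i<..col T (Suc i)}} = {}" by blast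
    then show ?thesis by (simp only: UN_empty card.empty)
  qed
  ultimately have "card (?Y - M) <= 2 * (nat (cw \<kappa> (width T)) - 1)"
  proof -
    assume sub: "?Y - M \<subseteq> (\<Union>x\<in>{Min M, Max M}. \<Union>i\<in>{i\<in>I. x \<in> {col T i<..col T (Suc i)}}. {col T i<..col T (Suc i)} - {x})"
    let ?H = "\<lambda>x. \<Union>i\<in>{i\<in>I. x \<in> {col T i<..col T (Suc i)}}. {col T i<..col T (Suc i)} - {x}"
    have fin: "finite (?H x)" for x using I(1) by simp
    have "card (?Y - M) <= card (?H (Min M) \<union> ?H (Max M))"
      using sub fin by (intro card_mono) auto
    also have "\<dots> <= card (?H (Min M)) + card (?H (Max M))" by (rule card_Un_le)
    finally show ?thesis using bound[of "Min M"] bound[of "Max M"] by linarith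
  qed
  then have "real (card (?Y - M)) <= 2 * real (nat (cw \<kappa> (width T)) - 1)" by linarith
  moreover have "real (nat (cw \<kappa> (width T)) - 1) = real_of_int (cw \<kappa> (width T)) - 1"
    using cw_pos[of "width T"] by (simp add: of_nat_diff)
  ultimately have YM: "real (card (?Y - M)) <= 4 * width T / K"
    using cw_minus_1_le[OF valid w] by simp
  have "c = card (\<Union>i\<in>I. pts F (?C i))" by (simp add: c_def chain_cells_disjoint[OF I(1)])
  also have "\<dots> <= card ((G \<inter> M \<inter> chain_pts T r) \<union> (?Y - M))"
  proof (intro of_nat_mono card_mono)
    show "(\<Union>i\<in>I. pts F (?C i)) \<subseteq> (G \<inter> M \<inter> chain_pts T r) \<union> (?Y - M)"
    proof
      fix x assume "x \<in> (\<Union>i\<in>I. pts F (?C i))"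
      then obtain i where i: "i \<in> I" "x \<in> pts F (?C i)" by blast
      have "bl <= lo" "hi <= bh" "lo <= hi" using valid by (auto simp: T valid_def)
      then have "x \<in> G" using i row_bounds[of lo hi a b "r i"] row_bounds[of lo hi a b "r (Suc i)"]
        by (auto simp: cell_def pts_def G_def T)
      moreover have "x \<in> chain_pts T r" "x \<in> ?Y" using i I(2) by (auto simp: chain_pts_def cell_def pts_def)
      ultimately show "x \<in> (G \<inter> M \<inter> chain_pts T r) \<union> (?Y - M)" by blast
    qed
  qed (use fM I in auto)
  also have "\<dots> <= card (G \<inter> M \<inter> chain_pts T r) + card (?Y - M)"
    using card_Un_le[of "G \<inter> M \<inter> chain_pts T r" "?Y - M"] by (simp only: of_nat_le_iff flip: of_nat_add)
  finally have "c <= real (card (G \<inter> M \<inter> chain_pts T r)) + real (card (?Y - M))" by simp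
  moreover have "real (card (G \<inter> M \<inter> chain_pts T r)) = real (card (G \<inter> M)) - real (card (G \<inter> M - chain_pts T r))"
  proof -
    have "card (G \<inter> M) = card (G \<inter> M \<inter> chain_pts T r) + card (G \<inter> M - chain_pts T r)"
      using fM by (subst card_Un_disjoint[symmetric]) (auto intro!: arg_cong[of _ _ card])
    then show ?thesis by simp
  qed
  ultimately have c: "c <= real (card (G \<inter> M)) - real (card (G \<inter> M - chain_pts T r)) + 4 * width T / K"
    using YM by linarith
  have "c = B" if "clog (width T) <= \<kappa>"
    unfolding B_def c_def
  proof (rule sum.cong[OF refl])
    fix i
    have "col T (Suc i) <= col T i + 1" using col_Suc_le[of a b lo hi i] that
      by (simp add: T width_def cw_def)
    then show "real (card (pts F (?C i))) = real (lisb F (?C i))"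
      using lisb_width_1[of "col T i" "col T (Suc i)"] col_mono[of i "Suc i" T] by (simp add: cell_def)
  qed
  then show ?thesis using r AB lower c by (intro exI[of _ r] exI[of _ B] exI[of _ c]) simp
qed

end

section \<open>Accuracy of a single leaf of the splitting tree\<close>

context lis_level begin

definition astray :: "int set => box => int set" where
  "astray L T = overshoot L T \<union> undershoot L T"

definition indices :: "box => int set" where
  "indices = (\<lambda>(a, b, lo, hi). {a<..b})"

definition muT :: "box => real" where "muT T = real (card (G \<inter> indices T))"

lemma muT_eq: "muT (a, b, lo, hi) = mu a b" by (simp add: muT_def mu_def indices_def)

lemma astray_subset: "astray L T \<subseteq> indices T"
  by (cases T) (auto simp: astray_def overshoot_def undershoot_def indices_def)

lemma middle_eq: "middle L T = indices T - astray L T"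
  by (cases T) (auto simp: astray_def middle_def indices_def)

lemma finite_indices [simp]: "finite (indices T)" by (cases T) (simp add: indices_def)

lemma card_split: "finite A ==> card (H \<inter> A) = card (H \<inter> (A \<inter> B)) + card (H \<inter> (A - B))"
  by (subst card_Un_disjoint[symmetric]) (auto intro!: arg_cong[of _ _ card])

lemma sparse_bound:
  assumes "good T" "1 <= width T" "\<not> E1 <= mc bl bh T 0 K"
  shows "muT T <= sparse_err * width T"
proof -
  obtain a b lo hi where T: "T = (a, b, lo, hi)" by (cases T)
  have valid: "valid T" and ab: "a <= b" using assms by (auto simp: good_def T valid_def)
  have ends: "col T 0 = a" "col T K = b" using ab by (simp_all add: T col_0 col_last)
  have "real_of_int (int (mc bl bh T 0 K)) <= real_of_int E1" using assms(3) by (simp only: of_int_le_iff)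
  then have "X T / J * mc bl bh T 0 K <= X T / J * E1" by (intro mult_left_mono) auto
  then have "mu a b <= (E1 / J + \<epsilon>) * X T"
    using mc_accurate[OF valid, of 0 K] unfolding ends by (simp add: algebra_simps)
  also have "\<dots> <= (E1 / J + \<epsilon>) * (2 * width T)"
    using X_le[OF valid assms(2)] E1_pos eps_pos by (intro mult_left_mono) auto
  finally show ?thesis by (simp add: T muT_eq sparse_err_def algebra_simps)
qed

lemma est_nonneg: "0 <= est V T / U"
  unfolding est_def best_chain_def using U_pos by (intro divide_nonneg_pos) (simp_all only: of_int_0_le_iff bmax_nonneg)

text \<open>There are three cases: the box is narrow and its cells are exact; it has few points and
  \<open>sparse_err\<close> absorbs them; or no corner is safe and many points lie outside of the
  chain, which lowers the charge per lost point from \<open>\<tau>\<close> to \<open>tau'\<close>.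
  Astray points are charged \<open>\<tau> / 2\<close> only, because the final account needs the rest
  of their share for the points of \<open>L\<close> among them.\<close>

lemma leaf_lower:
  assumes good: "good T" and L: "L \<subseteq> G" "mono_on L F" and "isel g bl bh T = 0"
  shows "real (card (L \<inter> (indices T - astray L T)))
    - tau' * (real (card (G \<inter> (indices T - astray L T))) - real (card (L \<inter> (indices T - astray L T))))
    - \<tau> / 2 * card (G \<inter> astray L T) - (leaf_err + \<delta>) * width T <= est V T / U"
proof -
  obtain a b lo hi where T: "T = (a, b, lo, hi)" by (cases T)
  have valid: "valid T" and ab: "a <= b" using good by (auto simp: good_def T valid_def)
  show ?thesis
  proof (cases "1 <= width T")
    case False
    then have "a = b" using ab by (simp add: T width_def)
    then have "indices T = {}" by (simp add: T indices_def)
    then show ?thesis using est_nonneg[of T] astray_subset[of L T] \<open>a = b\<close> by (simp add: T width_def)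
  next
    case w: True
    define l p q w where "l = real (card (L \<inter> middle L T))" and "p = real (card (G \<inter> middle L T))"
      and "q = real (card (G \<inter> astray L T))" and "w = real_of_int (width T)"
    have "finite (middle L T)" by (simp add: middle_eq)
    then have lp: "0 <= l" "l <= p" using L(1) unfolding l_def p_def by (auto intro!: card_mono)
    have w0: "1 <= w" using w by (simp add: w_def)
    have m: "muT T = p + q"
    proof -
      have "indices T \<inter> astray L T = astray L T" using astray_subset by blast
      then show ?thesis using card_split[OF finite_indices[of T], of G "astray L T"]
        by (simp add: muT_def p_def q_def middle_eq)
    qed
    define A where "A = l - 2 * real K * \<epsilon> * w"
    have "\<exists>r' B r. (\<forall>i. r' i < J + 2) \<and> (\<forall>i. rowv T (r' i) <= rowv T (r' (Suc i))) \<and> A <= B \<and>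
      (1 + \<tau>) * B - \<tau> * r - \<delta> * w <= est V T / U \<and>
      r <= p - real (card (G \<inter> middle L T - chain_pts T r')) + 4 * w / real K \<and>
      (clog (width T) <= \<kappa> --> r = B)"
      using est_ge[OF T good L w] unfolding l_def p_def w_def A_def .
    then obtain r' B r where r': "\<forall>i. r' i < J + 2" "\<forall>i. rowv T (r' i) <= rowv T (r' (Suc i))"
      and B: "A <= B"
      and E: "(1 + \<tau>) * B - \<tau> * r - \<delta> * w <= est V T / U"
      and r: "r <= p - real (card (G \<inter> middle L T - chain_pts T r')) + 4 * w / real K"
      and small: "clog (width T) <= \<kappa> --> r = B"
      by (elim exE conjE)
    have err: "0 <= 2 * K * \<epsilon> * w" "0 <= 4 * w / K" "0 <= sparse_err * w"
      using eps_pos E1_pos w0 J_pos by (auto simp: sparse_err_def)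
    have leaf: "leaf_err * w = 4 * K * \<epsilon> * w + 4 * w / K + sparse_err * w"
      by (simp add: leaf_err_def distrib_right)
    have t: "0 <= tau' * (p - l)" "0 <= \<tau> / 2 * q" using lp tau'_bounds tau_pos by (auto simp: q_def)
    have "l - tau' * (p - l) - \<tau> / 2 * q - (leaf_err + \<delta>) * w <= est V T / U"
    proof (cases "clog (width T) <= \<kappa>")
      case True
      then have "B - \<delta> * w <= est V T / U" using E small by (simp add: algebra_simps)
      then show ?thesis using A_def B err leaf t unfolding distrib_right by linarith
    next
      case big: False
      define o' where "o' = real (card (G \<inter> middle L T - chain_pts T r'))"
      have "\<tau> * r <= \<tau> * (p - o') + 1 * (4 * w / K)"
      proof -
        have "\<tau> * r <= \<tau> * (p - o' + 4 * w / K)" using r tau_pos unfolding o'_def by (intro mult_left_mono) auto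
        also have "\<dots> <= \<tau> * (p - o') + 1 * (4 * w / K)"
          unfolding distrib_left using tau_le_1 err by (intro add_left_mono mult_right_mono) auto
        finally show ?thesis .
      qed
      moreover have "(1 + \<tau>) * A <= (1 + \<tau>) * B" using B tau_pos by (intro mult_left_mono) auto
      moreover have "(1 + \<tau>) * A = l + \<tau> * l - (1 + \<tau>) * (2 * K * \<epsilon> * w)" by (simp add: A_def algebra_simps)
      moreover have "(1 + \<tau>) * (2 * K * \<epsilon> * w) <= 2 * (2 * K * \<epsilon> * w)"
        using tau_le_1 err by (intro mult_right_mono) auto
      ultimately have E': "l - \<tau> * (p - l) + \<tau> * o' - 2 * (2 * K * \<epsilon> * w) - 4 * w / K - \<delta> * w <= est V T / U"
        using E unfolding right_diff_distrib by linarith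
      have o': "0 <= \<tau> * o'" using tau_pos by (simp add: o'_def)
      show ?thesis
      proof (cases "E1 <= mc bl bh T 0 K")
        case False
        have "p + q <= sparse_err * w" using sparse_bound[OF good w False] m by (simp add: w_def)
        moreover have "(\<tau> - tau') * (p - l) <= 1 * p"
          using tau'_bounds tau_le_1 lp by (intro mult_mono) auto
        then have "\<tau> * (p - l) <= tau' * (p - l) + p" by (simp add: algebra_simps)
        moreover have "0 <= q" by (simp add: q_def)
        ultimately show ?thesis using E' err leaf t o' unfolding distrib_right by linarith
      next
        case True
        have "2 / g * mu a b <= card (G \<inter> {a<..b} - chain_pts T r')"
          using isel_0_not_safe[OF assms(4) E1_pos] r' E2_margin E1_margin eps_pos big True
          by (intro many_outside_chain[OF T valid]) auto
        also have "\<dots> <= card ((G \<inter> middle L T - chain_pts T r') \<union> (G \<inter> astray L T))"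
          using finite_subset[OF astray_subset[of L T] finite_indices]
          by (intro of_nat_mono card_mono) (auto simp: middle_eq T indices_def)
        also have "\<dots> <= o' + q"
          using card_Un_le[of "G \<inter> middle L T - chain_pts T r'" "G \<inter> astray L T"] by (simp add: o'_def q_def)
        finally have "2 / g * (p + q) <= o' + q" using m by (simp add: T muT_eq)
        \<comment> \<open>Half of the gain is given away by the factor 2 on \<open>o'\<close>. This
          halves the charge per astray point to \<open>\<tau> / 2\<close>, and the remaining gain
          \<open>\<tau> / g\<close> is just what \<open>tau'\<close> requires.\<close>
        then have "2 / g * (p + q) - q <= 2 * o'" by (simp add: o'_def)
        then have "\<tau> / 2 * (2 / g * (p + q) - q) <= \<tau> / 2 * (2 * o')"
          using tau_pos by (intro mult_left_mono) auto
        then have 1: "\<tau> / g * (p + q) - \<tau> / 2 * q <= \<tau> * o'" using g_real by (simp add: field_simps)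
        have "\<tau> / g * (p - l) <= \<tau> / g * (p + q)"
          using tau_pos g_real lp by (intro mult_left_mono) (auto simp: q_def)
        moreover have "tau' * (p - l) = \<tau> * (p - l) - \<tau> / g * (p - l)" by (simp add: tau'_def algebra_simps)
        ultimately show ?thesis using E' err leaf 1 unfolding distrib_right by linarith
      qed
    qed
    then show ?thesis by (simp add: l_def p_def q_def w_def middle_eq)
  qed
qed

text \<open>Increasing subsets of the cells of the maximizing chain can be joined, so their sizes
  add up to at most \<open>lisb F T\<close>. The error \<open>\<tau>\<close> is charged to points
  inside the cells only, and outside of narrow or sparse boxes a fraction \<open>2 / g\<close> of
  the points lies outside of the cells.\<close>

lemma leaf_upper:
  assumes good: "good T" and "isel g bl bh T = 0"
  shows "est V T / U <= lisb F T + tau' * (muT T - lisb F T) + (leaf_err + \<delta>) * width T"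
proof -
  obtain a b lo hi where T: "T = (a, b, lo, hi)" by (cases T)
  have valid: "valid T" and ab: "a <= b" and lohi: "lo <= hi" "bl <= lo" "hi <= bh"
    using good by (auto simp: good_def T valid_def)
  have "\<exists>r. (\<forall>i\<le>K. r i < J + 2) \<and> (\<forall>i<K. rowv T (r i) <= rowv T (r (Suc i))) \<and>
     est V T = (\<Sum>i<K. V (cell T i (r i) (r (Suc i))))"
    unfolding est_def using V_cell_nonneg[OF good] by (intro best_chain_attained) auto
  then obtain r where r: "\<And>i. i <= K ==> r i < J + 2" "\<And>i. i < K ==> rowv T (r i) <= rowv T (r (Suc i))"
     and est: "est V T = (\<Sum>i<K. V (cell T i (r i) (r (Suc i))))" by blast
  let ?C = "\<lambda>i. cell T i (r i) (r (Suc i))"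
  define B where "B = (\<Sum>i<K. real (lisb F (?C i)))"
  define c where "c = (\<Sum>i<K. real (card (pts F (?C i))))"
  define w where "w = real_of_int (width T)"
  have w0: "0 <= w" using ab by (simp add: w_def T width_def)
  have "est V T / U = (\<Sum>i<K. V (?C i) / U)" by (simp add: est sum_divide_distrib)
  also have "\<dots> <= (\<Sum>i<K. (1 - \<tau>) * lisb F (?C i) + \<tau> * card (pts F (?C i)) + \<delta> * real_of_int (col T (Suc i) - col T i))"
  proof (rule sum_mono)
    fix i assume "i \<in> {..<K}"
    then show "V (?C i) / U <= (1 - \<tau>) * lisb F (?C i) + \<tau> * card (pts F (?C i)) + \<delta> * real_of_int (col T (Suc i) - col T i)"
      using V_cell_approx[OF good r(2), of i i] by (simp add: algebra_simps abs_le_iff)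
  qed
  also have "\<dots> = (1 - \<tau>) * B + \<tau> * c + \<delta> * real_of_int (\<Sum>i<K. col T (Suc i) - col T i)"
    by (simp only: sum.distrib B_def c_def of_int_sum flip: sum_distrib_left)
  finally have E: "est V T / U <= (1 - \<tau>) * B + \<tau> * c + \<delta> * w"
    unfolding sum_col[OF good] w_def .
  have "(\<Sum>i<K. lisb F (?C i)) <= lisb F (col T 0, col T K, rowv T (r 0), rowv T (r K))"
    unfolding cell_def using col_mono[of _ _ T] r(2) by (intro lisb_chain) auto
  also have "\<dots> <= lisb F T"
  proof -
    obtain S where S: "S \<subseteq> pts F (col T 0, col T K, rowv T (r 0), rowv T (r K))" "mono_on S F"
      "card S = lisb F (col T 0, col T K, rowv T (r 0), rowv T (r K))" by (rule lisb_attained)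
    have "S \<subseteq> pts F T" using S(1) row_bounds[OF lohi(1), of a b] ab
      by (auto simp: T pts_def col_0 col_last intro: order_trans dest!: subsetD) 
    then show ?thesis using lisb_ge[of S F T] S by metis
  qed
  finally have BL: "B <= lisb F T" by (simp add: B_def flip: of_nat_sum)
  have chain: "chain_pts T r \<subseteq> G \<inter> indices T"
  proof
    fix x assume "x \<in> chain_pts T r"
    then obtain i where i: "x \<in> pts F (?C i)" by (auto simp: chain_pts_def)
    then show "x \<in> G \<inter> indices T"
      using row_bounds[OF lohi(1), of a b "r i"] row_bounds[OF lohi(1), of a b "r (Suc i)"] lohi
        col_ge[OF ab, of lo hi i] col_le[of a b lo hi "Suc i"]
      by (auto simp: cell_def pts_def G_def indices_def T)
  qed
  have c: "c = card (chain_pts T r)" by (simp add: c_def chain_pts_def chain_cells_disjoint)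
  have "card (chain_pts T r) <= card (G \<inter> indices T)" using chain by (intro card_mono) auto
  then have cm: "c <= muT T" by (simp add: c muT_def)
  have Bc: "0 <= B" "B <= c" unfolding B_def c_def by (auto intro!: sum_mono sum_nonneg lisb_le_card)
  have "pts F T \<subseteq> G \<inter> indices T" using lohi by (auto simp: T pts_def G_def indices_def)
  then have lm: "real (lisb F T) <= muT T" unfolding muT_def using lisb_le_card[of F T]
    by (metis card_mono finite_Int finite_indices of_nat_le_iff order_trans)
  \<comment> \<open>The right hand side of the bound is increasing in the length because
    \<open>tau'\<close> is at most 1; this allows \<open>B\<close> to be replaced by
    \<open>lisb F T\<close>.\<close>
  have mono: "x + tau' * (muT T - x) <= lisb F T + tau' * (muT T - lisb F T)" if "x <= lisb F T" for x :: real
  proof -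
    have "(1 - tau') * x <= (1 - tau') * lisb F T" using that tau'_bounds by (intro mult_left_mono) auto
    then show ?thesis by (simp add: algebra_simps)
  qed
  have err: "0 <= leaf_err * w" "sparse_err * w <= leaf_err * w"
    using eps_pos E1_pos w0 J_pos by (auto simp: sparse_err_def leaf_err_def intro!: mult_right_mono mult_nonneg_nonneg add_nonneg_nonneg)
  have "est V T / U <= lisb F T + tau' * (muT T - lisb F T) + (leaf_err + \<delta>) * w"
  proof (cases "clog (width T) <= \<kappa>")
    case True
    have "c = B"
      unfolding B_def c_def
    proof (rule sum.cong[OF refl])
      fix i
      have "col T (Suc i) <= col T i + 1" using col_Suc_le[of a b lo hi i] True
        by (simp add: T width_def cw_def)
      then show "real (card (pts F (?C i))) = real (lisb F (?C i))"
        using lisb_width_1[of "col T i" "col T (Suc i)"] col_mono[of i "Suc i" T] by (simp add: cell_def)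
    qed
    then have "est V T / U <= B + \<delta> * w" using E by (simp add: algebra_simps)
    moreover have "0 <= tau' * (muT T - lisb F T)" using lm tau'_bounds by simp
    ultimately show ?thesis using BL err unfolding distrib_right by linarith
  next
    case big: False
    show ?thesis
    proof (cases "E1 <= mc bl bh T 0 K")
      case False
      have w1: "1 <= width T" using big by (cases "width T <= 0") (auto simp: clog_def intro!: Least_le)
      have "muT T <= sparse_err * w" using sparse_bound[OF good w1 False] by (simp add: w_def)
      moreover have "\<tau> * c <= \<tau> * muT T" using cm tau_pos by simp
      moreover have "(\<tau> - tau') * (muT T - B) <= 1 * muT T"
        using tau'_bounds tau_le_1 Bc cm by (intro mult_mono) auto
      then have "(1 - \<tau>) * B + \<tau> * muT T <= B + tau' * (muT T - B) + muT T" by (simp add: algebra_simps)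
      ultimately show ?thesis using E mono[OF BL] err unfolding distrib_right by linarith
    next
      case True
      have "2 / g * mu a b <= card (G \<inter> {a<..b} - chain_pts T r)"
        using isel_0_not_safe[OF assms(2) E1_pos] r E2_margin E1_margin eps_pos big True
        by (intro many_outside_chain[OF T valid]) auto
      also have "\<dots> = muT T - c"
        using chain by (subst card_Diff_subset)
          (auto simp: muT_def c T indices_def of_nat_diff card_mono intro: finite_subset)
      finally have "c <= muT T - 2 / g * muT T" by (simp add: T muT_eq)
      then have "\<tau> * c <= \<tau> * (muT T - 2 / g * muT T)" using tau_pos by simp
      moreover have "0 <= \<tau> / g * muT T" "0 <= \<tau> / g * B" using tau_pos g_real Bc by (auto simp: muT_def)
      moreover have "B + tau' * (muT T - B) - ((1 - \<tau>) * B + \<tau> * (muT T - 2 / g * muT T)) = \<tau> / g * muT T + \<tau> / g * B"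
        using g_real by (simp add: tau'_def field_simps)
      ultimately show ?thesis using E mono[OF BL] err unfolding distrib_right by linarith
    qed
  qed
  then show ?thesis by (simp add: w_def)
qed

end

section \<open>Error account of the splitting tree\<close>

context lis_level begin

abbreviation "lo_box \<equiv> lower g bl bh"
abbreviation "up_box \<equiv> upper g bl bh"

text \<open>The indices at which \<open>L\<close> has left, or not yet entered, the value range of
  the leaf responsible for them.\<close>

primrec bad :: "int set => nat => box => int set" where
  "bad L 0 T = astray L T"
| "bad L (Suc d) T = (if isel g bl bh T = 0 then astray L T else bad L d (lo_box T) \<union> bad L d (up_box T))"

lemma split_cases:
  assumes good: "good T" and "isel g bl bh T \<noteq> 0"
  obtains a b lo hi c y where "T = (a, b, lo, hi)" "c = col T (isel g bl bh T)"
    "lo_box T = (a, c, lo, y)" "up_box T = (c, b, y, hi)" "a <= c" "c <= b" "lo <= y" "y <= hi"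
    "good (lo_box T)" "good (up_box T)" "safe g bl bh T (isel g bl bh T) y" "isel g bl bh T < K"
proof -
  obtain a b lo hi where T: "T = (a, b, lo, hi)" by (cases T)
  define c y where "c = col T (isel g bl bh T)" and "y = rowv T (qsel g bl bh T)"
  have v: "0 <= a" "a <= b" "b <= n" "bl <= lo" "lo <= hi" "hi <= bh" "lo \<in> Vals" "hi \<in> Vals"
    using good by (auto simp: good_def valid_def T)
  have c: "a <= c" "c <= b" using v by (auto simp: c_def T col_ge col_le)
  have y: "lo <= y" "y <= hi" "y \<in> Vals"
    using row_bounds[OF v(5)] row_in_Vals good by (auto simp: y_def T)
  have lu: "lo_box T = (a, c, lo, y)" "up_box T = (c, b, y, hi)"
    by (auto simp: lower_def upper_def T c_def y_def)
  show ?thesis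
  proof (rule that[OF T c_def lu c y(1,2)])
    show "good (lo_box T)" "good (up_box T)" unfolding lu using c y v by (auto simp: good_def valid_def)
  qed (use isel_safe[OF assms(2)] in \<open>auto simp: y_def\<close>)
qed

lemma split_indices:
  assumes "good T" "isel g bl bh T \<noteq> 0"
  shows "indices T = indices (lo_box T) \<union> indices (up_box T)" "indices (lo_box T) \<inter> indices (up_box T) = {}"
    "width T = width (lo_box T) + width (up_box T)" "0 <= width (lo_box T)" "0 <= width (up_box T)"
  by (rule split_cases[OF assms]; auto simp: indices_def width_def)+

text \<open>The lower box shares its left and lower sides with \<open>T\<close>, the upper box its
  right and upper sides. New astray indices can thus arise only by passing above the corner on its
  left or below it on its right.\<close>

lemma split_astray:
  assumes "good T" "isel g bl bh T \<noteq> 0"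
  shows "astray L T \<subseteq> astray L (lo_box T) \<union> astray L (up_box T)"
    "astray L (lo_box T) \<subseteq> astray L T \<union> overshoot L (lo_box T)"
    "astray L (up_box T) \<subseteq> astray L T \<union> undershoot L (up_box T)"
  by (rule split_cases[OF assms]; fastforce simp: astray_def overshoot_def undershoot_def)+

lemma bad_subset: "good T ==> bad L d T \<subseteq> indices T"
proof (induction d arbitrary: T)
  case (Suc d)
  show ?case
  proof (cases "isel g bl bh T = 0")
    case False
    have "good (lo_box T)" "good (up_box T)" using split_cases[OF Suc.prems False] by metis+
    then have "bad L d (lo_box T) \<subseteq> indices (lo_box T)" "bad L d (up_box T) \<subseteq> indices (up_box T)"
      using Suc.IH by blast+
    then show ?thesis using False split_indices(1)[OF Suc.prems False] by auto
  qed (use astray_subset in auto)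
qed (use astray_subset in auto)

lemma astray_subset_bad: "good T ==> astray L T \<subseteq> bad L d T"
proof (induction d arbitrary: T)
  case (Suc d)
  show ?case
  proof (cases "isel g bl bh T = 0")
    case False
    then have "good (lo_box T)" "good (up_box T)" using split_cases[OF Suc.prems False] by metis+
    then show ?thesis using False split_astray(1)[OF Suc.prems False, of L] Suc.IH by fastforce
  qed auto
qed auto

lemma muT_split:
  assumes "good T" "isel g bl bh T \<noteq> 0"
  shows "muT T = muT (lo_box T) + muT (up_box T)" "muT (lo_box T) <= 4 / 5 * muT T" "muT (up_box T) <= 4 / 5 * muT T"
    "1 <= muT T" "1 <= width T"
proof -
  obtain a b lo hi c y where s: "T = (a, b, lo, hi)" "c = col T (isel g bl bh T)"
    "lo_box T = (a, c, lo, y)" "up_box T = (c, b, y, hi)" "a <= c" "c <= b"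
    "safe g bl bh T (isel g bl bh T) y" "isel g bl bh T < K" using split_cases[OF assms] by metis
  have "valid T" using assms by (simp add: good_def)
  note sb = safe_balanced[OF s(1) this s(7,8) E1_margin(1)]
  have m: "muT T = mu a b" "muT (lo_box T) = mu a c" "muT (up_box T) = mu c b"
    by (simp only: s(1) muT_eq, simp only: s(3) muT_eq, simp only: s(4) muT_eq)
  show "muT T = muT (lo_box T) + muT (up_box T)" unfolding m using s(5,6) by (rule mu_add)
  show "muT (lo_box T) <= 4 / 5 * muT T" "muT (up_box T) <= 4 / 5 * muT T"
    unfolding m s(2) using sb by simp_all
  show "1 <= muT T" "1 <= width T" using sb by (simp_all add: s(1) muT_eq)
qed

lemma terminal_if_light: "good T ==> muT T < 1 ==> isel g bl bh T = 0"
  using muT_split(4) by fastforce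

text \<open>A split leaves at most four fifths of the points on either side, and a box with less
  than one point is terminal. The potential \<open>muT T * (4 / 5) ^ d\<close> thus certifies that
  depth \<open>d\<close> suffices to reach leaves.\<close>

lemma depth_step:
  assumes "good T" "isel g bl bh T \<noteq> 0" "muT T * (4 / 5) ^ Suc d < 1"
  shows "muT (lo_box T) * (4 / 5) ^ d < 1" "muT (up_box T) * (4 / 5) ^ d < 1"
proof -
  have "muT (lo_box T) * (4 / 5) ^ d <= 4 / 5 * muT T * (4 / 5) ^ d" "muT (up_box T) * (4 / 5) ^ d <= 4 / 5 * muT T * (4 / 5) ^ d"
    using muT_split[OF assms(1,2)] by (auto intro!: mult_right_mono)
  moreover have "4 / 5 * muT T * (4 / 5) ^ d = muT T * (4 / 5) ^ Suc d" by simp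
  ultimately show "muT (lo_box T) * (4 / 5) ^ d < 1" "muT (up_box T) * (4 / 5) ^ d < 1"
    using assms(3) by linarith+
qed

lemma card_Int_Un_disjoint: "finite A ==> finite B ==> A \<inter> B = {} ==> card (H \<inter> (A \<union> B)) = card (H \<inter> A) + card (H \<inter> B)"
  unfolding Int_Un_distrib by (rule card_Un_disjoint) auto

text \<open>The lengths \<open>lisb\<close> of the two parts need not add up to that of
  \<open>T\<close>. Fixing one set \<open>L\<close> and cutting it along the leaves, which partition
  the indices, makes the lower bound additive.\<close>

lemma tree_lower:
  assumes "good T" "L \<subseteq> G" "mono_on L F" "muT T * (4 / 5) ^ d < 1"
  shows "real (card (L \<inter> (indices T - bad L d T)))
    - tau' * (real (card (G \<inter> (indices T - bad L d T))) - real (card (L \<inter> (indices T - bad L d T))))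
    - \<tau> / 2 * card (G \<inter> bad L d T) - (leaf_err + \<delta>) * width T <= tree_est V g bl bh d T / U"
  using assms(1,4)
proof (induction d arbitrary: T)
  case 0
  then show ?case using leaf_lower[OF 0(1) assms(2,3)] terminal_if_light by simp
next
  case (Suc d)
  show ?case
  proof (cases "isel g bl bh T = 0")
    case True
    then show ?thesis using leaf_lower[OF Suc.prems(1) assms(2,3)] by simp
  next
    case False
    define A B where "A = indices (lo_box T) - bad L d (lo_box T)" and "B = indices (up_box T) - bad L d (up_box T)"
    have gd: "good (lo_box T)" "good (up_box T)" using split_cases[OF Suc.prems(1) False] by metis+
    note si = split_indices[OF Suc.prems(1) False]
    note bs = bad_subset[OF gd(1), of L d] bad_subset[OF gd(2), of L d]
    have "indices T - bad L (Suc d) T = A \<union> B" "A \<inter> B = {}" using False si(1,2) bs by (auto simp: A_def B_def)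
    moreover have "finite A" "finite B" by (auto simp: A_def B_def)
    ultimately have c: "card (H \<inter> (indices T - bad L (Suc d) T)) = card (H \<inter> A) + card (H \<inter> B)" for H
      by (simp add: card_Int_Un_disjoint del: bad.simps)
    have "card (G \<inter> bad L (Suc d) T) = card (G \<inter> bad L d (lo_box T)) + card (G \<inter> bad L d (up_box T))"
      using False bs si(2) finite_subset[OF bs(1)] finite_subset[OF bs(2)]
      by (simp, intro card_Int_Un_disjoint) auto
    moreover have "tree_est V g bl bh (Suc d) T / U = tree_est V g bl bh d (lo_box T) / U + tree_est V g bl bh d (up_box T) / U"
      using False by (simp add: add_divide_distrib)
    moreover have "real_of_int (width T) = width (lo_box T) + width (up_box T)" using si(3) by simp
    ultimately show ?thesis
      using Suc.IH[OF gd(1) depth_step(1)[OF Suc.prems(1) False Suc.prems(2)]]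
        Suc.IH[OF gd(2) depth_step(2)[OF Suc.prems(1) False Suc.prems(2)]]
      unfolding A_def[symmetric] B_def[symmetric] c of_nat_add
      by (simp del: bad.simps tree_est.simps add: algebra_simps)
  qed
qed

lemma tree_upper:
  assumes "good T" "muT T * (4 / 5) ^ d < 1"
  shows "tree_est V g bl bh d T / U <= lisb F T + tau' * (muT T - lisb F T) + (leaf_err + \<delta>) * width T"
  using assms
proof (induction d arbitrary: T)
  case 0
  then show ?case using leaf_upper[OF 0(1)] terminal_if_light by simp
next
  case (Suc d)
  show ?case
  proof (cases "isel g bl bh T = 0")
    case True
    then show ?thesis using leaf_upper[OF Suc.prems(1)] by simp
  next
    case False
    have gd: "good (lo_box T)" "good (up_box T)" using split_cases[OF Suc.prems(1) False] by metis+
    have "lisb F (lo_box T) + lisb F (up_box T) <= lisb F T"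
      by (rule split_cases[OF Suc.prems(1) False]) (use lisb_split in force)
    then have "real (lisb F (lo_box T)) + real (lisb F (up_box T)) <= real (lisb F T)" by linarith
    then have "(1 - tau') * (real (lisb F (lo_box T)) + real (lisb F (up_box T))) <= (1 - tau') * real (lisb F T)"
      using tau'_bounds by (intro mult_left_mono) auto
    moreover have "tree_est V g bl bh (Suc d) T / U = tree_est V g bl bh d (lo_box T) / U + tree_est V g bl bh d (up_box T) / U"
      using False by (simp add: add_divide_distrib)
    moreover have "real_of_int (width T) = width (lo_box T) + width (up_box T)"
      using split_indices(3)[OF Suc.prems(1) False] by simp
    ultimately show ?thesis
      using Suc.IH[OF gd(1) depth_step(1)[OF Suc.prems(1) False Suc.prems(2)]]
        Suc.IH[OF gd(2) depth_step(2)[OF Suc.prems(1) False Suc.prems(2)]] muT_split(1)[OF Suc.prems(1) False]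
      by (simp del: tree_est.simps add: algebra_simps)
  qed
qed

text \<open>Each split contributes an overshoot and an undershoot. Those that are sparse in the
  relative sense are collected in \<open>\<F>\<close>, as input for the covering lemma. The others
  go to \<open>N\<close> at a cost of \<open>4 * sigma\<close> times the width; since the widths
  within a layer add up to at most the width of \<open>T\<close>, \<open>d\<close> layers cost
  \<open>8 * sigma * d\<close> times this width.\<close>

lemma bad_cover:
  assumes "good T" "L \<subseteq> G" "mono_on L F" "0 <= E2"
  shows "\<exists>\<F> N. finite \<F> \<and> (\<forall>I\<in>\<F>. (\<exists>l r. I = {l..r}) \<and> real (card (L \<inter> I)) <= 32 / g * real (card (G \<inter> I))) \<and>
    \<Union>\<F> \<subseteq> bad L d T \<and> bad L d T \<subseteq> astray L T \<union> \<Union>\<F> \<union> N \<and> finite N \<and>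
    real (card (L \<inter> N)) <= 8 * sigma * d * width T"
  using assms(1)
proof (induction d arbitrary: T)
  case 0
  show ?case by (intro exI[of _ "{}"]) simp
next
  case (Suc d)
  have sig: "0 <= sigma" using assms(4) eps_pos by (simp add: sigma_def)
  have w0: "0 <= width T" using Suc.prems by (cases T) (auto simp: good_def valid_def width_def)
  show ?case
  proof (cases "isel g bl bh T = 0")
    case True
    then show ?thesis using sig w0 by (intro exI[of _ "{}"]) simp
  next
    case False
    have gd: "good (lo_box T)" "good (up_box T)" using split_cases[OF Suc.prems(1) False] by metis+
    obtain \<F>1 N1 where 1: "finite \<F>1" "\<forall>I\<in>\<F>1. (\<exists>l r. I = {l..r}) \<and> real (card (L \<inter> I)) <= 32 / g * real (card (G \<inter> I))"
      "\<Union>\<F>1 \<subseteq> bad L d (lo_box T)" "bad L d (lo_box T) \<subseteq> astray L (lo_box T) \<union> \<Union>\<F>1 \<union> N1" "finite N1"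
      "real (card (L \<inter> N1)) <= 8 * sigma * d * width (lo_box T)" using Suc.IH[OF gd(1)] by metis
    obtain \<F>2 N2 where 2: "finite \<F>2" "\<forall>I\<in>\<F>2. (\<exists>l r. I = {l..r}) \<and> real (card (L \<inter> I)) <= 32 / g * real (card (G \<inter> I))"
      "\<Union>\<F>2 \<subseteq> bad L d (up_box T)" "bad L d (up_box T) \<subseteq> astray L (up_box T) \<union> \<Union>\<F>2 \<union> N2" "finite N2"
      "real (card (L \<inter> N2)) <= 8 * sigma * d * width (up_box T)" using Suc.IH[OF gd(2)] by metis
    have w: "1 <= width T" using muT_split[OF Suc.prems False] by simp
    define A B where "A = overshoot L (lo_box T)" and "B = undershoot L (up_box T)"
    have AB: "(\<exists>l r. A = {l..r}) \<and> (real (card (L \<inter> A)) <= 32 / g * real (card (G \<inter> A)) \<or> real (card (L \<inter> A)) <= 4 * sigma * width T)"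
      "(\<exists>l r. B = {l..r}) \<and> (real (card (L \<inter> B)) <= 32 / g * real (card (G \<inter> B)) \<or> real (card (L \<inter> B)) <= 4 * sigma * width T)"
    proof -
      obtain a b lo hi c y where s: "T = (a, b, lo, hi)" "c = col T (isel g bl bh T)"
        "lo_box T = (a, c, lo, y)" "up_box T = (c, b, y, hi)"
        "safe g bl bh T (isel g bl bh T) y" "isel g bl bh T < K" using split_cases[OF Suc.prems False] by metis
      have "valid T" using Suc.prems by (simp add: good_def)
      from overshoot_sparse[OF s(1) this s(5,6) assms(2-4) w] undershoot_sparse[OF s(1) this s(5,6) assms(2-4) w]
      show "(\<exists>l r. A = {l..r}) \<and> (real (card (L \<inter> A)) <= 32 / g * real (card (G \<inter> A)) \<or> real (card (L \<inter> A)) <= 4 * sigma * width T)"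
        "(\<exists>l r. B = {l..r}) \<and> (real (card (L \<inter> B)) <= 32 / g * real (card (G \<inter> B)) \<or> real (card (L \<inter> B)) <= 4 * sigma * width T)"
        unfolding A_def B_def s(3,4) s(2)[symmetric] by auto
    qed
    have pick: "\<exists>\<F> N. finite \<F> \<and> (\<forall>I\<in>\<F>. (\<exists>l r. I = {l..r}) \<and> real (card (L \<inter> I)) <= 32 / g * real (card (G \<inter> I))) \<and>
       \<Union>\<F> \<subseteq> A' \<and> A' \<subseteq> \<Union>\<F> \<union> N \<and> finite N \<and> real (card (L \<inter> N)) <= 4 * sigma * width T"
      if "(\<exists>l r. A' = {l..r::int}) \<and> (real (card (L \<inter> A')) <= 32 / g * real (card (G \<inter> A')) \<or> real (card (L \<inter> A')) <= 4 * sigma * width T)" for A'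
    proof (cases "real (card (L \<inter> A')) <= 32 / g * real (card (G \<inter> A'))")
      case True
      then show ?thesis using that sig w0 by (intro exI[of _ "{A'}"] exI[of _ "{}"]) auto
    next
      case False
      then show ?thesis using that by (intro exI[of _ "{}"] exI[of _ A']) auto
    qed
    obtain \<F>3 N3 where 3: "finite \<F>3" "\<forall>I\<in>\<F>3. (\<exists>l r. I = {l..r}) \<and> real (card (L \<inter> I)) <= 32 / g * real (card (G \<inter> I))"
      "\<Union>\<F>3 \<subseteq> A" "A \<subseteq> \<Union>\<F>3 \<union> N3" "finite N3" "real (card (L \<inter> N3)) <= 4 * sigma * width T"
      using pick[OF AB(1)] by metis
    obtain \<F>4 N4 where 4: "finite \<F>4" "\<forall>I\<in>\<F>4. (\<exists>l r. I = {l..r}) \<and> real (card (L \<inter> I)) <= 32 / g * real (card (G \<inter> I))"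
      "\<Union>\<F>4 \<subseteq> B" "B \<subseteq> \<Union>\<F>4 \<union> N4" "finite N4" "real (card (L \<inter> N4)) <= 4 * sigma * width T"
      using pick[OF AB(2)] by metis
    have "A \<subseteq> bad L d (lo_box T)" "B \<subseteq> bad L d (up_box T)"
      using astray_subset_bad[OF gd(1), of L d] astray_subset_bad[OF gd(2), of L d] by (auto simp: A_def B_def astray_def)
    moreover have "astray L (lo_box T) \<subseteq> astray L T \<union> A" "astray L (up_box T) \<subseteq> astray L T \<union> B"
      using split_astray(2,3)[OF Suc.prems False] by (auto simp: A_def B_def)
    moreover have "real (card (L \<inter> (N1 \<union> N2 \<union> N3 \<union> N4))) <= 8 * sigma * Suc d * width T"
    proof -
      have "card (L \<inter> (N1 \<union> N2 \<union> N3 \<union> N4)) <= card (L \<inter> N1) + card (L \<inter> N2) + card (L \<inter> N3) + card (L \<inter> N4)"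
        unfolding Int_Un_distrib by (meson add_right_mono card_Un_le order_trans)
      then have "real (card (L \<inter> (N1 \<union> N2 \<union> N3 \<union> N4))) \<le>
         8 * sigma * d * width (lo_box T) + 8 * sigma * d * width (up_box T) + 4 * sigma * width T + 4 * sigma * width T"
        using 1(6) 2(6) 3(6) 4(6) by linarith
      also have "\<dots> = 8 * sigma * Suc d * width T"
        unfolding split_indices(3)[OF Suc.prems False] by (simp add: algebra_simps)
      finally show ?thesis .
    qed
    ultimately have *: "A \<union> B \<subseteq> bad L (Suc d) T" "bad L (Suc d) T = bad L d (lo_box T) \<union> bad L d (up_box T)"
      "astray L (lo_box T) \<union> astray L (up_box T) \<subseteq> astray L T \<union> A \<union> B"
      "real (card (L \<inter> (N1 \<union> N2 \<union> N3 \<union> N4))) <= 8 * sigma * Suc d * width T"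
      using False by auto
    let ?F = "\<F>1 \<union> \<F>2 \<union> \<F>3 \<union> \<F>4" and ?N = "N1 \<union> N2 \<union> N3 \<union> N4"
    have "\<Union>?F \<subseteq> bad L (Suc d) T"
      using 1(3) 2(3) 3(3) 4(3) *(1,2) by blast
    moreover have "bad L (Suc d) T \<subseteq> astray L T \<union> \<Union>?F \<union> ?N"
      unfolding *(2) using 1(4) 2(4) 3(4) 4(4) *(3) by blast
    moreover have "\<forall>I\<in>?F. (\<exists>l r. I = {l..r}) \<and> real (card (L \<inter> I)) <= 32 / g * real (card (G \<inter> I))"
      using 1(2) 2(2) 3(2) 4(2) by blast
    moreover have "finite ?F" "finite ?N" using 1(1,5) 2(1,5) 3(1,5) 4(1,5) by auto
    ultimately show ?thesis using *(4) by (intro exI[of _ ?F] exI[of _ ?N]) (simp only: simp_thms)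
  qed
qed

text \<open>A point of \<open>L\<close> in the bad part costs itself and the \<open>tau'\<close> of
  one more lost point, at most 2. By the covering lemma there are at most \<open>64 / g\<close>
  times as many of them as bad points, up to absolute errors, so they cost
  \<open>128 / g <= 8 * (\<tau> / 20)\<close> per bad point. Together with the charge
  \<open>\<tau> / 2\<close> from the leaves this is \<open>9 / 10 * \<tau>\<close>, below
  \<open>15 / 16 * \<tau> <= tau'\<close>, which a bad point may cost since it counts as
  lost.\<close>

theorem tree_est_approx:
  fixes a b :: int
  assumes "0 <= a" "a <= b" "b <= n" "bl <= bh" "bl \<in> Vals" "bh \<in> Vals" "0 <= E2"
    and d: "real_of_int n * (4 / 5) ^ d < 1"
  defines "B \<equiv> (a, b, bl, bh) :: box"
  shows "\<bar>tree_est V g bl bh d B / U - lisb F B\<bar> <= tau' * (real (card (pts F B)) - lisb F B) +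
    (leaf_err + 16 * sigma * d + \<delta>) * (b - a)"
proof -
  have gB: "good B" using assms by (auto simp: B_def good_def valid_def)
  have m: "muT B = card (pts F B)"
    unfolding muT_def by (intro arg_cong[of _ _ real] arg_cong[of _ _ card]) (auto simp: G_def indices_def pts_def B_def)
  have w: "width B = b - a" by (simp add: B_def width_def)
  have "muT B <= real_of_int n" using card_pts_le_width[of B F] assms(1-3) unfolding m w by linarith
  then have "muT B * (4 / 5) ^ d <= real_of_int n * (4 / 5) ^ d" by (intro mult_right_mono) auto
  then have dB: "muT B * (4 / 5) ^ d < 1" using d by linarith
  have sig: "0 <= sigma" using assms(7) eps_pos by (simp add: sigma_def)
  have sw: "0 <= 16 * sigma * d * (b - a)" using sig assms(2) by simp
  have wr: "real_of_int (width B) = real_of_int b - real_of_int a" by (simp add: w)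
  have up: "tree_est V g bl bh d B / U - lisb F B <= tau' * (real (card (pts F B)) - lisb F B) +
    (leaf_err + 16 * sigma * d + \<delta>) * (b - a)"
    using tree_upper[OF gB dB] sw unfolding m wr by (simp add: algebra_simps)
  obtain L where L: "L \<subseteq> pts F B" "mono_on L F" "card L = lisb F B" by (rule lisb_attained)
  have LG: "L \<subseteq> G" "L \<subseteq> indices B" "finite L"
    using L(1) finite_subset[OF L(1) finite_pts] by (auto simp: B_def pts_def G_def indices_def)
  have "astray L B = {}" using L(1) by (fastforce simp: astray_def overshoot_def undershoot_def B_def pts_def)
  then obtain \<F> N where FN: "finite \<F>" "\<And>I. I \<in> \<F> ==> \<exists>l r. I = {l..r}"
    "\<And>I. I \<in> \<F> ==> real (card (L \<inter> I)) <= 32 / g * real (card (G \<inter> indices B \<inter> I))"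
    "\<Union>\<F> \<subseteq> bad L d B" "bad L d B \<subseteq> \<Union>\<F> \<union> N" "finite N" "real (card (L \<inter> N)) <= 8 * sigma * d * (b - a)"
  proof -
    assume e: "astray L B = {}"
    obtain \<F> N where *: "finite \<F>" "\<forall>I\<in>\<F>. (\<exists>l r. I = {l..r}) \<and> real (card (L \<inter> I)) <= 32 / g * real (card (G \<inter> I))"
      "\<Union>\<F> \<subseteq> bad L d B" "bad L d B \<subseteq> astray L B \<union> \<Union>\<F> \<union> N" "finite N" "real (card (L \<inter> N)) <= 8 * sigma * d * width B"
      using bad_cover[OF gB LG(1) L(2) assms(7)] by metis
    have "G \<inter> indices B \<inter> I = G \<inter> I" if "I \<in> \<F>" for I
      using that *(3) bad_subset[OF gB, of L d] by blast
    then show ?thesis using * e that[of \<F> N] unfolding wr by auto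
  qed
  let ?bad = "bad L d B"
  have fb: "finite ?bad" using bad_subset[OF gB, of L d] finite_subset finite_indices by blast
  have "real (card (L \<inter> \<Union>\<F>)) <= 2 * (32 / g) * real (card (G \<inter> indices B \<inter> \<Union>\<F>))"
    using FN g_real LG by (intro sparse_on_Union) auto
  also have "real (card (G \<inter> indices B \<inter> \<Union>\<F>)) <= real (card (G \<inter> ?bad))"
    using FN(4) fb by (intro of_nat_mono card_mono) auto
  finally have 1: "real (card (L \<inter> \<Union>\<F>)) <= 64 / g * real (card (G \<inter> ?bad))" 
    using g_real by (simp add: mult_left_mono divide_right_mono)
  have "card (L \<inter> ?bad) <= card (L \<inter> \<Union>\<F> \<union> L \<inter> N)"
    using FN(5) LG(3) by (intro card_mono) auto
  also have "\<dots> <= card (L \<inter> \<Union>\<F>) + card (L \<inter> N)" by (rule card_Un_le)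
  finally have lb: "real (card (L \<inter> ?bad)) <= 64 / g * real (card (G \<inter> ?bad)) + 8 * sigma * d * (b - a)"
    using 1 FN(7) by linarith
  define l q x where "l = real (card (L \<inter> (indices B - ?bad)))" and "q = real (card (G \<inter> ?bad))"
    and "x = real (card (L \<inter> ?bad))"
  have "indices B \<inter> ?bad = ?bad" using bad_subset[OF gB, of L d] by blast
  then have sp: "card (H \<inter> indices B) = card (H \<inter> ?bad) + card (H \<inter> (indices B - ?bad))" for H
    using card_split[OF finite_indices[of B], of H ?bad] by simp
  have "L \<inter> indices B = L" using LG by blast
  then have l: "real (lisb F B) = l + x" using sp[of L] L(3) by (simp add: l_def x_def)
  have p: "real (card (G \<inter> (indices B - ?bad))) = muT B - q" using sp[of G] by (simp add: muT_def q_def)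
  have 2: "l - tau' * (muT B - q - l) - \<tau> / 2 * q - (leaf_err + \<delta>) * (b - a) <= tree_est V g bl bh d B / U"
    using tree_lower[OF gB LG(1) L(2) dB] unfolding p wr l_def[symmetric] q_def[symmetric] by simp
  have "(1 + tau') * x <= 2 * x" using tau'_bounds by (intro mult_right_mono) (auto simp: x_def)
  also have "2 * x <= 128 / g * q + 16 * sigma * d * (b - a)" using lb unfolding x_def q_def by simp
  also have "128 / g * q <= 8 * (\<tau> / 20) * q"
    using g_tau by (intro mult_right_mono) (auto simp: q_def)
  finally have 3: "(1 + tau') * x <= 8 * (\<tau> / 20) * q + 16 * sigma * d * (b - a)" by simp
  have "15 / 16 * \<tau> <= tau'"
  proof -
    have "1 / real_of_int g <= 1 / 16" using g_real by (simp add: field_simps)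
    then have "\<tau> * (15 / 16) <= \<tau> * (1 - 1 / g)" using tau_pos by (intro mult_left_mono) auto
    then show ?thesis by (simp add: tau'_def)
  qed
  then have "(\<tau> / 2 + 8 * (\<tau> / 20)) * q <= tau' * q" using tau_pos by (intro mult_right_mono) (auto simp: q_def)
  then have "\<tau> / 2 * q + 8 * (\<tau> / 20) * q <= tau' * q" by (simp add: distrib_right)
  with 2 3 have "lisb F B - tree_est V g bl bh d B / U <= tau' * (muT B - lisb F B) +
    (leaf_err + 16 * sigma * d + \<delta>) * (b - a)"
    unfolding l by (simp add: algebra_simps)
  then show ?thesis using up unfolding m by (auto simp: abs_le_iff)
qed

end

section \<open>The recursive estimator\<close>

text \<open>Division on a machine without division: the positive multiples of \<open>u\<close> up to
  \<open>e\<close> are counted. The bound \<open>m\<close> makes the count finite and caps the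
  result.\<close>

definition quot :: "nat => int => int => nat" where
  "quot m u e = card {i. i < m \<and> (int i + 1) * u <= e}"

lemma quot_eq: "0 < u ==> 0 <= e ==> e <= int m * u ==> int (quot m u e) = e div u"
proof -
  assume u: "0 < u" and e: "0 <= e" "e <= int m * u"
  have "e div u <= int m" using zdiv_mono1[OF e(2) u] u by simp
  moreover have "((int i + 1) * u <= e) = (int i < e div u)" for i
  proof
    assume "(int i + 1) * u <= e"
    from zdiv_mono1[OF this u] show "int i < e div u" using u by simp
  next
    assume "int i < e div u"
    then have "(int i + 1) * u <= e div u * u" using u by (intro mult_right_mono) auto
    also have "\<dots> <= e" using u by (simp add: minus_mod_eq_div_mult[symmetric])
    finally show "(int i + 1) * u <= e" .
  qed
  ultimately have 1: "quot m u e = card {i. i < m \<and> int i < e div u}" "e div u <= int m"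
    unfolding quot_def by (simp_all only:)
  have "{i. i < m \<and> int i < q} = {..<nat q}" if "q <= int m" for q using that by auto
  from this[OF 1(2)] show ?thesis unfolding 1(1) using u e by (simp add: pos_imp_zdiv_nonneg_iff)
qed

context grid begin

definition leaf :: "int => int => int => nat => int => box => box" where
  "leaf g bl bh d x T = (descend g bl bh x ^^ d) T"

text \<open>The estimate of a leaf per index, in units of \<open>1 / Q\<close> and rounded down.
  Summing over all indices the density of the leaf that contains the index recovers the estimate of
  the whole tree, and such a sum can be sampled. The cap \<open>2 * Q\<close> provides the bounded
  range that Hoeffding's inequality requires.\<close>

definition density :: "nat => (box => int) => box => nat" where
  "density Q V T = quot (2 * Q) (width T * int J) (est V T)"

text \<open>Values are in units of \<open>1 / (J * Q)\<close>, which avoids dividing by the number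
  of samples. Level 0 counts points, which errs by exactly the loss apart from sampling. Level
  \<open>Suc t\<close> averages with the fresh seeds \<open>sd t\<close>, whereas all grids share
  the seeds \<open>s\<close>; the function that is averaged does not depend on the seeds at which it
  is evaluated.\<close>

primrec av :: "(nat => nat => nat => int) => nat => nat => nat => box => int" where
  "av sd Q d 0 B = 2 ^ clog (width B) * (int Q * int (card {j. j < J \<and> smp B j \<in> pts F B}))"
| "av sd Q d (Suc t) B = (case B of (a, b, bl, bh) =>
     2 ^ clog (b - a) * (\<Sum>j<J. let x = a + 1 + sd t (clog (b - a)) j in
       if x <= b then int (density Q (av sd Q d t) (leaf (int t + 321) bl bh d x (a, b, bl, bh))) else 0))"

end

section \<open>The leaf densities add up to the estimate of the tree\<close>

context lis_level begin

lemma leaf_terminal: "isel g bl bh T = 0 ==> leaf g bl bh d x T = T"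
  by (induction d) (auto simp: leaf_def descend_def)

lemma leaf_split:
  assumes "good T" "isel g bl bh T \<noteq> 0"
  shows "x \<in> indices (lo_box T) ==> leaf g bl bh (Suc d) x T = leaf g bl bh d x (lo_box T)"
    "x \<in> indices (up_box T) ==> leaf g bl bh (Suc d) x T = leaf g bl bh d x (up_box T)"
proof -
  have *: "leaf g bl bh (Suc d) x T = leaf g bl bh d x (descend g bl bh x T)"
    by (simp add: leaf_def funpow_swap1)
  obtain a b lo hi c y where s: "c = col T (isel g bl bh T)" "lo_box T = (a, c, lo, y)" "up_box T = (c, b, y, hi)"
    using split_cases[OF assms] by metis
  show "x \<in> indices (lo_box T) ==> leaf g bl bh (Suc d) x T = leaf g bl bh d x (lo_box T)"
    "x \<in> indices (up_box T) ==> leaf g bl bh (Suc d) x T = leaf g bl bh d x (up_box T)"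
    unfolding * using assms(2) s(1) by (auto simp: descend_def s(2,3) indices_def)
qed

text \<open>The estimate of a leaf is at most its number of points plus an error of at most its
  width, hence at most twice its width. So the cap of \<open>quot\<close> does not interfere, and
  only rounding down costs up to \<open>width T / Q\<close>.\<close>

lemma density_bounds:
  assumes "good T" "isel g bl bh T = 0" "1 <= width T" "leaf_err + \<delta> <= 1" "0 < Q" "U = real (J * Q)"
  shows "real (density Q V T) * width T / Q <= est V T / U"
    "est V T / U - width T / Q <= real (density Q V T) * width T / Q"
    "density Q V T <= 2 * Q"
proof -
  obtain a b lo hi where T: "T = (a, b, lo, hi)" by (cases T)
  let ?u = "width T * int J"
  have u: "0 < ?u" using assms J_pos by simp
  have ab: "a <= b" "lo <= hi" "bl <= lo" "hi <= bh" using assms(1) by (auto simp: good_def valid_def T)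
  have m: "muT T <= width T" using mu_le[OF ab(1)] by (simp add: T muT_eq width_def)
  have "pts F T \<subseteq> G \<inter> indices T" using ab by (auto simp: T pts_def G_def indices_def)
  then have lm: "real (lisb F T) <= muT T" unfolding muT_def using lisb_le_card[of F T]
    by (metis card_mono finite_Int finite_indices of_nat_le_iff order_trans)
  have "tau' * (muT T - lisb F T) <= 1 * (muT T - lisb F T)" using tau'_bounds lm by (intro mult_right_mono) auto
  moreover have "(leaf_err + \<delta>) * width T <= 1 * real_of_int (width T)" using assms(3,4) by (intro mult_right_mono) auto
  moreover have "x <= 2 * w" if "a <= 1 * (m - l)" "b <= 1 * w" "x <= l + a + b" "m <= w" for x l a b m w :: real
    using that by simp
  ultimately have "est V T / U <= 2 * real_of_int (width T)" using leaf_upper[OF assms(1,2)] m by blast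
  then have "real_of_int (est V T) <= real_of_int (int (2 * Q) * ?u)"
    using U_pos by (simp add: assms(6) field_simps)
  then have "est V T <= int (2 * Q) * ?u" by (simp only: of_int_le_iff)
  moreover have e0: "0 <= est V T" by (simp only: est_def best_chain_def bmax_nonneg)
  ultimately have q: "int (density Q V T) = est V T div ?u" unfolding density_def by (intro quot_eq u)
  have "est V T div ?u * ?u <= est V T" using u by (metis add_le_same_cancel1 div_mult_mod_eq le_add_same_cancel1 pos_mod_sign)
  moreover have "est V T <= est V T div ?u * ?u + ?u" using u by (metis add_le_cancel_left div_mult_mod_eq less_imp_le pos_mod_bound)
  ultimately have "real_of_int (int (density Q V T) * ?u) <= est V T" "real_of_int (est V T) <= real_of_int (int (density Q V T) * ?u + ?u)"
    unfolding q by (simp_all only: of_int_le_iff)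
  moreover have e1: "real (density Q V T) * width T / Q * U = real (density Q V T) * (width T * real J)"
    "(real (density Q V T) * width T / Q + width T / Q) * U = real (density Q V T) * (width T * real J) + width T * real J"
    using assms(5) by (simp_all add: assms(6) field_simps)
  ultimately have "real (density Q V T) * width T / Q * U <= est V T" "real_of_int (est V T) <= (real (density Q V T) * width T / Q + width T / Q) * U"
    using e1 by simp_all
  then show "real (density Q V T) * width T / Q <= est V T / U"
    "est V T / U - width T / Q <= real (density Q V T) * width T / Q"
    using U_pos by (simp_all add: pos_le_divide_eq pos_divide_le_eq diff_le_eq)
  have "card {i. i < 2 * Q \<and> (int i + 1) * ?u <= est V T} <= card {..<2 * Q}" by (intro card_mono) auto
  then show "density Q V T <= 2 * Q" unfolding density_def quot_def by simp
qed

lemma sum_density: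
  assumes "good T" "muT T * (4 / 5) ^ d < 1" "leaf_err + \<delta> <= 1" "0 < Q" "U = real (J * Q)"
  shows "\<bar>(\<Sum>x\<in>indices T. real (density Q V (leaf g bl bh d x T)) / Q) - tree_est V g bl bh d T / U\<bar> <= width T / Q \<and>
    (\<forall>x\<in>indices T. density Q V (leaf g bl bh d x T) <= 2 * Q)"
proof -
  have terminal: "\<bar>(\<Sum>x\<in>indices T. real (density Q V (leaf g bl bh d x T)) / Q) - tree_est V g bl bh d T / U\<bar> <= width T / Q \<and>
    (\<forall>x\<in>indices T. density Q V (leaf g bl bh d x T) <= 2 * Q)" if "good T" "isel g bl bh T = 0" "tree_est V g bl bh d T = est V T" for T d
  proof (cases "1 <= width T")
    case True
    have 0: "0 <= width T / Q" using True by simp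
    have "card (indices T) = width T" using True by (cases T) (simp add: indices_def width_def)
    then have "(\<Sum>x\<in>indices T. real (density Q V (leaf g bl bh d x T)) / Q) = real (density Q V T) * width T / Q"
      using that by (simp add: leaf_terminal)
    moreover have "\<bar>D - E\<bar> <= w" if "D <= E" "E - w <= D" "0 <= w" for D E w :: real using that by linarith
    note this[OF density_bounds(1,2)[OF that(1,2) True assms(3-5)] 0]
    ultimately have "\<bar>(\<Sum>x\<in>indices T. real (density Q V (leaf g bl bh d x T)) / Q) - tree_est V g bl bh d T / U\<bar> <= width T / Q"
      by (simp only: that(3))
    then show ?thesis using density_bounds(3)[OF that(1,2) True assms(3-5)] that(2) by (simp only: leaf_terminal) simp
  next
    case False
    moreover have "0 <= width T" using that by (cases T) (auto simp: good_def valid_def width_def)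
    ultimately have w: "width T = 0" by simp
    then have i: "indices T = {}" by (cases T) (simp add: indices_def width_def)
    have "pts F T = {}" using i by (cases T) (auto simp: indices_def pts_def)
    then have l: "lisb F T = 0" using lisb_le_card[of F T] by simp
    have "est V T / U <= 0" using leaf_upper[OF that(1,2)] by (simp add: w l muT_def i)
    then have "est V T / U = 0" using est_nonneg[of T] by simp
    then show ?thesis using that by (simp add: i w)
  qed
  show ?thesis
  using assms(1,2)
proof (induction d arbitrary: T)
  case 0
  then show ?case using terminal[of T 0] terminal_if_light by simp
next
  case (Suc d)
  show ?case
  proof (cases "isel g bl bh T = 0")
    case True
    then show ?thesis using terminal[of T "Suc d"] Suc.prems by simp
  next
    case False
    have gd: "good (lo_box T)" "good (up_box T)" using split_cases[OF Suc.prems(1) False] by metis+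
    note IH = Suc.IH[OF gd(1) depth_step(1)[OF Suc.prems(1) False Suc.prems(2)]]
      Suc.IH[OF gd(2) depth_step(2)[OF Suc.prems(1) False Suc.prems(2)]]
    note si = split_indices[OF Suc.prems(1) False]
    note ls = leaf_split[OF Suc.prems(1) False]
    have "(\<Sum>x\<in>indices T. real (density Q V (leaf g bl bh (Suc d) x T)) / Q) =
      (\<Sum>x\<in>indices (lo_box T). real (density Q V (leaf g bl bh d x (lo_box T))) / Q) +
      (\<Sum>x\<in>indices (up_box T). real (density Q V (leaf g bl bh d x (up_box T))) / Q)"
      unfolding si(1) by (subst sum.union_disjoint) (auto simp: si(2) ls)
    moreover have "tree_est V g bl bh (Suc d) T / U = tree_est V g bl bh d (lo_box T) / U + tree_est V g bl bh d (up_box T) / U"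
      using False by (simp add: add_divide_distrib)
    moreover have "real_of_int (width T) / Q = width (lo_box T) / Q + width (up_box T) / Q"
      using si(3) by (simp add: add_divide_distrib)
    moreover have "\<forall>x\<in>indices T. density Q V (leaf g bl bh (Suc d) x T) <= 2 * Q"
      unfolding si(1) using IH ls by auto
    ultimately show ?thesis using IH by (auto simp: abs_le_iff)
  qed
qed
qed

end

text \<open>The deterministic conditions that the random seeds have to meet, for all levels at once.
  Densities are divided by \<open>2 * Q\<close> to obtain functions into the unit interval; this
  factor 2 reappears in the error of the average.\<close>

locale estimator = grid +
  fixes n :: int and \<epsilon> :: real and Q d tmax :: nat and Vals :: "int set" and sd :: "nat => nat => nat => int"
  assumes J_pos: "0 < J" and E1_pos: "0 < E1" and E2_nonneg: "0 <= E2" and eps_pos: "0 < \<epsilon>" and Q_pos: "0 < Q"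
    and Vals: "\<And>x. 0 < x ==> x <= n ==> F x \<in> Vals"
    and d: "real_of_int n * (4 / 5) ^ d < 1"
    and accurate: "\<And>a b l r u v. 0 <= a ==> a <= n ==> a <= l ==> r <= b ==> a <= b ==> b <= n ==>
      \<bar>2 ^ clog (b - a) / real J * real (card {j. j < J \<and> a + 1 + s (clog (b - a)) j \<in> pts F (l, r, u, v)})
       - real (card (pts F (l, r, u, v)))\<bar> <= \<epsilon> * 2 ^ clog (b - a)"
    and seeds_nonneg: "\<And>t k j. t < tmax ==> j < J ==> 0 <= sd t k j"
    and level_accurate: "\<And>t a b bl bh \<phi>. t < tmax ==> 0 <= a ==> a <= b ==> b <= n ==> bl \<in> Vals ==> bh \<in> Vals ==>
      (\<And>x. \<phi> x = real (density Q (av sd Q d t) (leaf (int t + 321) bl bh d x (a, b, bl, bh))) / (2 * Q)) ==>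
      (\<And>x. x \<in> {a<..b} ==> \<phi> x <= 1) ==>
      \<bar>2 ^ clog (b - a) / real J * (\<Sum>j<J. if a + 1 + sd t (clog (b - a)) j <= b then \<phi> (a + 1 + sd t (clog (b - a)) j) else 0)
       - (\<Sum>x\<in>{a<..b}. \<phi> x)\<bar> <= \<epsilon> * 2 ^ clog (b - a)"
    and E2_margin: "(16 + 2 * (real tmax + 320)) * \<epsilon> <= E2 / J"
    and E1_margin: "24 * \<epsilon> <= E1 / J" "8 * (1 / 2 ^ \<kappa> + \<epsilon>) <= E1 / J"
begin

definition leaf_error :: real where
  "leaf_error = 4 * 2 ^ \<kappa> * \<epsilon> + 4 / 2 ^ \<kappa> + 2 * (E1 / J) + 2 * \<epsilon>"

text \<open>The additive error of one level: leaves, absolute errors of the \<open>d\<close> layers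
  of splits, rounding of densities, and sampling of the average. The last one is
  \<open>4 * \<epsilon>\<close> because a density in units of \<open>1 / Q\<close> is twice the
  sampled function and the rounded width is at most twice the width.\<close>

definition eta :: real where
  "eta = leaf_error + 16 * (2 / 2 ^ \<kappa> + 3 * \<epsilon> + E2 / J) * d + 1 / Q + 4 * \<epsilon>"

text \<open>The step from \<open>t\<close> uses \<open>g = t + 321\<close> and
  \<open>\<tau> = 320 / (t + 320)\<close>. Then \<open>16 / g <= \<tau> / 20\<close> holds, and
  \<open>\<tau> * (1 - 1 / g)\<close> is \<open>320 / (t + 321)\<close>. The assumption
  \<open>small\<close> keeps the additive error of every leaf below its width, so that densities are
  not capped.\<close>

theorem av_approx:
  assumes small: "(real tmax + 1) * eta + leaf_error <= 1"
  shows "t <= tmax ==> 0 <= a ==> a <= b ==> b <= n ==> bl <= bh ==> bl \<in> Vals ==> bh \<in> Vals ==>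
    0 <= av sd Q d t (a, b, bl, bh) \<and>
    \<bar>av sd Q d t (a, b, bl, bh) / real (J * Q) - lisb F (a, b, bl, bh)\<bar> \<le>
      320 / (real t + 320) * (real (card (pts F (a, b, bl, bh))) - lisb F (a, b, bl, bh)) + (real t + 1) * eta * (b - a)"
proof (induction t arbitrary: a b bl bh)
  have eta: "0 <= eta" "2 * \<epsilon> <= eta" "0 <= leaf_error"
    using eps_pos E1_pos E2_nonneg unfolding eta_def leaf_error_def by auto
  have pow: "2 ^ clog (b - a) <= 2 * real_of_int (b - a)" if "1 <= b - a" for a b
    using two_power_clog_le[OF that] of_int_le_iff[of "2 ^ clog (b - a)" "2 * (b - a)", where 'a = real] by simp
  {
    case 0
    let ?B = "(a, b, bl, bh)"
    let ?c = "card {j. j < J \<and> smp ?B j \<in> pts F ?B}"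
    have l: "real (lisb F ?B) <= card (pts F ?B)" using lisb_le_card by (simp only: of_nat_le_iff)
    have eq: "av sd Q d 0 ?B / real (J * Q) = 2 ^ clog (b - a) / J * ?c"
      using Q_pos by (simp add: width_def)
    have "\<bar>2 ^ clog (b - a) / real J * ?c - card (pts F ?B)\<bar> <= eta * (b - a)"
    proof (cases "1 <= b - a")
      case True
      have "\<bar>2 ^ clog (b - a) / real J * ?c - card (pts F ?B)\<bar> <= \<epsilon> * 2 ^ clog (b - a)"
        using accurate[of a a b b bl bh] 0 by (simp add: smp_def)
      also have "\<dots> <= \<epsilon> * (2 * real_of_int (b - a))" using pow[OF True] eps_pos by (intro mult_left_mono) auto
      also have "\<epsilon> * (2 * real_of_int (b - a)) = 2 * \<epsilon> * real_of_int (b - a)" by simp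
      also have "\<dots> <= eta * (b - a)" using eta(2) True by (intro mult_right_mono) auto
      finally show ?thesis .
    next
      case False
      then have "pts F ?B = {}" using 0 by (auto simp: pts_def)
      then show ?thesis using False 0 eta(1) by simp
    qed
    then have "\<bar>av sd Q d 0 ?B / real (J * Q) - card (pts F ?B)\<bar> <= eta * (b - a)" unfolding eq .
    then show ?case using l by (simp add: abs_le_iff)
  next
    case (Suc t)
    let ?B = "(a, b, bl, bh)" and ?U = "real (J * Q)" and ?V = "av sd Q d t" and ?g = "int t + 321"
    define \<tau> \<delta> where "\<tau> = 320 / (real t + 320)" and "\<delta> = (real t + 1) * eta"
    have t: "t < tmax" using Suc.prems by simp
    have IH: "0 <= ?V (a, b, lo, hi) \<and> \<bar>?V (a, b, lo, hi) / ?U - lisb F (a, b, lo, hi)\<bar> \<le>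
        \<tau> * (real (card (pts F (a, b, lo, hi))) - lisb F (a, b, lo, hi)) + \<delta> * (b - a)"
      if "0 <= a" "a <= b" "b <= n" "lo <= hi" "lo \<in> Vals" "hi \<in> Vals" for a b lo hi
      using Suc.IH[OF _ that] t by (simp add: \<tau>_def \<delta>_def)
    have IH1: "0 <= ?V (a, b, lo, hi)" and IH2: "\<bar>?V (a, b, lo, hi) / ?U - lisb F (a, b, lo, hi)\<bar> \<le>
        \<tau> * (real (card (pts F (a, b, lo, hi))) - lisb F (a, b, lo, hi)) + \<delta> * (b - a)"
      if "0 <= a" "a <= b" "b <= n" "lo <= hi" "lo \<in> Vals" "hi \<in> Vals" for a b lo hi
      using IH[OF that] by auto
    have "(16 + 2 * real_of_int ?g) * \<epsilon> <= (16 + 2 * (real tmax + 320)) * \<epsilon>"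
      using t eps_pos by (intro mult_right_mono) auto
    then have num: "(16 + 2 * real_of_int ?g) * \<epsilon> <= E2 / J" using E2_margin by linarith
    have num2: "16 <= ?g" "0 < ?U" "0 < \<tau>" "\<tau> <= 1" "0 <= \<delta>" "16 / real_of_int ?g <= \<tau> / 20"
      using J_pos Q_pos eta(1) by (auto simp: \<tau>_def \<delta>_def field_simps)
    interpret L: lis_level F s J \<kappa> E1 E2 n \<epsilon> bl bh ?g ?V ?U \<tau> \<delta> Vals
      by (unfold_locales; (fact J_pos E1_pos eps_pos num num2 E1_margin | (rule accurate Vals IH1 IH2; assumption)))
    have le: "L.leaf_err = leaf_error" by (simp add: L.leaf_err_def L.sparse_err_def leaf_error_def)
    have sg: "L.sigma = 2 / 2 ^ \<kappa> + 3 * \<epsilon> + E2 / J" by (simp add: L.sigma_def)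
    have "(real t + 1) * eta <= (real tmax + 1) * eta" using t eta by (intro mult_right_mono) auto
    then have le1: "L.leaf_err + \<delta> <= 1" using small by (simp add: le \<delta>_def)
    have good: "L.good ?B" using Suc.prems by (auto simp: L.good_def L.valid_def)
    have "L.muT ?B <= real_of_int n" using L.mu_le[of a b] Suc.prems by (simp add: L.muT_eq)
    then have "L.muT ?B * (4 / 5) ^ d <= real_of_int n * (4 / 5) ^ d" by (intro mult_right_mono) auto
    then have dB: "L.muT ?B * (4 / 5) ^ d < 1" using d by linarith
    note sd = L.sum_density[OF good dB le1 Q_pos refl]
    define \<phi> where "\<phi> x = real (density Q ?V (leaf ?g bl bh d x ?B)) / (2 * Q)" for x
    let ?c = "2 ^ clog (b - a) / real J" and ?x = "\<lambda>j. a + 1 + sd t (clog (b - a)) j"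
    have "\<bar>?c * (\<Sum>j<J. if ?x j <= b then \<phi> (?x j) else 0) - (\<Sum>x\<in>{a<..b}. \<phi> x)\<bar> <= \<epsilon> * 2 ^ clog (b - a)"
    proof (rule level_accurate[OF t, of a b bl bh \<phi>])
      show "\<phi> x <= 1" if "x \<in> {a<..b}" for x
      proof -
        have "density Q ?V (leaf ?g bl bh d x ?B) <= 2 * Q" using sd that by (auto simp: L.indices_def)
        then have "real (density Q ?V (leaf ?g bl bh d x ?B)) <= real (2 * Q)" by (simp only: of_nat_le_iff)
        then show ?thesis using Q_pos by (simp add: \<phi>_def)
      qed
    qed (use Suc.prems in \<open>auto simp: \<phi>_def\<close>)
    moreover have av: "av sd Q d (Suc t) ?B / ?U = 2 * (?c * (\<Sum>j<J. if ?x j <= b then \<phi> (?x j) else 0))"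
    proof -
      have "(\<Sum>j<J. if ?x j <= b then \<phi> (?x j) else 0) =
        (\<Sum>j<J. real_of_int (let x = ?x j in if x <= b then int (density Q ?V (leaf ?g bl bh d x ?B)) else 0)) / (2 * Q)"
        unfolding sum_divide_distrib by (intro sum.cong) (auto simp: \<phi>_def Let_def)
      then show ?thesis using Q_pos by (simp flip: of_int_sum)
    qed
    moreover have "(\<Sum>x\<in>L.indices ?B. real (density Q ?V (leaf ?g bl bh d x ?B)) / Q) = 2 * (\<Sum>x\<in>{a<..b}. \<phi> x)"
      by (simp add: \<phi>_def sum_distrib_left L.indices_def)
    ultimately have 1: "\<bar>av sd Q d (Suc t) ?B / ?U - tree_est ?V ?g bl bh d ?B / ?U\<bar> <= (b - a) / Q + 2 * (\<epsilon> * 2 ^ clog (b - a))"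
      using sd by (auto simp: width_def abs_le_iff)
    have 2: "2 * (\<epsilon> * 2 ^ clog (b - a)) <= 4 * \<epsilon> * (b - a) \<or> a = b"
      using pow[of b a] Suc.prems eps_pos by (cases "a = b") auto
    have "1 - 1 / real_of_int ?g = (real t + 320) / (real t + 321)" by (simp add: field_simps)
    moreover have "320 / x * (x / y) = 320 / y" if "0 < x" for x y :: real using that by simp
    from this[of "real t + 320" "real t + 321"]
    have "320 / (real t + 320) * ((real t + 320) / (real t + 321)) = 320 / (real t + 321)" by linarith
    ultimately have tau: "L.tau' = 320 / (real (Suc t) + 320)" unfolding L.tau'_def
      by (simp only: \<tau>_def) (simp add: add.commute)
    note 3 = L.tree_est_approx[OF Suc.prems(2-7) E2_nonneg d]
    have 4: "(real (Suc t) + 1) * eta * (b - a) = (L.leaf_err + 16 * L.sigma * d + \<delta>) * (b - a) + (b - a) / Q + 4 * \<epsilon> * (b - a)"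
      unfolding le sg \<delta>_def eta_def by (simp add: algebra_simps add_divide_distrib diff_divide_distrib)
    have nonneg: "0 <= av sd Q d (Suc t) ?B" by (auto intro!: mult_nonneg_nonneg sum_nonneg simp: Let_def)
    have "\<bar>av sd Q d (Suc t) ?B / ?U - lisb F ?B\<bar> \<le>
      320 / (real (Suc t) + 320) * (real (card (pts F ?B)) - lisb F ?B) + (real (Suc t) + 1) * eta * (b - a)"
    proof (cases "a = b")
      \<comment> \<open>An empty box still has rounded width 1, so the sampling bound says too
        little. Its value is exactly 0, since nonnegative seeds place all samples beyond
        \<open>b\<close>.\<close>
      case True
      have "pts F ?B = {}" by (auto simp: pts_def True)
      moreover have "av sd Q d (Suc t) ?B = 0"
        using seeds_nonneg[OF t] True by (auto simp: Let_def intro!: sum.neutral) (smt (verit))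
      ultimately show ?thesis using lisb_le_card[of F ?B] True by simp
    next
      case False
      then show ?thesis using 1 2 3 unfolding 4 tau by (auto simp: abs_le_iff)
    qed
    with nonneg show ?case by simp
  }
qed

end

section \<open>Functions and state transformers computed by programs\<close>

datatype ctx = Ctx (len: nat) (arr: "nat => nat") (par: real)

definition csteps :: "ctx => nat => config => config pmf" where
  "csteps x = steps (len x) (arr x) (par x)"

text \<open>Deterministic execution in exactly \<open>t\<close> steps. The quantifier over the
  pending commands \<open>cs\<close> is what makes runs composable.\<close>

definition runs :: "ctx => com => mem => nat => mem => bool" where
  "runs x c m t m' \<longleftrightarrow> (\<forall>cs. csteps x t (c # cs, m) = return_pmf (cs, m'))"

lemma steps_add: "steps n f \<tau> (s + t) cfg = bind_pmf (steps n f \<tau> s cfg) (steps n f \<tau> t)"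
  by (induction s arbitrary: cfg) (auto simp: bind_return_pmf bind_assoc_pmf intro!: bind_pmf_cong)

lemma csteps_add: "csteps x (s + t) cfg = bind_pmf (csteps x s cfg) (csteps x t)"
  by (simp add: csteps_def steps_add)

lemma csteps_Suc: "csteps x (Suc t) cfg = bind_pmf (csteps x 1 cfg) (csteps x t)"
  using csteps_add[of x 1 t cfg] by simp

lemma runs_Store: "runs x (Store a e) m 1 (m(eval_exp m a := eval_exp m e))"
  by (cases x) (simp add: runs_def csteps_def bind_return_pmf)

lemma runs_Query: "runs x (Query a e) m 1 (m(eval_exp m a := query (len x) (arr x) (eval_exp m e)))"
  by (cases x) (simp add: runs_def csteps_def bind_return_pmf)

lemma runs_Seq:
  assumes "runs x c m s m'" "runs x d m' t m''"
  shows "runs x (Seq c d) m (Suc (s + t)) m''"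
proof -
  have 1: "csteps x 1 (Seq c d # cs, m) = return_pmf (c # d # cs, m)" for cs
    by (simp add: csteps_def bind_return_pmf bind_return_pmf')
  show ?thesis unfolding runs_def
    by (simp only: csteps_Suc[of x "s + t"] csteps_add[of x s t] 1 bind_return_pmf
        assms[unfolded runs_def, rule_format] simp_thms)
qed

lemma runs_If:
  assumes "runs x (if eval_test (par x) m b then c else d) m t m'"
  shows "runs x (If b c d) m (Suc t) m'"
proof -
  have 1: "csteps x 1 (If b c d # cs, m) = return_pmf ((if eval_test (par x) m b then c else d) # cs, m)" for cs
    by (simp add: csteps_def bind_return_pmf bind_return_pmf')
  show ?thesis unfolding runs_def
    by (simp only: csteps_Suc[of x t] 1 bind_return_pmf assms[unfolded runs_def, rule_format] simp_thms)
qed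

lemma runs_While_False:
  assumes "\<not> eval_test (par x) m b"
  shows "runs x (While b c) m 1 m"
  using assms by (simp add: runs_def csteps_def bind_return_pmf)

lemma runs_While_True:
  assumes "eval_test (par x) m b" "runs x c m s m'" "runs x (While b c) m' t m''"
  shows "runs x (While b c) m (Suc (s + t)) m''"
proof -
  have 1: "csteps x 1 (While b c # cs, m) = return_pmf (c # While b c # cs, m)" for cs
    using assms(1) by (simp add: csteps_def bind_return_pmf bind_return_pmf')
  show ?thesis unfolding runs_def
    by (simp only: csteps_Suc[of x "s + t"] csteps_add[of x s t] 1 bind_return_pmf
        assms(2,3)[unfolded runs_def, rule_format] simp_thms)
qed

text \<open>The memory is divided into 16 interleaved arrays. Array \<open>0\<close> holds the temporaries of
  compiled expressions; its initial part up to \<open>d\<close> is in use at nesting depth \<open>d\<close>.\<close>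

definition ar :: "mem => nat => int => int" where "ar m r i = m (16 * i + int r)"

definition upd :: "nat => int => int => mem => mem" where "upd r i e m = m(16 * i + int r := e)"

lemma ar_upd: "r < 16 ==> r' < 16 ==> ar (upd r i e m) r' i' = (if r = r' \<and> i = i' then e else ar m r' i')"
proof -
  assume "r < 16" "r' < 16"
  have "r = r' \<and> i = i'" if e: "16 * i' + int r' = 16 * i + int r"
  proof -
    have "(16 * i' + int r') mod 16 = int r'" "(16 * i + int r) mod 16 = int r"
      using \<open>r < 16\<close> \<open>r' < 16\<close> by simp_all
    then have "r = r'" using e by simp
    then show ?thesis using e by simp
  qed
  then have "16 * i' + int r' = 16 * i + int r \<longleftrightarrow> r = r' \<and> i = i'" by blast
  then show ?thesis by (simp add: ar_def upd_def)
qed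

text \<open>Compiled code may overwrite temporaries from depth \<open>d\<close> on, so memories are
  compared modulo these cells.\<close>

definition agree :: "nat => mem => mem => bool" where
  "agree d m m' \<longleftrightarrow> (\<forall>a. m a \<noteq> m' a --> (\<exists>i\<ge>int d. a = 16 * i))"

lemma agree_refl [simp]: "agree d m m" by (simp add: agree_def)
lemma agree_trans: "agree d m m' ==> agree d m' m'' ==> agree d m m''"
  unfolding agree_def by metis
lemma agree_mono: "agree d m m' ==> d' <= d ==> agree d' m m'" unfolding agree_def by (meson of_nat_le_iff order_trans)

lemma agree_upd_0: "int d <= i ==> agree d m (upd 0 i e m)" by (auto simp: agree_def upd_def)
lemma agree_upd: "agree d m m' ==> agree d (upd r i e m) (upd r i e m')" by (auto simp: agree_def upd_def)
lemma agree_ar: "agree d m m' ==> 0 < r ==> r < 16 ==> ar m r i = ar m' r i"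
proof (rule ccontr)
  assume "agree d m m'" "0 < r" "r < 16" "ar m r i \<noteq> ar m' r i"
  then obtain j where "16 * i + int r = 16 * j" unfolding agree_def ar_def by blast
  then have "(16 * i + int r) mod 16 = 0" by simp
  then show False using \<open>0 < r\<close> \<open>r < 16\<close> by simp
qed

lemma agree_ar_0: "agree d m m' ==> i < int d ==> ar m 0 i = ar m' 0 i"
proof (rule ccontr)
  assume "agree d m m'" "i < int d" "ar m 0 i \<noteq> ar m' 0 i"
  then obtain j where "16 * i = 16 * j" "int d <= j" unfolding agree_def ar_def by auto
  then show False using \<open>i < int d\<close> by simp
qed

definition tmp :: "nat => exp" where "tmp d = Load (Num (16 * int d))"
definition times16 :: "exp => exp" where
  "times16 e = (let a = Add e e; b = Add a a; c = Add b b in Add c c)"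

lemma eval_tmp [simp]: "eval_exp m (tmp d) = ar m 0 (int d)" by (simp add: tmp_def ar_def)
lemma eval_times16 [simp]: "eval_exp m (times16 e) = 16 * eval_exp m e" by (simp add: times16_def Let_def)

definition setv :: "nat => exp => com" where "setv d e = Store (Num (16 * int d)) e"

lemma runs_setv: "runs x (setv d e) m 1 (upd 0 (int d) (eval_exp m e) m)"
  using runs_Store[of x "Num (16 * int d)" e m] by (simp add: setv_def upd_def)

text \<open>Running times are measured by powers of a size \<open>Z\<close>. Since \<open>Z\<close>
  is at least 2, constants, sums and products of such powers are again bounded by powers, and only
  the existence of an exponent has to be tracked.\<close>

locale cost =
  fixes Z :: "ctx => nat"
  assumes Z_ge_2: "\<And>x. 2 <= Z x"
begin

lemma const_le: "k <= Z x ^ k"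
proof -
  have "k < 2 ^ k" by (rule less_exp)
  also have "\<dots> <= Z x ^ k" using Z_ge_2 by (intro power_mono) auto
  finally show ?thesis by simp
qed

lemma power_ge_1: "1 <= Z x ^ q" using Z_ge_2[of x] by simp

lemma add_le: "s <= Z x ^ p ==> t <= Z x ^ q ==> s + t <= Z x ^ Suc (p + q)"
proof -
  assume "s <= Z x ^ p" "t <= Z x ^ q"
  moreover have "Z x ^ p * 1 <= Z x ^ p * Z x ^ q" "1 * Z x ^ q <= Z x ^ p * Z x ^ q"
    using power_ge_1 by (auto intro!: mult_le_mono)
  ultimately have "s + t <= 2 * (Z x ^ p * Z x ^ q)" by linarith
  also have "\<dots> <= Z x * (Z x ^ p * Z x ^ q)" using Z_ge_2 by (intro mult_right_mono) auto
  finally show ?thesis by (simp add: power_add)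
qed

lemma mult_le: "s <= Z x ^ p ==> t <= Z x ^ q ==> s * t <= Z x ^ (p + q)"
  by (simp add: power_add mult_le_mono)

lemma Suc_le: "t <= Z x ^ q ==> Suc t <= Z x ^ Suc q"
  using add_le[of 1 x 0 t q] by simp

definition local_pred :: "(ctx => mem => bool) => nat => bool" where
  "local_pred P v \<longleftrightarrow> (\<forall>x m m'. P x m --> agree v m m' --> P x m')"

definition computes :: "(ctx => mem => bool) => nat => (ctx => mem => int) => com => nat => bool" where
  "computes P d F c q \<longleftrightarrow> (\<forall>x m. P x m -->
     (\<exists>t m'. t <= Z x ^ q \<and> runs x c m t m' \<and> agree d m m' \<and> ar m' 0 (int d) = F x m))"

text \<open>The order of the quantifiers matters: one command and one exponent serve all inputs and
  memories, as a program must not depend on its input. The command is only shown to exist, so that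
  the rules for \<open>pure\<close> act as a compiler run by the proof. Every depth \<open>d\<close>
  is required because intermediate results are kept in the temporaries below.\<close>

definition pure :: "(ctx => mem => bool) => nat => (ctx => mem => int) => bool" where
  "pure P v F \<longleftrightarrow> local_pred P v \<and> (\<forall>x m m'. P x m --> agree v m m' --> F x m = F x m') \<and>
     (\<forall>d\<ge>v. \<exists>c q. computes P d F c q)"

definition pureb :: "(ctx => mem => bool) => nat => (ctx => mem => bool) => bool" where
  "pureb P v B \<longleftrightarrow> pure P v (\<lambda>x m. of_bool (B x m))"

lemma pure_local: "pure P v F ==> local_pred P v" by (simp add: pure_def)
lemma pure_inv: "pure P v F ==> P x m ==> agree v m m' ==> F x m = F x m'" unfolding pure_def by blast
lemma local_predD: "local_pred P v ==> P x m ==> agree v m m' ==> P x m'" unfolding local_pred_def by blast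

lemma pure_comp: "pure P v F ==> v <= d ==> \<exists>c q. computes P d F c q"
  unfolding pure_def by blast

lemma computesD: "computes P d F c q ==> P x m ==>
   \<exists>t m'. t <= Z x ^ q \<and> runs x c m t m' \<and> agree d m m' \<and> ar m' 0 (int d) = F x m"
  unfolding computes_def by blast

lemma computes_mono:
  assumes "computes P d F c q" "q <= q'"
  shows "computes P d F c q'"
  unfolding computes_def
proof (intro allI impI)
  fix x m assume "P x m"
  then obtain t m' where *: "t <= Z x ^ q" "runs x c m t m' \<and> agree d m m' \<and> ar m' 0 (int d) = F x m"
    using assms(1) unfolding computes_def by blast
  have "t <= Z x ^ q'" using order_trans[OF *(1) power_increasing[OF assms(2)]] Z_ge_2[of x] by simp
  then show "\<exists>t m'. t <= Z x ^ q' \<and> runs x c m t m' \<and> agree d m m' \<and> ar m' 0 (int d) = F x m"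
    using *(2) by blast
qed

lemma pure_cong: "pure P v F ==> (\<And>x m. P x m ==> F x m = G x m) ==> pure P v G"
  unfolding pure_def local_pred_def computes_def by (simp cong: conj_cong)

lemma pure_weaken:
  assumes "pure P v F" "v <= v'" "local_pred P' v'" "\<And>x m. P' x m ==> P x m"
  shows "pure P' v' F"
  unfolding pure_def
proof (intro conjI allI impI)
  show "F x m = F x m'" if "P' x m" "agree v' m m'" for x m m'
    using pure_inv[OF assms(1)] assms(4) that agree_mono[OF _ assms(2)] by blast
  fix d assume "v' <= d"
  then have d: "v <= d" using assms(2) by simp
  obtain c q where c: "computes P d F c q"
    using pure_comp[OF assms(1) d] by blast
  then show "\<exists>c q. computes P' d F c q"
    using assms(4) unfolding computes_def by blast
qed (use assms in auto)

lemma pureI: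
  assumes "local_pred P v" "\<And>x m m'. P x m ==> agree v m m' ==> F x m = F x m'"
    "\<And>d. v <= d ==> \<exists>c q. computes P d F c q"
  shows "pure P v F"
  using assms unfolding pure_def by blast

lemma ar_0_upd_0: "ar (upd 0 i e m) 0 j = (if i = j then e else ar m 0 j)" by (simp add: ar_upd)

lemma pure_const: "local_pred P v ==> pure P v (\<lambda>x m. k)"
proof (rule pureI)
  fix d
  show "\<exists>c q. computes P d (\<lambda>x m. k) c q"
  proof (rule exI[of _ "setv d (Num k)"], rule exI[of _ 0], unfold computes_def, intro allI impI)
    fix x m
    show "\<exists>t m'. t <= Z x ^ 0 \<and> runs x (setv d (Num k)) m t m' \<and> agree d m m' \<and> ar m' 0 (int d) = k"
      using runs_setv[of x d "Num k" m] by (intro exI[of _ 1] exI[of _ "upd 0 (int d) k m"]) (simp add: agree_upd_0 ar_0_upd_0)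
  qed
qed auto

lemma pure_var:
  assumes "local_pred P v" "u < v"
  shows "pure P v (\<lambda>x m. ar m 0 (int u))"
proof (rule pureI)
  fix d assume "v <= d"
  show "\<exists>c q. computes P d (\<lambda>x m. ar m 0 (int u)) c q"
  proof (rule exI[of _ "setv d (tmp u)"], rule exI[of _ 0], unfold computes_def, intro allI impI)
    fix x m
    show "\<exists>t m'. t <= Z x ^ 0 \<and> runs x (setv d (tmp u)) m t m' \<and> agree d m m' \<and> ar m' 0 (int d) = ar m 0 (int u)"
      using runs_setv[of x d "tmp u" m] by (intro exI[of _ 1] exI) (auto simp: agree_upd_0 ar_0_upd_0)
  qed
qed (use assms agree_ar_0 in auto)

lemma pure_unop:
  assumes F: "pure P v F"
    and op: "\<And>d. \<exists>c. \<forall>x m. \<exists>t\<le>3. runs x c m t (upd 0 (int d) (H x m (ar m 0 (int d))) m)"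
    and H: "\<And>x m m' k. P x m ==> agree v m m' ==> H x m k = H x m' k"
  shows "pure P v (\<lambda>x m. H x m (F x m))"
proof (rule pureI)
  show "local_pred P v" using F by (rule pure_local)
  show "H x m (F x m) = H x m' (F x m')" if "P x m" "agree v m m'" for x m m'
    using H[OF that] pure_inv[OF F that] by simp
  fix d assume d: "v <= d"
  obtain c q where c: "computes P d F c q"
    using pure_comp[OF F d] by blast
  obtain c' where c': "\<And>x m. \<exists>t\<le>3. runs x c' m t (upd 0 (int d) (H x m (ar m 0 (int d))) m)" using op by metis
  show "\<exists>c q. computes P d (\<lambda>x m. H x m (F x m)) c q"
  proof (rule exI[of _ "Seq c c'"], rule exI[of _ "Suc (Suc (q + 3))"], unfold computes_def, intro allI impI)
    fix x m assume P: "P x m"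
    obtain t m1 where 1: "t <= Z x ^ q" "runs x c m t m1" "agree d m m1" "ar m1 0 (int d) = F x m" using computesD[OF c, OF P] by blast
    obtain t' where 2: "t' <= 3" "runs x c' m1 t' (upd 0 (int d) (H x m1 (ar m1 0 (int d))) m1)" using c' by blast
    have "Suc (t + t') <= Z x ^ Suc (Suc (q + 3))"
      using Suc_le[OF add_le[OF 1(1), of t' 3]] 2(1) const_le[of 3 x] by simp
    moreover have "H x m1 (ar m1 0 (int d)) = H x m (F x m)" using H[OF P agree_mono[OF 1(3) d]] 1(4) by simp
    ultimately show "\<exists>t m'. t <= Z x ^ Suc (Suc (q + 3)) \<and> runs x (Seq c c') m t m' \<and> agree d m m' \<and> ar m' 0 (int d) = H x m (F x m)"
      using runs_Seq[OF 1(2) 2(2)] agree_trans[OF 1(3) agree_upd_0[of d "int d"]]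
      by (intro exI[of _ "Suc (t + t')"] exI) (auto simp: ar_0_upd_0)
  qed
qed

lemma pure_binop:
  assumes F: "pure P v F" and G: "pure P v G"
    and op: "\<And>d. \<exists>c. \<forall>x m. \<exists>t\<le>3. runs x c m t (upd 0 (int d) (H x (ar m 0 (int d)) (ar m 0 (int (Suc d)))) m)"
  shows "pure P v (\<lambda>x m. H x (F x m) (G x m))"
proof (rule pureI)
  show "local_pred P v" using F by (rule pure_local)
  show "H x (F x m) (G x m) = H x (F x m') (G x m')" if "P x m" "agree v m m'" for x m m'
    using pure_inv[OF F that] pure_inv[OF G that] by simp
  fix d assume d: "v <= d"
  obtain c1 q1 where c1: "computes P d F c1 q1"
    using pure_comp[OF F d] by blast
  have d': "v <= Suc d" using d by simp
  obtain c2 q2 where c2: "computes P (Suc d) G c2 q2"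
    using pure_comp[OF G d'] by blast
  obtain c' where c': "\<And>x m. \<exists>t\<le>3. runs x c' m t (upd 0 (int d) (H x (ar m 0 (int d)) (ar m 0 (int (Suc d)))) m)" using op by metis
  let ?q = "Suc (Suc (q1 + Suc (Suc (q2 + 3))))"
  show "\<exists>c q. computes P d (\<lambda>x m. H x (F x m) (G x m)) c q"
  proof (rule exI[of _ "Seq c1 (Seq c2 c')"], rule exI[of _ ?q], unfold computes_def, intro allI impI)
    fix x m assume P: "P x m"
    obtain t1 m1 where 1: "t1 <= Z x ^ q1" "runs x c1 m t1 m1" "agree d m m1" "ar m1 0 (int d) = F x m" using computesD[OF c1, OF P] by blast
    have a1: "agree v m m1" using agree_mono[OF 1(3) d] .
    have P1: "P x m1" using local_predD[OF pure_local[OF F], OF P a1] .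
    obtain t2 m2 where 2: "t2 <= Z x ^ q2" "runs x c2 m1 t2 m2" "agree (Suc d) m1 m2" "ar m2 0 (int (Suc d)) = G x m1" using computesD[OF c2, OF P1] by blast
    obtain t3 where 3: "t3 <= 3" "runs x c' m2 t3 (upd 0 (int d) (H x (ar m2 0 (int d)) (ar m2 0 (int (Suc d)))) m2)" using c' by blast
    have "Suc (t2 + t3) <= Z x ^ Suc (Suc (q2 + 3))"
      using Suc_le[OF add_le[OF 2(1), of t3 3]] 3(1) const_le[of 3 x] by simp
    then have t: "Suc (t1 + Suc (t2 + t3)) <= Z x ^ ?q" using Suc_le[OF add_le[OF 1(1)]] by blast
    have "ar m2 0 (int d) = F x m" using agree_ar_0[OF 2(3), of "int d"] 1(4) by simp
    moreover have "ar m2 0 (int (Suc d)) = G x m" using 2(4) pure_inv[OF G P a1] by simp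
    moreover have "agree d m m2" using agree_trans[OF 1(3) agree_mono[OF 2(3)]] by simp
    ultimately show "\<exists>t m'. t <= Z x ^ ?q \<and> runs x (Seq c1 (Seq c2 c')) m t m' \<and> agree d m m' \<and> ar m' 0 (int d) = H x (F x m) (G x m)"
      using runs_Seq[OF 1(2) runs_Seq[OF 2(2) 3(2)]] t agree_trans[OF _ agree_upd_0[of d "int d"]]
      by (intro exI[of _ "Suc (t1 + Suc (t2 + t3))"] exI) (auto simp: ar_0_upd_0)
  qed
qed

lemma op_setv: "\<exists>c. \<forall>x m. \<exists>t\<le>3. runs x c m t (upd 0 (int d) (eval_exp m e) m)"
  by (metis one_le_numeral runs_setv)

lemma pure_add:
  assumes "pure P v F" "pure P v G"
  shows "pure P v (\<lambda>x m. F x m + G x m)"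
proof (rule pure_binop[OF assms, where H = "\<lambda>x a b. a + b"])
  show "\<exists>c. \<forall>x m. \<exists>t\<le>3. runs x c m t (upd 0 (int d) ((\<lambda>x a b. a + b) x (ar m 0 (int d)) (ar m 0 (int (Suc d)))) m)" for d
    using op_setv[of d "Add (tmp d) (tmp (Suc d))"] by simp
qed

lemma pure_diff:
  assumes "pure P v F" "pure P v G"
  shows "pure P v (\<lambda>x m. F x m - G x m)"
proof (rule pure_binop[OF assms, where H = "\<lambda>x a b. a - b"])
  show "\<exists>c. \<forall>x m. \<exists>t\<le>3. runs x c m t (upd 0 (int d) ((\<lambda>x a b. a - b) x (ar m 0 (int d)) (ar m 0 (int (Suc d)))) m)" for d
    using op_setv[of d "Sub (tmp d) (tmp (Suc d))"] by simp
qed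

lemma op_test: "\<exists>c. \<forall>x m. \<exists>t\<le>3. runs x c m t (upd 0 (int d) (of_bool (eval_test (par x) m b)) m)"
proof (intro exI[of _ "If b (setv d (Num 1)) (setv d (Num 0))"] allI exI[of _ 2] conjI)
  fix x m
  show "runs x (If b (setv d (Num 1)) (setv d (Num 0))) m 2 (upd 0 (int d) (of_bool (eval_test (par x) m b)) m)"
    unfolding numeral_2_eq_2 by (rule runs_If) (use runs_setv[of x d "Num 1" m] runs_setv[of x d "Num 0" m] in auto)
qed simp

lemma pureb_less:
  assumes "pure P v F" "pure P v G"
  shows "pureb P v (\<lambda>x m. F x m < G x m)"
  unfolding pureb_def
proof (rule pure_binop[OF assms, where H = "\<lambda>x a b. of_bool (a < b)"])
  show "\<exists>c. \<forall>x m. \<exists>t\<le>3. runs x c m t (upd 0 (int d) ((\<lambda>x a b. of_bool (a < b)) x (ar m 0 (int d)) (ar m 0 (int (Suc d)))) m)" for d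
    using op_test[of d "Less (tmp d) (tmp (Suc d))"] by (simp only: eval_test.simps eval_tmp)
qed

lemma pureb_param:
  assumes "pure P v F" "pure P v G"
  shows "pureb P v (\<lambda>x m. real_of_int (F x m) < real_of_int (G x m) * par x)"
  unfolding pureb_def
proof (rule pure_binop[OF assms, where H = "\<lambda>x a b. of_bool (real_of_int a < real_of_int b * par x)"])
  show "\<exists>c. \<forall>x m. \<exists>t\<le>3. runs x c m t (upd 0 (int d) ((\<lambda>x a b. of_bool (real_of_int a < real_of_int b * par x)) x (ar m 0 (int d)) (ar m 0 (int (Suc d)))) m)" for d
    using op_test[of d "Param_less (tmp d) (tmp (Suc d))"] by (simp only: eval_test.simps eval_tmp)
qed

lemma pure_ar:
  assumes "pure P v F" "0 < r" "r < 16"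
  shows "pure P v (\<lambda>x m. ar m r (F x m))"
proof (rule pure_unop[OF assms(1), where H = "\<lambda>x m k. ar m r k"])
  fix d
  show "\<exists>c. \<forall>x m. \<exists>t\<le>3. runs x c m t (upd 0 (int d) (ar m r (ar m 0 (int d))) m)"
    using op_setv[of d "Load (Add (times16 (tmp d)) (Num (int r)))"] by (simp add: ar_def[of _ r])
qed (use assms agree_ar in auto)

lemma pure_query:
  assumes "pure P v F"
  shows "pure P v (\<lambda>x m. query (len x) (arr x) (F x m))"
proof (rule pure_unop[OF assms(1), where H = "\<lambda>x m k. query (len x) (arr x) k"])
  fix d
  show "\<exists>c. \<forall>x m. \<exists>t\<le>3. runs x c m t (upd 0 (int d) (query (len x) (arr x) (ar m 0 (int d))) m)"
    using runs_Query[of _ "Num (16 * int d)" "tmp d"]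
    by (intro exI[of _ "Query (Num (16 * int d)) (tmp d)"] allI exI[of _ 1]) (simp add: upd_def)
qed auto

lemma pure_if:
  assumes B: "pureb P v B"
    and F: "pure (\<lambda>x m. P x m \<and> B x m) v F" and G: "pure (\<lambda>x m. P x m \<and> \<not> B x m) v G"
  shows "pure P v (\<lambda>x m. if B x m then F x m else G x m)"
proof (rule pureI)
  have B': "pure P v (\<lambda>x m. of_bool (B x m))" using B by (simp add: pureb_def)
  show lP: "local_pred P v" using pure_local[OF B'] .
  have Binv: "B x m = B x m'" if "P x m" "agree v m m'" for x m m'
    using pure_inv[OF B' that] by (auto split: if_splits simp: of_bool_def)
  show "(if B x m then F x m else G x m) = (if B x m' then F x m' else G x m')" if "P x m" "agree v m m'" for x m m'
    using Binv[OF that] pure_inv[OF F _ that(2)] pure_inv[OF G _ that(2)] that by auto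
  fix d assume d: "v <= d"
  obtain c1 q1 where c1: "computes P d (\<lambda>x m. of_bool (B x m)) c1 q1"
    using pure_comp[OF B' d] by blast
  obtain c2 q2 where c2: "computes (\<lambda>x m. P x m \<and> B x m) d F c2 q2"
    using pure_comp[OF F d] by blast
  obtain c3 q3 where c3: "computes (\<lambda>x m. P x m \<and> \<not> B x m) d G c3 q3"
    using pure_comp[OF G d] by blast
  let ?q = "Suc (Suc (q1 + Suc (q2 + q3)))" and ?c = "Seq c1 (If (Less (Num 0) (tmp d)) c2 c3)"
  show "\<exists>c q. computes P d (\<lambda>x m. (if B x m then F x m else G x m)) c q"
  proof (rule exI[of _ ?c], rule exI[of _ ?q], unfold computes_def, intro allI impI)
    fix x m assume P: "P x m"
    obtain t1 m1 where 1: "t1 <= Z x ^ q1" "runs x c1 m t1 m1" "agree d m m1" "ar m1 0 (int d) = of_bool (B x m)" using computesD[OF c1, OF P] by blast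
    have a1: "agree v m m1" using agree_mono[OF 1(3) d] .
    have P1: "P x m1" using local_predD[OF lP, OF P a1] .
    have "\<exists>t m'. t <= Z x ^ (q2 + q3) \<and> runs x (if B x m then c2 else c3) m1 t m' \<and> agree d m1 m' \<and> ar m' 0 (int d) = (if B x m then F x m else G x m)"
    proof (cases "B x m")
      case True
      then have *: "P x m1 \<and> B x m1" using P1 Binv[OF P a1] by simp
      have "F x m1 = F x m" using pure_inv[OF F, of x m m1] P True a1 by simp
      then show ?thesis using computesD[OF computes_mono[OF c2 le_add1], OF *] True by simp
    next
      case False
      then have *: "P x m1 \<and> \<not> B x m1" using P1 Binv[OF P a1] by simp
      have "G x m1 = G x m" using pure_inv[OF G, of x m m1] P False a1 by simp
      then show ?thesis using computesD[OF computes_mono[OF c3 le_add2], OF *] False by simp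
    qed
    then obtain t2 m2 where 2: "t2 <= Z x ^ (q2 + q3)" "runs x (if B x m then c2 else c3) m1 t2 m2" "agree d m1 m2"
      "ar m2 0 (int d) = (if B x m then F x m else G x m)" by blast
    have "runs x (If (Less (Num 0) (tmp d)) c2 c3) m1 (Suc t2) m2"
      by (rule runs_If) (use 2(2) 1(4) in \<open>auto split: if_splits\<close>)
    from runs_Seq[OF 1(2) this] have "runs x ?c m (Suc (t1 + Suc t2)) m2" .
    moreover have "Suc (t1 + Suc t2) <= Z x ^ ?q" using Suc_le[OF add_le[OF 1(1) Suc_le[OF 2(1)]]] .
    ultimately show "\<exists>t m'. t <= Z x ^ ?q \<and> runs x ?c m t m' \<and> agree d m m' \<and> ar m' 0 (int d) = (if B x m then F x m else G x m)"
      using agree_trans[OF 1(3) 2(3)] 2(4) by blast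
  qed
qed

end

section \<open>Bounded loops over values and over memories\<close>

primrec iter :: "(int => int => int) => nat => int => int" where
  "iter b 0 a = a"
| "iter b (Suc k) a = b (int k) (iter b k a)"

primrec forl :: "(int => mem => mem) => nat => mem => mem" where
  "forl b 0 m = m"
| "forl b (Suc k) m = b (int k) (forl b k m)"

context cost
begin

definition poly_le :: "(ctx => nat) => bool" where "poly_le T \<longleftrightarrow> (\<exists>q. \<forall>x. T x <= Z x ^ q)"

lemma poly_const: "poly_le (\<lambda>x. k)" unfolding poly_le_def using const_le by blast
lemma poly_power: "poly_le (\<lambda>x. Z x ^ q)" unfolding poly_le_def by blast
lemma poly_add: "poly_le S ==> poly_le T ==> poly_le (\<lambda>x. S x + T x)" unfolding poly_le_def using add_le by meson
lemma poly_mult: "poly_le S ==> poly_le T ==> poly_le (\<lambda>x. S x * T x)" unfolding poly_le_def using mult_le by meson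
lemmas poly_intros = poly_const poly_power poly_add poly_mult

lemma runs_setv_then:
  assumes "runs x c (upd 0 (int d) (eval_exp m e) m) t m'"
  shows "runs x (Seq (setv d e) c) m (2 + t) m'"
  using runs_Seq[OF runs_setv assms] by simp

text \<open>Temporary \<open>d\<close> holds the loop index, \<open>d + 1\<close> the accumulator
  and \<open>d + 2\<close> the number of rounds; the body is evaluated from \<open>d + 3\<close> on.
  The premise \<open>body\<close> treats arbitrary expressions \<open>K\<close> and \<open>A\<close>
  in place of these cells, so that it can be proved by the same syntax-directed rules as any other
  expression.\<close>

lemma pure_fold:
  assumes N: "pure P v N" and I: "pure P v I" and bound: "\<And>x m. P x m ==> N x m <= int (Z x ^ q)"
    and body: "\<And>P' d K A. v <= d ==> (\<And>x m. P' x m ==> P x m \<and> 0 <= K x m \<and> K x m < N x m) ==>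
      pure P' d K ==> pure P' d A ==> pure P' d (\<lambda>x m. body x m (K x m) (A x m))"
  shows "pure P v (\<lambda>x m. iter (body x m) (nat (N x m)) (I x m))"
proof (rule pureI)
  show lP: "local_pred P v" using pure_local[OF N] .
  have binv: "body x m k a = body x m' k a" if "P x m" "agree v m m'" "0 <= k" "k < N x m" for x m m' k a
  proof -
    let ?P = "\<lambda>x m. P x m \<and> 0 <= k \<and> k < N x m"
    have l: "local_pred ?P v"
      unfolding local_pred_def using local_predD[OF lP] pure_inv[OF N] by metis
    have "pure ?P v (\<lambda>x m. body x m k a)"
      by (rule body[of v ?P "\<lambda>x m. k" "\<lambda>x m. a"]) (auto intro: pure_const l)
    from pure_inv[OF this, of x m m'] that show ?thesis by simp
  qed
  have iter_inv: "iter (body x m) j a = iter (body x m') j a" if "P x m" "agree v m m'" "int j <= N x m" for x m m' j a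
    using that by (induction j) (auto simp: binv)
  show "iter (body x m) (nat (N x m)) (I x m) = iter (body x m') (nat (N x m')) (I x m')"
    if "P x m" "agree v m m'" for x m m'
    using iter_inv[OF that, of "nat (N x m)"] pure_inv[OF N that] pure_inv[OF I that]
    by (cases "0 <= N x m") auto
  fix d assume d: "v <= d"
  have d': "v <= d + 3" using d by simp
  let ?Q = "\<lambda>x m. P x m \<and> 0 <= ar m 0 (int d) \<and> ar m 0 (int d) < N x m"
  have lQ: "local_pred ?Q (d + 3)"
    unfolding local_pred_def
  proof (intro allI impI)
    fix x m m' assume *: "?Q x m" "agree (d + 3) m m'"
    have a: "agree v m m'" using agree_mono[OF *(2)] d by simp
    have "P x m" using * by simp
    moreover have "P x m'" using local_predD[OF lP \<open>P x m\<close> a] .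
    moreover have "ar m 0 (int d) = ar m' 0 (int d)" by (rule agree_ar_0[OF *(2)]) simp
    ultimately show "?Q x m'" using * pure_inv[OF N \<open>P x m\<close> a] by simp
  qed
  have "pure ?Q (d + 3) (\<lambda>x m. body x m (ar m 0 (int d)) (ar m 0 (int (d + 1))))"
    using d by (intro body pure_var lQ) auto
  from pure_comp[OF this order_refl] obtain cB qB
    where B: "computes ?Q (d + 3) (\<lambda>x m. body x m (ar m 0 (int d)) (ar m 0 (int (d + 1)))) cB qB" by blast
  obtain cN qN where cN: "computes P d N cN qN" using pure_comp[OF N d] by blast
  obtain cI qI where cI: "computes P (d + 3) I cI qI" using pure_comp[OF I d'] by blast
  define loop where "loop = While (Less (tmp d) (tmp (d + 2)))
    (Seq cB (Seq (setv (d + 1) (tmp (d + 3))) (setv d (Add (tmp d) (Num 1)))))"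
  define C where "C = Seq cN (Seq (setv (d + 2) (tmp d)) (Seq cI (Seq (setv (d + 1) (tmp (d + 3)))
    (Seq (setv d (Num 0)) (Seq loop (setv d (tmp (d + 1))))))))"
  have loop: "\<exists>t m'. t <= 1 + r * (Z x ^ qB + 6) \<and> runs x loop m1 t m' \<and> agree d m m' \<and>
      ar m' 0 (int (d + 1)) = iter (body x m) (nat (N x m)) (I x m)"
    if "P x m" "agree d m m1" "ar m1 0 (int d) = int j" "ar m1 0 (int (d + 2)) = N x m" "j + r = nat (N x m)" "0 <= N x m"
      "ar m1 0 (int (d + 1)) = iter (body x m) j (I x m)" for r j x m m1
    using that
  proof (induction r arbitrary: j m1)
    case 0
    have "runs x loop m1 1 m1" unfolding loop_def by (rule runs_While_False) (use 0 in auto)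
    moreover have "(1::nat) <= 1 + 0 * (Z x ^ qB + 6)" by simp
    ultimately show ?case using 0 by (intro exI[of _ 1] exI[of _ m1]) simp
  next
    case (Suc r)
    have av: "agree v m m1" using agree_mono[OF Suc.prems(2) d] .
    have P1: "P x m1" using local_predD[OF lP, OF Suc.prems(1) av] .
    have jN: "int j < N x m" using Suc.prems(5,6) by linarith
    have "?Q x m1" using P1 Suc.prems jN pure_inv[OF N Suc.prems(1) av] by simp
    from computesD[OF B, OF this] obtain t2 m2 where 2: "t2 <= Z x ^ qB" "runs x cB m1 t2 m2" "agree (d + 3) m1 m2"
      "ar m2 0 (int (d + 3)) = body x m1 (ar m1 0 (int d)) (ar m1 0 (int (d + 1)))" by blast
    have v2: "ar m2 0 (int (d + 3)) = iter (body x m) (Suc j) (I x m)"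
      using 2(4) Suc.prems(3,7) binv[OF Suc.prems(1) av _ jN] by simp
    let ?m3 = "upd 0 (int (d + 1)) (ar m2 0 (int (d + 3))) m2"
    let ?m4 = "upd 0 (int d) (ar ?m3 0 (int d) + 1) ?m3"
    have r4: "runs x (Seq cB (Seq (setv (d + 1) (tmp (d + 3))) (setv d (Add (tmp d) (Num 1))))) m1 (Suc (t2 + Suc (1 + 1))) ?m4"
      using runs_Seq[OF 2(2) runs_Seq[OF runs_setv[of x "d + 1" "tmp (d + 3)" m2, unfolded eval_tmp] runs_setv[of x d "Add (tmp d) (Num 1)" ?m3]]] by simp
    have keep: "ar m2 0 (int d) = int j" "ar m2 0 (int (d + 2)) = N x m"
      using agree_ar_0[OF 2(3), of "int d"] agree_ar_0[OF 2(3), of "int (d + 2)"] Suc.prems by simp_all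
    have a4: "agree d m ?m4"
      using agree_trans[OF Suc.prems(2) agree_trans[OF agree_mono[OF 2(3)] agree_trans[OF agree_upd_0 agree_upd_0]]] by simp
    obtain t5 m5 where 5: "t5 <= 1 + r * (Z x ^ qB + 6)" "runs x loop ?m4 t5 m5" "agree d m m5"
      "ar m5 0 (int (d + 1)) = iter (body x m) (nat (N x m)) (I x m)"
      using Suc.IH[OF Suc.prems(1) a4, of "Suc j"] keep Suc.prems v2 by (auto simp: ar_0_upd_0)
    have "runs x loop m1 (Suc (Suc (t2 + Suc (1 + 1)) + t5)) m5"
      unfolding loop_def by (rule runs_While_True[OF _ r4 5(2)[unfolded loop_def]]) (use Suc.prems jN in simp)
    moreover have "Suc (Suc (t2 + Suc (1 + 1)) + t5) <= 1 + Suc r * (Z x ^ qB + 6)" using 2(1) 5(1) by simp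
    ultimately show ?case using 5(3,4) by blast
  qed
  have "poly_le (\<lambda>x. Z x ^ qN + Z x ^ qI + Z x ^ q * (Z x ^ qB + 6) + 20)" by (intro poly_intros)
  then obtain p where p: "\<And>x. Z x ^ qN + Z x ^ qI + Z x ^ q * (Z x ^ qB + 6) + 20 <= Z x ^ p" unfolding poly_le_def by blast
  have "computes P d (\<lambda>x m. iter (body x m) (nat (N x m)) (I x m)) C p"
    unfolding computes_def
  proof (intro allI impI)
    fix x m assume P: "P x m"
    obtain t1 m1 where 1: "t1 <= Z x ^ qN" "runs x cN m t1 m1" "agree d m m1" "ar m1 0 (int d) = N x m"
      using computesD[OF cN, OF P] by blast
    let ?m2 = "upd 0 (int (d + 2)) (ar m1 0 (int d)) m1"
    have a2: "agree d m ?m2" using agree_trans[OF 1(3) agree_upd_0] by simp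
    have P2: "P x ?m2" using local_predD[OF lP, OF P agree_mono[OF a2 d]] .
    obtain t3 m3 where 3: "t3 <= Z x ^ qI" "runs x cI ?m2 t3 m3" "agree (d + 3) ?m2 m3" "ar m3 0 (int (d + 3)) = I x ?m2"
      using computesD[OF cI, OF P2] by blast
    have I3: "ar m3 0 (int (d + 3)) = I x m" using 3(4) pure_inv[OF I P agree_mono[OF a2 d]] by simp
    have N3: "ar m3 0 (int (d + 2)) = N x m" using agree_ar_0[OF 3(3), of "int (d + 2)"] 1(4) by (simp add: ar_0_upd_0)
    let ?m4 = "upd 0 (int (d + 1)) (ar m3 0 (int (d + 3))) m3"
    let ?m5 = "upd 0 (int d) 0 ?m4"
    have a5: "agree d m ?m5"
      using agree_trans[OF a2 agree_trans[OF agree_mono[OF 3(3)] agree_trans[OF agree_upd_0 agree_upd_0]]] by simp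
    have "\<exists>t m'. t <= 1 + Z x ^ q * (Z x ^ qB + 6) \<and> runs x loop ?m5 t m' \<and> agree d m m' \<and>
      ar m' 0 (int (d + 1)) = iter (body x m) (nat (N x m)) (I x m)"
    proof (cases "0 <= N x m")
      case True
      have "nat (N x m) <= Z x ^ q" unfolding nat_le_iff by (rule bound[OF P])
      then have "1 + nat (N x m) * (Z x ^ qB + 6) <= 1 + Z x ^ q * (Z x ^ qB + 6)" by simp
      moreover have "\<exists>t m'. t <= 1 + nat (N x m) * (Z x ^ qB + 6) \<and> runs x loop ?m5 t m' \<and> agree d m m' \<and>
        ar m' 0 (int (d + 1)) = iter (body x m) (nat (N x m)) (I x m)"
        using True I3 N3 by (intro loop[OF P a5, of 0]) (simp_all add: ar_0_upd_0)
      ultimately show ?thesis by (meson order_trans)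
    next
      case False
      have "runs x loop ?m5 1 ?m5" unfolding loop_def
        by (rule runs_While_False) (use False N3 in \<open>auto simp: ar_0_upd_0\<close>)
      then show ?thesis using a5 False I3 by (intro exI[of _ 1] exI[of _ ?m5]) (simp add: ar_0_upd_0)
    qed
    then obtain t6 m6 where 6: "t6 <= 1 + Z x ^ q * (Z x ^ qB + 6)" "runs x loop ?m5 t6 m6" "agree d m m6"
      "ar m6 0 (int (d + 1)) = iter (body x m) (nat (N x m)) (I x m)" by blast
    let ?m7 = "upd 0 (int d) (ar m6 0 (int (d + 1))) m6"
    have "runs x (Seq loop (setv d (tmp (d + 1)))) ?m5 (Suc (t6 + 1)) ?m7"
      using runs_Seq[OF 6(2) runs_setv[of x d "tmp (d + 1)" m6]] by simp
    from runs_setv_then[of x _ d m3] have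
      "runs x (Seq (setv (d + 1) (tmp (d + 3))) (Seq (setv d (Num 0)) (Seq loop (setv d (tmp (d + 1)))))) m3 (2 + (2 + Suc (t6 + 1))) ?m7"
      by (intro runs_setv_then) (use \<open>runs x (Seq loop (setv d (tmp (d + 1)))) ?m5 (Suc (t6 + 1)) ?m7\<close> in simp)
    from runs_Seq[OF 1(2) runs_setv_then[of x _ "d + 2" m1 "tmp d", simplified eval_tmp, OF runs_Seq[OF 3(2) this]]]
    have "runs x C m (Suc (t1 + (2 + Suc (t3 + (2 + (2 + Suc (t6 + 1))))))) ?m7" unfolding C_def .
    moreover have "Suc (t1 + (2 + Suc (t3 + (2 + (2 + Suc (t6 + 1)))))) <= Z x ^ p"
      using 1(1) 3(1) 6(1) p[of x] by linarith
    moreover have "agree d m ?m7" using agree_trans[OF 6(3) agree_upd_0] by simp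
    ultimately show "\<exists>t m'. t <= Z x ^ p \<and> runs x C m t m' \<and> agree d m m' \<and>
        ar m' 0 (int d) = iter (body x m) (nat (N x m)) (I x m)"
      by (intro exI[of _ "Suc (t1 + (2 + Suc (t3 + (2 + (2 + Suc (t6 + 1))))))"] exI[of _ ?m7] conjI)
        (simp_all only: ar_0_upd_0 6(4) simp_thms if_True)
  qed
  then show "\<exists>c q. computes P d (\<lambda>x m. iter (body x m) (nat (N x m)) (I x m)) c q" by blast
qed

definition transforms :: "(ctx => mem => bool) => nat => (ctx => mem => mem) => com => nat => bool" where
  "transforms P d G c q \<longleftrightarrow> (\<forall>x m. P x m --> (\<exists>t m'. t <= Z x ^ q \<and> runs x c m t m' \<and> agree d (G x m) m'))"

text \<open>The code need only agree with the specification \<open>G\<close> up to temporaries. For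
  composition, \<open>G\<close> must therefore respect this equivalence at every depth at which it
  may be compiled.\<close>

definition prog :: "(ctx => mem => bool) => nat => (ctx => mem => mem) => bool" where
  "prog P v G \<longleftrightarrow> local_pred P v \<and>
     (\<forall>d\<ge>v. (\<forall>x m m'. P x m --> agree d m m' --> agree d (G x m) (G x m')) \<and> (\<exists>c q. transforms P d G c q))"

lemma prog_local: "prog P v G ==> local_pred P v" by (simp add: prog_def)
lemma prog_inv: "prog P v G ==> v <= d ==> P x m ==> agree d m m' ==> agree d (G x m) (G x m')"
  unfolding prog_def by blast
lemma prog_comp: "prog P v G ==> v <= d ==> \<exists>c q. transforms P d G c q" unfolding prog_def by blast
lemma transformsD: "transforms P d G c q ==> P x m ==> \<exists>t m'. t <= Z x ^ q \<and> runs x c m t m' \<and> agree d (G x m) m'"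
  unfolding transforms_def by blast

lemma progI:
  assumes "local_pred P v" "\<And>d x m m'. v <= d ==> P x m ==> agree d m m' ==> agree d (G x m) (G x m')"
    "\<And>d. v <= d ==> \<exists>c q. transforms P d G c q"
  shows "prog P v G"
  using assms unfolding prog_def by blast

lemma prog_upd:
  assumes I: "pure P v I" and E: "pure P v E" and r: "0 < r" "r < 16"
  shows "prog P v (\<lambda>x m. upd r (I x m) (E x m) m)"
proof (rule progI)
  show lP: "local_pred P v" using pure_local[OF I] .
  show "agree d (upd r (I x m) (E x m) m) (upd r (I x m') (E x m') m')"
    if "v <= d" "P x m" "agree d m m'" for d x m m'
    using pure_inv[OF I that(2) agree_mono[OF that(3,1)]] pure_inv[OF E that(2) agree_mono[OF that(3,1)]]
      agree_upd[OF that(3)] by simp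
  fix d assume d: "v <= d"
  have d': "v <= Suc d" using d by simp
  obtain c1 q1 where c1: "computes P d I c1 q1" using pure_comp[OF I d] by blast
  obtain c2 q2 where c2: "computes P (Suc d) E c2 q2" using pure_comp[OF E d'] by blast
  let ?s = "Store (Add (times16 (tmp d)) (Num (int r))) (tmp (Suc d))"
  have "poly_le (\<lambda>x. Z x ^ q1 + Z x ^ q2 + 10)" by (intro poly_intros)
  then obtain p where p: "\<And>x. Z x ^ q1 + Z x ^ q2 + 10 <= Z x ^ p" unfolding poly_le_def by blast
  have "transforms P d (\<lambda>x m. upd r (I x m) (E x m) m) (Seq c1 (Seq c2 ?s)) p"
    unfolding transforms_def
  proof (intro allI impI)
    fix x m assume P: "P x m"
    obtain t1 m1 where 1: "t1 <= Z x ^ q1" "runs x c1 m t1 m1" "agree d m m1" "ar m1 0 (int d) = I x m"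
      using computesD[OF c1, OF P] by blast
    have a1: "agree v m m1" using agree_mono[OF 1(3) d] .
    have P1: "P x m1" using local_predD[OF lP, OF P a1] .
    obtain t2 m2 where 2: "t2 <= Z x ^ q2" "runs x c2 m1 t2 m2" "agree (Suc d) m1 m2" "ar m2 0 (int (Suc d)) = E x m1"
      using computesD[OF c2, OF P1] by blast
    have "ar m2 0 (int d) = I x m" using agree_ar_0[OF 2(3), of "int d"] 1(4) by simp
    moreover have "ar m2 0 (int (Suc d)) = E x m" using 2(4) pure_inv[OF E P a1] by simp
    ultimately have "runs x ?s m2 1 (upd r (I x m) (E x m) m2)"
      using runs_Store[of x "Add (times16 (tmp d)) (Num (int r))" "tmp (Suc d)" m2] by (simp add: upd_def)
    from runs_Seq[OF 1(2) runs_Seq[OF 2(2) this]]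
    have "runs x (Seq c1 (Seq c2 ?s)) m (Suc (t1 + Suc (t2 + 1))) (upd r (I x m) (E x m) m2)" .
    moreover have "Suc (t1 + Suc (t2 + 1)) <= Z x ^ p" using 1(1) 2(1) p[of x] by linarith
    moreover have "agree d m m2" using agree_trans[OF 1(3) agree_mono[OF 2(3)]] by simp
    ultimately show "\<exists>t m'. t <= Z x ^ p \<and> runs x (Seq c1 (Seq c2 ?s)) m t m' \<and> agree d (upd r (I x m) (E x m) m) m'"
      using agree_upd by blast
  qed
  then show "\<exists>c q. transforms P d (\<lambda>x m. upd r (I x m) (E x m) m) c q" by blast
qed

lemma prog_seq:
  assumes G: "prog P v G" and H: "prog P' v H" and P': "\<And>x m. P x m ==> P' x (G x m)"
  shows "prog P v (\<lambda>x m. H x (G x m))"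
proof (rule progI)
  show lP: "local_pred P v" using prog_local[OF G] .
  show "agree d (H x (G x m)) (H x (G x m'))" if "v <= d" "P x m" "agree d m m'" for d x m m'
    using prog_inv[OF H that(1) P'[OF that(2)] prog_inv[OF G that]] .
  fix d assume d: "v <= d"
  obtain c1 q1 where c1: "transforms P d G c1 q1" using prog_comp[OF G d] by blast
  obtain c2 q2 where c2: "transforms P' d H c2 q2" using prog_comp[OF H d] by blast
  have "poly_le (\<lambda>x. Z x ^ q1 + Z x ^ q2 + 1)" by (intro poly_intros)
  then obtain p where p: "\<And>x. Z x ^ q1 + Z x ^ q2 + 1 <= Z x ^ p" unfolding poly_le_def by blast
  have "transforms P d (\<lambda>x m. H x (G x m)) (Seq c1 c2) p"
    unfolding transforms_def
  proof (intro allI impI)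
    fix x m assume P: "P x m"
    obtain t1 m1 where 1: "t1 <= Z x ^ q1" "runs x c1 m t1 m1" "agree d (G x m) m1" using transformsD[OF c1, OF P] by blast
    have "P' x m1" using local_predD[OF prog_local[OF H], OF P'[OF P] agree_mono[OF 1(3) d]] .
    then obtain t2 m2 where 2: "t2 <= Z x ^ q2" "runs x c2 m1 t2 m2" "agree d (H x m1) m2" using transformsD[OF c2] by blast
    have "agree d (H x (G x m)) m2" using agree_trans[OF prog_inv[OF H d P'[OF P] 1(3)] 2(3)] .
    moreover have "Suc (t1 + t2) <= Z x ^ p" using 1(1) 2(1) p[of x] by linarith
    ultimately show "\<exists>t m'. t <= Z x ^ p \<and> runs x (Seq c1 c2) m t m' \<and> agree d (H x (G x m)) m'"
      using runs_Seq[OF 1(2) 2(2)] by blast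
  qed
  then show "\<exists>c q. transforms P d (\<lambda>x m. H x (G x m)) c q" by blast
qed

text \<open>The counter and the bound of the compiled loop are temporaries below those of the body.
  By \<open>frame\<close> the specification of the body leaves them alone, and its code uses only
  temporaries above them.\<close>

lemma prog_for:
  assumes N: "pure P v N" and bound: "\<And>x m. P x m ==> N x m <= int (Z x ^ q)"
    and body: "\<And>P' d K. v <= d ==> (\<And>x m. P' x m ==> P x m \<and> 0 <= K x m \<and> K x m < N x m) ==>
      pure P' d K ==> prog P' d (\<lambda>x m. body x (K x m) m)"
    and inv: "\<And>x m k. P x m ==> 0 <= k ==> k < N x m ==> P x (body x k m) \<and> N x (body x k m) = N x m"
    and frame: "\<And>x m k i. ar (body x k m) 0 i = ar m 0 i"
  shows "prog P v (\<lambda>x m. forl (body x) (nat (N x m)) m)"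
proof (rule progI)
  show lP: "local_pred P v" using pure_local[OF N] .
  have binv: "agree d (body x k m) (body x k m')" if "v <= d" "P x m" "agree d m m'" "0 <= k" "k < N x m" for d x m m' k
  proof -
    let ?P = "\<lambda>x m. P x m \<and> 0 <= k \<and> k < N x m"
    have l: "local_pred ?P d"
      unfolding local_pred_def using local_predD[OF lP] pure_inv[OF N] agree_mono[OF _ that(1)] by metis
    have "prog ?P d (\<lambda>x m. body x k m)"
      by (rule body[of d ?P "\<lambda>x m. k"]) (auto intro: pure_const l that)
    from prog_inv[OF this order_refl, of x m m'] that show ?thesis by simp
  qed
  have keep: "P x (forl (body x) j m) \<and> N x (forl (body x) j m) = N x m" if "P x m" "int j <= N x m" for x m j
    using that by (induction j) (auto simp: inv)
  have forl_inv: "agree d (forl (body x) j m) (forl (body x) j m')" if "v <= d" "P x m" "agree d m m'" "int j <= N x m" for d x m m' j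
    using that by (induction j) (auto intro!: binv simp: keep)
  show "agree d (forl (body x) (nat (N x m)) m) (forl (body x) (nat (N x m')) m')"
    if "v <= d" "P x m" "agree d m m'" for d x m m'
    using forl_inv[OF that, of "nat (N x m)"] pure_inv[OF N that(2) agree_mono[OF that(3,1)]] that(3)
    by (cases "0 <= N x m") auto
  fix d assume d: "v <= d"
  let ?Q = "\<lambda>x m. P x m \<and> 0 <= ar m 0 (int d) \<and> ar m 0 (int d) < N x m"
  have lQ: "local_pred ?Q (d + 2)"
    unfolding local_pred_def
  proof (intro allI impI)
    fix x m m' assume *: "?Q x m" "agree (d + 2) m m'"
    have a: "agree v m m'" using agree_mono[OF *(2)] d by simp
    have "P x m" using * by simp
    moreover have "P x m'" using local_predD[OF lP \<open>P x m\<close> a] .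
    moreover have "ar m 0 (int d) = ar m' 0 (int d)" by (rule agree_ar_0[OF *(2)]) simp
    ultimately show "?Q x m'" using * pure_inv[OF N \<open>P x m\<close> a] by simp
  qed
  have "prog ?Q (d + 2) (\<lambda>x m. body x (ar m 0 (int d)) m)"
    using d by (intro body pure_var lQ) auto
  from prog_comp[OF this order_refl] obtain cB qB
    where B: "transforms ?Q (d + 2) (\<lambda>x m. body x (ar m 0 (int d)) m) cB qB" by blast
  obtain cN qN where cN: "computes P d N cN qN" using pure_comp[OF N d] by blast
  define loop where "loop = While (Less (tmp d) (tmp (d + 1))) (Seq cB (setv d (Add (tmp d) (Num 1))))"
  define C where "C = Seq cN (Seq (setv (d + 1) (tmp d)) (Seq (setv d (Num 0)) loop))"
  have loop: "\<exists>t m'. t <= 1 + r * (Z x ^ qB + 6) \<and> runs x loop m1 t m' \<and> agree d (forl (body x) (nat (N x m)) m) m'"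
    if "P x m" "agree d (forl (body x) j m) m1" "ar m1 0 (int d) = int j" "ar m1 0 (int (d + 1)) = N x m"
      "j + r = nat (N x m)" "0 <= N x m" for r j x m m1
    using that
  proof (induction r arbitrary: j m1)
    case 0
    have "runs x loop m1 1 m1" unfolding loop_def by (rule runs_While_False) (use 0 in auto)
    then show ?case using 0 by (intro exI[of _ 1] exI[of _ m1]) simp
  next
    case (Suc r)
    let ?M = "forl (body x) j m"
    have jN: "int j < N x m" using Suc.prems(5,6) by linarith
    have kM: "P x ?M" "N x ?M = N x m" using keep[OF Suc.prems(1), of j] jN by auto
    have P1: "P x m1" using local_predD[OF lP, OF kM(1) agree_mono[OF Suc.prems(2) d]] .
    have N1: "N x m1 = N x m" using pure_inv[OF N kM(1) agree_mono[OF Suc.prems(2) d]] kM(2) by simp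
    have "?Q x m1" using P1 N1 Suc.prems(3) jN by simp
    from transformsD[OF B, OF this] obtain t2 m2 where 2: "t2 <= Z x ^ qB" "runs x cB m1 t2 m2"
      "agree (d + 2) (body x (int j) m1) m2" using Suc.prems(3) by auto
    have a2: "agree d (forl (body x) (Suc j) m) m2"
      using agree_trans[OF binv[OF d kM(1) Suc.prems(2), of "int j"] agree_mono[OF 2(3)]] kM(2) jN by simp
    let ?m3 = "upd 0 (int d) (ar m2 0 (int d) + 1) m2"
    have r3: "runs x (Seq cB (setv d (Add (tmp d) (Num 1)))) m1 (Suc (t2 + 1)) ?m3"
      using runs_Seq[OF 2(2) runs_setv[of x d "Add (tmp d) (Num 1)" m2]] by simp
    have k2: "ar m2 0 (int d) = int j" "ar m2 0 (int (d + 1)) = N x m"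
      using agree_ar_0[OF 2(3), of "int d"] agree_ar_0[OF 2(3), of "int (d + 1)"] Suc.prems(3,4) by (simp_all add: frame)
    have a3: "agree d (forl (body x) (Suc j) m) ?m3" using agree_trans[OF a2 agree_upd_0] by simp
    obtain t4 m4 where 4: "t4 <= 1 + r * (Z x ^ qB + 6)" "runs x loop ?m3 t4 m4" "agree d (forl (body x) (nat (N x m)) m) m4"
      using Suc.IH[OF Suc.prems(1) a3] k2 Suc.prems(5,6) by (auto simp: ar_0_upd_0)
    have "runs x loop m1 (Suc (Suc (t2 + 1) + t4)) m4"
      unfolding loop_def by (rule runs_While_True[OF _ r3 4(2)[unfolded loop_def]]) (use Suc.prems jN in simp)
    moreover have "Suc (Suc (t2 + 1) + t4) <= 1 + Suc r * (Z x ^ qB + 6)" using 2(1) 4(1) by simp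
    ultimately show ?case using 4(3) by blast
  qed
  have "poly_le (\<lambda>x. Z x ^ qN + Z x ^ q * (Z x ^ qB + 6) + 20)" by (intro poly_intros)
  then obtain p where p: "\<And>x. Z x ^ qN + Z x ^ q * (Z x ^ qB + 6) + 20 <= Z x ^ p" unfolding poly_le_def by blast
  have "transforms P d (\<lambda>x m. forl (body x) (nat (N x m)) m) C p"
    unfolding transforms_def
  proof (intro allI impI)
    fix x m assume P: "P x m"
    obtain t1 m1 where 1: "t1 <= Z x ^ qN" "runs x cN m t1 m1" "agree d m m1" "ar m1 0 (int d) = N x m"
      using computesD[OF cN, OF P] by blast
    let ?m2 = "upd 0 (int (d + 1)) (ar m1 0 (int d)) m1"
    let ?m3 = "upd 0 (int d) 0 ?m2"
    have a3: "agree d m ?m3" using agree_trans[OF 1(3) agree_trans[OF agree_upd_0 agree_upd_0]] by simp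
    have "\<exists>t m'. t <= 1 + Z x ^ q * (Z x ^ qB + 6) \<and> runs x loop ?m3 t m' \<and> agree d (forl (body x) (nat (N x m)) m) m'"
    proof (cases "0 <= N x m")
      case True
      have "nat (N x m) <= Z x ^ q" unfolding nat_le_iff by (rule bound[OF P])
      then have "1 + nat (N x m) * (Z x ^ qB + 6) <= 1 + Z x ^ q * (Z x ^ qB + 6)" by simp
      moreover have "\<exists>t m'. t <= 1 + nat (N x m) * (Z x ^ qB + 6) \<and> runs x loop ?m3 t m' \<and> agree d (forl (body x) (nat (N x m)) m) m'"
        using a3 True 1(4) by (intro loop[OF P, of 0]) (simp_all add: ar_0_upd_0)
      ultimately show ?thesis by (meson order_trans)
    next
      case False
      have "runs x loop ?m3 1 ?m3" unfolding loop_def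
        by (rule runs_While_False) (use False 1(4) in \<open>auto simp: ar_0_upd_0\<close>)
      then show ?thesis using a3 False by (intro exI[of _ 1] exI[of _ ?m3]) simp
    qed
    then obtain t4 m4 where 4: "t4 <= 1 + Z x ^ q * (Z x ^ qB + 6)" "runs x loop ?m3 t4 m4"
      "agree d (forl (body x) (nat (N x m)) m) m4" by blast
    have "runs x (Seq (setv (d + 1) (tmp d)) (Seq (setv d (Num 0)) loop)) m1 (2 + (2 + t4)) m4"
      by (intro runs_setv_then) (use 4(2) in simp)
    from runs_Seq[OF 1(2) this] have "runs x C m (Suc (t1 + (2 + (2 + t4)))) m4" unfolding C_def .
    moreover have "Suc (t1 + (2 + (2 + t4))) <= Z x ^ p" using 1(1) 4(1) p[of x] by linarith
    ultimately show "\<exists>t m'. t <= Z x ^ p \<and> runs x C m t m' \<and> agree d (forl (body x) (nat (N x m)) m) m'"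
      using 4(3) by blast
  qed
  then show "\<exists>c q. transforms P d (\<lambda>x m. forl (body x) (nat (N x m)) m) c q" by blast
qed

end

section \<open>Derived operations: logic, multiplication, sums, maxima, searches and
  division\<close>

context cost
begin

lemma local_conj: "pureb P v B ==> local_pred (\<lambda>x m. P x m \<and> B x m) v" "pureb P v B ==> local_pred (\<lambda>x m. P x m \<and> \<not> B x m) v"
proof -
  assume "pureb P v B"
  then have p: "pure P v (\<lambda>x m. of_bool (B x m))" by (simp add: pureb_def)
  have "B x m = B x m'" if "P x m" "agree v m m'" for x m m'
    using pure_inv[OF p that] by (auto simp: of_bool_def split: if_splits)
  then show "local_pred (\<lambda>x m. P x m \<and> B x m) v" "local_pred (\<lambda>x m. P x m \<and> \<not> B x m) v"
    using local_predD[OF pure_local[OF p]] unfolding local_pred_def by metis+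
qed

lemma pure_ite:
  assumes "pureb P v B" "pure P v F" "pure P v G"
  shows "pure P v (\<lambda>x m. if B x m then F x m else G x m)"
  by (intro pure_if assms pure_weaken[OF assms(2) order_refl] pure_weaken[OF assms(3) order_refl] local_conj) auto

lemma pureb_cong: "pureb P v F ==> (\<And>x m. P x m ==> F x m = G x m) ==> pureb P v G"
  unfolding pureb_def by (erule pure_cong) simp

lemma pureb_not: "pureb P v B ==> pureb P v (\<lambda>x m. \<not> B x m)"
  unfolding pureb_def by (rule pure_cong[OF pure_diff[OF pure_const[of P v 1]]]) (auto simp: pure_local)

lemma pureb_conj: "pureb P v A ==> pureb P v B ==> pureb P v (\<lambda>x m. A x m \<and> B x m)"
  unfolding pureb_def[of _ _ "\<lambda>x m. A x m \<and> B x m"]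
  by (rule pure_cong[OF pure_ite[of P v A "\<lambda>x m. of_bool (B x m)" "\<lambda>x m. 0"]])
    (auto simp: pureb_def intro: pure_const pure_local)

lemma pureb_le: "pure P v F ==> pure P v G ==> pureb P v (\<lambda>x m. F x m <= G x m)"
  by (rule pureb_cong[OF pureb_not[OF pureb_less[of P v G F]]]) auto

lemma pureb_eq: "pure P v F ==> pure P v G ==> pureb P v (\<lambda>x m. F x m = G x m)"
  by (rule pureb_cong[OF pureb_conj[OF pureb_le[of P v F G] pureb_le[of P v G F]]]) auto

lemma pureb_if:
  "pureb P v C ==> pureb P v A ==> pureb P v B ==> pureb P v (\<lambda>x m. if C x m then A x m else B x m)"
  unfolding pureb_def[of _ _ "\<lambda>x m. if C x m then A x m else B x m"]
  by (rule pure_cong[OF pure_ite[of P v C "\<lambda>x m. of_bool (A x m)" "\<lambda>x m. of_bool (B x m)"]])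
    (auto simp: pureb_def)

lemma pure_max: "pure P v F ==> pure P v G ==> pure P v (\<lambda>x m. max (F x m) (G x m))"
  unfolding max_def by (intro pure_ite pureb_le)

lemma pure_min: "pure P v F ==> pure P v G ==> pure P v (\<lambda>x m. min (F x m) (G x m))"
  unfolding min_def by (intro pure_ite pureb_le)

definition bounded :: "(ctx => mem => bool) => (ctx => mem => int) => bool" where
  "bounded P N \<longleftrightarrow> (\<exists>q. \<forall>x m. P x m --> N x m <= int (Z x ^ q))"

lemma boundedE:
  assumes "bounded P N"
  obtains q where "\<And>x m. P x m ==> N x m <= int (Z x ^ q)"
  using assms unfolding bounded_def by blast

lemma bounded_le: "bounded P N ==> (\<And>x m. P' x m ==> P x m \<and> M x m <= N x m) ==> bounded P' M"
  unfolding bounded_def by (meson order_trans)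

lemma pure_iter:
  assumes N: "pure P v N" and I: "pure P v I" and b: "bounded P N"
    and body: "\<And>P' d K A. v <= d ==> (\<And>x m. P' x m ==> P x m) ==> (\<And>x m. P' x m ==> 0 <= K x m \<and> K x m < N x m) ==>
      local_pred P' d ==> pure P' d K ==> pure P' d A ==> pure P' d (\<lambda>x m. body x m (K x m) (A x m))"
  shows "pure P v (\<lambda>x m. iter (body x m) (nat (N x m)) (I x m))"
proof -
  obtain q where q: "\<And>x m. P x m ==> N x m <= int (Z x ^ q)" using b by (rule boundedE) blast
  show ?thesis
  proof (rule pure_fold[OF N I q])
    fix P' d K A assume *: "v <= d" "\<And>x m. P' x m ==> P x m \<and> 0 <= K x m \<and> K x m < N x m" "pure P' d K" "pure P' d A"
    show "pure P' d (\<lambda>x m. body x m (K x m) (A x m))"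
      by (rule body[OF *(1) _ _ pure_local[OF *(3)] *(3,4)]) (use *(2) in auto)
  qed
qed

lemma iter_mult: "iter (\<lambda>k a. a + c) n 0 = c * int n" by (induction n) (auto simp: algebra_simps)
lemma iter_pow2: "iter (\<lambda>k a. a + a) n 1 = 2 ^ n" by (induction n) auto
lemma iter_sum: "iter (\<lambda>k a. a + f (nat k)) n 0 = (\<Sum>k<n. f k)" by (induction n) auto
lemma iter_last: "iter (\<lambda>k a. if B (nat k) then k else a) n 0 = int (last_index n B)" by (induction n) auto
lemma iter_bmax: "iter (\<lambda>k a. max a (g (nat k))) n 0 = bmax n g" by (induction n) auto

text \<open>The machine has no multiplication. Repeated addition is affordable if one factor is
  bounded by a power of \<open>Z\<close>; the other may be arbitrarily large.\<close>

lemma pure_mult: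
  assumes "pure P v F" "pure P v G" "bounded P G" "\<And>x m. P x m ==> 0 <= G x m"
  shows "pure P v (\<lambda>x m. F x m * G x m)"
proof (rule pure_cong)
  show "pure P v (\<lambda>x m. iter (\<lambda>k a. a + F x m) (nat (G x m)) 0)"
    by (rule pure_iter[OF assms(2) pure_const[OF pure_local[OF assms(2)]] assms(3)])
      (intro pure_add pure_weaken[OF assms(1)])
qed (use assms(4) in \<open>simp add: iter_mult\<close>)

lemma pure_pow2:
  assumes "pure P v G" "bounded P G"
  shows "pure P v (\<lambda>x m. 2 ^ nat (G x m))"
proof (rule pure_cong)
  show "pure P v (\<lambda>x m. iter (\<lambda>k a. a + a) (nat (G x m)) 1)"
    by (rule pure_iter[OF assms(1) pure_const[OF pure_local[OF assms(1)]] assms(2)]) (intro pure_add)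
qed (simp only: iter_pow2)

lemma pure_sum:
  assumes N: "pure P v N" and b: "bounded P N"
    and body: "\<And>P' d K. v <= d ==> (\<And>x m. P' x m ==> P x m) ==> (\<And>x m. P' x m ==> 0 <= K x m \<and> K x m < N x m) ==>
      local_pred P' d ==> pure P' d K ==> pure P' d (\<lambda>x m. f x m (nat (K x m)))"
  shows "pure P v (\<lambda>x m. \<Sum>k<nat (N x m). f x m k)"
proof (rule pure_cong)
  show "pure P v (\<lambda>x m. iter (\<lambda>k a. a + f x m (nat k)) (nat (N x m)) 0)"
    by (rule pure_iter[OF N pure_const[OF pure_local[OF N]] b]) (intro pure_add body)
qed (simp add: iter_sum)

lemma pure_bmax:
  assumes N: "pure P v N" and b: "bounded P N"
    and body: "\<And>P' d K. v <= d ==> (\<And>x m. P' x m ==> P x m) ==> (\<And>x m. P' x m ==> 0 <= K x m \<and> K x m < N x m) ==>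
      local_pred P' d ==> pure P' d K ==> pure P' d (\<lambda>x m. f x m (nat (K x m)))"
  shows "pure P v (\<lambda>x m. bmax (nat (N x m)) (f x m))"
proof (rule pure_cong)
  show "pure P v (\<lambda>x m. iter (\<lambda>k a. max a (f x m (nat k))) (nat (N x m)) 0)"
    by (rule pure_iter[OF N pure_const[OF pure_local[OF N]] b]) (intro pure_max body)
qed (simp add: iter_bmax)

lemma pure_last_index:
  assumes N: "pure P v N" and b: "bounded P N"
    and body: "\<And>P' d K. v <= d ==> (\<And>x m. P' x m ==> P x m) ==> (\<And>x m. P' x m ==> 0 <= K x m \<and> K x m < N x m) ==>
      local_pred P' d ==> pure P' d K ==> pureb P' d (\<lambda>x m. B x m (nat (K x m)))"
  shows "pure P v (\<lambda>x m. int (last_index (nat (N x m)) (B x m)))"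
proof (rule pure_cong)
  show "pure P v (\<lambda>x m. iter (\<lambda>k a. if B x m (nat k) then k else a) (nat (N x m)) 0)"
    by (rule pure_iter[OF N pure_const[OF pure_local[OF N]] b]) (intro pure_ite body)
qed (simp add: iter_last)

lemma pure_card:
  assumes N: "pure P v N" and b: "bounded P N"
    and body: "\<And>P' d K. v <= d ==> (\<And>x m. P' x m ==> P x m) ==> (\<And>x m. P' x m ==> 0 <= K x m \<and> K x m < N x m) ==>
      local_pred P' d ==> pure P' d K ==> pureb P' d (\<lambda>x m. B x m (nat (K x m)))"
  shows "pure P v (\<lambda>x m. int (card {k. k < nat (N x m) \<and> B x m k}))"
proof (rule pure_cong)
  show "pure P v (\<lambda>x m. \<Sum>k<nat (N x m). of_bool (B x m k))"
    by (rule pure_sum[OF N b]) (rule body[unfolded pureb_def])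
  show "(\<Sum>k<nat (N x m). of_bool (B x m k)) = int (card {k. k < nat (N x m) \<and> B x m k})" for x m
    by (simp add: of_bool_def sum.If_cases Int_def)
qed

lemma pureb_ex:
  assumes N: "pure P v N" and b: "bounded P N"
    and body: "\<And>P' d K. v <= d ==> (\<And>x m. P' x m ==> P x m) ==> (\<And>x m. P' x m ==> 0 <= K x m \<and> K x m < N x m) ==>
      local_pred P' d ==> pure P' d K ==> pureb P' d (\<lambda>x m. B x m (nat (K x m)))"
  shows "pureb P v (\<lambda>x m. \<exists>k<nat (N x m). B x m k)"
proof (rule pureb_cong)
  show "pureb P v (\<lambda>x m. 0 < int (card {k. k < nat (N x m) \<and> B x m k}))"
    by (intro pureb_less pure_const pure_local[OF N] pure_card[OF N b] body)
qed (auto simp: card_gt_0_iff)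

lemma pureb_all:
  assumes N: "pure P v N" and b: "bounded P N"
    and body: "\<And>P' d K. v <= d ==> (\<And>x m. P' x m ==> P x m) ==> (\<And>x m. P' x m ==> 0 <= K x m \<and> K x m < N x m) ==>
      local_pred P' d ==> pure P' d K ==> pureb P' d (\<lambda>x m. B x m (nat (K x m)))"
  shows "pureb P v (\<lambda>x m. \<forall>k<nat (N x m). B x m k)"
proof (rule pureb_cong)
  show "pureb P v (\<lambda>x m. \<not> (\<exists>k<nat (N x m). \<not> B x m k))"
    by (rule pureb_not[OF pureb_ex[OF N b]]) (rule pureb_not, rule body)
qed auto

lemma clog_eq_card: "w <= 2 ^ n ==> clog w = card {i. i < n \<and> 2 ^ i < w}"
proof -
  assume "w <= 2 ^ n"
  then have "clog w <= n" by (rule clog_le)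
  have "2 ^ i < w \<longleftrightarrow> i < clog w" for i
  proof
    assume "2 ^ i < w"
    show "i < clog w"
    proof (rule ccontr)
      assume "\<not> i < clog w"
      then have "(2::int) ^ clog w <= 2 ^ i" by (intro power_increasing) auto
      then show False using le_two_power_clog[of w] \<open>2 ^ i < w\<close> by linarith
    qed
  next
    assume "i < clog w"
    then show "2 ^ i < w" using clog_le[of w i] by linarith
  qed
  then have "{i. i < n \<and> 2 ^ i < w} = {i. i < n \<and> i < clog w}" by (simp only:)
  also have "\<dots> = {..<clog w}" using \<open>clog w <= n\<close> by auto
  finally show ?thesis by simp
qed

lemma pure_clog:
  assumes W: "pure P v W" and B: "pure P v B" and b: "bounded P B" and le: "\<And>x m. P x m ==> W x m <= 2 ^ nat (B x m)"
  shows "pure P v (\<lambda>x m. int (clog (W x m)))"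
proof (rule pure_cong)
  show "pure P v (\<lambda>x m. int (card {i. i < nat (B x m) \<and> 2 ^ i < W x m}))"
  proof (rule pure_card[OF B b])
    fix P' d K assume *: "v <= d" "\<And>x m. P' x m ==> P x m" "\<And>x m. P' x m ==> 0 <= K x m \<and> K x m < B x m"
      "local_pred P' d" "pure P' d K"
    have "bounded P' K" by (rule bounded_le[OF b]) (use * in force)
    then show "pureb P' d (\<lambda>x m. 2 ^ nat (K x m) < W x m)"
      by (intro pureb_less pure_pow2 pure_weaken[OF W] *)
  qed
qed (simp add: clog_eq_card[OF le])

lemma pure_quot:
  assumes "pure P v M" "bounded P M" "pure P v U" "pure P v E"
  shows "pure P v (\<lambda>x m. int (quot (nat (M x m)) (U x m) (E x m)))"
  unfolding quot_def
proof (rule pure_card[OF assms(1,2)])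
  fix P' d K assume *: "v <= d" "\<And>x m. P' x m ==> P x m" "\<And>x m. P' x m ==> 0 <= K x m \<and> K x m < M x m"
    "local_pred P' d" "pure P' d K"
  have b: "bounded P' (\<lambda>x m. int (nat (K x m)) + 1)" by (rule bounded_le[OF assms(2)]) (use * in force)
  have K: "pure P' d (\<lambda>x m. int (nat (K x m)))" by (rule pure_cong[OF *(5)]) (use * in force)
  have "pure P' d (\<lambda>x m. U x m * (int (nat (K x m)) + 1))"
    by (intro pure_mult pure_add pure_const pure_weaken[OF assms(3)] * K b) simp_all
  then show "pureb P' d (\<lambda>x m. (int (nat (K x m)) + 1) * U x m <= E x m)"
    unfolding mult.commute[of "_ + 1"] by (intro pureb_le pure_weaken[OF assms(4)] *)
qed

end

section \<open>Parameters of the algorithm\<close>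

definition lamN :: "nat => nat" where "lamN n = clog (int n)"
definition rhoN :: "nat => nat" where "rhoN n = clog (int (lamN n))"
text \<open>The logarithm of \<open>n\<close>, rounded up to a power of two so that the number of
  columns, a multiple of its square, is a power of two as well.\<close>

definition LamN :: "nat => nat" where "LamN n = 2 ^ rhoN n"
text \<open>Write \<open>L\<close> for \<open>LamN n\<close>. The constants are tuned to a sampling
  error \<open>1 / (2 ^ 30 * L ^ 3)\<close>, a slack \<open>E2 / J = 1 / (2 ^ 17 * L ^ 2)\<close>, a
  relative column width \<open>1 / (2 ^ 18 * L ^ 2)\<close> and a threshold
  \<open>E1 / J = 1 / (2 ^ 12 * L)\<close>: each error is negligible compared with the next. The
  product of \<open>J\<close> and the squared sampling error is \<open>2 ^ 10 * L ^ 2\<close>, so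
  that Hoeffding's bound is \<open>n\<close> to a negative power of order
  \<open>log n\<close>.\<close>

definition JN :: "nat => nat" where "JN n = 2 ^ 70 * LamN n ^ 8"
definition kapN :: "nat => nat" where "kapN n = 18 + 2 * rhoN n"
definition QN :: "nat => nat" where "QN n = 2 ^ 12 * LamN n"
text \<open>The fourth power of 4/5 is less than 1/2, so \<open>4 * lamN n\<close> balanced splits
  reduce \<open>n\<close> points to at most 1; one more split makes the bound strict.\<close>

definition dN :: "nat => nat" where "dN n = 4 * lamN n + 1"
definition E1N :: "nat => nat" where "E1N n = 2 ^ 58 * LamN n ^ 7"
definition E2N :: "nat => nat" where "E2N n = 2 ^ 53 * LamN n ^ 6"
definition KN :: "nat => nat" where "KN n = 2 ^ kapN n"
definition RN :: "nat => nat" where "RN n = JN n + 2"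
text \<open>A node has one child for each sample of its average, each column and each pair of rows,
  that is, for every grid cell of the leaf reached by each sample.\<close>

definition childN :: "nat => nat" where "childN n = JN n * KN n * RN n * RN n"

text \<open>The number of levels: \<open>320 / (t + 320) <= \<tau>\<close> holds for \<open>t \<ge> 320 / \<tau>\<close>.\<close>

definition levels :: "ctx => nat" where "levels x = nat \<lfloor>320 / par x\<rfloor> + 1"

text \<open>The geometric sum \<open>1 + c + ... + c ^ (t - 1)\<close>: the number of nodes above
  layer \<open>t\<close> of a complete tree, and hence also the number of the first node in layer
  \<open>t\<close>.\<close>

primrec node_count :: "nat => nat => nat" where
  "node_count c 0 = 0"
| "node_count c (Suc t) = node_count c t * c + 1"

definition innerN :: "ctx => nat" where "innerN x = node_count (childN (len x)) (levels x)"

text \<open>The size in which running times are measured. Fixed powers of it bound both the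
  polylogarithmic quantities and the size of the recursion tree, while they are themselves
  \<open>log n\<close> to a power of order \<open>1 / \<tau>\<close>.\<close>

definition timeN :: "ctx => nat" where "timeN x = (2 * LamN (len x)) ^ (levels x + 1)"

interpretation cost timeN
proof
  fix x
  have "2 ^ 1 <= (2 * LamN (len x)) ^ (levels x + 1)"
    by (rule order_trans[OF power_increasing[of 1 "levels x + 1" 2] power_mono]) (auto simp: LamN_def)
  then show "2 <= timeN x" by (simp add: timeN_def)
qed

lemma polylog_bounded: "k <= (2 * LamN (len x)) ^ q ==> k <= timeN x ^ q"
proof -
  have "1 <= LamN (len x)" by (simp add: LamN_def)
  then have "(2 * LamN (len x)) ^ q <= timeN x ^ q"
    unfolding timeN_def by (intro power_mono self_le_power) auto
  then show "k <= (2 * LamN (len x)) ^ q ==> k <= timeN x ^ q" by simp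
qed

lemma monomial_le: "2 ^ a * LamN n ^ b <= (2 * LamN n) ^ (a + b)"
proof -
  have "2 ^ a * LamN n ^ b <= (2 * LamN n) ^ a * (2 * LamN n) ^ b"
    by (intro mult_le_mono power_mono) (auto simp: LamN_def)
  then show ?thesis by (simp add: power_add)
qed

lemma lamN_le: "lamN n <= LamN n"
  using le_two_power_clog[of "int (lamN n)"] unfolding LamN_def rhoN_def
  by (metis of_nat_le_iff of_nat_numeral of_nat_power)

lemma KN_eq: "KN n = 2 ^ 18 * LamN n ^ 2"
  by (simp only: KN_def kapN_def LamN_def power_add power_mult[symmetric] mult.commute[of 2 "rhoN n"])

lemma LamN_ge_1: "1 <= LamN n" by (simp add: LamN_def)

lemma params_le:
  "lamN n <= (2 * LamN n) ^ 1" "LamN n <= (2 * LamN n) ^ 1" "JN n <= (2 * LamN n) ^ 78" "QN n <= (2 * LamN n) ^ 13"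
  "KN n <= (2 * LamN n) ^ 20" "RN n <= (2 * LamN n) ^ 80" "childN n <= (2 * LamN n) ^ 258" "childN n + 1 <= (2 * LamN n) ^ 259"
  "rhoN n <= (2 * LamN n) ^ 1" "dN n <= (2 * LamN n) ^ 4"
proof -
  let ?Z = "2 * LamN n"
  have Z: "1 <= ?Z" "2 <= ?Z" using LamN_ge_1[of n] by auto
  show "lamN n <= ?Z ^ 1" "LamN n <= ?Z ^ 1" using lamN_le[of n] by auto
  show J: "JN n <= ?Z ^ 78" using monomial_le[of 70 n 8] by (simp add: JN_def)
  show "QN n <= ?Z ^ 13" using monomial_le[of 12 n 1] by (simp add: QN_def)
  show K: "KN n <= ?Z ^ 20" using monomial_le[of 18 n 2] by (simp add: KN_eq)
  have "2 ^ 1 * ?Z ^ 78 <= ?Z ^ 1 * ?Z ^ 78" using Z by (intro mult_right_mono) auto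
  then have "2 * ?Z ^ 78 <= ?Z ^ 79" by (simp flip: power_Suc)
  moreover have "?Z ^ 79 * 2 <= ?Z ^ 79 * ?Z" using Z by (intro mult_left_mono) auto
  then have "2 * ?Z ^ 79 <= ?Z ^ 80" by (simp add: mult.commute[of _ 2] flip: power_Suc2)
  moreover have "1 <= ?Z ^ 78" "1 <= ?Z ^ 79" using Z by (auto intro: one_le_power)
  ultimately show R: "RN n <= ?Z ^ 80" using J unfolding RN_def by linarith
  have "childN n <= ?Z ^ 78 * ?Z ^ 20 * ?Z ^ 80 * ?Z ^ 80"
    unfolding childN_def by (intro mult_le_mono J K R)
  then show N: "childN n <= ?Z ^ 258" by (simp flip: power_add)
  have "?Z ^ 258 * 2 <= ?Z ^ 258 * ?Z" using Z by (intro mult_left_mono) auto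
  then have "2 * ?Z ^ 258 <= ?Z ^ 259" by (simp add: mult.commute[of _ 2] flip: power_Suc2)
  moreover have "1 <= ?Z ^ 258" using Z by (auto intro: one_le_power)
  ultimately show "childN n + 1 <= ?Z ^ 259" using N by linarith
  have "rhoN n < 2 ^ rhoN n" by (rule less_exp)
  then show "rhoN n <= ?Z ^ 1" unfolding LamN_def power_one_right by linarith
  have "2 ^ 3 * ?Z <= ?Z ^ 3 * ?Z" using Z by (intro mult_right_mono power_mono) auto
  then have "8 * ?Z <= ?Z ^ 4" by (simp add: power_Suc2[symmetric])
  then show "dN n <= ?Z ^ 4" using lamN_le[of n] LamN_ge_1[of n] unfolding dN_def by linarith
qed

lemma node_count_le: "node_count c t <= (c + 1) ^ t"
proof (induction t)
  case (Suc t)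
  have "node_count c (Suc t) <= (c + 1) ^ t * c + (c + 1) ^ t" using mult_le_mono1[OF Suc, of c] one_le_power[of "c + 1" t] unfolding node_count.simps by linarith
  then show ?case by (simp add: mult.commute)
qed simp

lemma JN_pos [simp]: "0 < JN n" by (simp add: JN_def LamN_def)
lemma KN_pos [simp]: "0 < KN n" by (simp add: KN_def)
lemma RN_pos [simp]: "0 < RN n" by (simp add: RN_def)
lemma QN_pos [simp]: "0 < QN n" by (simp add: QN_def LamN_def)
lemma childN_pos [simp]: "0 < childN n" by (simp add: childN_def)

text \<open>\<open>childN * innerN + 1\<close> counts the nodes of all layers, one layer more than
  \<open>innerN\<close>; this explains the exponent \<open>levels x + 1\<close> in
  \<open>timeN\<close>.\<close>

lemma innerN_le: "innerN x <= timeN x ^ 259" "childN (len x) * innerN x + 1 <= timeN x ^ 259"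
proof -
  let ?Z = "2 * LamN (len x)" and ?c = "childN (len x)"
  have "?c * node_count ?c t + 1 = node_count ?c (Suc t)" for t by simp
  then have "?c * innerN x + 1 <= (?c + 1) ^ (levels x + 1)" using node_count_le[of ?c "levels x + 1"] by (simp add: innerN_def mult.commute)
  also have "\<dots> <= (?Z ^ 259) ^ (levels x + 1)" by (intro power_mono params_le) simp
  also have "\<dots> = timeN x ^ 259" unfolding timeN_def by (simp only: power_mult[symmetric] mult.commute)
  finally show "?c * innerN x + 1 <= timeN x ^ 259" .
  moreover have "1 <= ?c" using childN_pos[of "len x"] by linarith
  then have "1 * innerN x <= ?c * innerN x" by (intro mult_right_mono) auto
  ultimately show "innerN x <= timeN x ^ 259" by linarith
qed

definition par_ok :: "ctx => mem => bool" where
  "par_ok x m \<longleftrightarrow> ar m 1 1 = int (len x) \<and> ar m 1 2 = int (lamN (len x)) \<and> ar m 1 4 = int (JN (len x)) \<and>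
     ar m 1 5 = int (kapN (len x)) \<and> ar m 1 6 = int (KN (len x)) \<and> ar m 1 7 = int (QN (len x)) \<and>
     ar m 1 8 = int (dN (len x)) \<and> ar m 1 9 = int (E1N (len x)) \<and> ar m 1 10 = int (E2N (len x)) \<and>
     ar m 1 11 = int (RN (len x)) \<and> ar m 1 12 = int (levels x) \<and> ar m 1 13 = int (childN (len x)) \<and>
     ar m 1 14 = int (innerN x)"

text \<open>Entering the body of a loop or of a bounded quantifier: the context gets stronger and
  more temporaries are in use.\<close>

definition lift :: "(ctx => mem => bool) => nat => (ctx => mem => bool) => nat => bool" where
  "lift P v P' d \<longleftrightarrow> v <= d \<and> local_pred P' d \<and> (\<forall>x m. P' x m --> P x m)"

definition natp :: "(ctx => mem => bool) => nat => (ctx => mem => nat) => bool" where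
  "natp P v i \<longleftrightarrow> pure P v (\<lambda>x m. int (i x m))"

definition small :: "(ctx => mem => bool) => (ctx => mem => nat) => bool" where
  "small P i \<longleftrightarrow> (\<exists>q. \<forall>x m. P x m --> i x m <= timeN x ^ q)"

definition okP :: "(ctx => mem => bool) => nat => bool" where
  "okP P v \<longleftrightarrow> local_pred P v \<and> (\<forall>x m. P x m --> par_ok x m)"

lemma lift_pure: "lift P v P' d ==> pure P v F ==> pure P' d F"
  unfolding lift_def by (blast intro: pure_weaken)
lemma lift_natp: "lift P v P' d ==> natp P v F ==> natp P' d F"
  unfolding natp_def by (rule lift_pure)
lemma lift_small: "lift P v P' d ==> small P F ==> small P' F"
  unfolding lift_def small_def by meson
lemma lift_okP: "lift P v P' d ==> okP P v ==> okP P' d"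
  unfolding lift_def okP_def by blast
lemma small_less: "small P N ==> lift P v P' d ==> (\<And>x m. P' x m ==> i x m < N x m) ==> small P' i"
  unfolding lift_def small_def by (meson less_imp_le order_trans)
lemma small_le: "small P N ==> (\<And>x m. P x m ==> i x m <= N x m) ==> small P i"
  unfolding small_def by (meson order_trans)
lemma small_bounded: "small P N ==> bounded P (\<lambda>x m. int (N x m))"
  unfolding small_def bounded_def by (meson of_nat_le_iff)
lemma small_const: "small P (\<lambda>x m. k)" unfolding small_def using const_le by blast
lemma small_add: "small P i ==> small P j ==> small P (\<lambda>x m. i x m + j x m)"
  unfolding small_def using add_le by meson
lemma small_mult: "small P i ==> small P j ==> small P (\<lambda>x m. i x m * j x m)"
  unfolding small_def using mult_le by meson
lemma small_polylog: "(\<And>x. k x <= (2 * LamN (len x)) ^ q) ==> small P (\<lambda>x m. k x)"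
  unfolding small_def using polylog_bounded by blast

lemmas small_params = params_le[THEN small_polylog]
lemma small_innerN: "small P (\<lambda>x m. innerN x)" unfolding small_def using innerN_le(1) by blast
lemma small_nodes: "small P (\<lambda>x m. childN (len x) * innerN x + 1)" unfolding small_def using innerN_le(2) by blast

lemma natp_const: "local_pred P v ==> natp P v (\<lambda>x m. k)" unfolding natp_def by (rule pure_const)
lemma natp_add: "natp P v i ==> natp P v j ==> natp P v (\<lambda>x m. i x m + j x m)"
  unfolding natp_def of_nat_add by (rule pure_add)
lemma natp_mult: "natp P v i ==> natp P v j ==> small P j ==> natp P v (\<lambda>x m. i x m * j x m)"
  unfolding natp_def of_nat_mult by (rule pure_mult) (auto intro: small_bounded)
lemma natp_Suc: "natp P v i ==> natp P v (\<lambda>x m. Suc (i x m))"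
  unfolding natp_def of_nat_Suc by (intro pure_add pure_const) (auto simp: pure_local)
lemma natp_local: "natp P v i ==> local_pred P v" unfolding natp_def by (rule pure_local)
lemma natp_cong: "natp P v i ==> (\<And>x m. P x m ==> i x m = j x m) ==> natp P v j"
  unfolding natp_def by (erule pure_cong) simp
lemma natp_nat: "pure P v F ==> natp P v (\<lambda>x m. nat (F x m))"
  unfolding natp_def
  by (rule pure_cong[OF pure_max[OF _ pure_const[of P v 0]]]) (auto simp: pure_local max_def)
lemma natp_diff: "natp P v i ==> natp P v j ==> natp P v (\<lambda>x m. i x m - j x m)"
  by (rule natp_cong[OF natp_nat[OF pure_diff[of P v "\<lambda>x m. int (i x m)" "\<lambda>x m. int (j x m)"]]])
    (auto simp: natp_def)

lemma pureb_nat_less: "natp P v i ==> natp P v j ==> pureb P v (\<lambda>x m. i x m < j x m)"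
  by (rule pureb_cong[OF pureb_less[of P v "\<lambda>x m. int (i x m)" "\<lambda>x m. int (j x m)"]]) (auto simp: natp_def)
lemma pureb_nat_le: "natp P v i ==> natp P v j ==> pureb P v (\<lambda>x m. i x m <= j x m)"
  by (rule pureb_cong[OF pureb_le[of P v "\<lambda>x m. int (i x m)" "\<lambda>x m. int (j x m)"]]) (auto simp: natp_def)
lemma pureb_nat_eq: "natp P v i ==> natp P v j ==> pureb P v (\<lambda>x m. i x m = j x m)"
  by (rule pureb_cong[OF pureb_eq[of P v "\<lambda>x m. int (i x m)" "\<lambda>x m. int (j x m)"]]) (auto simp: natp_def)

lemma bodyI:
  assumes "v <= d" "\<And>x m. P' x m ==> P x m" "\<And>x m. P' x m ==> 0 <= K x m \<and> K x m < int (N x m)" "local_pred P' d" "pure P' d K"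
  shows "lift P v P' d" "natp P' d (\<lambda>x m. nat (K x m))" "\<And>x m. P' x m ==> nat (K x m) < N x m"
  using assms natp_nat[OF assms(5)] by (auto simp: lift_def nat_less_iff)

lemma natp_card:
  assumes "natp P v N" "small P N"
    "\<And>P' d k. lift P v P' d ==> natp P' d k ==> (\<And>x m. P' x m ==> k x m < N x m) ==> pureb P' d (\<lambda>x m. B x m (k x m))"
  shows "natp P v (\<lambda>x m. card {k. k < N x m \<and> B x m k})"
  unfolding natp_def
proof (rule pure_card[OF assms(1)[unfolded natp_def] small_bounded[OF assms(2)], unfolded nat_int])
  fix P' d K
  assume *: "v <= d" "\<And>x m. P' x m ==> P x m" "\<And>x m. P' x m ==> 0 <= K x m \<and> K x m < int (N x m)" "local_pred P' d" "pure P' d K"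
  show "pureb P' d (\<lambda>x m. B x m (nat (K x m)))" by (rule assms(3)[OF bodyI[OF *]])
qed

lemma natp_last_index:
  assumes "natp P v N" "small P N"
    "\<And>P' d k. lift P v P' d ==> natp P' d k ==> (\<And>x m. P' x m ==> k x m < N x m) ==> pureb P' d (\<lambda>x m. B x m (k x m))"
  shows "natp P v (\<lambda>x m. last_index (N x m) (B x m))"
  unfolding natp_def
proof (rule pure_last_index[OF assms(1)[unfolded natp_def] small_bounded[OF assms(2)], unfolded nat_int])
  fix P' d K
  assume *: "v <= d" "\<And>x m. P' x m ==> P x m" "\<And>x m. P' x m ==> 0 <= K x m \<and> K x m < int (N x m)" "local_pred P' d" "pure P' d K"
  show "pureb P' d (\<lambda>x m. B x m (nat (K x m)))" by (rule assms(3)[OF bodyI[OF *]])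
qed

lemma pureb_exn:
  assumes "natp P v N" "small P N"
    "\<And>P' d k. lift P v P' d ==> natp P' d k ==> (\<And>x m. P' x m ==> k x m < N x m) ==> pureb P' d (\<lambda>x m. B x m (k x m))"
  shows "pureb P v (\<lambda>x m. \<exists>k<N x m. B x m k)"
proof (rule pureb_ex[OF assms(1)[unfolded natp_def] small_bounded[OF assms(2)], unfolded nat_int])
  fix P' d K
  assume *: "v <= d" "\<And>x m. P' x m ==> P x m" "\<And>x m. P' x m ==> 0 <= K x m \<and> K x m < int (N x m)" "local_pred P' d" "pure P' d K"
  show "pureb P' d (\<lambda>x m. B x m (nat (K x m)))" by (rule assms(3)[OF bodyI[OF *]])
qed

lemma pureb_alln:
  assumes "natp P v N" "small P N"
    "\<And>P' d k. lift P v P' d ==> natp P' d k ==> (\<And>x m. P' x m ==> k x m < N x m) ==> pureb P' d (\<lambda>x m. B x m (k x m))"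
  shows "pureb P v (\<lambda>x m. \<forall>k<N x m. B x m k)"
proof (rule pureb_all[OF assms(1)[unfolded natp_def] small_bounded[OF assms(2)], unfolded nat_int])
  fix P' d K
  assume *: "v <= d" "\<And>x m. P' x m ==> P x m" "\<And>x m. P' x m ==> 0 <= K x m \<and> K x m < int (N x m)" "local_pred P' d" "pure P' d K"
  show "pureb P' d (\<lambda>x m. B x m (nat (K x m)))" by (rule assms(3)[OF bodyI[OF *]])
qed

lemma pure_sumn:
  assumes "natp P v N" "small P N"
    "\<And>P' d k. lift P v P' d ==> natp P' d k ==> (\<And>x m. P' x m ==> k x m < N x m) ==> pure P' d (\<lambda>x m. f x m (k x m))"
  shows "pure P v (\<lambda>x m. \<Sum>k<N x m. f x m k)"
proof (rule pure_sum[OF assms(1)[unfolded natp_def] small_bounded[OF assms(2)], unfolded nat_int])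
  fix P' d K
  assume *: "v <= d" "\<And>x m. P' x m ==> P x m" "\<And>x m. P' x m ==> 0 <= K x m \<and> K x m < int (N x m)" "local_pred P' d" "pure P' d K"
  show "pure P' d (\<lambda>x m. f x m (nat (K x m)))" by (rule assms(3)[OF bodyI[OF *]])
qed

lemma pure_bmaxn:
  assumes "natp P v N" "small P N"
    "\<And>P' d k. lift P v P' d ==> natp P' d k ==> (\<And>x m. P' x m ==> k x m < N x m) ==> pure P' d (\<lambda>x m. f x m (k x m))"
  shows "pure P v (\<lambda>x m. bmax (N x m) (f x m))"
proof (rule pure_bmax[OF assms(1)[unfolded natp_def] small_bounded[OF assms(2)], unfolded nat_int])
  fix P' d K
  assume *: "v <= d" "\<And>x m. P' x m ==> P x m" "\<And>x m. P' x m ==> 0 <= K x m \<and> K x m < int (N x m)" "local_pred P' d" "pure P' d K"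
  show "pure P' d (\<lambda>x m. f x m (nat (K x m)))" by (rule assms(3)[OF bodyI[OF *]])
qed

lemma natp_param:
  "local_pred P v ==> (\<And>x m. P x m ==> ar m 1 k = int (F x)) ==> natp P v (\<lambda>x m. F x)"
  unfolding natp_def by (rule pure_cong[OF pure_ar[OF pure_const[of P v k]]]) auto

lemma okP_natp:
  assumes "okP P v"
  shows "natp P v (\<lambda>x m. len x)" "natp P v (\<lambda>x m. lamN (len x))" "natp P v (\<lambda>x m. JN (len x))"
    "natp P v (\<lambda>x m. kapN (len x))" "natp P v (\<lambda>x m. KN (len x))" "natp P v (\<lambda>x m. QN (len x))"
    "natp P v (\<lambda>x m. dN (len x))" "natp P v (\<lambda>x m. E1N (len x))" "natp P v (\<lambda>x m. E2N (len x))"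
    "natp P v (\<lambda>x m. RN (len x))" "natp P v (\<lambda>x m. levels x)" "natp P v (\<lambda>x m. childN (len x))"
    "natp P v (\<lambda>x m. innerN x)"
proof -
  have l: "local_pred P v" using assms by (simp add: okP_def)
  have p: "P x m ==> par_ok x m" for x m using assms by (simp add: okP_def)
  note p' = p[unfolded par_ok_def]
  show "natp P v (\<lambda>x m. len x)" by (rule natp_param[OF l, of 1]) (use p' in blast)
  show "natp P v (\<lambda>x m. lamN (len x))" by (rule natp_param[OF l, of 2]) (use p' in blast)
  show "natp P v (\<lambda>x m. JN (len x))" by (rule natp_param[OF l, of 4]) (use p' in blast)
  show "natp P v (\<lambda>x m. kapN (len x))" by (rule natp_param[OF l, of 5]) (use p' in blast)
  show "natp P v (\<lambda>x m. KN (len x))" by (rule natp_param[OF l, of 6]) (use p' in blast)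
  show "natp P v (\<lambda>x m. QN (len x))" by (rule natp_param[OF l, of 7]) (use p' in blast)
  show "natp P v (\<lambda>x m. dN (len x))" by (rule natp_param[OF l, of 8]) (use p' in blast)
  show "natp P v (\<lambda>x m. E1N (len x))" by (rule natp_param[OF l, of 9]) (use p' in blast)
  show "natp P v (\<lambda>x m. E2N (len x))" by (rule natp_param[OF l, of 10]) (use p' in blast)
  show "natp P v (\<lambda>x m. RN (len x))" by (rule natp_param[OF l, of 11]) (use p' in blast)
  show "natp P v (\<lambda>x m. levels x)" by (rule natp_param[OF l, of 12]) (use p' in blast)
  show "natp P v (\<lambda>x m. childN (len x))" by (rule natp_param[OF l, of 13]) (use p' in blast)
  show "natp P v (\<lambda>x m. innerN x)" by (rule natp_param[OF l, of 14]) (use p' in blast)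
qed

lemma okP_local: "okP P v ==> local_pred P v" by (simp add: okP_def)

section \<open>Compiling the grid operations\<close>

abbreviation Fq :: "ctx => int => int" where "Fq x \<equiv> query (len x) (arr x)"

text \<open>Block \<open>l = 0\<close> serves the grids of all levels, and block
  \<open>l = Suc t\<close> the averages of level \<open>Suc t\<close>. Within a block there are
  \<open>JN\<close> seeds for every scale \<open>k\<close>.\<close>

definition seeds :: "ctx => mem => nat => nat => nat => int" where
  "seeds x m l k j = (if k <= lamN (len x) \<and> j < JN (len x)
     then ar m 3 (int ((l * (lamN (len x) + 1) + k) * JN (len x) + j)) else 0)"

abbreviation gcol where "gcol x T i \<equiv> grid.col (kapN (len x)) T i"
abbreviation gsmp where "gsmp x m T j \<equiv> grid.smp (seeds x m 0) T j"
abbreviation growv where "growv x m T q \<equiv> grid.rowv (Fq x) (seeds x m 0) (JN (len x)) T q"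
abbreviation gmc where "gmc x m bl bh T i i' \<equiv> grid.mc (Fq x) (seeds x m 0) (JN (len x)) (kapN (len x)) bl bh T i i'"
abbreviation gvc where "gvc x m bl bh T i y i' i'' \<equiv> grid.vc (Fq x) (seeds x m 0) (JN (len x)) (kapN (len x)) bl bh T i y i' i''"
abbreviation gsafe where "gsafe x m g bl bh T i y \<equiv>
  grid.safe (Fq x) (seeds x m 0) (JN (len x)) (kapN (len x)) (int (E1N (len x))) (int (E2N (len x))) g bl bh T i y"
abbreviation gisel where "gisel x m g bl bh T \<equiv>
  grid.isel (Fq x) (seeds x m 0) (JN (len x)) (kapN (len x)) (int (E1N (len x))) (int (E2N (len x))) g bl bh T"
abbreviation gqsel where "gqsel x m g bl bh T \<equiv>
  grid.qsel (Fq x) (seeds x m 0) (JN (len x)) (kapN (len x)) (int (E1N (len x))) (int (E2N (len x))) g bl bh T"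

text \<open>The bound on the width is part of the notion because it makes \<open>clog\<close> of the
  width computable by a loop of \<open>lamN\<close> rounds.\<close>

definition boxp :: "(ctx => mem => bool) => nat => (ctx => mem => box) => bool" where
  "boxp P v T \<longleftrightarrow> pure P v (\<lambda>x m. fst (T x m)) \<and> pure P v (\<lambda>x m. fst (snd (T x m))) \<and>
     pure P v (\<lambda>x m. fst (snd (snd (T x m)))) \<and> pure P v (\<lambda>x m. snd (snd (snd (T x m)))) \<and>
     (\<forall>x m. P x m --> width (T x m) <= int (len x))"

lemma lift_boxp: "lift P v P' d ==> boxp P v T ==> boxp P' d T"
  unfolding boxp_def using lift_pure unfolding lift_def by blast

lemma width_eq: "width T = fst (snd T) - fst T" by (cases T) (simp add: width_def)

lemma col_eq: "grid.col \<kappa> T i = min (fst (snd T)) (fst T + int i * cw \<kappa> (width T))"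
  by (cases T) (simp add: grid.col_def width_def)

lemma smp_eq: "grid.smp s T j = fst T + 1 + s (clog (width T)) j"
  by (cases T) (simp add: grid.smp_def width_def)

lemma in_pts: "z \<in> pts F T \<longleftrightarrow> (fst T < z \<and> z <= fst (snd T)) \<and> fst (snd (snd T)) <= F z \<and> F z <= snd (snd (snd T))"
  by (cases T) (simp add: pts_def)

lemma rowv_eq: "grid.rowv F s J T q = (if q < J then (if grid.smp s T q \<in> pts F T then F (grid.smp s T q) else fst (snd (snd T)))
    else if q = J then fst (snd (snd T)) else snd (snd (snd T)))"
  by (cases T) (simp add: grid.rowv_def)

lemma boxp_pure: "boxp P v T ==> pure P v (\<lambda>x m. fst (T x m))" "boxp P v T ==> pure P v (\<lambda>x m. fst (snd (T x m)))"
  "boxp P v T ==> pure P v (\<lambda>x m. fst (snd (snd (T x m))))" "boxp P v T ==> pure P v (\<lambda>x m. snd (snd (snd (T x m))))"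
  by (auto simp: boxp_def)

lemma pure_width: "boxp P v T ==> pure P v (\<lambda>x m. width (T x m))"
  unfolding width_eq by (intro pure_diff boxp_pure)

lemma len_le: "int n <= 2 ^ lamN n" unfolding lamN_def by (rule le_two_power_clog)

lemma natp_clog_width:
  assumes ok: "okP P v" and T: "boxp P v T"
  shows "natp P v (\<lambda>x m. clog (width (T x m)))"
  unfolding natp_def
proof (rule pure_clog[OF pure_width[OF T] okP_natp(2)[OF ok, unfolded natp_def] small_bounded[OF small_params(1)]])
  fix x m assume "P x m"
  then have "width (T x m) <= int (len x)" using T by (simp add: boxp_def)
  then show "width (T x m) <= 2 ^ nat (int (lamN (len x)))" unfolding nat_int by (rule order_trans[OF _ len_le])
qed

lemma small_clog_width:
  assumes T: "boxp P v T"
  shows "small P (\<lambda>x m. clog (width (T x m)))"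
proof (rule small_le[OF small_params(1)])
  fix x m assume "P x m"
  then have "width (T x m) <= int (len x)" using T by (simp add: boxp_def)
  then show "clog (width (T x m)) <= lamN (len x)" by (intro clog_le order_trans[OF _ len_le])
qed

lemma pure_cw:
  assumes ok: "okP P v" and T: "boxp P v T"
  shows "pure P v (\<lambda>x m. cw (kapN (len x)) (width (T x m)))"
proof -
  have "natp P v (\<lambda>x m. clog (width (T x m)) - kapN (len x))"
    by (intro natp_diff natp_clog_width[OF ok T] okP_natp[OF ok])
  moreover have "small P (\<lambda>x m. clog (width (T x m)) - kapN (len x))"
    by (rule small_le[OF small_clog_width[OF T]]) simp
  ultimately have "pure P v (\<lambda>x m. 2 ^ nat (int (clog (width (T x m)) - kapN (len x))))"
    by (intro pure_pow2 small_bounded) (auto simp: natp_def)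
  then show ?thesis by (simp add: cw_def)
qed

lemma pure_natp: "natp P v i ==> pure P v (\<lambda>x m. int (i x m))" by (simp add: natp_def)

lemma pure_times_nat: "pure P v F ==> natp P v i ==> small P i ==> pure P v (\<lambda>x m. int (i x m) * F x m)"
  unfolding mult.commute[of "int _"] by (rule pure_mult) (auto simp: natp_def intro: small_bounded)

lemma pure_col:
  assumes ok: "okP P v" and T: "boxp P v T" and i: "natp P v i" "small P i"
  shows "pure P v (\<lambda>x m. gcol x (T x m) (i x m))"
  unfolding col_eq by (intro pure_min pure_add boxp_pure[OF T] pure_times_nat pure_cw ok T i)

lemma pure_seeds:
  assumes ok: "okP P v" and "natp P v l" "natp P v k" "natp P v j"
  shows "pure P v (\<lambda>x m. seeds x m (l x m) (k x m) (j x m))"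
  unfolding seeds_def
  by (intro pure_ite pureb_conj pureb_nat_le pureb_nat_less pure_ar pure_natp natp_add natp_mult assms okP_natp[OF ok]
      natp_const pure_const okP_local[OF ok] small_add small_params small_const) auto

lemma pure_smp:
  assumes ok: "okP P v" and T: "boxp P v T" and j: "natp P v j"
  shows "pure P v (\<lambda>x m. gsmp x m (T x m) (j x m))"
  unfolding smp_eq
  by (intro pure_add boxp_pure[OF T] pure_const okP_local[OF ok] pure_seeds[OF ok] natp_const natp_clog_width ok T j)

lemma pureb_in_pts:
  assumes "pure P v z" "pure P v a" "pure P v b" "pure P v lo" "pure P v hi"
  shows "pureb P v (\<lambda>x m. z x m \<in> pts (Fq x) (a x m, b x m, lo x m, hi x m))"
  unfolding in_pts fst_conv snd_conv by (intro pureb_conj pureb_less pureb_le pure_query assms)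

lemma pureb_in_box:
  assumes "pure P v z" "boxp P v T"
  shows "pureb P v (\<lambda>x m. z x m \<in> pts (Fq x) (T x m))"
  unfolding in_pts by (intro pureb_conj pureb_less pureb_le pure_query boxp_pure[OF assms(2)] assms(1))

lemma pure_rowv:
  assumes ok: "okP P v" and T: "boxp P v T" and q: "natp P v q"
  shows "pure P v (\<lambda>x m. growv x m (T x m) (q x m))"
  unfolding rowv_eq
  by (intro pure_ite pureb_nat_less pureb_nat_eq pureb_in_box pure_query pure_smp boxp_pure[OF T] okP_natp[OF ok] ok T q)

lemma natp_mc:
  assumes ok: "okP P v" and T: "boxp P v T" and b: "pure P v bl" "pure P v bh"
    and i: "natp P v i" "small P i" "natp P v i'" "small P i'"
  shows "natp P v (\<lambda>x m. gmc x m (bl x m) (bh x m) (T x m) (i x m) (i' x m))"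
  unfolding grid.mc_def
proof (rule natp_card[OF okP_natp(3)[OF ok] small_params(3)])
  fix P' d k assume l: "lift P v P' d" and k: "natp P' d k"
  note ok' = lift_okP[OF l ok] and T' = lift_boxp[OF l T]
  show "pureb P' d (\<lambda>x m. gsmp x m (T x m) (k x m) \<in>
    pts (Fq x) (gcol x (T x m) (i x m), gcol x (T x m) (i' x m), bl x m, bh x m))"
    by (intro pureb_in_pts pure_smp pure_col ok' T' k lift_natp[OF l] lift_small[OF l] lift_pure[OF l] b i)
qed

lemma pureb_violates:
  assumes "pure P v c" "pure P v y" "pure P v z"
  shows "pureb P v (\<lambda>x m. grid.violates (Fq x) (c x m) (y x m) (z x m))"
  unfolding grid.violates_def by (intro pureb_if pureb_le pureb_less pure_query assms)

lemma natp_vc: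
  assumes ok: "okP P v" and T: "boxp P v T" and b: "pure P v bl" "pure P v bh" "pure P v y"
    and i: "natp P v i" "small P i" "natp P v i'" "small P i'" "natp P v i''" "small P i''"
  shows "natp P v (\<lambda>x m. gvc x m (bl x m) (bh x m) (T x m) (i x m) (y x m) (i' x m) (i'' x m))"
  unfolding grid.vc_def
proof (rule natp_card[OF okP_natp(3)[OF ok] small_params(3)])
  fix P' d k assume l: "lift P v P' d" and k: "natp P' d k"
  note ok' = lift_okP[OF l ok] and T' = lift_boxp[OF l T]
  show "pureb P' d (\<lambda>x m. gsmp x m (T x m) (k x m) \<in>
      pts (Fq x) (gcol x (T x m) (i' x m), gcol x (T x m) (i'' x m), bl x m, bh x m) \<and>
      grid.violates (Fq x) (gcol x (T x m) (i x m)) (y x m) (gsmp x m (T x m) (k x m)))"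
    by (intro pureb_conj pureb_violates pureb_in_pts pure_smp pure_col ok' T' k lift_natp[OF l] lift_small[OF l] lift_pure[OF l] b i)
qed

lemma card_J_le: "card {j. j < J \<and> Q j} <= (J :: nat)"
  using card_mono[of "{..<J}" "{j. j < J \<and> Q j}"] by auto

lemma small_mc: "small P (\<lambda>x m. gmc x m (bl x m) (bh x m) (T x m) (i x m) (i' x m))"
  by (rule small_le[OF small_params(3)]) (simp add: grid.mc_def card_J_le)

lemma small_vc: "small P (\<lambda>x m. gvc x m (bl x m) (bh x m) (T x m) (i x m) (y x m) (i' x m) (i'' x m))"
  by (rule small_le[OF small_params(3)]) (simp add: grid.vc_def card_J_le)

lemma pure_mult_nat: "pure P v F ==> natp P v i ==> small P i ==> pure P v (\<lambda>x m. F x m * int (i x m))"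
  by (rule pure_mult) (auto simp: natp_def intro: small_bounded)

lemma pureb_safe:
  assumes ok: "okP P v" and T: "boxp P v T" and b: "pure P v g" "pure P v bl" "pure P v bh" "pure P v y"
    and i: "natp P v i" "small P i"
  shows "pureb P v (\<lambda>x m. gsafe x m (g x m) (bl x m) (bh x m) (T x m) (i x m) (y x m))"
proof -
  have SK: "natp P v (\<lambda>x m. Suc (KN (len x)))" "small P (\<lambda>x m. Suc (KN (len x)))"
    using natp_Suc[OF okP_natp(5)[OF ok]] small_add[OF small_const[of P 1] small_params(5)] by auto
  have "pureb P v (\<lambda>x m. \<forall>i'<Suc (KN (len x)). \<forall>i''<Suc (KN (len x)). \<not> (i' < i x m \<and> i x m < i'' \<and>
      \<not> g x m * int (gvc x m (bl x m) (bh x m) (T x m) (i x m) (y x m) i' i'')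
        <= 16 * int (gmc x m (bl x m) (bh x m) (T x m) i' i'') + int (E2N (len x))))"
  proof (rule pureb_alln[OF SK], goal_cases)
    case (1 P' d k)
    show ?case
    proof (rule pureb_alln[OF lift_natp[OF 1(1) SK(1)] lift_small[OF 1(1) SK(2)]], goal_cases)
      case (1 P'' d' k')
      note 2 = \<open>lift P v P' d\<close> \<open>natp P' d k\<close> and l = 1(1)
      have ss: "small P' k" by (rule small_less[OF SK(2) 2(1)]) fact
      have s': "small P'' k'" by (rule small_less[OF lift_small[OF 2(1) SK(2)] l]) fact
      note ok' = lift_okP[OF l lift_okP[OF 2(1) ok]] and T' = lift_boxp[OF l lift_boxp[OF 2(1) T]]
      note lp = lift_pure[OF l lift_pure[OF 2(1)]] and ln = lift_natp[OF l lift_natp[OF 2(1)]]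
        and ls = lift_small[OF l lift_small[OF 2(1)]]
      show ?case
        by (intro pureb_not pureb_conj pureb_nat_less pureb_le pure_mult_nat pure_add natp_mc natp_vc small_mc small_vc
            pure_natp pure_const okP_local[OF ok'] okP_natp[OF ok'] ok' T' b(1)[THEN lp] b(2)[THEN lp] b(3)[THEN lp] b(4)[THEN lp]
            i(1)[THEN ln] i(2)[THEN ls] 1(2) s' lift_natp[OF l 2(2)] lift_small[OF l ss])
    qed
  qed
  moreover have mcs: "natp P v (\<lambda>x m. gmc x m (bl x m) (bh x m) (T x m) 0 (KN (len x)))"
    "natp P v (\<lambda>x m. gmc x m (bl x m) (bh x m) (T x m) 0 (i x m))"
    "natp P v (\<lambda>x m. gmc x m (bl x m) (bh x m) (T x m) (i x m) (KN (len x)))"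
    by (intro natp_mc ok T b i natp_const okP_local[OF ok] small_const okP_natp[OF ok] small_params)+
  ultimately have "pureb P v (\<lambda>x m. kapN (len x) < clog (width (T x m)) \<and>
     E1N (len x) <= gmc x m (bl x m) (bh x m) (T x m) 0 (KN (len x)) \<and>
     gmc x m (bl x m) (bh x m) (T x m) 0 (KN (len x)) <= 4 * gmc x m (bl x m) (bh x m) (T x m) 0 (i x m) \<and>
     gmc x m (bl x m) (bh x m) (T x m) 0 (KN (len x)) <= 4 * gmc x m (bl x m) (bh x m) (T x m) (i x m) (KN (len x)) \<and>
     (\<forall>i'<Suc (KN (len x)). \<forall>i''<Suc (KN (len x)). \<not> (i' < i x m \<and> i x m < i'' \<and>
      \<not> g x m * int (gvc x m (bl x m) (bh x m) (T x m) (i x m) (y x m) i' i'')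
        <= 16 * int (gmc x m (bl x m) (bh x m) (T x m) i' i'') + int (E2N (len x)))))"
    by (intro pureb_conj pureb_nat_less pureb_nat_le natp_mult natp_const okP_local[OF ok] small_mc okP_natp[OF ok] natp_clog_width ok T)
  then show ?thesis by (rule pureb_cong) (auto simp: grid.safe_def KN_def)
qed

lemma natp_isel:
  assumes ok: "okP P v" and T: "boxp P v T" and b: "pure P v g" "pure P v bl" "pure P v bh"
  shows "natp P v (\<lambda>x m. gisel x m (g x m) (bl x m) (bh x m) (T x m))"
  unfolding grid.isel_def KN_def[symmetric] RN_def[symmetric]
proof (rule natp_last_index[OF okP_natp(5)[OF ok] small_params(5)], goal_cases)
  case (1 P' d k)
  show ?case
  proof (rule pureb_exn[OF okP_natp(10)[OF lift_okP[OF 1(1) ok]] small_params(6)], goal_cases)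
    case (1 P'' d' k')
    note 2 = \<open>lift P v P' d\<close> \<open>natp P' d k\<close> and l = 1(1)
    have ss: "small P' k" by (rule small_less[OF small_params(5) 2(1)]) fact
    note ok' = lift_okP[OF l lift_okP[OF 2(1) ok]] and T' = lift_boxp[OF l lift_boxp[OF 2(1) T]]
    note lp = lift_pure[OF l lift_pure[OF 2(1)]]
    show ?case
      by (intro pureb_safe pure_rowv ok' T' b(1)[THEN lp] b(2)[THEN lp] b(3)[THEN lp] 1(2) lift_natp[OF l 2(2)] lift_small[OF l ss])
  qed
qed

lemma small_isel: "small P (\<lambda>x m. gisel x m (g x m) (bl x m) (bh x m) (T x m))"
proof (rule small_le[OF small_params(5)])
  have "last_index k P <= k" for k P by (induction k) auto
  then show "gisel x m (g x m) (bl x m) (bh x m) (T x m) <= KN (len x)" for x m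
    by (simp add: grid.isel_def KN_def)
qed

lemma natp_qsel:
  assumes ok: "okP P v" and T: "boxp P v T" and b: "pure P v g" "pure P v bl" "pure P v bh"
  shows "natp P v (\<lambda>x m. gqsel x m (g x m) (bl x m) (bh x m) (T x m))"
  unfolding grid.qsel_def RN_def[symmetric]
proof (rule natp_last_index[OF okP_natp(10)[OF ok] small_params(6)], goal_cases)
  case (1 P' d k)
  note l = 1(1)
  note ok' = lift_okP[OF l ok] and T' = lift_boxp[OF l T]
  note lp = lift_pure[OF l]
  show ?case
    by (intro pureb_safe pure_rowv natp_isel small_isel ok' T' b(1)[THEN lp] b(2)[THEN lp] b(3)[THEN lp] 1(2))
qed

section \<open>The program\<close>

text \<open>Array 3 holds the random seeds. The recursion tree of the estimator is complete with
  branching factor \<open>childN\<close>; its nodes are numbered level by level, so that the children of \<open>i\<close> are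
  \<open>i * childN + e + 1\<close>. Arrays 4 to 7 hold the box of a node, array 8 its level, array 9 its value,
  and array 12 the width of the leaf of the splitting tree that the node belongs to. Array 10 holds
  the box that is being split, array 11 the values of the chains, and array 14 the loop indices.\<close>

definition bx :: "mem => int => box" where "bx m i = (ar m 4 i, ar m 5 i, ar m 6 i, ar m 7 i)"
definition Tb :: "mem => box" where "Tb m = (ar m 10 0, ar m 10 1, ar m 10 2, ar m 10 3)"

abbreviation Nc :: "ctx => nat" where "Nc x \<equiv> childN (len x)"
abbreviation Rc :: "ctx => nat" where "Rc x \<equiv> RN (len x)"
abbreviation Kc :: "ctx => nat" where "Kc x \<equiv> KN (len x)"
abbreviation Jc :: "ctx => nat" where "Jc x \<equiv> JN (len x)"

definition ix :: "int => mem => nat" where "ix c m = nat (ar m 14 c)"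

text \<open>The width bound concerns all indices, so that boxes may be read at any computed
  position. Entries that have not been written are boxes of width 0.\<close>

definition okB :: "ctx => mem => bool" where
  "okB x m \<longleftrightarrow> par_ok x m \<and> (\<forall>i. width (bx m i) <= int (len x))"

definition okI :: "ctx => mem => bool" where
  "okI x m \<longleftrightarrow> okB x m \<and> ix 0 m <= Nc x * innerN x + 1"

definition okJ :: "ctx => mem => bool" where
  "okJ x m \<longleftrightarrow> okI x m \<and> ix 1 m <= Jc x"

definition okK :: "ctx => mem => bool" where
  "okK x m \<longleftrightarrow> okJ x m \<and> ix 2 m <= Kc x * Rc x"

definition okT :: "ctx => mem => bool" where
  "okT x m \<longleftrightarrow> par_ok x m \<and> width (Tb m) <= int (len x) \<and> ix 0 m <= Nc x * innerN x + 1"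

text \<open>The index is written to array 14, where the specifications of nested bodies can read it.
  The counter of the compiled loop is a separate temporary, invisible to the specification.\<close>

definition loop :: "int => (mem => mem) => nat => mem => mem" where
  "loop c H n = forl (\<lambda>k m. H (upd 14 c k m)) n"

lemma prog_loop:
  assumes N: "natp P v N" "small P N" and H: "prog P' v H"
    and enter: "\<And>x m k. P x m ==> k < N x m ==> P' x (upd 14 c (int k) m)"
    and inv: "\<And>x m k. P x m ==> k < N x m ==> P x (H x (upd 14 c (int k) m)) \<and> N x (H x (upd 14 c (int k) m)) = N x m"
    and frame: "\<And>x m i. ar (H x m) 0 i = ar m 0 i"
  shows "prog P v (\<lambda>x m. loop c (H x) (N x m) m)"
proof -
  obtain q where q: "\<And>x m. P x m ==> N x m <= timeN x ^ q" using N(2) unfolding small_def by blast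
  have "prog P v (\<lambda>x m. forl (\<lambda>k m. H x (upd 14 c k m)) (nat (int (N x m))) m)"
  proof (rule prog_for[where q = q])
    show "pure P v (\<lambda>x m. int (N x m))" using N(1) by (simp add: natp_def)
    show "int (N x m) <= int (timeN x ^ q)" if "P x m" for x m using q[OF that] by (simp only: of_nat_le_iff)
    fix P'' d K assume *: "v <= d" "\<And>x m. P'' x m ==> P x m \<and> 0 <= K x m \<and> K x m < int (N x m)" "pure P'' d K"
    have l: "local_pred P'' d" using pure_local[OF *(3)] .
    have "prog P'' d (\<lambda>x m. upd 14 c (K x m) m)" by (intro prog_upd pure_const l *(3)) auto
    moreover have "prog P' d H" using H *(1) unfolding prog_def local_pred_def by (meson agree_mono order_trans)
    moreover have "P' x (upd 14 c (K x m) m)" if "P'' x m" for x m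
      using enter[of x m "nat (K x m)"] *(2)[OF that] by (simp add: nat_less_iff)
    ultimately show "prog P'' d (\<lambda>x m. H x (upd 14 c (K x m) m))"
      by (rule prog_seq[where G = "\<lambda>x m. upd 14 c (K x m) m" and P' = P' and H = H])
  next
    fix x m k assume "P x m" "0 <= k" "k < int (N x m)"
    then show "P x (H x (upd 14 c k m)) \<and> int (N x (H x (upd 14 c k m))) = int (N x m)"
      using inv[of x m "nat k"] by (simp add: nat_less_iff)
  qed (simp add: frame ar_upd)
  then show ?thesis by (simp add: loop_def)
qed

lemma natp_div:
  assumes a: "natp P v a" "small P a" and b: "natp P v b" and pos: "\<And>x m. P x m ==> 0 < b x m"
  shows "natp P v (\<lambda>x m. a x m div b x m)"
proof -
  have "pure P v (\<lambda>x m. int (quot (nat (int (a x m))) (int (b x m)) (int (a x m))))"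
    by (rule pure_quot[OF a(1)[unfolded natp_def] small_bounded[OF a(2)] b[unfolded natp_def] a(1)[unfolded natp_def]])
  moreover have "int (quot (nat (int (a x m))) (int (b x m)) (int (a x m))) = int (a x m div b x m)" if "P x m" for x m
  proof -
    have "1 * a x m <= b x m * a x m" using pos[OF that] by (intro mult_right_mono) auto
    then have "int (a x m) <= int (a x m) * int (b x m)" by (simp add: mult.commute flip: of_nat_mult)
    then show ?thesis using quot_eq[of "int (b x m)" "int (a x m)" "a x m"] pos[OF that] by (simp add: zdiv_int)
  qed
  ultimately show ?thesis unfolding natp_def by (rule pure_cong)
qed

lemma natp_mod:
  assumes a: "natp P v a" "small P a" and b: "natp P v b" "small P b" and pos: "\<And>x m. P x m ==> 0 < b x m"
  shows "natp P v (\<lambda>x m. a x m mod b x m)"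
  unfolding modulo_nat_def by (intro natp_diff natp_mult natp_div a b pos)

lemma small_div: "small P a ==> small P (\<lambda>x m. a x m div b x m)"
  by (erule small_le) simp
lemma small_mod: "small P a ==> small P (\<lambda>x m. a x m mod b x m)"
  by (erule small_le) simp
lemma agree_par_ok: "agree v m m' ==> par_ok x m = par_ok x m'"
  unfolding par_ok_def by (simp add: agree_ar[of v m m' "Suc 0"])
lemma agree_bx: "agree v m m' ==> bx m i = bx m' i" unfolding bx_def by (simp add: agree_ar)
lemma agree_Tb: "agree v m m' ==> Tb m = Tb m'" unfolding Tb_def by (simp add: agree_ar)
lemma agree_ix: "agree v m m' ==> ix c m = ix c m'" unfolding ix_def by (simp add: agree_ar)

lemma okP_ok: "okP par_ok v" "okP okB v" "okP okI v" "okP okT v" "okP okJ v" "okP okK v"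
  unfolding okP_def local_pred_def okK_def okJ_def okI_def okT_def okB_def
  using agree_par_ok agree_bx agree_Tb agree_ix by metis+

lemmas ok_local = okP_ok[THEN okP_local]

lemma natp_ix: "local_pred P v ==> natp P v (\<lambda>x m. ix c m)"
  unfolding ix_def by (intro natp_nat pure_ar pure_const) auto

lemma small_ix: "small okI (\<lambda>x m. ix 0 m)" "small okJ (\<lambda>x m. ix 0 m)" "small okK (\<lambda>x m. ix 0 m)"
  "small okT (\<lambda>x m. ix 0 m)" "small okJ (\<lambda>x m. ix 1 m)" "small okK (\<lambda>x m. ix 1 m)" "small okK (\<lambda>x m. ix 2 m)"
proof -
  show "small okI (\<lambda>x m. ix 0 m)" "small okJ (\<lambda>x m. ix 0 m)" "small okK (\<lambda>x m. ix 0 m)" "small okT (\<lambda>x m. ix 0 m)"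
    by (rule small_le[OF small_nodes], simp add: okI_def okJ_def okK_def okT_def)+
  show "small okJ (\<lambda>x m. ix 1 m)" "small okK (\<lambda>x m. ix 1 m)"
    by (rule small_le[OF small_params(3)], simp add: okJ_def okK_def)+
  show "small okK (\<lambda>x m. ix 2 m)"
    by (rule small_le[OF small_mult[OF small_params(5) small_params(6)]]) (simp add: okK_def)
qed

text \<open>Mixed radix decoding of a child number. From the most to the least significant digit:
  sample, column, upper row, lower row.\<close>

definition par_ix :: "ctx => mem => nat" where "par_ix x m = ix 0 m div Nc x"
definition child_ix :: "ctx => mem => nat" where "child_ix x m = ix 0 m mod Nc x"
definition smp_ix :: "ctx => mem => nat" where "smp_ix x m = child_ix x m div (Kc x * Rc x * Rc x)"
definition col_ix :: "ctx => mem => nat" where "col_ix x m = child_ix x m mod (Kc x * Rc x * Rc x) div (Rc x * Rc x)"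
definition hi_ix :: "ctx => mem => nat" where "hi_ix x m = child_ix x m mod (Rc x * Rc x) div Rc x"
definition lo_ix :: "ctx => mem => nat" where "lo_ix x m = child_ix x m mod Rc x"

lemma natp_ixs:
  assumes "okP P v" "small P (\<lambda>x m. ix 0 m)"
  shows "natp P v par_ix" "natp P v smp_ix" "natp P v col_ix" "natp P v hi_ix" "natp P v lo_ix"
    "small P col_ix" "small P par_ix"
proof -
  note l = okP_local[OF assms(1)] and o = okP_natp[OF assms(1)]
  note RR = small_mult[OF small_params(6) small_params(6), of P]
  note KR = small_mult[OF small_params(5) small_params(6), of P]
  note KRR = small_mult[OF KR small_params(6)]
  show "natp P v par_ix" unfolding par_ix_def by (intro natp_div natp_ix l assms o) simp
  have c: "natp P v child_ix" "small P child_ix" unfolding child_ix_def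
    by (intro natp_mod natp_ix l assms o small_params childN_pos, intro small_mod assms)
  have p: "natp P v (\<lambda>x m. Rc x * Rc x)" "natp P v (\<lambda>x m. Kc x * Rc x * Rc x)"
    by (intro natp_mult o small_params)+
  show "natp P v smp_ix" unfolding smp_ix_def by (rule natp_div[OF c p(2)]) simp
  have m: "natp P v (\<lambda>x m. child_ix x m mod (Kc x * Rc x * Rc x))" "small P (\<lambda>x m. child_ix x m mod (Kc x * Rc x * Rc x))"
    "natp P v (\<lambda>x m. child_ix x m mod (Rc x * Rc x))" "small P (\<lambda>x m. child_ix x m mod (Rc x * Rc x))"
    using natp_mod[OF c p(2) KRR] natp_mod[OF c p(1) RR] small_mod[OF c(2)] by simp_all
  show "natp P v col_ix" unfolding col_ix_def by (rule natp_div[OF m(1,2) p(1)]) simp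
  show "natp P v hi_ix" unfolding hi_ix_def by (rule natp_div[OF m(3,4) o(10)]) simp
  show "natp P v lo_ix" unfolding lo_ix_def by (rule natp_mod[OF c o(10) small_params(6)]) simp
  show "small P col_ix" "small P par_ix" unfolding col_ix_def par_ix_def
    by (intro small_div small_mod c assms)+
qed

definition fw_x :: "ctx => mem => int" where
  "fw_x x m = ar m 4 (int (par_ix x m)) + 1 +
     seeds x m (nat (ar m 8 (int (par_ix x m)))) (clog (width (bx m (int (par_ix x m))))) (smp_ix x m)"

definition fw_init :: "ctx => mem => mem" where
  "fw_init x m = upd 10 4 (fw_x x m) (upd 10 3 (ar m 7 (int (par_ix x m))) (upd 10 2 (ar m 6 (int (par_ix x m)))
     (upd 10 1 (ar m 5 (int (par_ix x m))) (upd 10 0 (ar m 4 (int (par_ix x m))) m))))"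

definition fw_g :: "ctx => mem => int" where "fw_g x m = ar m 8 (int (par_ix x m)) + 320"
definition fw_bl :: "ctx => mem => int" where "fw_bl x m = ar m 6 (int (par_ix x m))"
definition fw_bh :: "ctx => mem => int" where "fw_bh x m = ar m 7 (int (par_ix x m))"

definition fw_sel :: "ctx => mem => mem" where
  "fw_sel x m = (let i = gisel x m (fw_g x m) (fw_bl x m) (fw_bh x m) (Tb m);
       y = growv x m (Tb m) (gqsel x m (fw_g x m) (fw_bl x m) (fw_bh x m) (Tb m)); c = gcol x (Tb m) i
     in upd 10 7 c (upd 10 6 y (upd 10 5 (int i) m)))"

text \<open>At a leaf the box is left unchanged, so that every descent can take the same number
  \<open>dN\<close> of rounds. Each written cell depends on its own old content and on cells 4 to 7
  only, hence the four assignments may be made one after another.\<close>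

definition fw_move :: "mem => mem" where
  "fw_move m = (let low = (ar m 10 4 <= ar m 10 7); stop = (ar m 10 5 = 0)
     in upd 10 3 (if stop then ar m 10 3 else if low then ar m 10 6 else ar m 10 3)
       (upd 10 2 (if stop then ar m 10 2 else if low then ar m 10 2 else ar m 10 6)
       (upd 10 1 (if stop then ar m 10 1 else if low then ar m 10 7 else ar m 10 1)
       (upd 10 0 (if stop then ar m 10 0 else if low then ar m 10 0 else ar m 10 7) m))))"

definition fw_step :: "ctx => mem => mem" where "fw_step x m = fw_move (fw_sel x m)"

definition fw_write :: "ctx => mem => mem" where
  "fw_write x m = (let k = int (ix 0 m) + 1; T = Tb m in
     upd 12 k (width T) (upd 8 k (ar m 8 (int (par_ix x m)) - 1) (upd 7 k (growv x m T (hi_ix x m))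
       (upd 6 k (growv x m T (lo_ix x m)) (upd 5 k (gcol x T (Suc (col_ix x m))) (upd 4 k (gcol x T (col_ix x m)) m))))))"

text \<open>The descent is repeated for every child, although the children of one sample share their
  leaf. This avoids a table of leaves at a polylogarithmic cost per child.\<close>

definition fw_body :: "ctx => mem => mem" where
  "fw_body x m = fw_write x (loop 1 (fw_step x) (dN (len x)) (fw_init x m))"

definition forward :: "ctx => mem => mem" where
  "forward x = loop 0 (fw_body x) (Nc x * innerN x)"

definition keeps :: "nat set => mem => mem => bool" where
  "keeps S m m' \<longleftrightarrow> (\<forall>r i. r < 16 --> r \<notin> S --> ar m' r i = ar m r i)"

lemma keepsD: "keeps S m m' ==> r < 16 ==> r \<notin> S ==> ar m' r i = ar m r i" by (simp add: keeps_def)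
lemma keeps_refl: "keeps S m m" by (simp add: keeps_def)
lemma keeps_trans: "keeps S m m' ==> keeps S m' m'' ==> keeps S m m''" by (simp add: keeps_def)
lemma keeps_upd: "r \<in> S ==> r < 16 ==> keeps S m m' ==> keeps S m (upd r i e m')" by (auto simp: keeps_def ar_upd)
lemma keeps_mono: "keeps S m m' ==> S \<subseteq> S' ==> keeps S' m m'" by (auto simp: keeps_def)

lemma keeps_loop:
  assumes "14 \<in> S" "\<And>m. keeps S m (H m)"
  shows "keeps S m (loop c H n m)"
proof -
  have "keeps S m (forl (\<lambda>k m. H (upd 14 c k m)) n m)"
  proof (induction n)
    case (Suc n)
    show ?case unfolding forl.simps by (rule keeps_trans[OF keeps_upd[OF assms(1) _ Suc.IH] assms(2)]) simp
  qed (simp add: keeps_refl)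
  then show ?thesis by (simp add: loop_def)
qed

lemma keeps_fw:
  "keeps {10} m (fw_init x m)" "keeps {10} m (fw_sel x m)" "keeps {10} m (fw_move m)" "keeps {10} m (fw_step x m)"
  "keeps {4,5,6,7,8,12} m (fw_write x m)" "keeps {4,5,6,7,8,10,12,14} m (fw_body x m)"
proof -
  show i: "keeps {10} m (fw_init x m)" and s: "keeps {10} m (fw_sel x m)" and mv: "keeps {10} m (fw_move m)" for m
    unfolding fw_init_def fw_sel_def fw_move_def Let_def by (intro keeps_upd keeps_refl; simp)+
  show st: "keeps {10} m (fw_step x m)" for m unfolding fw_step_def by (rule keeps_trans[OF s mv])
  show w: "keeps {4,5,6,7,8,12} m (fw_write x m)" for m
    unfolding fw_write_def Let_def by (intro keeps_upd keeps_refl; simp)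
  have "keeps {10,14} m (loop 1 (fw_step x) n m)" for n m
    by (rule keeps_loop) (auto intro: keeps_mono[OF st])
  from keeps_trans[OF keeps_mono[OF i] keeps_trans[OF keeps_mono[OF this] keeps_mono[OF w]]]
  show "keeps {4,5,6,7,8,10,12,14} m (fw_body x m)" unfolding fw_body_def by auto
qed

lemma keeps_par_ok: "keeps S m m' ==> 1 \<notin> S ==> par_ok x m' = par_ok x m"
  unfolding par_ok_def by (simp add: keepsD[of S m m' "Suc 0"])

lemma keeps_seeds: "keeps S m m' ==> 3 \<notin> S ==> seeds x m' = seeds x m"
  unfolding seeds_def by (auto simp: keepsD[of S m m' 3] intro!: ext)

lemma keeps_bx: "keeps S m m' ==> 4 \<notin> S ==> 5 \<notin> S ==> 6 \<notin> S ==> 7 \<notin> S ==> bx m' i = bx m i"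
  unfolding bx_def by (simp add: keepsD[of S])

lemma keeps_ix: "keeps S m m' ==> 14 \<notin> S ==> ix c m' = ix c m"
  unfolding ix_def by (simp add: keepsD[of S])

lemma boxp_Tb: "boxp okT v (\<lambda>x m. Tb m)"
  unfolding boxp_def Tb_def fst_conv snd_conv
  by (intro conjI pure_ar pure_const ok_local) (auto simp: okT_def Tb_def)

lemma boxp_bx: "natp okI v i ==> boxp okI v (\<lambda>x m. bx m (int (i x m)))"
  unfolding boxp_def bx_def fst_conv snd_conv
  by (intro conjI pure_ar pure_natp) (auto simp: okI_def okB_def bx_def)

definition wr :: "nat => (ctx => mem => int) => (ctx => mem => int) => ctx => mem => mem" where
  "wr r I E x m = upd r (I x m) (E x m) m"

lemma prog_wr: "pure P v I ==> pure P v E ==> 0 < r ==> r < 16 ==> prog P v (wr r I E)"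
  using prog_upd[of P v I E r] by (simp add: wr_def[abs_def])

lemma prog_wr_seq:
  assumes "prog P v G" "pure P v I" "pure P v E" "0 < r" "r < 16" "\<And>x m. P x m ==> P x (G x m)"
  shows "prog P v (\<lambda>x m. wr r I E x (G x m))"
  by (rule prog_seq[OF assms(1) prog_wr[OF assms(2,3,4,5)] assms(6)])

lemma prog_cong:
  assumes "prog P v G" "\<And>x m. P x m ==> G x m = H x m"
  shows "prog P v H"
proof (rule progI)
  show l: "local_pred P v" using prog_local[OF assms(1)] .
  show "agree d (H x m) (H x m')" if "v <= d" "P x m" "agree d m m'" for d x m m'
    using prog_inv[OF assms(1) that] assms(2)[OF that(2)] assms(2)[OF local_predD[OF l that(2) agree_mono[OF that(3,1)]]] by simp
  show "\<exists>c q. transforms P d H c q" if "v <= d" for d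
    using prog_comp[OF assms(1) that] assms(2) unfolding transforms_def by simp
qed

lemma ok_upd [simp]:
  "r \<noteq> 0 ==> r < 16 ==> r \<notin> {1,4,5,6,7,14} ==> okI x (upd r i e m) = okI x m"
  "r \<noteq> 0 ==> r < 16 ==> r \<notin> {1,4,5,6,7,14} ==> okJ x (upd r i e m) = okJ x m"
  "r \<noteq> 0 ==> r < 16 ==> r \<notin> {1,4,5,6,7,14} ==> okK x (upd r i e m) = okK x m"
  "r < 16 ==> r \<notin> {1,10,14} ==> okT x (upd r i e m) = okT x m"
  "4 < i ==> okT x (upd 10 i e m) = okT x m"
  unfolding okK_def okJ_def okI_def okT_def okB_def par_ok_def bx_def Tb_def ix_def
  by (simp_all add: ar_upd cong: conj_cong)

lemma seeds_upd: "r < 16 ==> r \<noteq> 3 ==> seeds x (upd r i e m) = seeds x m"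
  unfolding seeds_def by (auto simp: ar_upd intro!: ext)

lemmas mem_simps = wr_def ar_upd par_ix_def ix_def seeds_upd smp_ix_def child_ix_def bx_def Tb_def

lemma prog_fw_init: "prog okI 0 fw_init"
proof -
  note o = okP_ok(3)[of 0] and l = ok_local(3)[of 0]
  note n = natp_ixs[OF o small_ix(1)]
  have A: "pure okI 0 (\<lambda>x m. ar m r (int (par_ix x m)))" if "0 < r" "r < 16" for r
    by (rule pure_ar[OF pure_natp[OF n(1)] that])
  have X: "pure okI 0 fw_x" unfolding fw_x_def[abs_def]
    by (intro pure_add A pure_const l pure_seeds o natp_nat natp_clog_width boxp_bx n; simp)
  have "prog okI 0 (\<lambda>x m. wr 10 (\<lambda>x m. 4) fw_x x (wr 10 (\<lambda>x m. 3) (\<lambda>x m. ar m 7 (int (par_ix x m))) x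
     (wr 10 (\<lambda>x m. 2) (\<lambda>x m. ar m 6 (int (par_ix x m))) x (wr 10 (\<lambda>x m. 1) (\<lambda>x m. ar m 5 (int (par_ix x m))) x
     (wr 10 (\<lambda>x m. 0) (\<lambda>x m. ar m 4 (int (par_ix x m))) x m)))))"
    by (intro prog_wr_seq prog_wr A X pure_const l; simp add: wr_def)
  then show ?thesis by (rule prog_cong) (simp add: mem_simps fw_init_def fw_x_def)
qed

lemma prog_fw_sel: "prog okT 0 fw_sel"
proof -
  note o = okP_ok(4)[of 0] and l = ok_local(4)[of 0] and T = boxp_Tb[of 0]
  note n = natp_ixs[OF o small_ix(4)]
  have A: "pure okT 0 (\<lambda>x m. ar m r (int (par_ix x m)))" if "0 < r" "r < 16" for r
    by (rule pure_ar[OF pure_natp[OF n(1)] that])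
  have g: "pure okT 0 fw_g" "pure okT 0 fw_bl" "pure okT 0 fw_bh"
    unfolding fw_g_def[abs_def] fw_bl_def[abs_def] fw_bh_def[abs_def] by (intro pure_add A pure_const l; simp)+
  define i where "i = (\<lambda>x m. gisel x m (fw_g x m) (fw_bl x m) (fw_bh x m) (Tb m))"
  define y where "y = (\<lambda>x m. growv x m (Tb m) (gqsel x m (fw_g x m) (fw_bl x m) (fw_bh x m) (Tb m)))"
  define c where "c = (\<lambda>x m. gcol x (Tb m) (i x m))"
  have i: "natp okT 0 i" "small okT i" unfolding i_def by (intro natp_isel o T g small_isel)+
  have y: "pure okT 0 y" unfolding y_def by (intro pure_rowv natp_qsel o T g)
  have c: "pure okT 0 c" unfolding c_def by (intro pure_col o T i)
  have "prog okT 0 (\<lambda>x m. wr 10 (\<lambda>x m. 7) c x (wr 10 (\<lambda>x m. 6) y x (wr 10 (\<lambda>x m. 5) (\<lambda>x m. int (i x m)) x m)))"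
    by (intro prog_wr_seq prog_wr pure_natp i y c pure_const l; simp add: wr_def)
  then show ?thesis
    by (rule prog_cong)
      (simp add: mem_simps fw_sel_def Let_def i_def y_def c_def fw_g_def fw_bl_def fw_bh_def grid.isel_def)
qed

lemma local_True: "local_pred (\<lambda>x m. True) v" by (simp add: local_pred_def)

lemma prog_fw_move: "prog (\<lambda>x m. True) 0 (\<lambda>x. fw_move)"
proof -
  let ?P = "\<lambda>(x :: ctx) (m :: mem). True"
  have A: "pure ?P 0 (\<lambda>x m. ar m 10 i)" for i by (intro pure_ar pure_const local_True; simp)
  have B: "pureb ?P 0 (\<lambda>x m. ar m 10 4 <= ar m 10 7)" "pureb ?P 0 (\<lambda>x m. ar m 10 5 = 0)"
    by (intro pureb_le pureb_eq A pure_const local_True)+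
  define e where "e i u w = (\<lambda>(x :: ctx) m. if ar m 10 5 = 0 then ar m 10 i else if ar m 10 4 <= ar m 10 7 then ar m 10 u else ar m 10 w)" for i u w
  have e: "pure ?P 0 (e i u w)" for i u w unfolding e_def by (intro pure_ite A B)
  have "prog ?P 0 (\<lambda>x m. wr 10 (\<lambda>x m. 3) (e 3 6 3) x (wr 10 (\<lambda>x m. 2) (e 2 2 6) x
      (wr 10 (\<lambda>x m. 1) (e 1 7 1) x (wr 10 (\<lambda>x m. 0) (e 0 0 7) x m))))"
    by (intro prog_wr_seq prog_wr e pure_const local_True; simp)
  then show ?thesis by (rule prog_cong) (simp add: wr_def ar_upd fw_move_def Let_def e_def)
qed

lemma col_diff_le: "grid.col k T i' - grid.col k T i <= max 0 (width T)"
proof (cases T)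
  case (fields a b lo hi)
  have "0 <= int i * cw k (b - a)" "0 <= int i' * cw k (b - a)" using grid.cw_pos[of k "b - a"] by simp_all
  then show ?thesis unfolding fields grid.col_def width_def by (simp add: min_def max_def)
qed

lemma fw_step_Tb: "Tb (fw_step x m) = grid.descend (Fq x) (seeds x m 0) (Jc x) (kapN (len x)) (int (E1N (len x)))
   (int (E2N (len x))) (fw_g x m) (fw_bl x m) (fw_bh x m) (ar m 10 4) (Tb m)" "ar (fw_step x m) 10 4 = ar m 10 4"
  unfolding fw_step_def fw_move_def fw_sel_def Let_def grid.descend_def grid.lower_def grid.upper_def
  by (simp_all add: Tb_def ar_upd)

lemma col_extreme: "fst (snd T) - grid.col k T i <= max 0 (width T)" "grid.col k T i - fst T <= max 0 (width T)"
proof -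
  obtain a b lo hi where T: "T = (a, b, lo, hi)" by (cases T)
  have "0 <= int i * cw k (b - a)" using grid.cw_pos[of k "b - a"] by simp
  then show "fst (snd T) - grid.col k T i <= max 0 (width T)" "grid.col k T i - fst T <= max 0 (width T)"
    unfolding T grid.col_def width_def by (simp_all add: min_def max_def)
qed

lemma descend_width: "width (grid.descend F s J k E1 E2 g bl bh z T) <= max 0 (width T)"
  using col_extreme[where T = T and k = k and i = "grid.isel F s J k E1 E2 g bl bh T"]
  by (cases T) (auto simp: grid.descend_def grid.lower_def grid.upper_def width_def)

lemma fw_step_ok: "okT x m ==> okT x (fw_step x m)"
  using order_trans[OF descend_width, of "Tb m" "int (len x)"]
  by (auto simp: okT_def fw_step_Tb keeps_par_ok[OF keeps_fw(4)] keeps_ix[OF keeps_fw(4)])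

lemma ok_ix_upd: "okB x (upd 14 c k m) = okB x m" "ix c (upd 14 c' k m) = (if c = c' then nat k else ix c m)"
  "par_ok x (upd 14 c k m) = par_ok x m" "Tb (upd 14 c k m) = Tb m" "seeds x (upd 14 c k m) = seeds x m"
  "bx (upd 14 c k m) i = bx m i"
  unfolding okB_def par_ok_def bx_def Tb_def ix_def by (simp_all add: ar_upd seeds_upd)

lemma prog_fw_loop: "prog okT 0 (\<lambda>x m. loop 1 (fw_step x) (dN (len x)) m)"
proof (rule prog_loop[where P' = okT and H = fw_step])
  show "natp okT 0 (\<lambda>x m. dN (len x))" by (rule okP_natp[OF okP_ok(4)])
  show "small okT (\<lambda>x m. dN (len x))" by (rule small_params)
  show "prog okT 0 fw_step" unfolding fw_step_def[abs_def] by (rule prog_seq[OF prog_fw_sel prog_fw_move]) simp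
  show *: "okT x (upd 14 1 (int k) m)" if "okT x m" for x m k using that by (simp add: okT_def ok_ix_upd)
  show "okT x (fw_step x (upd 14 1 (int k) m)) \<and> dN (len x) = dN (len x)" if "okT x m" for x m k
    using fw_step_ok[OF *[OF that]] by simp
  show "ar (fw_step x m) 0 i = ar m 0 i" for x m i using keepsD[OF keeps_fw(4)] by simp
qed

lemma fw_init_ok: "okI x m ==> okT x (fw_init x m)"
  by (auto simp: okI_def okB_def okT_def keeps_par_ok[OF keeps_fw(1)] keeps_ix[OF keeps_fw(1)])
    (simp add: Tb_def fw_init_def ar_upd bx_def)

lemma fw_loop_ok: "okT x m ==> okT x (loop 1 (fw_step x) n m)"
  unfolding loop_def
proof (induction n)
  case (Suc n)
  then have "okT x (upd 14 1 (int n) (forl (\<lambda>k m. fw_step x (upd 14 1 k m)) n m))" by (simp add: okT_def ok_ix_upd)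
  then show ?case unfolding forl.simps by (rule fw_step_ok)
qed simp

lemma prog_fw_write: "prog okT 0 fw_write"
proof -
  note o = okP_ok(4)[of 0] and l = ok_local(4)[of 0] and T = boxp_Tb[of 0]
  note n = natp_ixs[OF o small_ix(4)]
  define k where "k = (\<lambda>(x :: ctx) m. int (Suc (ix 0 m)))"
  have k: "pure okT 0 k" unfolding k_def by (intro pure_natp natp_Suc natp_ix l)
  have S: "natp okT 0 (\<lambda>x m. Suc (col_ix x m))" "small okT (\<lambda>x m. Suc (col_ix x m))"
    using natp_Suc[OF n(3)] small_add[OF small_const[of okT 1] n(6)] by auto
  have "prog okT 0 (\<lambda>x m. wr 12 k (\<lambda>x m. width (Tb m)) x (wr 8 k (\<lambda>x m. ar m 8 (int (par_ix x m)) - 1) x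
    (wr 7 k (\<lambda>x m. growv x m (Tb m) (hi_ix x m)) x (wr 6 k (\<lambda>x m. growv x m (Tb m) (lo_ix x m)) x
    (wr 5 k (\<lambda>x m. gcol x (Tb m) (Suc (col_ix x m))) x (wr 4 k (\<lambda>x m. gcol x (Tb m) (col_ix x m)) x m))))))"
    by (intro prog_wr_seq prog_wr k pure_width pure_diff pure_ar pure_natp n pure_rowv pure_col S o T pure_const l; simp add: wr_def)
  then show ?thesis
    by (rule prog_cong) (simp add: mem_simps fw_write_def Let_def k_def hi_ix_def lo_ix_def col_ix_def add.commute)
qed

lemma fw_write_ok: "okB x m ==> okT x m ==> okB x (fw_write x m)"
proof -
  assume B: "okB x m" and T: "okT x m"
  have "width (bx (fw_write x m) i) <= int (len x)" for i
  proof (cases "i = int (ix 0 m) + 1")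
    case True
    have "width (bx (fw_write x m) i) <= max 0 (width (Tb m))" unfolding True
      using col_diff_le[of "kapN (len x)" "Tb m" "Suc (col_ix x m)" "col_ix x m"]
      by (simp add: bx_def fw_write_def Let_def ar_upd width_def)
    then show ?thesis using T by (auto simp: okT_def)
  next
    case False
    then have "bx (fw_write x m) i = bx m i" by (simp add: bx_def fw_write_def Let_def ar_upd)
    then show ?thesis using B by (simp add: okB_def)
  qed
  then show ?thesis using T by (simp add: okB_def okT_def keeps_par_ok[OF keeps_fw(5)])
qed

lemma prog_fw_body: "prog okI 0 fw_body"
  unfolding fw_body_def[abs_def]
  by (rule prog_seq[OF prog_seq[OF prog_fw_init prog_fw_loop fw_init_ok] prog_fw_write])
    (auto intro: fw_loop_ok fw_init_ok)

lemma fw_body_ok: "okI x m ==> okB x (fw_body x m)"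
proof -
  assume I: "okI x m"
  have k: "keeps {10,14} m (loop 1 (fw_step x) (dN (len x)) (fw_init x m))"
    by (rule keeps_trans[OF keeps_mono[OF keeps_fw(1)] keeps_loop[OF _ keeps_mono[OF keeps_fw(4)]]]) auto
  have "okB x (loop 1 (fw_step x) (dN (len x)) (fw_init x m))"
    using I keeps_par_ok[OF k] keeps_bx[OF k] by (simp add: okI_def okB_def)
  then show ?thesis unfolding fw_body_def by (intro fw_write_ok fw_loop_ok fw_init_ok I)
qed

lemma forward_ok_step: "okB x m ==> k < Nc x * innerN x ==> okI x (upd 14 0 (int k) m)"
  by (simp add: okI_def ok_ix_upd)

lemma prog_forward: "prog okB 0 forward"
  unfolding forward_def[abs_def]
proof (rule prog_loop[where P' = okI and H = fw_body])
  show "natp okB 0 (\<lambda>x m. Nc x * innerN x)" by (intro natp_mult okP_natp[OF okP_ok(2)] small_innerN)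
  show "small okB (\<lambda>x m. Nc x * innerN x)" by (rule small_le[OF small_nodes]) simp
  show "prog okI 0 fw_body" by (rule prog_fw_body)
  show *: "okI x (upd 14 0 (int k) m)" if "okB x m" "k < Nc x * innerN x" for x m k using forward_ok_step[OF that] .
  show "okB x (fw_body x (upd 14 0 (int k) m)) \<and> Nc x * innerN x = Nc x * innerN x" if "okB x m" "k < Nc x * innerN x" for x m k
    using fw_body_ok[OF *[OF that]] by simp
  show "ar (fw_body x m) 0 i = ar m 0 i" for x m i using keepsD[OF keeps_fw(6)] by simp
qed

section \<open>The backward pass: evaluation of the recursion tree\<close>

definition bw_node :: "ctx => mem => nat" where "bw_node x m = innerN x - 1 - ix 0 m"

definition bw_edge :: "ctx => mem => nat" where
  "bw_edge x m = bw_node x m * Nc x + (ix 1 m * (Kc x * Rc x) + ix 2 m) * Rc x"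

text \<open>One entry of the dynamic program. The entry of column \<open>c\<close> and row
  \<open>q\<close> has number \<open>c * Rc x + q\<close>; its predecessors are reached by removing
  the row part and stepping back by one column. In column 0 the previous values are 0.\<close>

definition bw_chain :: "ctx => mem => mem" where
  "bw_chain x m = upd 11 (int (ix 2 m)) (bmax (Rc x) (\<lambda>p.
     if ar m 6 (int (bw_edge x m + p + 1)) <= ar m 7 (int (bw_edge x m + p + 1))
     then (if ix 2 m < Rc x then 0 else ar m 11 (int (ix 2 m - Rc x - ix 2 m mod Rc x + p))) + ar m 9 (int (bw_edge x m + p + 1))
     else 0)) m"

definition bw_x :: "ctx => mem => int" where
  "bw_x x m = ar m 4 (int (bw_node x m)) + 1 +
     seeds x m (nat (ar m 8 (int (bw_node x m)))) (clog (width (bx m (int (bw_node x m))))) (ix 1 m)"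

text \<open>All children of a sample carry the width of their leaf, and it is read from the first of
  them. The final entries of the dynamic program are those of column \<open>Kc x - 1\<close>, since
  entry \<open>c\<close> stands for chains of \<open>c + 1\<close> cells.\<close>

definition bw_alpha :: "ctx => mem => mem" where
  "bw_alpha x m = upd 13 (int (ix 1 m)) (if bw_x x m <= ar m 5 (int (bw_node x m))
     then 2 ^ clog (width (bx m (int (bw_node x m)))) * int (quot (2 * QN (len x))
       (ar m 12 (int (bw_node x m * Nc x + ix 1 m * (Kc x * Rc x * Rc x) + 1)) * int (Jc x))
       (bmax (Rc x) (\<lambda>q. ar m 11 (int ((Kc x - 1) * Rc x + q)))))
     else 0) m"

definition bw_val :: "ctx => mem => mem" where
  "bw_val x m = upd 9 (int (bw_node x m)) (\<Sum>j<Jc x. ar m 13 (int j)) m"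

definition bw_leaf :: "ctx => mem => mem" where
  "bw_leaf x m = upd 9 (int (ix 0 m)) (2 ^ clog (width (bx m (int (ix 0 m)))) * int (QN (len x) *
     card {j. j < Jc x \<and> gsmp x m (bx m (int (ix 0 m))) j \<in> pts (Fq x) (bx m (int (ix 0 m)))})) m"

definition bw_chains :: "ctx => mem => mem" where "bw_chains x = loop 2 (bw_chain x) (Kc x * Rc x)"
definition bw_sample :: "ctx => mem => mem" where "bw_sample x m = bw_alpha x (bw_chains x m)"
definition bw_body :: "ctx => mem => mem" where "bw_body x m = bw_val x (loop 1 (bw_sample x) (Jc x) m)"
definition bw_leaves :: "ctx => mem => mem" where "bw_leaves x = loop 0 (bw_leaf x) (Nc x * innerN x + 1)"
text \<open>All nodes receive a value of level 0, which is final for the leaves. The inner nodes are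
  then overwritten in descending order: children have larger numbers than their parent and are
  finished before it.\<close>

definition backward :: "ctx => mem => mem" where "backward x m = loop 0 (bw_body x) (innerN x) (bw_leaves x m)"

lemma pure_pow2n:
  assumes "natp P v k" "small P k"
  shows "pure P v (\<lambda>x m. 2 ^ k x m)"
  using pure_pow2[OF assms(1)[unfolded natp_def] small_bounded[OF assms(2)]] by simp

lemma natp_bw_node: "okP P v ==> natp P v bw_node"
  unfolding bw_node_def[abs_def] by (intro natp_diff okP_natp natp_const natp_ix okP_local)

lemma boxp_bx_okJ: "natp okJ v i ==> boxp okJ v (\<lambda>x m. bx m (int (i x m)))"
  unfolding boxp_def bx_def fst_conv snd_conv
  by (intro conjI pure_ar pure_natp) (auto simp: okJ_def okI_def okB_def bx_def)

lemma small_KR: "small P (\<lambda>x m. Kc x * Rc x)" "small P (\<lambda>x m. Kc x * Rc x * Rc x)"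
  by (intro small_mult small_params)+

lemma prog_bw_chain: "prog okK 0 bw_chain"
proof -
  note o = okP_ok(6)[of 0] and l = ok_local(6)[of 0]
  have e: "natp okK 0 bw_edge" unfolding bw_edge_def[abs_def]
    by (intro natp_add natp_mult natp_bw_node natp_ix okP_natp o l small_params small_KR)
  have "pure okK 0 (\<lambda>x m. bmax (Rc x) (\<lambda>p.
     if ar m 6 (int (bw_edge x m + p + 1)) <= ar m 7 (int (bw_edge x m + p + 1))
     then (if ix 2 m < Rc x then 0 else ar m 11 (int (ix 2 m - Rc x - ix 2 m mod Rc x + p))) + ar m 9 (int (bw_edge x m + p + 1))
     else 0))"
  proof (rule pure_bmaxn[OF okP_natp(10)[OF o] small_params(6)], goal_cases)
    case (1 P' d k)
    note ok' = lift_okP[OF 1(1) o] and ln = lift_natp[OF 1(1)]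
    have i2: "natp P' d (\<lambda>x m. ix 2 m)" "small P' (\<lambda>x m. ix 2 m)"
      by (rule ln[OF natp_ix[OF l]], rule lift_small[OF 1(1) small_ix(7)])
    have mo: "natp P' d (\<lambda>x m. ix 2 m mod Rc x)" by (rule natp_mod[OF i2 okP_natp(10)[OF ok'] small_params(6)]) simp
    have k: "natp P' d (\<lambda>x m. bw_edge x m + k x m + 1)"
      by (intro natp_add ln[OF e] 1 natp_const okP_local[OF ok'])
    have A: "pure P' d (\<lambda>x m. ar m r (int (bw_edge x m + k x m + 1)))" if "0 < r" "r < 16" for r
      by (rule pure_ar[OF pure_natp[OF k] that])
    have B: "natp P' d (\<lambda>x m. ix 2 m - Rc x - ix 2 m mod Rc x + k x m)"
      by (intro natp_add natp_diff i2 mo 1 okP_natp[OF ok'])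
    have C: "pure P' d (\<lambda>x m. ar m 11 (int (ix 2 m - Rc x - ix 2 m mod Rc x + k x m)))"
      by (rule pure_ar[OF pure_natp[OF B]]) auto
    show ?case
      by (intro pure_ite pure_add pureb_le pureb_nat_less A C i2 okP_natp[OF ok'] pure_const okP_local[OF ok']; simp)
  qed
  then show ?thesis unfolding bw_chain_def[abs_def] by (intro prog_upd pure_natp natp_ix l; simp)
qed

lemma prog_bw_alpha: "prog okJ 0 bw_alpha"
proof -
  note o = okP_ok(5)[of 0] and l = ok_local(5)[of 0]
  note n = natp_bw_node[OF o]
  have A: "pure okJ 0 (\<lambda>x m. ar m r (int (bw_node x m)))" if "0 < r" "r < 16" for r
    by (rule pure_ar[OF pure_natp[OF n] that])
  have X: "pure okJ 0 bw_x" unfolding bw_x_def[abs_def]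
    by (intro pure_add A pure_const l pure_seeds o natp_nat natp_clog_width boxp_bx_okJ n natp_ix; simp)
  have Q: "natp okJ 0 (\<lambda>x m. 2 * QN (len x))" "small okJ (\<lambda>x m. 2 * QN (len x))"
    by (intro natp_mult natp_const l okP_natp o small_params small_mult small_const)+
  have t: "natp okJ 0 (\<lambda>x m. bw_node x m * Nc x + ix 1 m * (Kc x * Rc x * Rc x) + 1)"
    by (intro natp_add natp_mult n natp_ix natp_const okP_natp o l small_params small_KR)
  have W: "pure okJ 0 (\<lambda>x m. ar m 12 (int (bw_node x m * Nc x + ix 1 m * (Kc x * Rc x * Rc x) + 1)) * int (Jc x))"
    by (intro pure_mult_nat okP_natp o small_params, rule pure_ar[OF pure_natp[OF t]]) auto
  have D: "pure okJ 0 (\<lambda>x m. bmax (Rc x) (\<lambda>q. ar m 11 (int ((Kc x - 1) * Rc x + q))))"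
  proof (rule pure_bmaxn[OF okP_natp(10)[OF o] small_params(6)], goal_cases)
    case (1 P' d k)
    note ok' = lift_okP[OF 1(1) o]
    have "natp P' d (\<lambda>x m. (Kc x - 1) * Rc x + k x m)"
      by (intro natp_add natp_mult natp_diff 1 okP_natp[OF ok'] natp_const okP_local[OF ok'] small_params)
    then show ?case by (intro pure_ar pure_natp) auto
  qed
  have q: "natp okJ 0 (\<lambda>x m. quot (2 * QN (len x))
       (ar m 12 (int (bw_node x m * Nc x + ix 1 m * (Kc x * Rc x * Rc x) + 1)) * int (Jc x))
       (bmax (Rc x) (\<lambda>q. ar m 11 (int ((Kc x - 1) * Rc x + q)))))"
    using pure_quot[OF Q(1)[unfolded natp_def] small_bounded[OF Q(2)] W D] unfolding natp_def nat_int .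
  have qs: "small okJ (\<lambda>x m. quot (2 * QN (len x)) (U x m) (E x m))" for U E
    by (rule small_le[OF Q(2)]) (simp only: quot_def card_J_le)
  have T: "boxp okJ 0 (\<lambda>x m. bx m (int (bw_node x m)))" by (rule boxp_bx_okJ[OF n])
  have P: "pure okJ 0 (\<lambda>x m. 2 ^ clog (width (bx m (int (bw_node x m)))))"
    by (rule pure_pow2n[OF natp_clog_width[OF o T] small_clog_width[OF T]])
  have "pureb okJ 0 (\<lambda>x m. bw_x x m <= ar m 5 (int (bw_node x m)))" by (rule pureb_le[OF X A]) auto
  from prog_upd[OF pure_natp[OF natp_ix[OF l]] pure_ite[OF this pure_mult_nat[OF P q qs] pure_const[OF l]], of 13]
  show ?thesis unfolding bw_alpha_def[abs_def] by simp
qed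

lemma prog_bw_val: "prog okI 0 bw_val"
proof -
  note o = okP_ok(3)[of 0] and l = ok_local(3)[of 0]
  have "pure okI 0 (\<lambda>x m. \<Sum>j<Jc x. ar m 13 (int j))"
    by (rule pure_sumn[OF okP_natp(3)[OF o] small_params(3)], intro pure_ar pure_natp; simp)
  then show ?thesis unfolding bw_val_def[abs_def] by (intro prog_upd pure_natp natp_bw_node o; simp)
qed

lemma prog_bw_leaf: "prog okI 0 bw_leaf"
proof -
  note o = okP_ok(3)[of 0] and l = ok_local(3)[of 0]
  have T: "boxp okI 0 (\<lambda>x m. bx m (int (ix 0 m)))" by (intro boxp_bx natp_ix l)
  have c: "natp okI 0 (\<lambda>x m. card {j. j < Jc x \<and> gsmp x m (bx m (int (ix 0 m))) j \<in> pts (Fq x) (bx m (int (ix 0 m)))})"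
  proof (rule natp_card[OF okP_natp(3)[OF o] small_params(3)], goal_cases)
    case (1 P' d k)
    then show ?case by (intro pureb_in_box pure_smp lift_okP[OF 1(1) o] lift_boxp[OF 1(1) T] 1(2))
  qed
  have s: "small okI (\<lambda>x m. card {j. j < Jc x \<and> gsmp x m (bx m (int (ix 0 m))) j \<in> pts (Fq x) (bx m (int (ix 0 m)))})"
    by (rule small_le[OF small_params(3)]) (rule card_J_le)
  have P: "pure okI 0 (\<lambda>x m. 2 ^ clog (width (bx m (int (ix 0 m)))))"
    by (rule pure_pow2n[OF natp_clog_width[OF o T] small_clog_width[OF T]])
  from prog_upd[OF pure_natp[OF natp_ix[OF l]] pure_mult_nat[OF P natp_mult[OF okP_natp(6)[OF o] c s] small_mult[OF small_params(4) s]], of 9]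
  show ?thesis unfolding bw_leaf_def[abs_def] by simp
qed

lemma keeps_bw:
  "keeps {11} m (bw_chain x m)" "keeps {13} m (bw_alpha x m)" "keeps {9} m (bw_val x m)" "keeps {9} m (bw_leaf x m)"
  "keeps {11,14} m (bw_chains x m)" "keeps {11,13,14} m (bw_sample x m)" "keeps {9,11,13,14} m (bw_body x m)"
  "keeps {9,14} m (bw_leaves x m)"
proof -
  show c: "keeps {11} m (bw_chain x m)" and a: "keeps {13} m (bw_alpha x m)" and v: "keeps {9} m (bw_val x m)"
    and lf: "keeps {9} m (bw_leaf x m)" for m
    unfolding bw_chain_def bw_alpha_def bw_val_def bw_leaf_def by (intro keeps_upd keeps_refl; simp)+
  show cs: "keeps {11,14} m (bw_chains x m)" for m
    unfolding bw_chains_def by (rule keeps_loop) (auto intro: keeps_mono[OF c])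
  show s: "keeps {11,13,14} m (bw_sample x m)" for m
    unfolding bw_sample_def by (rule keeps_trans[OF keeps_mono[OF cs] keeps_mono[OF a]]) auto
  have "keeps {11,13,14} m (loop 1 (bw_sample x) (Jc x) m)" by (rule keeps_loop) (auto intro: keeps_mono[OF s])
  then show "keeps {9,11,13,14} m (bw_body x m)"
    unfolding bw_body_def by (intro keeps_trans[OF keeps_mono keeps_mono[OF v]]) auto
  show "keeps {9,14} m (bw_leaves x m)"
    unfolding bw_leaves_def by (rule keeps_loop) (auto intro: keeps_mono[OF lf])
qed

lemma forl_14: "(\<And>m. ar (H m) 14 i = ar m 14 i) ==> i \<noteq> c ==> ar (forl (\<lambda>k m. H (upd 14 c k m)) n m) 14 i = ar m 14 i"
  by (induction n) (auto simp: ar_upd)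

lemma bw_14:
  "ar (bw_chain x m) 14 i = ar m 14 i" "ar (bw_alpha x m) 14 i = ar m 14 i" "ar (bw_val x m) 14 i = ar m 14 i"
  "ar (bw_leaf x m) 14 i = ar m 14 i"
  "i \<noteq> 2 ==> ar (bw_chains x m) 14 i = ar m 14 i" "i \<noteq> 2 ==> ar (bw_sample x m) 14 i = ar m 14 i"
  "i \<noteq> 1 ==> i \<noteq> 2 ==> ar (bw_body x m) 14 i = ar m 14 i"
proof -
  show c: "ar (bw_chain x m) 14 i = ar m 14 i" and a: "ar (bw_alpha x m) 14 i = ar m 14 i" and v: "ar (bw_val x m) 14 i = ar m 14 i"
    and "ar (bw_leaf x m) 14 i = ar m 14 i" for m
    using keepsD[OF keeps_bw(1)] keepsD[OF keeps_bw(2)] keepsD[OF keeps_bw(3)] keepsD[OF keeps_bw(4)] by auto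
  show cs: "ar (bw_chains x m) 14 i = ar m 14 i" if "i \<noteq> 2" for m
    unfolding bw_chains_def loop_def using c that by (rule forl_14)
  show s: "ar (bw_sample x m) 14 i = ar m 14 i" if "i \<noteq> 2" for m
    unfolding bw_sample_def using cs[OF that] a by simp
  show "ar (bw_body x m) 14 i = ar m 14 i" if "i \<noteq> 1" "i \<noteq> 2"
    unfolding bw_body_def v loop_def using s[OF that(2)] that(1) by (rule forl_14)
qed

lemma ok_bw:
  assumes "keeps S m m'" "S \<subseteq> {9,11,13,14}"
  shows "okB x m ==> okB x m'" "okI x m ==> ar m' 14 0 = ar m 14 0 ==> okI x m'"
    "okJ x m ==> ar m' 14 0 = ar m 14 0 ==> ar m' 14 1 = ar m 14 1 ==> okJ x m'"
proof -
  have "1 \<notin> S" "4 \<notin> S" "5 \<notin> S" "6 \<notin> S" "7 \<notin> S" using assms(2) by auto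
  then show B: "okB x m ==> okB x m'"
    using keeps_par_ok[OF assms(1)] keeps_bx[OF assms(1)] by (simp add: okB_def)
  then show I: "okI x m ==> ar m' 14 0 = ar m 14 0 ==> okI x m'"
    by (simp add: okI_def ix_def)
  then show "okJ x m ==> ar m' 14 0 = ar m 14 0 ==> ar m' 14 1 = ar m 14 1 ==> okJ x m'"
    by (simp add: okJ_def ix_def)
qed

lemma prog_bw_chains: "prog okJ 0 bw_chains"
  unfolding bw_chains_def[abs_def]
proof (rule prog_loop[where P' = okK and H = bw_chain])
  show "natp okJ 0 (\<lambda>x m. Kc x * Rc x)" by (intro natp_mult okP_natp[OF okP_ok(5)] small_params)
  show "small okJ (\<lambda>x m. Kc x * Rc x)" by (rule small_KR)
  show "prog okK 0 bw_chain" by (rule prog_bw_chain)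
  show "okK x (upd 14 2 (int k) m)" if "okJ x m" "k < Kc x * Rc x" for x m k
    using that by (simp add: okK_def okJ_def okI_def ok_ix_upd)
  show "okJ x (bw_chain x (upd 14 2 (int k) m)) \<and> Kc x * Rc x = Kc x * Rc x" if "okJ x m" for x m k
  proof -
    have "okJ x (upd 14 2 (int k) m)" using that by (simp add: okJ_def okI_def ok_ix_upd)
    then show ?thesis using ok_bw(3)[OF keeps_bw(1)] by (simp add: bw_14)
  qed
  show "ar (bw_chain x m) 0 i = ar m 0 i" for x m i using keepsD[OF keeps_bw(1)] by simp
qed

lemma prog_bw_sample: "prog okJ 0 bw_sample"
  unfolding bw_sample_def[abs_def]
  by (rule prog_seq[OF prog_bw_chains prog_bw_alpha]) (rule ok_bw(3)[OF keeps_bw(5)], auto simp: bw_14)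

lemma bw_loop_ok:
  assumes "okI x m"
  shows "okI x (loop 1 (bw_sample x) n m)"
proof -
  have "keeps {11,13,14} m (loop 1 (bw_sample x) n m)" by (rule keeps_loop) (auto intro: keeps_mono[OF keeps_bw(6)])
  moreover have "ar (loop 1 (bw_sample x) n m) 14 0 = ar m 14 0" unfolding loop_def by (rule forl_14) (auto simp: bw_14)
  ultimately show ?thesis using ok_bw(2)[OF _ _ assms] by blast
qed

lemma prog_bw_body: "prog okI 0 bw_body"
  unfolding bw_body_def[abs_def]
proof (rule prog_seq[OF prog_loop[where P = okI and P' = okJ and H = bw_sample] prog_bw_val])
  show "natp okI 0 (\<lambda>x m. Jc x)" by (rule okP_natp[OF okP_ok(3)])
  show "small okI (\<lambda>x m. Jc x)" by (rule small_params)
  show "prog okJ 0 bw_sample" by (rule prog_bw_sample)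
  show *: "okJ x (upd 14 1 (int k) m)" if "okI x m" "k < Jc x" for x m k using that by (simp add: okJ_def okI_def ok_ix_upd)
  show "okI x (bw_sample x (upd 14 1 (int k) m)) \<and> Jc x = Jc x" if "okI x m" for x m k
  proof -
    have "okI x (upd 14 1 (int k) m)" using that by (simp add: okI_def ok_ix_upd)
    then show ?thesis using ok_bw(2)[OF keeps_bw(6)] by (simp add: bw_14)
  qed
  show "ar (bw_sample x m) 0 i = ar m 0 i" for x m i using keepsD[OF keeps_bw(6)] by simp
qed (rule bw_loop_ok)

lemma prog_bw_leaves: "prog okB 0 bw_leaves"
  unfolding bw_leaves_def[abs_def]
proof (rule prog_loop[where P' = okI and H = bw_leaf])
  show "natp okB 0 (\<lambda>x m. Nc x * innerN x + 1)"
    by (intro natp_add natp_mult okP_natp[OF okP_ok(2)] small_innerN natp_const ok_local)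
  show "small okB (\<lambda>x m. Nc x * innerN x + 1)" by (rule small_nodes)
  show "prog okI 0 bw_leaf" by (rule prog_bw_leaf)
  show "okI x (upd 14 0 (int k) m)" if "okB x m" "k < Nc x * innerN x + 1" for x m k using that by (simp add: okI_def ok_ix_upd)
  show "okB x (bw_leaf x (upd 14 0 (int k) m)) \<and> Nc x * innerN x + 1 = Nc x * innerN x + 1" if "okB x m" for x m k
    using ok_bw(1)[OF keeps_bw(4)] that by (simp add: ok_ix_upd)
  show "ar (bw_leaf x m) 0 i = ar m 0 i" for x m i using keepsD[OF keeps_bw(4)] by simp
qed

lemma innerN_le_nodes: "innerN x <= Nc x * innerN x"
  using childN_pos[of "len x"] by (cases "Nc x") auto

lemma prog_backward: "prog okB 0 backward"
  unfolding backward_def[abs_def]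
proof (rule prog_seq[OF prog_bw_leaves prog_loop[where P = okB and P' = okI and H = bw_body]])
  show "natp okB 0 (\<lambda>x m. innerN x)" by (rule okP_natp[OF okP_ok(2)])
  show "small okB (\<lambda>x m. innerN x)" by (rule small_innerN)
  show "prog okI 0 bw_body" by (rule prog_bw_body)
  show "okI x (upd 14 0 (int k) m)" if "okB x m" "k < innerN x" for x m k
  proof -
    have "k <= Nc x * innerN x + 1" using that(2) innerN_le_nodes[of x] by linarith
    then show ?thesis using that(1) by (simp add: okI_def ok_ix_upd)
  qed
  show "okB x (bw_body x (upd 14 0 (int k) m)) \<and> innerN x = innerN x" if "okB x m" for x m k
    using ok_bw(1)[OF keeps_bw(7)] that by (simp add: ok_ix_upd)
  show "ar (bw_body x m) 0 i = ar m 0 i" for x m i using keepsD[OF keeps_bw(7)] by simp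
  show "okB x (bw_leaves x m)" if "okB x m" for x m using ok_bw(1)[OF keeps_bw(8)] that by simp
qed

section \<open>The program computes the estimator\<close>

text \<open>A node of level \<open>Suc t\<close> splits with \<open>g = t + 321\<close>, which is
  its level plus 320.\<close>

definition nodeT :: "ctx => mem => int => nat => box" where
  "nodeT x m i j = grid.leaf (Fq x) (seeds x m 0) (Jc x) (kapN (len x)) (int (E1N (len x))) (int (E2N (len x)))
     (ar m 8 i + 320) (ar m 6 i) (ar m 7 i) (dN (len x))
     (ar m 4 i + 1 + seeds x m (nat (ar m 8 i)) (clog (width (bx m i))) j) (bx m i)"

text \<open>Correctness of one edge of the tree. It mentions only the entries of the child and of
  its parent and therefore survives the writing of later nodes.\<close>

definition node_ok :: "ctx => mem => nat => bool" where
  "node_ok x m w \<longleftrightarrow> (let e = w mod Nc x; T = nodeT x m (int (w div Nc x)) (e div (Kc x * Rc x * Rc x)) in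
     bx m (int w + 1) = grid.cell (Fq x) (seeds x m 0) (Jc x) (kapN (len x)) T
       (e mod (Kc x * Rc x * Rc x) div (Rc x * Rc x)) (e mod Rc x) (e mod (Rc x * Rc x) div Rc x) \<and>
     ar m 8 (int w + 1) = ar m 8 (int (w div Nc x)) - 1 \<and> ar m 12 (int w + 1) = width T)"

lemma fw_loop_val:
  assumes M: "M = loop 1 (fw_step x) n (fw_init x m)"
  shows "keeps {10,14} m M" "ar M 14 0 = ar m 14 0" "ar M 10 4 = fw_x x m"
    "Tb M = (grid.descend (Fq x) (seeds x m 0) (Jc x) (kapN (len x)) (int (E1N (len x))) (int (E2N (len x)))
       (fw_g x m) (fw_bl x m) (fw_bh x m) (fw_x x m) ^^ n) (bx m (int (par_ix x m)))"
proof -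
  let ?D = "grid.descend (Fq x) (seeds x m 0) (Jc x) (kapN (len x)) (int (E1N (len x))) (int (E2N (len x)))
       (fw_g x m) (fw_bl x m) (fw_bh x m) (fw_x x m)"
  let ?B = "bx m (int (par_ix x m))"
  have "keeps {10,14} m M \<and> ar M 14 0 = ar m 14 0 \<and> ar M 10 4 = fw_x x m \<and> Tb M = (?D ^^ n) ?B"
    unfolding M loop_def
  proof (induction n)
    case 0
    have "Tb (fw_init x m) = ?B" by (simp add: Tb_def bx_def fw_init_def ar_upd)
    moreover have "ar (fw_init x m) 10 4 = fw_x x m" by (simp add: fw_init_def ar_upd)
    ultimately show ?case using keepsD[OF keeps_fw(1)[of m x], of 14 0] keeps_mono[OF keeps_fw(1)[of m x], of "{10,14}"] by simp
  next
    case (Suc n)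
    define M' where "M' = forl (\<lambda>k m. fw_step x (upd 14 1 k m)) n (fw_init x m)"
    define M1 where "M1 = upd 14 1 (int n) M'"
    note IH = Suc.IH[folded M'_def]
    have k1: "keeps {10,14} m M1" unfolding M1_def by (rule keeps_upd) (use IH in auto)
    have i1: "ar M1 14 0 = ar m 14 0" "ar M1 10 4 = fw_x x m" "Tb M1 = (?D ^^ n) ?B"
      using IH by (simp_all add: M1_def ar_upd Tb_def)
    have p: "par_ix x M1 = par_ix x m" using i1(1) by (simp add: par_ix_def ix_def)
    have g: "fw_g x M1 = fw_g x m" "fw_bl x M1 = fw_bl x m" "fw_bh x M1 = fw_bh x m"
      using keepsD[OF k1] by (simp_all add: fw_g_def fw_bl_def fw_bh_def p)
    have s: "seeds x M1 = seeds x m" using keeps_seeds[OF k1] by simp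
    have "Tb (fw_step x M1) = ?D (Tb M1)" by (simp add: fw_step_Tb g s i1)
    moreover have "keeps {10,14} m (fw_step x M1)" using keeps_trans[OF k1 keeps_mono[OF keeps_fw(4)]] by simp
    moreover have "ar (fw_step x M1) 14 0 = ar m 14 0" using keepsD[OF keeps_fw(4)] i1 by simp
    ultimately show ?case using i1 by (simp add: fw_step_Tb(2) M1_def M'_def)
  qed
  then show "keeps {10,14} m M" "ar M 14 0 = ar m 14 0" "ar M 10 4 = fw_x x m" "Tb M = (?D ^^ n) ?B" by auto
qed

lemma fw_body_val:
  assumes ix: "ix 0 m = w"
  shows "node_ok x (fw_body x m) w"
    "i \<noteq> int w + 1 ==> r \<in> {4,5,6,7,8,12} ==> ar (fw_body x m) r i = ar m r i"
    "i \<noteq> int w + 1 ==> bx (fw_body x m) i = bx m i"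
proof -
  define M where "M = loop 1 (fw_step x) (dN (len x)) (fw_init x m)"
  note v = fw_loop_val[OF M_def]
  have b: "fw_body x m = fw_write x M" by (simp add: fw_body_def M_def)
  have ix': "ix 0 M = w" using v(2) ix by (simp add: ix_def)
  show o: "i \<noteq> int w + 1 ==> r \<in> {4,5,6,7,8,12} ==> ar (fw_body x m) r i = ar m r i" for i r
    unfolding b fw_write_def Let_def using keepsD[OF v(1)] ix' by (auto simp: ar_upd)
  then show ob: "i \<noteq> int w + 1 ==> bx (fw_body x m) i = bx m i" for i by (simp add: bx_def)
  have ne: "int (w div Nc x) \<noteq> int w + 1" using div_le_dividend[of w "Nc x"] by linarith
  have p: "par_ix x m = w div Nc x" "par_ix x M = w div Nc x" by (simp_all add: par_ix_def ix ix')
  have sd: "seeds x (fw_body x m) = seeds x m" "seeds x M = seeds x m"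
    using keeps_seeds[OF keeps_fw(6)] keeps_seeds[OF v(1)] by auto
  have T: "Tb M = nodeT x (fw_body x m) (int (w div Nc x)) (w mod Nc x div (Kc x * Rc x * Rc x))"
    unfolding v(4) nodeT_def grid.leaf_def
    by (simp add: o[OF ne] ob[OF ne] sd fw_g_def fw_bl_def fw_bh_def fw_x_def p smp_ix_def child_ix_def ix)
  have "bx (fw_body x m) (int w + 1) = grid.cell (Fq x) (seeds x m 0) (Jc x) (kapN (len x)) (Tb M) (col_ix x M) (lo_ix x M) (hi_ix x M)"
    "ar (fw_body x m) 8 (int w + 1) = ar m 8 (int (w div Nc x)) - 1" "ar (fw_body x m) 12 (int w + 1) = width (Tb M)"
    unfolding b fw_write_def Let_def bx_def grid.cell_def using keepsD[OF v(1)] ix' by (simp_all add: ar_upd sd p)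
  then show "node_ok x (fw_body x m) w"
    unfolding node_ok_def Let_def T[symmetric] sd by (simp add: o[OF ne] col_ix_def lo_ix_def hi_ix_def child_ix_def ix')
qed

lemma node_ok_cong:
  assumes "\<And>i r. i \<in> {int w + 1, int (w div Nc x)} ==> r \<in> {4,5,6,7,8,12} ==> ar m' r i = ar m r i" "seeds x m' = seeds x m"
  shows "node_ok x m' w = node_ok x m w"
  unfolding node_ok_def Let_def nodeT_def bx_def by (simp add: assms)

lemma forward_val:
  assumes M: "M = forward x m"
  shows "keeps {4,5,6,7,8,10,12,14} m M" "w < Nc x * innerN x ==> node_ok x M w" "bx M 0 = bx m 0" "ar M 8 0 = ar m 8 0"
proof -
  let ?S = "{4,5,6,7,8,10,12,14} :: nat set"
  have "keeps ?S m (forl (\<lambda>k m. fw_body x (upd 14 0 k m)) n m) \<and> (\<forall>w<n. node_ok x (forl (\<lambda>k m. fw_body x (upd 14 0 k m)) n m) w) \<and>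
    bx (forl (\<lambda>k m. fw_body x (upd 14 0 k m)) n m) 0 = bx m 0 \<and> ar (forl (\<lambda>k m. fw_body x (upd 14 0 k m)) n m) 8 0 = ar m 8 0" for n
  proof (induction n)
    case (Suc n)
    define M' where "M' = forl (\<lambda>k m. fw_body x (upd 14 0 k m)) n m"
    define M1 where "M1 = upd 14 0 (int n) M'"
    note IH = Suc.IH[folded M'_def]
    have k1: "keeps ?S m M1" unfolding M1_def by (rule keeps_upd) (use IH in auto)
    have ix: "ix 0 M1 = n" by (simp add: M1_def ix_def ar_upd)
    note v = fw_body_val[OF ix, where x = x]
    have sd: "seeds x (fw_body x M1) = seeds x M1" using keeps_seeds[OF keeps_fw(6)] by simp
    have "node_ok x (fw_body x M1) w" if "w < Suc n" for w
    proof (cases "w = n")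
      case False
      then have "w < n" using that by simp
      have "int (w div Nc x) \<noteq> int n + 1" using div_le_dividend[of w "Nc x"] \<open>w < n\<close> by linarith
      then have "node_ok x (fw_body x M1) w = node_ok x M1 w"
        using \<open>w < n\<close> by (intro node_ok_cong v(2) sd) auto
      also have "\<dots> = node_ok x M' w" by (rule node_ok_cong) (auto simp: M1_def ar_upd ok_ix_upd)
      finally show ?thesis using IH \<open>w < n\<close> by simp
    qed (simp add: v)
    moreover have "keeps ?S m (fw_body x M1)" by (rule keeps_trans[OF k1 keeps_fw(6)])
    moreover have "bx (fw_body x M1) 0 = bx m 0" "ar (fw_body x M1) 8 0 = ar m 8 0"
      using v(2)[of 0 8] v(3)[of 0] IH by (simp_all add: M1_def ok_ix_upd ar_upd)
    ultimately show ?case by (simp add: M1_def M'_def)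
  qed (simp add: keeps_refl)
  from this[of "Nc x * innerN x"]
  show "keeps ?S m M" "w < Nc x * innerN x ==> node_ok x M w" "bx M 0 = bx m 0" "ar M 8 0 = ar m 8 0"
    unfolding M forward_def loop_def by auto
qed

text \<open>The numbering of children follows the same recursion as \<open>node_count\<close>, so
  that the children of one layer fill exactly the next one, and the stored level drops by one from
  layer to layer.\<close>

lemma node_level:
  assumes ok: "\<And>w. w < Nc x * innerN x ==> node_ok x m w" and root: "ar m 8 0 = int (levels x)"
  shows "i <= Nc x * innerN x ==> node_count (Nc x) s <= i ==> i < node_count (Nc x) (Suc s) ==> ar m 8 (int i) = int (levels x) - int s"
proof (induction i arbitrary: s rule: less_induct)
  case (less i)
  show ?case
  proof (cases i)
    case 0
    then have "s = 0" using less.prems(2) by (cases s) auto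
    then show ?thesis using root 0 by simp
  next
    case (Suc w)
    let ?p = "w div Nc x"
    obtain s' where s': "s = Suc s'" using less.prems(3) Suc by (cases s) auto
    have "node_count (Nc x) s' <= ?p"
      using less.prems(2) Suc s' by (simp add: less_eq_div_iff_mult_less_eq)
    moreover have "?p < node_count (Nc x) (Suc s')"
    proof (rule ccontr)
      assume "\<not> ?p < node_count (Nc x) (Suc s')"
      then have "node_count (Nc x) (Suc s') * Nc x <= w" by (simp add: less_eq_div_iff_mult_less_eq not_less)
      then show False using less.prems(3) Suc s' by simp
    qed
    moreover have "?p < i" using div_le_dividend[of w "Nc x"] Suc by linarith
    ultimately have "ar m 8 (int ?p) = int (levels x) - int s'" using less.IH[of ?p s'] less.prems(1) by simp
    moreover have "ar m 8 (int i) = ar m 8 (int ?p) - 1"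
      using ok[of w] less.prems(1) Suc by (simp add: node_ok_def Let_def add.commute)
    ultimately show ?thesis using s' by simp
  qed
qed

lemma node_count_ex: "i < node_count c t ==> \<exists>s<t. node_count c s <= i \<and> i < node_count c (Suc s)"
proof (induction t)
  case (Suc t)
  then show ?case by (cases "i < node_count c t") (auto simp: less_Suc_eq not_less simp del: node_count.simps(2))
qed simp

lemma bmax_cong: "(\<And>i. i < k ==> g i = h i) ==> bmax k g = bmax k h"
  by (induction k) auto

lemma bw_chains_val:
  assumes i: "bw_node x m = i" and j: "ix 1 m = j"
    and y: "\<And>c q p. c < Kc x ==> q < Rc x ==> p < Rc x ==>
      (let k = int (i * Nc x + ((j * Kc x + c) * Rc x + q) * Rc x + p + 1) in ar m 6 k = y p \<and> ar m 7 k = y q \<and> ar m 9 k = V c p q)"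
    and c: "c < Kc x" "q < Rc x"
  shows "ar (bw_chains x m) 11 (int (c * Rc x + q)) = dp (Rc x) y V (Suc c) q"
proof -
  let ?R = "Rc x"
  define B where "B = (\<lambda>n. forl (\<lambda>k m. bw_chain x (upd 14 2 k m)) n m)"
  have "n <= Kc x * ?R ==> keeps {11,14} m (B n) \<and> ar (B n) 14 0 = ar m 14 0 \<and> ar (B n) 14 1 = ar m 14 1 \<and>
    (\<forall>c'<n. ar (B n) 11 (int c') = dp ?R y V (Suc (c' div ?R)) (c' mod ?R))" for n
  proof (induction n)
    case (Suc n)
    define M where "M = upd 14 2 (int n) (B n)"
    have BS: "B (Suc n) = bw_chain x M" by (simp add: B_def M_def)
    have IH: "keeps {11,14} m (B n)" "ar (B n) 14 0 = ar m 14 0" "ar (B n) 14 1 = ar m 14 1"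
      "\<And>c'. c' < n ==> ar (B n) 11 (int c') = dp ?R y V (Suc (c' div ?R)) (c' mod ?R)" using Suc by auto
    have k1: "keeps {11,14} m M" unfolding M_def by (rule keeps_upd) (use IH in auto)
    have x0: "bw_node x M = i" "ix 1 M = j" "ix 2 M = n"
      using IH i j by (simp_all add: M_def ix_def ar_upd bw_node_def)
    let ?c = "n div ?R" and ?q = "n mod ?R"
    have cq: "?c < Kc x" "?q < ?R" using Suc.prems by (auto simp: less_mult_imp_div_less)
    have n: "n = ?c * ?R + ?q" by simp
    have e: "bw_edge x M = i * Nc x + ((j * Kc x + ?c) * ?R + ?q) * ?R"
    proof -
      have "(j * Kc x + ?c) * ?R + ?q = j * (Kc x * ?R) + n" by (simp add: add_mult_distrib)
      then show ?thesis by (simp add: bw_edge_def x0)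
    qed
    have arM: "ar M r k = ar m r k" if "r < 16" "r \<noteq> 11" "r \<noteq> 14" for r k using keepsD[OF k1] that by simp
    have val: "ar (bw_chain x M) 11 (int n) = dp ?R y V (Suc ?c) ?q"
    proof -
      have "ar (bw_chain x M) 11 (int n) = bmax ?R (\<lambda>p. if ar M 6 (int (bw_edge x M + p + 1)) <= ar M 7 (int (bw_edge x M + p + 1))
         then (if n < ?R then 0 else ar M 11 (int (n - ?R - ?q + p))) + ar M 9 (int (bw_edge x M + p + 1)) else 0)"
        unfolding bw_chain_def x0 by (simp add: ar_upd)
      also have "\<dots> = dp ?R y V (Suc ?c) ?q" unfolding dp.simps
      proof (rule bmax_cong)
        fix p assume p: "p < ?R"
        note yp = y[OF cq p, unfolded Let_def]
        have "(if n < ?R then 0 else ar M 11 (int (n - ?R - ?q + p))) = dp ?R y V ?c p"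
        proof (cases ?c)
          case 0
          then show ?thesis using RN_pos[of "len x"] by (auto simp: div_eq_0_iff)
        next
          case (Suc c0)
          then have "n = ?R + c0 * ?R + ?q" using n by simp
          then have "n - ?R - ?q + p = c0 * ?R + p" "\<not> n < ?R" "c0 * ?R + p < n" using p by linarith+
          moreover have "ar M 11 (int (c0 * ?R + p)) = ar (B n) 11 (int (c0 * ?R + p))" by (simp add: M_def ar_upd)
          moreover have "(c0 * ?R + p) div ?R = c0" "(c0 * ?R + p) mod ?R = p" using p by simp_all
          ultimately show ?thesis using IH(4)[of "c0 * ?R + p"] Suc by simp
        qed
        then show "(if ar M 6 (int (bw_edge x M + p + 1)) <= ar M 7 (int (bw_edge x M + p + 1))
         then (if n < ?R then 0 else ar M 11 (int (n - ?R - ?q + p))) + ar M 9 (int (bw_edge x M + p + 1)) else 0) =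
         (if y p <= y ?q then dp ?R y V ?c p + V ?c p ?q else 0)"
          using yp by (simp add: e arM)
      qed
      finally show ?thesis .
    qed
    have o: "ar (bw_chain x M) 11 (int c') = ar (B n) 11 (int c')" if "c' < n" for c'
      using that by (simp add: bw_chain_def ar_upd x0) (simp add: M_def ar_upd)
    have "keeps {11,14} m (bw_chain x M)" by (rule keeps_trans[OF k1 keeps_mono[OF keeps_bw(1)]]) simp
    moreover have "ar (bw_chain x M) 14 0 = ar m 14 0" "ar (bw_chain x M) 14 1 = ar m 14 1"
      using IH by (simp_all add: bw_14, simp_all add: M_def ar_upd)
    ultimately show ?case unfolding BS using val o IH(4) by (auto simp: less_Suc_eq)
  qed (simp add: B_def keeps_refl)
  from this[of "Kc x * ?R"] have "\<forall>c'<Kc x * ?R. ar (B (Kc x * ?R)) 11 (int c') = dp ?R y V (Suc (c' div ?R)) (c' mod ?R)" by blast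
  moreover have "c * ?R + q < Kc x * ?R"
  proof -
    have "Suc c * ?R <= Kc x * ?R" using c by (intro mult_right_mono) auto
    then show ?thesis using c by simp
  qed
  ultimately have "ar (B (Kc x * ?R)) 11 (int (c * ?R + q)) = dp ?R y V (Suc ((c * ?R + q) div ?R)) ((c * ?R + q) mod ?R)"
    by blast
  moreover have "(c * ?R + q) div ?R = c" "(c * ?R + q) mod ?R = q" using c by simp_all
  ultimately show ?thesis unfolding bw_chains_def loop_def B_def by (simp only:)
qed

lemma edge_index:
  fixes K R J j :: nat
  assumes "c < K" "q < R" "p < R"
  defines "e \<equiv> ((j * K + c) * R + q) * R + p"
  shows "e div (K * R * R) = j" "e mod (K * R * R) div (R * R) = c" "e mod (R * R) div R = q" "e mod R = p"
    "j < J ==> e < J * K * R * R"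
proof -
  have "Suc q * R <= R * R" using assms by (intro mult_right_mono) auto
  then have 1: "q * R + p < R * R" using assms by simp
  have "Suc c * (R * R) <= K * (R * R)" using assms by (intro mult_right_mono) auto
  then have 2: "c * (R * R) + (q * R + p) < K * R * R" using 1 by (simp add: mult.assoc)
  have e1: "e = j * (K * R * R) + (c * (R * R) + (q * R + p))" unfolding e_def by (simp add: algebra_simps)
  have e2: "e = (j * K + c) * (R * R) + (q * R + p)" unfolding e_def by (simp add: algebra_simps)
  have dm: "(a * N + r) div N = a" "(a * N + r) mod N = r" if "r < N" for a N r :: nat using that by simp_all
  show "e div (K * R * R) = j" unfolding e1 by (rule dm(1)[OF 2])
  have "e mod (K * R * R) = c * (R * R) + (q * R + p)" unfolding e1 by (rule dm(2)[OF 2])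
  then show "e mod (K * R * R) div (R * R) = c" by (simp only: dm(1)[OF 1])
  have "e mod (R * R) = q * R + p" unfolding e2 by (rule dm(2)[OF 1])
  then show "e mod (R * R) div R = q" using assms by simp
  show "e mod R = p" unfolding e_def using assms by simp
  show "e < J * K * R * R" if "j < J"
  proof -
    have "Suc j * (K * R * R) <= J * (K * R * R)" using that by (intro mult_right_mono) auto
    then show ?thesis using 2 unfolding e1 by (simp add: mult.assoc)
  qed
qed

abbreviation gdensity where
  "gdensity x m V T \<equiv> grid.density (Fq x) (seeds x m 0) (Jc x) (kapN (len x)) (QN (len x)) V T"

abbreviation gcell where
  "gcell x m T \<equiv> grid.cell (Fq x) (seeds x m 0) (Jc x) (kapN (len x)) T"

lemma node_ok_edge:
  assumes ok: "\<And>w. w < Nc x * innerN x ==> node_ok x m w" and i: "i < innerN x" and j: "j < Jc x"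
    and cqp: "c < Kc x" "q < Rc x" "p < Rc x"
  defines "k \<equiv> i * Nc x + ((j * Kc x + c) * Rc x + q) * Rc x + p + 1" and "T \<equiv> nodeT x m (int i) j"
  shows "bx m (int k) = gcell x m T c p q" "ar m 12 (int k) = width T" "ar m 8 (int k) = ar m 8 (int i) - 1"
    "k <= Nc x * innerN x" "i < k"
proof -
  define e where "e = ((j * Kc x + c) * Rc x + q) * Rc x + p"
  note E = edge_index[OF cqp, of j, folded e_def]
  have eN: "e < Nc x" using E(5)[OF j] by (simp add: childN_def)
  have "Suc i * Nc x <= innerN x * Nc x" using i by (intro mult_right_mono) auto
  then have w: "i * Nc x + e < Nc x * innerN x" using eN by (simp add: mult.commute)
  have d: "(i * Nc x + e) div Nc x = i" "(i * Nc x + e) mod Nc x = e" using eN by simp_all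
  have k: "int k = int (i * Nc x + e) + 1" "k = Suc (i * Nc x + e)" by (simp_all add: k_def e_def)
  show "bx m (int k) = gcell x m T c p q" "ar m 12 (int k) = width T" "ar m 8 (int k) = ar m 8 (int i) - 1"
    using ok[OF w] unfolding node_ok_def Let_def d E k(1) T_def by simp_all
  show "k <= Nc x * innerN x" using w k(2) by simp
  have "i <= i * Nc x" using childN_pos[of "len x"] by (cases "Nc x") auto
  then show "i < k" unfolding k(2) by linarith
qed

lemma bw_body_val:
  assumes i: "bw_node x m = i" "i < innerN x" and ok: "\<And>w. w < Nc x * innerN x ==> node_ok x m w"
    and V: "\<And>k. i < k ==> k <= Nc x * innerN x ==> ar m 8 (int k) = ar m 8 (int i) - 1 ==> ar m 9 (int k) = V (bx m (int k))"
  shows "ar (bw_body x m) 9 (int i) = (case bx m (int i) of (a, b, bl, bh) => 2 ^ clog (b - a) * (\<Sum>j<Jc x.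
      let z = a + 1 + seeds x m (nat (ar m 8 (int i))) (clog (b - a)) j in if z <= b then
        int (gdensity x m V (grid.leaf (Fq x) (seeds x m 0) (Jc x) (kapN (len x)) (int (E1N (len x))) (int (E2N (len x)))
          (ar m 8 (int i) + 320) bl bh (dN (len x)) z (a, b, bl, bh))) else 0))"
    "k \<noteq> int i ==> ar (bw_body x m) 9 k = ar m 9 k"
proof -
  define A where "A = (\<lambda>j. if ar m 4 (int i) + 1 + seeds x m (nat (ar m 8 (int i))) (clog (width (bx m (int i)))) j <= ar m 5 (int i)
     then 2 ^ clog (width (bx m (int i))) * int (gdensity x m V (nodeT x m (int i) j)) else 0)"
  define B where "B = (\<lambda>n. forl (\<lambda>k m. bw_sample x (upd 14 1 k m)) n m)"
  have B: "n <= Jc x ==> keeps {11,13,14} m (B n) \<and> ar (B n) 14 0 = ar m 14 0 \<and> (\<forall>j<n. ar (B n) 13 (int j) = A j)" for n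
  proof (induction n)
    case (Suc n)
    then have n: "n < Jc x" by simp
    define M where "M = upd 14 1 (int n) (B n)"
    define C where "C = bw_chains x M"
    have BS: "B (Suc n) = bw_alpha x C" by (simp add: B_def M_def C_def bw_sample_def)
    have IH: "keeps {11,13,14} m (B n)" "ar (B n) 14 0 = ar m 14 0" "\<And>j. j < n ==> ar (B n) 13 (int j) = A j"
      using Suc by auto
    have k1: "keeps {11,13,14} m M" unfolding M_def by (rule keeps_upd) (use IH in auto)
    have k2: "keeps {11,13,14} m C" unfolding C_def by (rule keeps_trans[OF k1 keeps_mono[OF keeps_bw(5)]]) auto
    have M0: "bw_node x M = i" "ix 1 M = n" using IH i by (simp_all add: M_def ix_def ar_upd bw_node_def)
    have C0: "bw_node x C = i" "ix 1 C = n" "ar C 14 0 = ar m 14 0"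
      using M0 IH by (simp_all add: C_def ix_def bw_node_def bw_14 M_def ar_upd)
    have arM: "ar M r k = ar m r k" and arC: "ar C r k = ar m r k" if "r < 16" "r \<notin> {11,13,14}" for r k
      using keepsD[OF k1 that] keepsD[OF k2 that] by auto
    define T where "T = nodeT x m (int i) n"
    define V' where "V' = (\<lambda>c p q. V (gcell x m T c p q))"
    have "ar C 11 (int ((Kc x - 1) * Rc x + q)) = dp (Rc x) (growv x m T) V' (Suc (Kc x - 1)) q" if "q < Rc x" for q
      unfolding C_def
    proof (rule bw_chains_val[OF M0])
      fix c q p assume cqp: "c < Kc x" "q < Rc x" "p < Rc x"
      define k where "k = i * Nc x + ((n * Kc x + c) * Rc x + q) * Rc x + p + 1"
      note N = node_ok_edge[OF ok i(2) n cqp, folded T_def k_def]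
      have "ar m 6 (int k) = growv x m T p" "ar m 7 (int k) = growv x m T q"
        using N(1) by (simp_all add: bx_def grid.cell_def)
      moreover have "ar m 9 (int k) = V' c p q" using V[OF N(5,4,3)] N(1) by (simp add: V'_def)
      ultimately show "let k = int (i * Nc x + ((n * Kc x + c) * Rc x + q) * Rc x + p + 1) in
          ar M 6 k = growv x m T p \<and> ar M 7 k = growv x m T q \<and> ar M 9 k = V' c p q"
        unfolding k_def[symmetric] Let_def by (simp add: arM)
    qed (use that KN_pos[of "len x"] in auto)
    then have "bmax (Rc x) (\<lambda>q. ar C 11 (int ((Kc x - 1) * Rc x + q))) = bmax (Rc x) (dp (Rc x) (growv x m T) V' (Kc x))"
      by (intro bmax_cong) (simp add: Suc_diff_1[OF KN_pos[of "len x"]])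
    then have e: "bmax (Rc x) (\<lambda>q. ar C 11 (int ((Kc x - 1) * Rc x + q))) = grid.est (Fq x) (seeds x m 0) (Jc x) (kapN (len x)) V T"
      by (simp only: grid.est_def best_chain_def V'_def KN_def RN_def)
    have w: "ar C 12 (int (i * Nc x + n * (Kc x * Rc x * Rc x) + 1)) = width T"
      using node_ok_edge(2)[OF ok i(2) n, of 0 0 0, folded T_def] by (simp add: arC mult.assoc)
    have "ar (bw_alpha x C) 13 (int n) = A n"
      unfolding bw_alpha_def C0 e w A_def T_def[symmetric] grid.density_def
      by (simp add: ar_upd C0 bw_x_def arC keeps_bx[OF k2] keeps_seeds[OF k2])
    moreover have "ar (bw_alpha x C) 13 (int j) = ar (B n) 13 (int j)" if "j < n" for j
    proof -
      have "ar C 13 (int j) = ar M 13 (int j)" unfolding C_def using keepsD[OF keeps_bw(5)] by simp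
      then show ?thesis using that by (simp add: bw_alpha_def ar_upd C0 M_def)
    qed
    moreover have "keeps {11,13,14} m (bw_alpha x C)" by (rule keeps_trans[OF k2 keeps_mono[OF keeps_bw(2)]]) auto
    moreover have "ar (bw_alpha x C) 14 0 = ar m 14 0" by (simp add: bw_14 C0)
    ultimately show ?case unfolding BS using IH(3) by (auto simp: less_Suc_eq)
  qed (simp add: B_def keeps_refl)
  let ?M = "B (Jc x)"
  have b: "bw_body x m = bw_val x ?M" by (simp add: bw_body_def loop_def B_def)
  note BJ = B[OF order_refl]
  have n: "bw_node x ?M = i" using BJ i by (simp add: bw_node_def ix_def)
  have "ar (bw_body x m) 9 (int i) = (\<Sum>j<Jc x. A j)" unfolding b bw_val_def using BJ by (simp add: ar_upd n)
  also have "\<dots> = 2 ^ clog (width (bx m (int i))) * (\<Sum>j<Jc x. if ar m 4 (int i) + 1 + seeds x m (nat (ar m 8 (int i)))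
      (clog (width (bx m (int i)))) j <= ar m 5 (int i) then int (gdensity x m V (nodeT x m (int i) j)) else 0)"
    unfolding A_def sum_distrib_left by (intro sum.cong) auto
  finally show "ar (bw_body x m) 9 (int i) = (case bx m (int i) of (a, b, bl, bh) => 2 ^ clog (b - a) * (\<Sum>j<Jc x.
      let z = a + 1 + seeds x m (nat (ar m 8 (int i))) (clog (b - a)) j in if z <= b then
        int (gdensity x m V (grid.leaf (Fq x) (seeds x m 0) (Jc x) (kapN (len x)) (int (E1N (len x))) (int (E2N (len x)))
          (ar m 8 (int i) + 320) bl bh (dN (len x)) z (a, b, bl, bh))) else 0))"
    unfolding nodeT_def bx_def width_def Let_def prod.case .
  show "ar (bw_body x m) 9 k = ar m 9 k" if "k \<noteq> int i"
    unfolding b bw_val_def using keepsD[OF conjunct1[OF BJ], of 9 k] that by (simp add: ar_upd n)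
qed

abbreviation gav where
  "gav x m t B \<equiv> grid.av (Fq x) (seeds x m 0) (Jc x) (kapN (len x)) (int (E1N (len x))) (int (E2N (len x)))
     (\<lambda>t. seeds x m (Suc t)) (QN (len x)) (dN (len x)) t B"

lemma bw_leaves_val:
  assumes "w <= Nc x * innerN x"
  shows "ar (bw_leaves x m) 9 (int w) = gav x m 0 (bx m (int w))"
proof -
  have "keeps {9,14} m (forl (\<lambda>k m. bw_leaf x (upd 14 0 k m)) n m) \<and>
     (\<forall>w<n. ar (forl (\<lambda>k m. bw_leaf x (upd 14 0 k m)) n m) 9 (int w) = gav x m 0 (bx m (int w)))" for n
  proof (induction n)
    case (Suc n)
    define B where "B = forl (\<lambda>k m. bw_leaf x (upd 14 0 k m)) n m"
    define M where "M = upd 14 0 (int n) B"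
    have IH: "keeps {9,14} m B" "\<And>w. w < n ==> ar B 9 (int w) = gav x m 0 (bx m (int w))" using Suc by (auto simp: B_def)
    have k1: "keeps {9,14} m M" unfolding M_def by (rule keeps_upd) (use IH in auto)
    have n: "ix 0 M = n" by (simp add: M_def ix_def ar_upd)
    have "ar (bw_leaf x M) 9 (int w) = gav x m 0 (bx m (int w))" if "w < Suc n" for w
    proof (cases "w = n")
      case True
      then show ?thesis
        by (simp add: bw_leaf_def ar_upd n keeps_bx[OF k1] keeps_seeds[OF k1] grid.av.simps)
    next
      case False
      then show ?thesis using IH(2)[of w] that by (simp add: bw_leaf_def ar_upd n) (simp add: M_def ar_upd)
    qed
    moreover have "keeps {9,14} m (bw_leaf x M)" by (rule keeps_trans[OF k1 keeps_mono[OF keeps_bw(4)]]) auto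
    ultimately show ?case unfolding forl.simps by (simp only: M_def B_def simp_thms) auto
  qed (simp add: keeps_refl)
  then show ?thesis using assms unfolding bw_leaves_def loop_def by (metis Suc_eq_plus1 less_Suc_eq_le)
qed

lemma backward_val:
  assumes ok: "\<And>w. w < Nc x * innerN x ==> node_ok x m w"
    and lev: "\<And>i. i < innerN x ==> 0 < ar m 8 (int i)" "\<And>i. innerN x <= i ==> i <= Nc x * innerN x ==> ar m 8 (int i) = 0"
    and pos: "0 < innerN x"
  shows "ar (backward x m) 9 0 = gav x m (nat (ar m 8 0)) (bx m 0)"
proof -
  define B where "B = (\<lambda>n. forl (\<lambda>k m. bw_body x (upd 14 0 k m)) n (bw_leaves x m))"
  \<comment> \<open>The invariant: after \<open>n\<close> rounds, all nodes from number
    \<open>innerN x - n\<close> on have their final values.\<close>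
  have "n <= innerN x ==> keeps {9,11,13,14} m (B n) \<and> (\<forall>i. innerN x - n <= i --> i <= Nc x * innerN x -->
      ar (B n) 9 (int i) = gav x m (nat (ar m 8 (int i))) (bx m (int i)))" for n
  proof (induction n)
    case 0
    have "keeps {9,11,13,14} m (bw_leaves x m)" by (rule keeps_mono[OF keeps_bw(8)]) auto
    then show ?case unfolding B_def by (auto simp: lev(2) bw_leaves_val)
  next
    case (Suc n)
    define M where "M = upd 14 0 (int n) (B n)"
    define i where "i = innerN x - Suc n"
    have IH: "keeps {9,11,13,14} m (B n)" "\<And>i. innerN x - n <= i ==> i <= Nc x * innerN x ==>
      ar (B n) 9 (int i) = gav x m (nat (ar m 8 (int i))) (bx m (int i))" using Suc by auto
    have k1: "keeps {9,11,13,14} m M" unfolding M_def by (rule keeps_upd) (use IH in auto)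
    have i: "bw_node x M = i" "i < innerN x" "innerN x - n = Suc i" using Suc.prems by (auto simp: bw_node_def ix_def M_def ar_upd i_def)
    have sd: "seeds x M = seeds x m" using keeps_seeds[OF k1] by simp
    have bxM: "bx M k = bx m k" for k using keeps_bx[OF k1] by simp
    have ar8: "ar M 8 k = ar m 8 k" for k using keepsD[OF k1] by simp
    obtain t where t: "ar m 8 (int i) = int (Suc t)" using lev(1)[OF i(2)] by (metis gr0_implies_Suc of_nat_0_less_iff zero_less_imp_eq_int)
    have okM: "node_ok x M w" if "w < Nc x * innerN x" for w
    proof -
      have "node_ok x M w = node_ok x m w" by (rule node_ok_cong) (use keepsD[OF k1] sd in auto)
      then show ?thesis using ok[OF that] by simp
    qed
    have VM: "ar M 9 (int k) = gav x m t (bx M (int k))" if "i < k" "k <= Nc x * innerN x" "ar M 8 (int k) = ar M 8 (int i) - 1" for k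
    proof -
      have "ar M 9 (int k) = gav x m (nat (ar m 8 (int k))) (bx m (int k))"
        using IH(2)[of k] that i(3) by (simp add: M_def ar_upd)
      moreover have "nat (ar m 8 (int k)) = t" using that(3) t by (simp add: ar8)
      ultimately show ?thesis by (simp add: bxM)
    qed
    note v = bw_body_val[OF i(1,2) okM VM]
    have v1: "ar (bw_body x M) 9 (int i) = gav x m (nat (ar m 8 (int i))) (bx m (int i))"
    proof -
      have l: "ar M 8 (int i) + 320 = int t + 321" "nat (ar M 8 (int i)) = Suc t" "nat (ar m 8 (int i)) = Suc t"
        using t by (simp_all add: ar8)
      show ?thesis
        apply (subst bw_body_val(1)[where V = "gav x m t", OF i(1,2)])
          apply (erule okM)
         apply (rule VM; assumption)
        unfolding l bxM sd by (simp add: grid.av.simps)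
    qed
    have "ar (bw_body x M) 9 (int k) = gav x m (nat (ar m 8 (int k))) (bx m (int k))" if "i <= k" "k <= Nc x * innerN x" for k
    proof (cases "k = i")
      case False
      then have "ar (bw_body x M) 9 (int k) = ar M 9 (int k)" by (intro v(2)) simp_all
      then show ?thesis using IH(2)[of k] i(3) that False by (simp add: M_def ar_upd)
    qed (simp add: v1)
    moreover have "keeps {9,11,13,14} m (bw_body x M)" by (rule keeps_trans[OF k1 keeps_bw(7)])
    moreover have "B (Suc n) = bw_body x M" by (simp add: B_def M_def)
    ultimately show ?case by (auto simp: i_def)
  qed
  note final = conjunct2[OF this[OF order_refl], rule_format, of 0]
  have "ar (B (innerN x)) 9 (int 0) = gav x m (nat (ar m 8 (int 0))) (bx m (int 0))" by (rule final) simp_all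
  then show ?thesis by (simp add: backward_def loop_def B_def)
qed

theorem estimate_val:
  assumes root: "ar m 8 0 = int (levels x)"
  shows "ar (backward x (forward x m)) 9 0 = gav x m (levels x) (bx m 0)"
proof -
  let ?M = "forward x m"
  note f = forward_val[OF refl, where x = x and m = m]
  have r: "ar ?M 8 0 = int (levels x)" using f(4) root by simp
  note lv = node_level[OF f(2) r]
  have nc: "node_count (Nc x) (Suc (levels x)) = Nc x * innerN x + 1" by (simp add: innerN_def)
  have "0 < ar ?M 8 (int i)" if "i < innerN x" for i
  proof -
    have "\<exists>s<levels x. node_count (Nc x) s <= i \<and> i < node_count (Nc x) (Suc s)"
      by (rule node_count_ex) (use that in \<open>simp add: innerN_def\<close>)
    then obtain s where "s < levels x" "node_count (Nc x) s <= i" "i < node_count (Nc x) (Suc s)" by blast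
    then show ?thesis using lv[of i s] that innerN_le_nodes[of x] by simp
  qed
  moreover have "ar ?M 8 (int i) = 0" if "innerN x <= i" "i <= Nc x * innerN x" for i
    using lv[of i "levels x"] that nc by (simp add: innerN_def mult.commute)
  moreover have "0 < innerN x" by (simp add: innerN_def levels_def)
  ultimately have "ar (backward x ?M) 9 0 = gav x ?M (nat (ar ?M 8 0)) (bx ?M 0)" by (intro backward_val f(2))
  then show ?thesis using r f(3) keeps_seeds[OF f(1)] by simp
qed

section \<open>Initialization\<close>

text \<open>The second condition is the nontrivial case of the theorem. It bounds
  \<open>320 / \<tau>\<close> by \<open>64 * lamN\<close>, so that a short loop can compute the
  number of levels. Arrays 4 and 5 must be zero for the width bound in \<open>okB\<close>.\<close>

definition prm :: "ctx => mem => bool" where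
  "prm x m \<longleftrightarrow> 0 < par x \<and> 5 < lamN (len x) * par x \<and> ar m 1 1 = int (len x) \<and> ar m 1 2 = int (lamN (len x)) \<and>
     (\<forall>i. ar m 4 i = 0 \<and> ar m 5 i = 0)"

text \<open>Parameters are computed in stages, because later loops and products rely on values of
  earlier parameters in memory.\<close>

definition prm3 :: "ctx => mem => bool" where "prm3 x m \<longleftrightarrow> prm x m \<and> ar m 1 3 = int (rhoN (len x))"
definition prm4 :: "ctx => mem => bool" where "prm4 x m \<longleftrightarrow> prm3 x m \<and> ar m 1 15 = int (LamN (len x))"

lemma prm_local: "local_pred prm v" "local_pred prm3 v" "local_pred prm4 v"
  unfolding local_pred_def prm4_def prm3_def prm_def
  by (auto simp: agree_ar[where r = 1] agree_ar[where r = 4] agree_ar[where r = 5] agree_ar[where r = "Suc 0"])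

lemma prm_natp: "natp prm v (\<lambda>x m. len x)" "natp prm v (\<lambda>x m. lamN (len x))"
  by (rule natp_param[OF prm_local(1), of 1], simp add: prm_def, rule natp_param[OF prm_local(1), of 2], simp add: prm_def)

lemma prm4_natp: "natp prm4 v (\<lambda>x m. len x)" "natp prm4 v (\<lambda>x m. lamN (len x))" "natp prm4 v (\<lambda>x m. rhoN (len x))"
  "natp prm4 v (\<lambda>x m. LamN (len x))"
  by (rule natp_param[OF prm_local(3), of 1], simp add: prm4_def prm3_def prm_def,
      rule natp_param[OF prm_local(3), of 2], simp add: prm4_def prm3_def prm_def,
      rule natp_param[OF prm_local(3), of 3], simp add: prm4_def prm3_def prm_def,
      rule natp_param[OF prm_local(3), of 15], simp add: prm4_def prm3_def prm_def)

lemma natp_power: "natp P v i ==> small P i ==> natp P v (\<lambda>x m. i x m ^ k)"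
proof (induction k)
  case (Suc k)
  then show ?case unfolding power_Suc2 by (intro natp_mult) auto
qed (simp add: natp_const natp_local)

lemma prm4_params:
  "natp prm4 v (\<lambda>x m. JN (len x))" "natp prm4 v (\<lambda>x m. kapN (len x))" "natp prm4 v (\<lambda>x m. KN (len x))"
  "natp prm4 v (\<lambda>x m. QN (len x))" "natp prm4 v (\<lambda>x m. dN (len x))" "natp prm4 v (\<lambda>x m. E1N (len x))"
  "natp prm4 v (\<lambda>x m. E2N (len x))" "natp prm4 v (\<lambda>x m. RN (len x))" "natp prm4 v (\<lambda>x m. childN (len x))"
proof -
  note c = natp_const[OF prm_local(3)[of v]]
  have pw: "natp prm4 v (\<lambda>x m. k * LamN (len x) ^ l)" for k l
  proof (intro natp_mult c natp_power prm4_natp small_params)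
    show "small prm4 (\<lambda>x m. LamN (len x) ^ l)"
      by (rule small_polylog[where q = l]) (simp add: power_mono)
  qed
  show J: "natp prm4 v (\<lambda>x m. JN (len x))" unfolding JN_def by (rule pw)
  show K: "natp prm4 v (\<lambda>x m. KN (len x))" unfolding KN_eq by (rule pw)
  show "natp prm4 v (\<lambda>x m. QN (len x))" using pw[of "2 ^ 12" 1] unfolding QN_def by simp
  show "natp prm4 v (\<lambda>x m. E1N (len x))" "natp prm4 v (\<lambda>x m. E2N (len x))" unfolding E1N_def E2N_def by (rule pw)+
  show "natp prm4 v (\<lambda>x m. kapN (len x))" unfolding kapN_def
    by (intro natp_add natp_mult c prm4_natp small_polylog[OF params_le(9)])
  show "natp prm4 v (\<lambda>x m. dN (len x))" unfolding dN_def by (intro natp_add natp_mult c prm4_natp small_params)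
  show R: "natp prm4 v (\<lambda>x m. RN (len x))" unfolding RN_def by (intro natp_add c J)
  show "natp prm4 v (\<lambda>x m. childN (len x))" unfolding childN_def by (intro natp_mult J K R small_params)
qed

lemma levels_le: "0 < par x ==> 5 < lamN (len x) * par x ==> levels x <= 64 * lamN (len x) + 1"
proof -
  assume *: "0 < par x" "5 < lamN (len x) * par x"
  then have "320 / par x <= 64 * real (lamN (len x))" by (simp add: field_simps)
  then have "\<lfloor>320 / par x\<rfloor> <= int (64 * lamN (len x))" by linarith
  then show ?thesis by (simp add: levels_def)
qed

text \<open>The floor of \<open>320 / \<tau>\<close> is expressed by comparisons of
  \<open>\<tau>\<close> with fractions, the only access to \<open>\<tau>\<close> that the machine
  offers. Counting from \<open>i = 0\<close> accounts for the summand 1 in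
  \<open>levels\<close>.\<close>

lemma levels_eq_card:
  assumes "0 < par x" "levels x <= B"
  shows "levels x = card {i. i < B \<and> \<not> 320 < real i * par x}"
proof -
  have "\<not> 320 < real i * par x \<longleftrightarrow> i < levels x" for i
  proof -
    have "0 <= 320 / par x" using assms by simp
    have "\<not> 320 < real i * par x \<longleftrightarrow> real i <= 320 / par x" using assms by (simp add: field_simps not_less)
    also have "\<dots> \<longleftrightarrow> int i <= \<lfloor>320 / par x\<rfloor>" by (simp add: le_floor_iff)
    also have "\<dots> \<longleftrightarrow> i < levels x" using \<open>0 <= 320 / par x\<close> unfolding levels_def by (simp add: le_nat_iff less_Suc_eq_le)
    finally show ?thesis .
  qed
  then have "{i. i < B \<and> \<not> 320 < real i * par x} = {i. i < B \<and> i < levels x}" by (simp only:)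
  also have "\<dots> = {..<levels x}" using assms(2) by auto
  finally show ?thesis by simp
qed

lemma small_levels: "small prm4 (\<lambda>x m. levels x)"
proof (rule small_le)
  show "small prm4 (\<lambda>x m. 64 * lamN (len x) + 1)" by (intro small_add small_mult small_const small_params)
  show "levels x <= 64 * lamN (len x) + 1" if "prm4 x m" for x m
    using levels_le[of x] that unfolding prm4_def prm3_def prm_def by blast
qed

lemma natp_levels: "natp prm4 v (\<lambda>x m. levels x)"
proof -
  note c = natp_const[OF prm_local(3)[of v]]
  have B: "natp prm4 v (\<lambda>x m. 64 * lamN (len x) + 1)" "small prm4 (\<lambda>x m. 64 * lamN (len x) + 1)"
    by (intro natp_add natp_mult c prm4_natp small_add small_mult small_const small_params)+
  have "natp prm4 v (\<lambda>x m. card {i. i < 64 * lamN (len x) + 1 \<and> \<not> 320 < real i * par x})"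
  proof (rule natp_card[OF B], goal_cases)
    case (1 P' d k)
    have "local_pred P' d" using 1(1) by (simp add: lift_def)
    from pureb_not[OF pureb_param[OF pure_const[OF this, of 320] pure_natp[OF 1(2)]]]
    show ?case by simp
  qed
  then show ?thesis
  proof (rule natp_cong)
    fix x m assume "prm4 x m"
    then have "0 < par x" "levels x <= 64 * lamN (len x) + 1" using levels_le by (auto simp: prm4_def prm3_def prm_def)
    then show "card {i. i < 64 * lamN (len x) + 1 \<and> \<not> 320 < real i * par x} = levels x" using levels_eq_card by metis
  qed
qed

lemma iter_node_count: "iter (\<lambda>k a. a * int c + 1) t 0 = int (node_count c t)"
  by (induction t) (auto simp: algebra_simps)

lemma natp_innerN: "natp prm4 v (\<lambda>x m. innerN x)"
proof -
  have "pure prm4 v (\<lambda>x m. iter (\<lambda>k a. a * int (Nc x) + 1) (nat (int (levels x))) 0)"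
  proof (rule pure_iter[OF natp_levels[unfolded natp_def] pure_const[OF prm_local(3)] small_bounded[OF small_levels]])
    fix P' :: "ctx => mem => bool" and d K A
    assume *: "v <= d" "\<And>x m. P' x m ==> prm4 x m" "local_pred P' d" "pure P' d A"
    have "lift prm4 v P' d" using * by (simp add: lift_def)
    then show "pure P' d (\<lambda>x m. A x m * int (Nc x) + 1)"
      by (intro pure_add pure_mult_nat pure_const * lift_natp[OF _ prm4_params(9)] small_params)
  qed
  then show ?thesis by (simp add: natp_def innerN_def iter_node_count)
qed

definition seedN :: "ctx => nat" where "seedN x = (levels x + 1) * (lamN (len x) + 1) * JN (len x)"

text \<open>The range of a seed is determined by its scale, which is recovered from its position in
  the array.\<close>

definition boundN :: "ctx => nat => int" where "boundN x i = 2 ^ (i div JN (len x) mod (lamN (len x) + 1))"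

definition init_params :: "ctx => mem => mem" where
  "init_params x m = upd 5 0 (int (len x)) (upd 7 0 (ar m 1 0) (upd 8 0 (int (levels x)) (upd 15 1 (int (seedN x)) (upd 15 0 0
    (upd 1 14 (int (innerN x)) (upd 1 13 (int (childN (len x))) (upd 1 12 (int (levels x)) (upd 1 11 (int (RN (len x)))
    (upd 1 10 (int (E2N (len x))) (upd 1 9 (int (E1N (len x))) (upd 1 8 (int (dN (len x))) (upd 1 7 (int (QN (len x)))
    (upd 1 6 (int (KN (len x))) (upd 1 5 (int (kapN (len x))) (upd 1 4 (int (JN (len x))) (upd 1 15 (int (LamN (len x)))
    (upd 1 3 (int (rhoN (len x))) m)))))))))))))))))"

lemma prm4_upd [simp]:
  "r < 16 ==> r \<notin> {1,4,5} ==> prm4 x (upd r i e m) = prm4 x m"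
  "3 < i ==> i \<noteq> 15 ==> prm4 x (upd (Suc 0) i e m) = prm4 x m"
  unfolding prm4_def prm3_def prm_def by (auto simp: ar_upd)

lemma prog_init_params: "prog prm 0 init_params"
proof -
  note l = prm_local(3)[of 0]
  have lam: "bounded prm (\<lambda>x m. int (lamN (len x)))" by (rule small_bounded[OF small_params(1)])
  have rho: "pure prm 0 (\<lambda>x m. int (rhoN (len x)))"
    unfolding rhoN_def using pure_clog[OF pure_natp[OF prm_natp(2)] pure_natp[OF prm_natp(2)] lam]
    by (simp add: order_less_imp_le of_nat_less_two_power)
  have rho3: "natp prm3 0 (\<lambda>x m. rhoN (len x))"
    by (rule natp_param[OF prm_local(2), of 3]) (simp add: prm3_def)
  have Lam: "pure prm3 0 (\<lambda>x m. int (LamN (len x)))"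
    using pure_pow2n[OF rho3 small_polylog[OF params_le(9)]] by (simp add: LamN_def)
  have 1: "prog prm 0 (wr 1 (\<lambda>x m. 3) (\<lambda>x m. int (rhoN (len x))))"
    by (intro prog_wr rho pure_const prm_local) auto
  have 2: "prog prm3 0 (wr 1 (\<lambda>x m. 15) (\<lambda>x m. int (LamN (len x))))"
    by (intro prog_wr Lam pure_const prm_local) auto
  have s: "natp prm4 0 (\<lambda>x m. seedN x)" unfolding seedN_def
    by (intro natp_add natp_mult natp_const l natp_levels prm4_natp prm4_params small_add small_const small_params)
  have 3: "prog prm4 0 (\<lambda>x m. wr 5 (\<lambda>x m. 0) (\<lambda>x m. int (len x)) x (wr 7 (\<lambda>x m. 0) (\<lambda>x m. ar m 1 0) x (wr 8 (\<lambda>x m. 0) (\<lambda>x m. int (levels x)) x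
     (wr 15 (\<lambda>x m. 1) (\<lambda>x m. int (seedN x)) x (wr 15 (\<lambda>x m. 0) (\<lambda>x m. 0) x (wr 1 (\<lambda>x m. 14) (\<lambda>x m. int (innerN x)) x
     (wr 1 (\<lambda>x m. 13) (\<lambda>x m. int (childN (len x))) x (wr 1 (\<lambda>x m. 12) (\<lambda>x m. int (levels x)) x
     (wr 1 (\<lambda>x m. 11) (\<lambda>x m. int (RN (len x))) x (wr 1 (\<lambda>x m. 10) (\<lambda>x m. int (E2N (len x))) x
     (wr 1 (\<lambda>x m. 9) (\<lambda>x m. int (E1N (len x))) x (wr 1 (\<lambda>x m. 8) (\<lambda>x m. int (dN (len x))) x
     (wr 1 (\<lambda>x m. 7) (\<lambda>x m. int (QN (len x))) x (wr 1 (\<lambda>x m. 6) (\<lambda>x m. int (KN (len x))) x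
     (wr 1 (\<lambda>x m. 5) (\<lambda>x m. int (kapN (len x))) x (wr 1 (\<lambda>x m. 4) (\<lambda>x m. int (JN (len x))) x m))))))))))))))))"
    by (intro prog_wr_seq prog_wr pure_natp prm4_params prm4_natp natp_levels natp_innerN s pure_const l pure_ar; simp add: wr_def)
  have "prog prm 0 (\<lambda>x m. wr 5 (\<lambda>x m. 0) (\<lambda>x m. int (len x)) x (wr 7 (\<lambda>x m. 0) (\<lambda>x m. ar m 1 0) x (wr 8 (\<lambda>x m. 0) (\<lambda>x m. int (levels x)) x
     (wr 15 (\<lambda>x m. 1) (\<lambda>x m. int (seedN x)) x (wr 15 (\<lambda>x m. 0) (\<lambda>x m. 0) x (wr 1 (\<lambda>x m. 14) (\<lambda>x m. int (innerN x)) x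
     (wr 1 (\<lambda>x m. 13) (\<lambda>x m. int (childN (len x))) x (wr 1 (\<lambda>x m. 12) (\<lambda>x m. int (levels x)) x
     (wr 1 (\<lambda>x m. 11) (\<lambda>x m. int (RN (len x))) x (wr 1 (\<lambda>x m. 10) (\<lambda>x m. int (E2N (len x))) x
     (wr 1 (\<lambda>x m. 9) (\<lambda>x m. int (E1N (len x))) x (wr 1 (\<lambda>x m. 8) (\<lambda>x m. int (dN (len x))) x
     (wr 1 (\<lambda>x m. 7) (\<lambda>x m. int (QN (len x))) x (wr 1 (\<lambda>x m. 6) (\<lambda>x m. int (KN (len x))) x
     (wr 1 (\<lambda>x m. 5) (\<lambda>x m. int (kapN (len x))) x (wr 1 (\<lambda>x m. 4) (\<lambda>x m. int (JN (len x))) x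
     (wr 1 (\<lambda>x m. 15) (\<lambda>x m. int (LamN (len x))) x (wr 1 (\<lambda>x m. 3) (\<lambda>x m. int (rhoN (len x))) x m))))))))))))))))))"
    by (rule prog_seq[OF prog_seq[OF 1 2] 3]) (auto simp: prm_def prm3_def prm4_def wr_def ar_upd)
  then show ?thesis by (rule prog_cong) (simp add: wr_def ar_upd init_params_def)
qed

lemma init_params_val:
  assumes "prm x m"
  shows "okB x (init_params x m)" "bx (init_params x m) 0 = (0, int (len x), ar m 6 0, ar m 1 0)"
    "ar (init_params x m) 8 0 = int (levels x)" "ar (init_params x m) 15 0 = 0" "ar (init_params x m) 15 1 = int (seedN x)"
proof -
  note s = assms[unfolded prm_def]
  have p: "par_ok x (init_params x m)" unfolding par_ok_def init_params_def using s by (simp add: ar_upd)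
  have "width (bx (init_params x m) i) <= int (len x)" for i
    unfolding bx_def width_def init_params_def using s by (simp add: ar_upd)
  then show "okB x (init_params x m)" using p by (simp add: okB_def)
  show "bx (init_params x m) 0 = (0, int (len x), ar m 6 0, ar m 1 0)"
    "ar (init_params x m) 8 0 = int (levels x)" "ar (init_params x m) 15 0 = 0" "ar (init_params x m) 15 1 = int (seedN x)"
    unfolding bx_def init_params_def using s by (simp_all add: ar_upd)
qed

lemma levels_le_innerN: "levels x <= innerN x"
proof -
  have "t <= node_count c t" if "0 < c" for c t
  proof (induction t)
    case (Suc t)
    have "node_count c t <= node_count c t * c" using that by (cases c) auto
    then show ?case using Suc unfolding node_count.simps by linarith
  qed simp
  then show ?thesis unfolding innerN_def by simp
qed

lemma small_seedN: "small P (\<lambda>x m. seedN x)"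
  unfolding seedN_def by (intro small_mult small_add small_const small_params small_le[OF small_innerN] levels_le_innerN)

definition okS :: "ctx => mem => bool" where "okS x m \<longleftrightarrow> okB x m \<and> ix 0 m <= seedN x"

lemma okP_okS: "okP okS v"
  using okP_ok(2)[of v] agree_ix unfolding okP_def local_pred_def okS_def by metis

definition set_bound :: "ctx => mem => mem" where
  "set_bound x m = upd 2 (int (ix 0 m)) (boundN x (ix 0 m)) m"

definition set_bounds :: "ctx => mem => mem" where "set_bounds x = loop 0 (set_bound x) (seedN x)"

lemma prog_set_bound: "prog okS 0 set_bound"
proof -
  note o = okP_okS[of 0] and l = okP_local[OF okP_okS[of 0]]
  have i: "natp okS 0 (\<lambda>x m. ix 0 m)" "small okS (\<lambda>x m. ix 0 m)"
    by (rule natp_ix[OF l], rule small_le[OF small_seedN], simp add: okS_def)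
  have d: "natp okS 0 (\<lambda>x m. ix 0 m div Jc x)" by (rule natp_div[OF i okP_natp(3)[OF o]]) simp
  have L: "natp okS 0 (\<lambda>x m. lamN (len x) + 1)" "small okS (\<lambda>x m. lamN (len x) + 1)"
    by (intro natp_add natp_const l okP_natp o small_add small_params small_const)+
  have e: "natp okS 0 (\<lambda>x m. ix 0 m div Jc x mod (lamN (len x) + 1))"
    by (rule natp_mod[OF d small_div[OF i(2)] L]) simp
  from prog_upd[OF pure_natp[OF i(1)] pure_pow2n[OF e small_mod[OF small_div[OF i(2)]]], of 2]
  show ?thesis unfolding set_bound_def[abs_def] boundN_def by simp
qed

lemma keeps_set_bound: "keeps {2} m (set_bound x m)"
  unfolding set_bound_def by (intro keeps_upd keeps_refl; simp)

lemma okB_keeps: "keeps S m m' ==> S \<inter> {1,4,5,6,7} = {} ==> okB x m ==> okB x m'"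
  using keeps_par_ok[of S m m' x] keeps_bx[of S m m'] by (auto simp: okB_def)

lemma prog_set_bounds: "prog okB 0 set_bounds"
  unfolding set_bounds_def[abs_def]
proof (rule prog_loop[where P' = okS and H = set_bound])
  note o = okP_ok(2)[of 0]
  show "natp okB 0 (\<lambda>x m. seedN x)" unfolding seedN_def
    by (intro natp_mult natp_add natp_const okP_natp o okP_local[OF o] small_add small_params small_const)
  show "small okB (\<lambda>x m. seedN x)" by (rule small_seedN)
  show "prog okS 0 set_bound" by (rule prog_set_bound)
  show "okS x (upd 14 0 (int k) m)" if "okB x m" "k < seedN x" for x m k using that by (simp add: okS_def ok_ix_upd)
  show "okB x (set_bound x (upd 14 0 (int k) m)) \<and> seedN x = seedN x" if "okB x m" for x m k
    using okB_keeps[OF keeps_set_bound] that by (simp add: ok_ix_upd)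
  show "ar (set_bound x m) 0 i = ar m 0 i" for x m i using keepsD[OF keeps_set_bound] by simp
qed

lemma set_bounds_val:
  shows "keeps {2,14} m (set_bounds x m)" "i < seedN x ==> ar (set_bounds x m) 2 (int i) = boundN x i"
proof -
  show "keeps {2,14} m (set_bounds x m)"
    unfolding set_bounds_def by (rule keeps_loop) (auto intro: keeps_mono[OF keeps_set_bound])
  have "\<forall>i<n. ar (forl (\<lambda>k m. set_bound x (upd 14 0 k m)) n m) 2 (int i) = boundN x i" for n
    by (induction n) (auto simp: set_bound_def ar_upd ix_def less_Suc_eq)
  then show "i < seedN x ==> ar (set_bounds x m) 2 (int i) = boundN x i" unfolding set_bounds_def loop_def by blast
qed

definition prepare :: "ctx => mem => mem" where "prepare x m = set_bounds x (init_params x m)"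

lemma prog_prepare: "prog prm 0 prepare"
  unfolding prepare_def[abs_def] by (rule prog_seq[OF prog_init_params prog_set_bounds init_params_val(1)])

definition finish :: "ctx => mem => mem" where
  "finish x m = upd 15 2 (int (Jc x * QN (len x))) (backward x (forward x m))"

lemma forward_ok: "okB x m ==> okB x (forward x m)"
proof -
  assume B: "okB x m"
  have "n <= Nc x * innerN x ==> okB x (forl (\<lambda>k m. fw_body x (upd 14 0 k m)) n m)" for n
    by (induction n) (auto intro!: fw_body_ok forward_ok_step B simp: okI_def ok_ix_upd)
  then show ?thesis unfolding forward_def loop_def by blast
qed

lemma keeps_backward: "keeps {9,11,13,14} m (backward x m)"
proof -
  have "keeps {9,11,13,14} (bw_leaves x m) (backward x m)"
    unfolding backward_def by (rule keeps_loop) (auto intro: keeps_bw)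
  then show ?thesis using keeps_trans[OF keeps_mono[OF keeps_bw(8)]] by auto
qed

lemma prog_finish: "prog okB 0 finish"
proof -
  note o = okP_ok(2)[of 0]
  have 1: "prog okB 0 (\<lambda>x m. backward x (forward x m))" by (rule prog_seq[OF prog_forward prog_backward forward_ok])
  have 2: "prog okB 0 (wr 15 (\<lambda>x m. 2) (\<lambda>x m. int (Jc x * QN (len x))))"
    by (intro prog_wr pure_natp natp_mult okP_natp o pure_const okP_local[OF o] small_params) auto
  have "prog okB 0 (\<lambda>x m. wr 15 (\<lambda>x m. 2) (\<lambda>x m. int (Jc x * QN (len x))) x (backward x (forward x m)))"
    by (rule prog_seq[OF 1 2]) (rule okB_keeps[OF keeps_backward _ forward_ok], auto)
  then show ?thesis by (rule prog_cong) (simp add: wr_def finish_def)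
qed

section \<open>The complete program\<close>

text \<open>This loop is coded by hand, because compiled loops need a bound for their length in
  advance and \<open>lamN\<close> is the first such bound. Cell 17 is entry 1 of array 1, and the
  result goes to cell 33, entry 2 of the same array.\<close>

definition log_loop :: "nat => com" where
  "log_loop d = While (Less (tmp d) (Load (Num 17))) (Seq (setv d (Add (tmp d) (tmp d))) (setv (d + 1) (Add (tmp (d + 1)) (Num 1))))"

definition log_com :: com where
  "log_com = Seq (setv 0 (Num 1)) (Seq (setv 1 (Num 0)) (Seq (log_loop 0) (Store (Num 33) (tmp 1))))"

lemma power_less_iff_clog: "2 ^ k < w \<longleftrightarrow> k < clog w"
proof
  show "2 ^ k < w ==> k < clog w"
  proof (rule ccontr)
    assume "2 ^ k < w" "\<not> k < clog w"
    then have "(2 :: int) ^ clog w <= 2 ^ k" by simp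
    then show False using le_two_power_clog[of w] \<open>2 ^ k < w\<close> by linarith
  qed
  show "k < clog w ==> 2 ^ k < w" using clog_le[of w k] by (meson not_le)
qed

lemma runs_log_loop:
  assumes "ar m 0 0 = 2 ^ k" "ar m 0 1 = int k" "ar m 1 1 = int n" "k + r = lamN n"
  shows "\<exists>m'. runs x (log_loop 0) m (1 + 4 * r) m' \<and> agree 0 m m' \<and> ar m' 0 1 = int (lamN n)"
  using assms
proof (induction r arbitrary: k m)
  case 0
  have "m 17 = int n" using 0 by (simp add: ar_def)
  then have "runs x (log_loop 0) m 1 m" unfolding log_loop_def
    using 0 power_less_iff_clog[of k "int n"] by (intro runs_While_False) (simp add: lamN_def)
  then show ?case using 0 by (intro exI[of _ m]) simp
next
  case (Suc r)
  let ?m1 = "upd 0 0 (2 ^ Suc k) m" let ?m2 = "upd 0 1 (int (Suc k)) ?m1"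
  have 17: "m 17 = int n" using Suc.prems by (simp add: ar_def)
  have b: "runs x (Seq (setv 0 (Add (tmp 0) (tmp 0))) (setv (0 + 1) (Add (tmp (0 + 1)) (Num 1)))) m 3 ?m2"
    using runs_Seq[OF runs_setv[of x 0 "Add (tmp 0) (tmp 0)" m] runs_setv[of x 1 "Add (tmp 1) (Num 1)"]] Suc.prems
    by (simp add: ar_upd numeral_3_eq_3 add.commute)
  obtain m' where m': "runs x (log_loop 0) ?m2 (1 + 4 * r) m'" "agree 0 ?m2 m'" "ar m' 0 1 = int (lamN n)"
    using Suc.IH[of ?m2 "Suc k"] Suc.prems by (auto simp: ar_upd)
  have "runs x (log_loop 0) m (Suc (3 + (1 + 4 * r))) m'"
    unfolding log_loop_def
    by (rule runs_While_True[OF _ b m'(1)[unfolded log_loop_def]])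
      (use 17 Suc.prems power_less_iff_clog[of k "int n"] in \<open>simp add: lamN_def\<close>)
  moreover have "agree 0 m m'" by (rule agree_trans[OF agree_trans[OF agree_upd_0 agree_upd_0] m'(2)]) simp_all
  ultimately show ?case using m'(3) by (intro exI[of _ m']) (simp add: numeral_eq_Suc)
qed

lemma runs_log_com:
  assumes "ar m 1 1 = int (len x)"
  shows "\<exists>m'. runs x log_com m (4 * lamN (len x) + 7) m' \<and> agree 0 (upd 1 2 (int (lamN (len x))) m) m'"
proof -
  let ?m1 = "upd 0 0 1 m" let ?m2 = "upd 0 1 0 ?m1"
  have 1: "ar ?m2 0 0 = 2 ^ 0" "ar ?m2 0 1 = int 0" "ar ?m2 1 1 = int (len x)" using assms by (simp_all add: ar_upd)
  from runs_log_loop[OF this, of "lamN (len x)" x] obtain m' where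
    m': "runs x (log_loop 0) ?m2 (1 + 4 * lamN (len x)) m'" "agree 0 ?m2 m'" "ar m' 0 1 = int (lamN (len x))" by auto
  have st: "runs x (Store (Num 33) (tmp 1)) m' 1 (upd 1 2 (int (lamN (len x))) m')"
    using runs_Store[of x "Num 33" "tmp 1" m'] m'(3) by (simp add: upd_def)
  have "runs x log_com m (Suc (1 + Suc (1 + Suc ((1 + 4 * lamN (len x)) + 1)))) (upd 1 2 (int (lamN (len x))) m')"
    unfolding log_com_def
    using runs_Seq[OF runs_setv[of x 0 "Num 1" m] runs_Seq[OF runs_setv[of x 1 "Num 0"] runs_Seq[OF _ st]]] m'(1) by simp
  moreover have "agree 0 (upd 1 2 (int (lamN (len x))) m) (upd 1 2 (int (lamN (len x))) m')"
    by (rule agree_upd[OF agree_trans[OF agree_trans[OF agree_upd_0 agree_upd_0] m'(2)]]) simp_all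
  moreover have "Suc (1 + Suc (1 + Suc ((1 + 4 * lamN (len x)) + 1))) = 4 * lamN (len x) + 7" by simp
  ultimately show ?thesis by metis
qed

text \<open>The only source of randomness in the program. Cells 15 and 31 are entries 0 and 1 of
  array 15: the counter and the number of seeds.\<close>

definition seed_loop :: com where
  "seed_loop = While (Less (Load (Num 15)) (Load (Num 31)))
     (Seq (Random (Add (Num 3) (times16 (Load (Num 15)))) (Load (Add (Num 2) (times16 (Load (Num 15))))))
       (Store (Num 15) (Add (Load (Num 15)) (Num 1))))"

primrec put_seeds :: "nat => (nat => int) => mem => mem" where
  "put_seeds 0 \<omega> m = m"
| "put_seeds (Suc n) \<omega> m = upd 15 0 (int (Suc n)) (upd 3 (int n) (\<omega> n) (put_seeds n \<omega> m))"

lemma ar_put_seeds: "r < 16 ==> ar (put_seeds n \<omega> m) r i = (if r = 3 \<and> 0 <= i \<and> i < int n then \<omega> (nat i)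
    else if r = 15 \<and> i = 0 \<and> n \<noteq> 0 then int n else ar m r i)"
  by (induction n) (auto simp: ar_upd)

lemma put_seeds_cong: "(\<And>i. i < n ==> \<omega> i = \<omega>' i) ==> put_seeds n \<omega> m = put_seeds n \<omega>' m"
  by (induction n) auto

lemma seed_step:
  assumes "ar m 15 0 = int n" "ar m 15 1 = int N" "n < N"
  shows "csteps x 4 (seed_loop # cs, m) =
    map_pmf (\<lambda>y. (seed_loop # cs, upd 15 0 (int (Suc n)) (upd 3 (int n) y m))) (uniform_below (ar m 2 (int n)))"
proof -
  have m: "m 15 = int n" "m 31 = int N" "m (2 + 16 * int n) = ar m 2 (int n)" using assms by (simp_all add: ar_def add.commute)
  have 4: "csteps x 4 = csteps x (Suc (Suc (Suc (Suc 0))))" by (simp add: numeral_eq_Suc)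
  have "int n + 1 = int (Suc n)" "(3 + 16 * int n = 15) = False" by presburger+
  then show ?thesis
    using m assms(3) unfolding 4
    by (simp add: csteps_def seed_loop_def bind_return_pmf map_pmf_def bind_assoc_pmf upd_def add.commute)
qed

text \<open>All ranges are in memory before the first draw and no draw alters them, so that drawing
  one seed after another produces a product distribution.\<close>

lemma seed_loop_dist:
  assumes "ar m 15 0 = 0" "ar m 15 1 = int N"
  shows "n <= N ==> csteps x (4 * n) (seed_loop # cs, m) =
    map_pmf (\<lambda>\<omega>. (seed_loop # cs, put_seeds n \<omega> m)) (Pi_pmf {..<n} 0 (\<lambda>i. uniform_below (ar m 2 (int i))))"
proof (induction n)
  case 0
  show ?case by (simp add: csteps_def)
next
  case (Suc n)
  let ?p = "\<lambda>i. uniform_below (ar m 2 (int i))"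
  have s: "csteps x 4 (seed_loop # cs, put_seeds n \<omega> m) = map_pmf (\<lambda>y. (seed_loop # cs, put_seeds (Suc n) (fun_upd \<omega> n y) m)) (?p n)" for \<omega>
  proof -
    have "put_seeds n (fun_upd \<omega> n y) m = put_seeds n \<omega> m" for y by (rule put_seeds_cong) simp
    moreover have "ar (put_seeds n \<omega> m) 15 0 = int n" "ar (put_seeds n \<omega> m) 15 1 = int N" "ar (put_seeds n \<omega> m) 2 (int n) = ar m 2 (int n)"
      using assms by (simp_all add: ar_put_seeds)
    ultimately show ?thesis using seed_step[of "put_seeds n \<omega> m" n N x cs] Suc.prems by simp
  qed
  have "csteps x (4 * Suc n) (seed_loop # cs, m) = bind_pmf (csteps x (4 * n) (seed_loop # cs, m)) (csteps x 4)"
    using csteps_add[of x "4 * n" 4] by (simp add: add.commute)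
  also have "\<dots> = bind_pmf (Pi_pmf {..<n} 0 ?p) (\<lambda>\<omega>. map_pmf (\<lambda>y. (seed_loop # cs, put_seeds (Suc n) (fun_upd \<omega> n y) m)) (?p n))"
    using Suc by (simp add: map_pmf_def bind_assoc_pmf bind_return_pmf s[unfolded map_pmf_def])
  also have "\<dots> = map_pmf (\<lambda>\<omega>. (seed_loop # cs, put_seeds (Suc n) \<omega> m)) (Pi_pmf (insert n {..<n}) 0 ?p)"
    by (subst Pi_pmf_insert', simp, simp, subst bind_commute_pmf) (simp add: map_pmf_def bind_assoc_pmf bind_return_pmf)
  finally show ?case by (simp add: lessThan_Suc)
qed

lemma csteps_Seq:
  assumes "runs x c m s m'"
  shows "csteps x (Suc s + t) (Seq c d # cs, m) = csteps x t (d # cs, m')"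
proof -
  have "csteps x 1 (Seq c d # cs, m) = return_pmf (c # d # cs, m)"
    by (simp add: csteps_def bind_return_pmf bind_return_pmf')
  then show ?thesis unfolding add_Suc
    by (simp only: csteps_Suc[of x "s + t"] csteps_add[of x s t] bind_return_pmf assms[unfolded runs_def, rule_format] simp_thms)
qed

lemma csteps_halted: "csteps x t ([], m) = return_pmf ([], m)"
  unfolding csteps_def by (induction t) (simp_all add: bind_return_pmf)

lemma runs_within: "runs x c m t m' ==> t <= T ==> csteps x T ([c], m) = return_pmf ([], m')"
  using csteps_add[of x t "T - t" "([c], m)"] by (simp add: runs_def bind_return_pmf csteps_halted)

lemma csteps_seed_loop:
  assumes "ar m 15 0 = 0" "ar m 15 1 = int N"
  shows "csteps x (4 * N + 2 + t) (Seq seed_loop d # cs, m) =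
    bind_pmf (Pi_pmf {..<N} 0 (\<lambda>i. uniform_below (ar m 2 (int i)))) (\<lambda>\<omega>. csteps x t (d # cs, put_seeds N \<omega> m))"
proof -
  have 1: "csteps x 1 (Seq seed_loop d # cs, m) = return_pmf (seed_loop # d # cs, m)"
    by (simp add: csteps_def bind_return_pmf bind_return_pmf')
  have "ar (put_seeds N \<omega> m) 15 0 = int N" "ar (put_seeds N \<omega> m) 15 1 = int N" for \<omega>
    using assms by (simp_all add: ar_put_seeds)
  then have "\<not> eval_test (par x) (put_seeds N \<omega> m) (Less (Load (Num 15)) (Load (Num 31)))" for \<omega>
    by (simp add: ar_def)
  from runs_While_False[OF this] have 2: "csteps x 1 (seed_loop # cs, put_seeds N \<omega> m) = return_pmf (cs, put_seeds N \<omega> m)" for \<omega> cs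
    by (simp add: runs_def seed_loop_def)
  have "csteps x (4 * N + 2 + t) (Seq seed_loop d # cs, m) = csteps x (Suc (4 * N + Suc t)) (Seq seed_loop d # cs, m)" by simp
  also have "\<dots> = bind_pmf (csteps x (4 * N) (seed_loop # d # cs, m)) (csteps x (Suc t))"
    by (simp only: csteps_Suc[of x "4 * N + Suc t"] 1 bind_return_pmf csteps_add[of x "4 * N"])
  also have "\<dots> = bind_pmf (Pi_pmf {..<N} 0 (\<lambda>i. uniform_below (ar m 2 (int i)))) (\<lambda>\<omega>. csteps x (Suc t) (seed_loop # d # cs, put_seeds N \<omega> m))"
    by (simp add: seed_loop_dist[OF assms] map_pmf_def bind_assoc_pmf bind_return_pmf)
  finally show ?thesis by (simp only: csteps_Suc[of x t] 2 bind_return_pmf)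
qed

section \<open>Concentration\<close>

lemma expectation_uniform_below:
  fixes g :: "int => real"
  assumes "0 < w"
  shows "measure_pmf.expectation (uniform_below w) g = (\<Sum>z\<in>{0..<w}. g z) / of_int w"
  using assms unfolding uniform_below_def by (subst integral_pmf_of_set) (auto simp: max_def)

text \<open>Hoeffding's inequality for the average of the samples. As the deviation is measured
  relative to the range \<open>2 ^ k\<close>, the bound is the same for all scales.\<close>

lemma concentration_samples:
  fixes p :: "'i => int pmf" and \<epsilon> :: real
  assumes D: "finite D" and inj: "inj_on f {..<J}" "f ` {..<J} \<subseteq> D" and J: "0 < J"
    and p: "\<And>j. j < J ==> p (f j) = uniform_below (2 ^ k)"
    and g: "\<And>x. 0 <= g x \<and> g x <= 1" and e: "0 <= \<epsilon>"
  shows "measure_pmf.prob (Pi_pmf D 0 p) {\<omega>. \<epsilon> * 2 ^ k < \<bar>2 ^ k / real J * (\<Sum>j<J. g (\<omega> (f j))) - (\<Sum>x\<in>{0..<2 ^ k}. g x)\<bar>}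
    <= 2 * exp (- 2 * real J * \<epsilon>\<^sup>2)"
proof -
  let ?M = "Pi_pmf D 0 p"
  have "prob_space.indep_vars ?M (\<lambda>_. count_space UNIV) (\<lambda>i \<omega>. \<omega> i) (f ` {..<J})"
    by (rule prob_space.indep_vars_subset[OF measure_pmf.prob_space_axioms indep_vars_Pi_pmf[OF D] inj(2)])
  then have "prob_space.indep_vars ?M (\<lambda>_. borel) (\<lambda>i \<omega>. g (\<omega> i)) (f ` {..<J})"
    by (rule prob_space.indep_vars_compose2[OF measure_pmf.prob_space_axioms]) simp
  then interpret Hoeffding_ineq ?M "f ` {..<J}" "\<lambda>i \<omega>. g (\<omega> i)" "\<lambda>_. 0" "\<lambda>_. 1"
      "\<Sum>i\<in>f ` {..<J}. measure_pmf.expectation ?M (\<lambda>\<omega>. g (\<omega> i))"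
    using g by unfold_locales (auto intro: AE_I2)
  define \<mu> where "\<mu> = (\<Sum>i\<in>f ` {..<J}. measure_pmf.expectation ?M (\<lambda>\<omega>. g (\<omega> i)))"
  have E: "measure_pmf.expectation ?M (\<lambda>\<omega>. g (\<omega> (f j))) = (\<Sum>x\<in>{0..<2 ^ k}. g x) / 2 ^ k" if "j < J" for j
  proof -
    have "measure_pmf.expectation ?M (\<lambda>\<omega>. g (\<omega> (f j))) = measure_pmf.expectation (map_pmf (\<lambda>\<omega>. \<omega> (f j)) ?M) g" by simp
    also have "map_pmf (\<lambda>\<omega>. \<omega> (f j)) ?M = uniform_below (2 ^ k)"
      using inj(2) that by (subst Pi_pmf_component[OF D]) (auto simp: p)
    finally show ?thesis by (simp add: expectation_uniform_below)
  qed
  have \<mu>: "\<mu> = J * ((\<Sum>x\<in>{0..<2 ^ k}. g x) / 2 ^ k)" by (simp add: \<mu>_def E sum.reindex[OF inj(1)])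
  have "measure_pmf.prob ?M {\<omega>. \<epsilon> * 2 ^ k < \<bar>2 ^ k / real J * (\<Sum>j<J. g (\<omega> (f j))) - (\<Sum>x\<in>{0..<2 ^ k}. g x)\<bar>}
    <= measure_pmf.prob ?M {\<omega> \<in> space ?M. \<epsilon> * J <= \<bar>(\<Sum>i\<in>f ` {..<J}. g (\<omega> i)) - \<mu>\<bar>}"
  proof (rule measure_pmf.finite_measure_mono, safe)
    fix \<omega> assume *: "\<epsilon> * 2 ^ k < \<bar>2 ^ k / real J * (\<Sum>j<J. g (\<omega> (f j))) - (\<Sum>x\<in>{0..<2 ^ k}. g x)\<bar>"
    have "2 ^ k / real J * (\<Sum>j<J. g (\<omega> (f j))) - (\<Sum>x\<in>{0..<2 ^ k}. g x) = 2 ^ k / real J * ((\<Sum>j<J. g (\<omega> (f j))) - \<mu>)"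
      using J by (simp add: \<mu> right_diff_distrib)
    then have "\<epsilon> * 2 ^ k < 2 ^ k / real J * \<bar>(\<Sum>j<J. g (\<omega> (f j))) - \<mu>\<bar>" using * by (simp add: abs_mult)
    then show "\<epsilon> * J <= \<bar>(\<Sum>i\<in>f ` {..<J}. g (\<omega> i)) - \<mu>\<bar>" using J by (simp add: sum.reindex[OF inj(1)] field_simps)
  qed auto
  also have "\<dots> <= 2 * exp (- 2 * (\<epsilon> * J)\<^sup>2 / (\<Sum>i\<in>f ` {..<J}. (1 - 0)\<^sup>2))"
    unfolding \<mu>_def by (rule Hoeffding_ineq_abs_ge) (use e J in \<open>auto simp: card_image[OF inj(1)]\<close>)
  also have "- 2 * (\<epsilon> * J)\<^sup>2 / (\<Sum>i\<in>f ` {..<J}. (1 - 0 :: real)\<^sup>2) = - 2 * real J * \<epsilon>\<^sup>2"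
    using J by (simp add: power2_eq_square card_image[OF inj(1)])
  finally show ?thesis .
qed

text \<open>Conditioning on the random choices outside of \<open>A\<close> fixes the sampled function.\<close>

lemma concentration_independent:
  fixes p :: "'i => int pmf" and \<epsilon> :: real and \<Phi> :: "('i => int) => int => real"
  assumes D: "finite D" and inj: "inj_on f {..<J}" "f ` {..<J} \<subseteq> A" and A: "A \<subseteq> D" and J: "0 < J"
    and p: "\<And>j. j < J ==> p (f j) = uniform_below (2 ^ k)"
    and g: "\<And>\<omega> x. 0 <= \<Phi> \<omega> x \<and> \<Phi> \<omega> x <= 1" and e: "0 <= \<epsilon>"
    and \<Phi>: "\<And>\<omega> \<omega>'. (\<And>i. i \<notin> A ==> \<omega> i = \<omega>' i) ==> \<Phi> \<omega> = \<Phi> \<omega>'"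
  shows "measure_pmf.prob (Pi_pmf D 0 p) {\<omega>. \<epsilon> * 2 ^ k <
      \<bar>2 ^ k / real J * (\<Sum>j<J. \<Phi> \<omega> (a + 1 + \<omega> (f j))) - (\<Sum>x\<in>{a<..a + 2 ^ k}. \<Phi> \<omega> x)\<bar>}
    <= 2 * exp (- 2 * real J * \<epsilon>\<^sup>2)"
proof -
  define bad where "bad \<omega> \<longleftrightarrow> \<epsilon> * 2 ^ k <
      \<bar>2 ^ k / real J * (\<Sum>j<J. \<Phi> \<omega> (a + 1 + \<omega> (f j))) - (\<Sum>x\<in>{a<..a + 2 ^ k}. \<Phi> \<omega> x)\<bar>" for \<omega>
  define h where "h g f' = (\<lambda>x. if x \<in> A then f' x else g x)" for g f' :: "'i => int"
  let ?e = "2 * exp (- 2 * real J * \<epsilon>\<^sup>2)"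
  have fA: "finite A" using A D finite_subset by blast
  have "Pi_pmf D 0 p = Pi_pmf (A \<union> (D - A)) 0 p" using A by (simp add: Un_absorb1)
  also have "\<dots> = map_pmf (\<lambda>(f', g). h g f') (pair_pmf (Pi_pmf A 0 p) (Pi_pmf (D - A) 0 p))"
    unfolding h_def using fA D by (subst Pi_pmf_union) auto
  also have "\<dots> = bind_pmf (Pi_pmf (D - A) 0 p) (\<lambda>g. map_pmf (h g) (Pi_pmf A 0 p))"
    by (subst pair_commute_pmf) (simp add: pair_pmf_def map_pmf_def bind_assoc_pmf bind_return_pmf)
  finally have split: "Pi_pmf D 0 p = bind_pmf (Pi_pmf (D - A) 0 p) (\<lambda>g. map_pmf (h g) (Pi_pmf A 0 p))" .
  have *: "measure_pmf.prob (map_pmf (h g) (Pi_pmf A 0 p)) {\<omega>. bad \<omega>} <= ?e" for g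
  proof -
    let ?G = "\<lambda>z. \<Phi> g (a + 1 + z)"
    have \<Phi>h: "\<Phi> (h g f') = \<Phi> g" for f' by (rule \<Phi>) (simp add: h_def)
    have hf: "h g f' (f j) = f' (f j)" if "j < J" for f' j using inj(2) that by (auto simp: h_def)
    have sum: "(\<Sum>x\<in>{a<..a + 2 ^ k}. \<Phi> g x) = (\<Sum>z\<in>{0..<2 ^ k}. ?G z)"
      by (rule sum.reindex_bij_witness[of _ "\<lambda>z. a + 1 + z" "\<lambda>x. x - (a + 1)"]) auto
    have "measure_pmf.prob (map_pmf (h g) (Pi_pmf A 0 p)) {\<omega>. bad \<omega>} =
      measure_pmf.prob (Pi_pmf A 0 p) {f'. \<epsilon> * 2 ^ k < \<bar>2 ^ k / real J * (\<Sum>j<J. ?G (f' (f j))) - (\<Sum>z\<in>{0..<2 ^ k}. ?G z)\<bar>}"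
      by (simp add: bad_def \<Phi>h hf sum vimage_def cong: sum.cong_simp)
    also have "\<dots> <= ?e" by (rule concentration_samples[where g = ?G and f = f and k = k]) (use fA inj J p g e in auto)
    finally show ?thesis .
  qed
  have "ennreal (measure_pmf.prob (Pi_pmf D 0 p) {\<omega>. bad \<omega>}) = emeasure (Pi_pmf D 0 p) {\<omega>. bad \<omega>}"
    by (simp add: measure_pmf.emeasure_eq_measure)
  also have "\<dots> = (\<integral>\<^sup>+ g. emeasure (map_pmf (h g) (Pi_pmf A 0 p)) {\<omega>. bad \<omega>} \<partial>Pi_pmf (D - A) 0 p)"
    by (subst split) (rule emeasure_bind_pmf)
  also have "\<dots> <= (\<integral>\<^sup>+ g. ennreal ?e \<partial>Pi_pmf (D - A) 0 p)"
    by (rule nn_integral_mono) (simp only: measure_pmf.emeasure_eq_measure ennreal_leI[OF *])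
  also have "\<dots> = ennreal ?e" by simp
  finally have "measure_pmf.prob (Pi_pmf D 0 p) {\<omega>. bad \<omega>} <= ?e" by (subst (asm) ennreal_le_iff) auto
  then show ?thesis by (simp only: bad_def)
qed

text \<open>Level \<open>t\<close> uses only the averaging seeds below \<open>t\<close>; this is the
  independence on which the sampling of the next level rests.\<close>

lemma av_cong:
  assumes "\<And>t'. t' < t ==> sd t' = sd' t'"
  shows "grid.av F s J \<kappa> E1 E2 sd Q d t = grid.av F s J \<kappa> E1 E2 sd' Q d t"
  using assms
proof (induction t)
  case 0
  show ?case by (rule ext) (simp add: grid.av.simps)
next
  case (Suc t)
  then have IH: "grid.av F s J \<kappa> E1 E2 sd Q d t = grid.av F s J \<kappa> E1 E2 sd' Q d t" and "sd t = sd' t" by auto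
  show ?case by (rule ext) (unfold grid.av.simps IH \<open>sd t = sd' t\<close>, rule refl)
qed

text \<open>Although \<open>u\<close> and \<open>v\<close> range over all integers, a nonempty set
  of this kind is determined by its first and last index and by two of its points, one of least and
  one of greatest value. The union bound thus needs \<open>n ^ 4 + 1\<close> sets, whatever the
  bound on the values.\<close>

lemma pts_cases:
  assumes "0 <= l" "r <= n"
  shows "pts F (l, r, u, v) = {} \<or> (\<exists>i1\<in>{1..n}. \<exists>i2\<in>{1..n}. \<exists>x1\<in>{1..n}. \<exists>x2\<in>{1..n}.
    pts F (l, r, u, v) = {x. i1 <= x \<and> x <= i2 \<and> F x1 <= F x \<and> F x <= F x2})"
proof (cases "pts F (l, r, u, v) = {}")
  case False
  let ?X = "pts F (l, r, u, v)"
  have mem: "x \<in> ?X \<longleftrightarrow> l < x \<and> x <= r \<and> u <= F x \<and> F x <= v" for x by (simp add: pts_def)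
  have sub: "?X \<subseteq> {1..n}" using assms by (auto simp: mem)
  then have fin: "finite ?X" using finite_subset by blast
  then have fF: "finite (F ` ?X)" "F ` ?X \<noteq> {}" using False by auto
  obtain x1 where x1: "x1 \<in> ?X" "F x1 = Min (F ` ?X)" using Min_in[OF fF] by force
  obtain x2 where x2: "x2 \<in> ?X" "F x2 = Max (F ` ?X)" using Max_in[OF fF] by force
  have 1: "F x1 <= F x" "F x <= F x2" if "x \<in> ?X" for x using that fF x1 x2 by auto
  have "?X = {x. Min ?X <= x \<and> x <= Max ?X \<and> F x1 <= F x \<and> F x <= F x2}"
  proof (intro set_eqI iffI)
    fix x assume "x \<in> ?X"
    then show "x \<in> {x. Min ?X <= x \<and> x <= Max ?X \<and> F x1 <= F x \<and> F x <= F x2}" using 1 fin by auto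
  next
    fix x assume x: "x \<in> {x. Min ?X <= x \<and> x <= Max ?X \<and> F x1 <= F x \<and> F x <= F x2}"
    have "l < Min ?X" "Max ?X <= r" using Min_in[OF fin False] Max_in[OF fin False] by (auto simp: mem)
    moreover have "u <= F x1" "F x2 <= v" using x1(1) x2(1) by (auto simp: mem)
    ultimately show "x \<in> ?X" using x by (auto simp: mem)
  qed
  moreover have "Min ?X \<in> {1..n}" "Max ?X \<in> {1..n}" using Min_in[OF fin False] Max_in[OF fin False] sub by blast+
  ultimately show ?thesis using x1(1) x2(1) sub by blast
qed simp

lemma card_pts_family:
  assumes "0 <= n"
  obtains S where "finite S" "card S <= nat n ^ 4 + 1" "\<And>l r u v. 0 <= l ==> r <= n ==> pts F (l, r, u, v) \<in> S"
proof -
  let ?g = "\<lambda>(i1, i2, x1, x2). {x. i1 <= x \<and> x <= i2 \<and> F x1 <= F x \<and> F x <= F x2}"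
  let ?Q = "{1..n} \<times> {1..n} \<times> {1..n} \<times> {1..n}"
  have "card (insert {} (?g ` ?Q)) <= card (?g ` ?Q) + 1" by (simp add: card_insert_if)
  moreover have "card (?g ` ?Q) <= card ?Q" by (rule card_image_le) simp
  moreover have "card ?Q = nat n ^ 4" using assms by (simp add: power4_eq_xxxx)
  ultimately have "card (insert {} (?g ` ?Q)) <= nat n ^ 4 + 1" by linarith
  moreover have "pts F (l, r, u, v) \<in> insert {} (?g ` ?Q)" if "0 <= l" "r <= n" for l r u v
    using pts_cases[OF that, of F u v] by (force simp: image_iff)
  ultimately show ?thesis using that[of "insert {} (?g ` ?Q)"] by blast
qed

text \<open>The seeds that the entries of array 3 provide, if these are independent and entry \<open>i\<close> is
  uniform below \<open>seed_bound n i\<close>.\<close>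

definition seeds_of :: "nat => (nat => int) => nat => nat => nat => int" where
  "seeds_of n \<omega> l k j = (if k <= lamN n \<and> j < JN n then \<omega> ((l * (lamN n + 1) + k) * JN n + j) else 0)"

definition seed_bound :: "nat => nat => int" where "seed_bound n i = 2 ^ (i div JN n mod (lamN n + 1))"

definition seed_pmf :: "nat => nat => (nat => int) pmf" where
  "seed_pmf n t = Pi_pmf {..<(t + 1) * (lamN n + 1) * JN n} 0 (\<lambda>i. uniform_below (seed_bound n i))"

definition epsN :: "nat => real" where "epsN n = 1 / (2 ^ 30 * real (LamN n) ^ 3)"

lemma seed_index:
  assumes "k <= lamN n" "j < JN n"
  shows "((l * (lamN n + 1) + k) * JN n + j) div JN n = l * (lamN n + 1) + k" "(l * (lamN n + 1) + k) div (lamN n + 1) = l"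
    "(l * (lamN n + 1) + k) mod (lamN n + 1) = k"
    "l <= t ==> (l * (lamN n + 1) + k) * JN n + j < (t + 1) * (lamN n + 1) * JN n"
proof -
  have dm: "(a * N + r) div N = a" "(a * N + r) mod N = r" if "r < N" for a N r :: nat using that by simp_all
  have k: "k < lamN n + 1" using assms by simp
  show "((l * (lamN n + 1) + k) * JN n + j) div JN n = l * (lamN n + 1) + k" by (rule dm(1)[OF assms(2)])
  show "(l * (lamN n + 1) + k) div (lamN n + 1) = l" "(l * (lamN n + 1) + k) mod (lamN n + 1) = k" by (rule dm[OF k])+
  assume "l <= t"
  have "l * (lamN n + 1) + k < (l + 1) * (lamN n + 1)" using k by simp
  also have "\<dots> <= (t + 1) * (lamN n + 1)" using \<open>l <= t\<close> by (intro mult_right_mono) auto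
  finally have "(l * (lamN n + 1) + k + 1) * JN n <= (t + 1) * (lamN n + 1) * JN n" by (intro mult_right_mono) auto
  moreover have "(l * (lamN n + 1) + k) * JN n + j < (l * (lamN n + 1) + k + 1) * JN n" using assms(2) by simp
  ultimately show "(l * (lamN n + 1) + k) * JN n + j < (t + 1) * (lamN n + 1) * JN n" by linarith
qed

lemma seeds_of_cong:
  assumes "\<And>i. i div JN n div (lamN n + 1) = l ==> \<omega> i = \<omega>' i"
  shows "seeds_of n \<omega> l = seeds_of n \<omega>' l"
proof (intro ext)
  fix k j
  show "seeds_of n \<omega> l k j = seeds_of n \<omega>' l k j"
    using assms[of "(l * (lamN n + 1) + k) * JN n + j"] seed_index(1,2)[of k n j l] unfolding seeds_of_def by presburger
qed

lemma seed_pmf_nonneg: "\<omega> \<in> set_pmf (seed_pmf n t) ==> 0 <= \<omega> i"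
proof -
  define N where "N = (t + 1) * (lamN n + 1) * JN n"
  assume "\<omega> \<in> set_pmf (seed_pmf n t)"
  then have "\<omega> \<in> PiE_dflt {..<N} 0 (\<lambda>i. set_pmf (uniform_below (seed_bound n i)))"
    unfolding seed_pmf_def N_def[symmetric] by (subst (asm) set_Pi_pmf) (auto simp: comp_def)
  then have "(i < N --> \<omega> i \<in> set_pmf (uniform_below (seed_bound n i))) \<and> (\<not> i < N --> \<omega> i = 0)"
    unfolding PiE_dflt_def by blast
  then show "0 <= \<omega> i" by (cases "i < N") (auto simp: uniform_below_def)
qed

lemma seeds_of_nonneg: "\<omega> \<in> set_pmf (seed_pmf n t) ==> 0 <= seeds_of n \<omega> l k j"
  by (auto simp: seeds_of_def seed_pmf_nonneg)

text \<open>The sampled function may depend on all blocks of seeds except block \<open>l\<close>,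
  from which the samples are taken.\<close>

lemma level_concentration:
  fixes \<Phi> :: "(nat => int) => int => real"
  assumes l: "l <= t" and k: "k <= lamN n" and g: "\<And>\<omega> x. 0 <= \<Phi> \<omega> x \<and> \<Phi> \<omega> x <= 1"
    and \<Phi>: "\<And>\<omega> \<omega>'. (\<And>i. i div JN n div (lamN n + 1) \<noteq> l ==> \<omega> i = \<omega>' i) ==> \<Phi> \<omega> = \<Phi> \<omega>'"
  shows "measure_pmf.prob (seed_pmf n t) {\<omega>. epsN n * 2 ^ k <
      \<bar>2 ^ k / real (JN n) * (\<Sum>j<JN n. \<Phi> \<omega> (a + 1 + seeds_of n \<omega> l k j)) - (\<Sum>x\<in>{a<..a + 2 ^ k}. \<Phi> \<omega> x)\<bar>}
    <= 2 * exp (- 2 * real (JN n) * (epsN n)\<^sup>2)"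
proof -
  let ?f = "\<lambda>j. (l * (lamN n + 1) + k) * JN n + j" and ?D = "{..<(t + 1) * (lamN n + 1) * JN n}"
  let ?A = "{i \<in> ?D. i div JN n div (lamN n + 1) = l}"
  have "(\<Sum>j<JN n. \<Phi> \<omega> (a + 1 + seeds_of n \<omega> l k j)) = (\<Sum>j<JN n. \<Phi> \<omega> (a + 1 + \<omega> (?f j)))" for \<omega>
    using k by (intro sum.cong) (auto simp: seeds_of_def)
  then have "{\<omega>. epsN n * 2 ^ k < \<bar>2 ^ k / real (JN n) * (\<Sum>j<JN n. \<Phi> \<omega> (a + 1 + seeds_of n \<omega> l k j)) - (\<Sum>x\<in>{a<..a + 2 ^ k}. \<Phi> \<omega> x)\<bar>} =
    {\<omega>. epsN n * 2 ^ k < \<bar>2 ^ k / real (JN n) * (\<Sum>j<JN n. \<Phi> \<omega> (a + 1 + \<omega> (?f j))) - (\<Sum>x\<in>{a<..a + 2 ^ k}. \<Phi> \<omega> x)\<bar>}"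
    by (simp only:)
  moreover have "measure_pmf.prob (Pi_pmf ?D 0 (\<lambda>i. uniform_below (seed_bound n i))) {\<omega>. epsN n * 2 ^ k <
      \<bar>2 ^ k / real (JN n) * (\<Sum>j<JN n. \<Phi> \<omega> (a + 1 + \<omega> (?f j))) - (\<Sum>x\<in>{a<..a + 2 ^ k}. \<Phi> \<omega> x)\<bar>}
    <= 2 * exp (- 2 * real (JN n) * (epsN n)\<^sup>2)"
  proof (rule concentration_independent[where A = ?A])
    show "inj_on ?f {..<JN n}" by (auto intro: inj_onI)
    show "?f ` {..<JN n} \<subseteq> ?A" using seed_index(4)[OF k _ l] seed_index(1,2)[OF k] by auto
    show "uniform_below (seed_bound n (?f j)) = uniform_below (2 ^ k)" if "j < JN n" for j
      unfolding seed_bound_def seed_index(1)[OF k that] seed_index(3)[OF k that] by (rule refl)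
    show "0 <= epsN n" by (simp add: epsN_def)
    show "\<Phi> \<omega> = \<Phi> \<omega>'" if "\<And>i. i \<notin> ?A ==> \<omega> i = \<omega>' i" for \<omega> \<omega>' by (rule \<Phi>) (use that in blast)
  qed (use g in auto)
  ultimately show ?thesis unfolding seed_pmf_def by (simp only:)
qed

lemma prob_UN_le:
  assumes "finite I" "\<And>i. i \<in> I ==> measure_pmf.prob p (B i) <= e"
  shows "measure_pmf.prob p (\<Union>i\<in>I. B i) <= real (card I) * e"
proof -
  have "measure_pmf.prob p (\<Union>i\<in>I. B i) <= (\<Sum>i\<in>I. measure_pmf.prob p (B i))"
    by (rule measure_pmf.finite_measure_subadditive_finite) (use assms in auto)
  also have "\<dots> <= card I * e" using sum_bounded_above[of I "\<lambda>i. measure_pmf.prob p (B i)" e] assms by simp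
  finally show ?thesis .
qed

section \<open>Union bounds over boxes and levels\<close>

locale seeded =
  fixes n :: nat and F :: "int => int" and Vals :: "int set" and tmax :: nat
  assumes fin: "finite Vals" and Vals: "F ` {1..int n} \<subseteq> Vals"
begin

abbreviation "J \<equiv> JN n"
abbreviation "avw \<omega> \<equiv> grid.av F (seeds_of n \<omega> 0) J (kapN n) (int (E1N n)) (int (E2N n)) (\<lambda>t. seeds_of n \<omega> (Suc t)) (QN n) (dN n)"
abbreviation "phi \<omega> t a b bl bh x \<equiv> real (grid.density F (seeds_of n \<omega> 0) J (kapN n) (QN n) (avw \<omega> t)
   (grid.leaf F (seeds_of n \<omega> 0) J (kapN n) (int (E1N n)) (int (E2N n)) (int t + 321) bl bh (dN n) x (a, b, bl, bh))) / real (2 * QN n)"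

definition counts_ok :: "(nat => int) => bool" where
  "counts_ok \<omega> \<longleftrightarrow> (\<forall>a b l r u v. 0 <= a --> a <= int n --> a <= l --> r <= b --> a <= b --> b <= int n -->
      \<bar>2 ^ clog (b - a) / real J * real (card {j. j < J \<and> a + 1 + seeds_of n \<omega> 0 (clog (b - a)) j \<in> pts F (l, r, u, v)})
       - real (card (pts F (l, r, u, v)))\<bar> <= epsN n * 2 ^ clog (b - a))"

definition levels_ok :: "(nat => int) => bool" where
  "levels_ok \<omega> \<longleftrightarrow> (\<forall>t a b bl bh. t < tmax --> 0 <= a --> a <= b --> b <= int n --> bl \<in> Vals --> bh \<in> Vals -->
      (\<forall>x\<in>{a<..b}. phi \<omega> t a b bl bh x <= 1) -->
      \<bar>2 ^ clog (b - a) / real J * (\<Sum>j<J. if a + 1 + seeds_of n \<omega> (Suc t) (clog (b - a)) j <= b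
          then phi \<omega> t a b bl bh (a + 1 + seeds_of n \<omega> (Suc t) (clog (b - a)) j) else 0)
       - (\<Sum>x\<in>{a<..b}. phi \<omega> t a b bl bh x)\<bar> <= epsN n * 2 ^ clog (b - a))"

text \<open>Concentration needs a function into the unit interval for every outcome, defined up to
  the rounded width. Truncation and extension by 0 beyond \<open>b\<close> provide it, and change
  nothing where the densities are at most 1.\<close>

definition clip :: "nat => int => int => int => int => (nat => int) => int => real" where
  "clip t a b bl bh \<omega> x = (if x <= b then min 1 (phi \<omega> t a b bl bh x) else 0)"

lemma clog_le_lam: "b - a <= int n ==> clog (b - a) <= lamN n"
  using le_two_power_clog[of "int n"] unfolding lamN_def by (intro clog_le) linarith

lemma prob_not_counts_ok:
  "measure_pmf.prob (seed_pmf n tmax) {\<omega>. \<not> counts_ok \<omega>} \<le>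
     real ((lamN n + 1) * (n + 1) * (n ^ 4 + 1)) * (2 * exp (- 2 * real J * (epsN n)\<^sup>2))"
proof -
  let ?e = "2 * exp (- 2 * real J * (epsN n)\<^sup>2)"
  obtain S where S: "finite S" "card S <= n ^ 4 + 1" "\<And>l r u v. 0 <= l ==> r <= int n ==> pts F (l, r, u, v) \<in> S"
    using card_pts_family[of "int n" F] by auto
  define bad where "bad = (\<lambda>(k, a, X :: int set). {\<omega>. epsN n * 2 ^ k < \<bar>2 ^ k / real J *
    (\<Sum>j<J. of_bool (a + 1 + seeds_of n \<omega> 0 k j \<in> X)) - (\<Sum>x\<in>{a<..a + 2 ^ k}. of_bool (x \<in> X))\<bar>})"
  let ?I = "{..lamN n} \<times> {0..int n} \<times> S"
  have "{\<omega>. \<not> counts_ok \<omega>} \<subseteq> (\<Union>i\<in>?I. bad i)"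
  proof
    fix \<omega> assume "\<omega> \<in> {\<omega>. \<not> counts_ok \<omega>}"
    then obtain a b l r u v where *: "0 <= a" "a <= int n" "a <= l" "r <= b" "a <= b" "b <= int n"
      and n: "epsN n * 2 ^ clog (b - a) < \<bar>2 ^ clog (b - a) / real J * real (card {j. j < J \<and> a + 1 + seeds_of n \<omega> 0 (clog (b - a)) j \<in> pts F (l, r, u, v)})
       - real (card (pts F (l, r, u, v)))\<bar>" unfolding counts_ok_def not_all not_imp not_le by blast
    let ?k = "clog (b - a)" and ?X = "pts F (l, r, u, v)"
    have X: "?X \<in> S" by (rule S(3)) (use * in auto)
    have k: "?k <= lamN n" by (rule clog_le_lam) (use * in auto)
    have "?X \<subseteq> {a<..a + 2 ^ ?k}" using le_two_power_clog[of "b - a"] * by (auto simp: pts_def)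
    then have "(\<Sum>x\<in>{a<..a + 2 ^ ?k}. of_bool (x \<in> ?X) :: real) = card ?X"
      by (simp add: of_bool_def sum.If_cases Int_absorb1)
    moreover have "(\<Sum>j<J. of_bool (a + 1 + seeds_of n \<omega> 0 ?k j \<in> ?X) :: real) = card {j. j < J \<and> a + 1 + seeds_of n \<omega> 0 ?k j \<in> ?X}"
      by (simp add: of_bool_def sum.If_cases Int_def)
    ultimately have "\<omega> \<in> bad (?k, a, ?X)" using n by (simp add: bad_def)
    moreover have "(?k, a, ?X) \<in> ?I" using X k * by simp
    ultimately show "\<omega> \<in> (\<Union>i\<in>?I. bad i)" by (rule UN_I[rotated])
  qed
  then have "measure_pmf.prob (seed_pmf n tmax) {\<omega>. \<not> counts_ok \<omega>} <= measure_pmf.prob (seed_pmf n tmax) (\<Union>i\<in>?I. bad i)"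
    by (rule measure_pmf.finite_measure_mono) simp
  also have "\<dots> <= real (card ?I) * ?e"
  proof (rule prob_UN_le[where I = ?I and p = "seed_pmf n tmax" and B = bad and e = ?e])
    show "measure_pmf.prob (seed_pmf n tmax) (bad i) <= ?e" if "i \<in> ?I" for i
    proof -
      obtain k a X where i: "i = (k, a, X)" by (cases i)
      show ?thesis unfolding i bad_def prod.case
        by (rule level_concentration[where \<Phi> = "\<lambda>\<omega> x. of_bool (x \<in> X)"]) (use that i in auto)
    qed
  qed (use S in simp)
  also have "real (card ?I) * ?e <= real ((lamN n + 1) * (n + 1) * (n ^ 4 + 1)) * ?e"
  proof (rule mult_right_mono)
    have "card ?I = (lamN n + 1) * (n + 1) * card S" by (simp add: card_cartesian_product nat_add_distrib algebra_simps)
    then have "card ?I <= (lamN n + 1) * (n + 1) * (n ^ 4 + 1)" by (simp only: mult_le_mono2[OF S(2)])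
    then show "real (card ?I) <= real ((lamN n + 1) * (n + 1) * (n ^ 4 + 1))" by (simp only: of_nat_le_iff)
  qed simp
  finally show ?thesis .
qed

text \<open>The densities of level \<open>t\<close> use block 0 and the blocks up to
  \<open>t\<close>, but not block \<open>Suc t\<close>, which samples them.\<close>

lemma clip_cong:
  assumes "\<And>i. i div JN n div (lamN n + 1) \<noteq> Suc t ==> \<omega> i = \<omega>' i"
  shows "clip t a b bl bh \<omega> = clip t a b bl bh \<omega>'"
proof -
  have s: "seeds_of n \<omega> l = seeds_of n \<omega>' l" if "l \<noteq> Suc t" for l
    by (rule seeds_of_cong) (use assms that in auto)
  have "avw \<omega> t = grid.av F (seeds_of n \<omega>' 0) J (kapN n) (int (E1N n)) (int (E2N n)) (\<lambda>t. seeds_of n \<omega> (Suc t)) (QN n) (dN n) t"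
    by (simp only: s[of 0] nat.distinct simp_thms)
  also have "\<dots> = avw \<omega>' t" by (rule av_cong) (use s in auto)
  finally have "avw \<omega> t = avw \<omega>' t" .
  then show ?thesis unfolding clip_def by (intro ext) (simp only: s[of 0] nat.distinct simp_thms)
qed

text \<open>The events are indexed by level, index bounds and value bounds of a box. On the support
  of the seeds all samples lie to the right of \<open>a\<close>, where the clipped and the true
  densities coincide; hence the intersection with \<open>set_pmf\<close>.\<close>

lemma prob_not_levels_ok:
  "measure_pmf.prob (seed_pmf n tmax) ({\<omega>. \<not> levels_ok \<omega>} \<inter> set_pmf (seed_pmf n tmax)) \<le>
     real (tmax * (n + 1) * (n + 1) * card Vals * card Vals) * (2 * exp (- 2 * real J * (epsN n)\<^sup>2))"
proof -
  let ?e = "2 * exp (- 2 * real J * (epsN n)\<^sup>2)"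
  define bad where "bad = (\<lambda>(t, a, b, bl, bh). {\<omega>. epsN n * 2 ^ clog (b - a) < \<bar>2 ^ clog (b - a) / real J *
    (\<Sum>j<J. clip t a b bl bh \<omega> (a + 1 + seeds_of n \<omega> (Suc t) (clog (b - a)) j)) - (\<Sum>x\<in>{a<..a + 2 ^ clog (b - a)}. clip t a b bl bh \<omega> x)\<bar>})"
  let ?I = "{..<tmax} \<times> {0..int n} \<times> {0..int n} \<times> Vals \<times> Vals"
  have "{\<omega>. \<not> levels_ok \<omega>} \<inter> set_pmf (seed_pmf n tmax) \<subseteq> (\<Union>i\<in>?I. bad i)"
  proof
    fix \<omega> assume w: "\<omega> \<in> {\<omega>. \<not> levels_ok \<omega>} \<inter> set_pmf (seed_pmf n tmax)"
    then obtain t a b bl bh where *: "t < tmax" "0 <= a" "a <= b" "b <= int n" "bl \<in> Vals" "bh \<in> Vals"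
      and le1: "\<And>x. x \<in> {a<..b} ==> phi \<omega> t a b bl bh x <= 1"
      and n: "epsN n * 2 ^ clog (b - a) < \<bar>2 ^ clog (b - a) / real J * (\<Sum>j<J. if a + 1 + seeds_of n \<omega> (Suc t) (clog (b - a)) j <= b
          then phi \<omega> t a b bl bh (a + 1 + seeds_of n \<omega> (Suc t) (clog (b - a)) j) else 0) - (\<Sum>x\<in>{a<..b}. phi \<omega> t a b bl bh x)\<bar>"
      unfolding levels_ok_def not_all not_imp not_le by blast
    let ?k = "clog (b - a)"
    have c: "clip t a b bl bh \<omega> x = (if x <= b then phi \<omega> t a b bl bh x else 0)" if "a < x" for x
      unfolding clip_def using le1[of x] that by (auto simp: min_def)
    have "(\<Sum>x\<in>{a<..a + 2 ^ ?k}. clip t a b bl bh \<omega> x) = (\<Sum>x\<in>{a<..b}. phi \<omega> t a b bl bh x)"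
    proof (rule sum.mono_neutral_cong_right)
      show "{a<..b} \<subseteq> {a<..a + 2 ^ ?k}" using le_two_power_clog[of "b - a"] by auto
    qed (auto simp: c)
    moreover have "(\<Sum>j<J. clip t a b bl bh \<omega> (a + 1 + seeds_of n \<omega> (Suc t) ?k j)) =
      (\<Sum>j<J. if a + 1 + seeds_of n \<omega> (Suc t) ?k j <= b then phi \<omega> t a b bl bh (a + 1 + seeds_of n \<omega> (Suc t) ?k j) else 0)"
    proof (rule sum.cong[OF refl])
      fix j
      have "0 <= seeds_of n \<omega> (Suc t) ?k j" by (rule seeds_of_nonneg) (use w in blast)
      then show "clip t a b bl bh \<omega> (a + 1 + seeds_of n \<omega> (Suc t) ?k j) =
          (if a + 1 + seeds_of n \<omega> (Suc t) ?k j <= b then phi \<omega> t a b bl bh (a + 1 + seeds_of n \<omega> (Suc t) ?k j) else 0)"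
        by (intro c) linarith
    qed
    ultimately have "\<omega> \<in> bad (t, a, b, bl, bh)" using n unfolding bad_def prod.case mem_Collect_eq by (simp only:)
    moreover have "(t, a, b, bl, bh) \<in> ?I" using * by simp
    ultimately show "\<omega> \<in> (\<Union>i\<in>?I. bad i)" by (rule UN_I[rotated])
  qed
  then have "measure_pmf.prob (seed_pmf n tmax) ({\<omega>. \<not> levels_ok \<omega>} \<inter> set_pmf (seed_pmf n tmax)) <= measure_pmf.prob (seed_pmf n tmax) (\<Union>i\<in>?I. bad i)"
    by (rule measure_pmf.finite_measure_mono) simp
  also have "\<dots> <= real (card ?I) * ?e"
  proof (rule prob_UN_le[where I = ?I and p = "seed_pmf n tmax" and B = bad and e = ?e])
    show "measure_pmf.prob (seed_pmf n tmax) (bad i) <= ?e" if "i \<in> ?I" for i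
    proof -
      obtain t a b bl bh where i: "i = (t, a, b, bl, bh)" by (cases i)
      show ?thesis unfolding i bad_def prod.case
      proof (rule level_concentration)
        show "Suc t <= tmax" using that i by simp
        show "clog (b - a) <= lamN n" using that i by (intro clog_le_lam) auto
        show "0 <= clip t a b bl bh \<omega> x \<and> clip t a b bl bh \<omega> x <= 1" for \<omega> x by (simp add: clip_def)
        show "clip t a b bl bh \<omega> = clip t a b bl bh \<omega>'" if "\<And>i. i div J div (lamN n + 1) \<noteq> Suc t ==> \<omega> i = \<omega>' i" for \<omega> \<omega>'
          using that by (rule clip_cong)
      qed
    qed
  qed (use fin in simp)
  also have "card ?I = tmax * (n + 1) * (n + 1) * card Vals * card Vals"
    by (simp add: card_cartesian_product nat_add_distrib algebra_simps)
  finally show ?thesis .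
qed

end

section \<open>Numerical estimates for the chosen parameters\<close>

lemma real_lam_bounds:
  assumes "2 <= n"
  shows "log 2 (real n) <= real (lamN n)" "1 <= real (LamN n)" "real (lamN n) <= real (LamN n)" "real n <= 2 ^ lamN n"
    "0 < log 2 (real n)"
proof -
  have "int n <= 2 ^ lamN n" unfolding lamN_def by (rule le_two_power_clog)
  then show n: "real n <= 2 ^ lamN n" by (metis of_int_of_nat_eq of_int_le_iff of_int_numeral of_int_power)
  then have "log 2 (real n) <= log 2 (2 ^ lamN n)" using assms by (subst log_le_cancel_iff) auto
  then show "log 2 (real n) <= real (lamN n)" by simp
  show "1 <= real (LamN n)" "real (lamN n) <= real (LamN n)" using LamN_ge_1[of n] lamN_le[of n] by simp_all
  show "0 < log 2 (real n)" using assms by simp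
qed

lemma param_ratios:
  fixes n :: nat
  defines "u \<equiv> 1 / real (LamN n)"
  shows "epsN n = u ^ 3 / 2 ^ 30" "real (E1N n) / real (JN n) = u / 2 ^ 12" "real (E2N n) / real (JN n) = u ^ 2 / 2 ^ 17"
    "1 / 2 ^ kapN n = u ^ 2 / 2 ^ 18" "2 ^ kapN n * epsN n = u / 2 ^ 12" "1 / real (QN n) = u / 2 ^ 12"
    "real (JN n) * (epsN n)\<^sup>2 = 2 ^ 10 * real (LamN n) ^ 2" "0 < u" "u <= 1" "real (LamN n) * u = 1"
proof -
  define L where "L = real (LamN n)"
  have L: "1 <= L" "L \<noteq> 0" "0 < L" using LamN_ge_1[of n] unfolding L_def by linarith+
  have u: "u = 1 / L" by (simp add: u_def L_def)
  have pw: "L ^ 8 = L ^ 7 * L" "L ^ 8 = L ^ 6 * L ^ 2" "L ^ 3 = L ^ 2 * L"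
    using power_add[of L 7 1] power_add[of L 6 2] power_add[of L 2 1] by simp_all
  have K: "(2 :: real) ^ kapN n = 2 ^ 18 * L ^ 2" using arg_cong[OF KN_eq[of n], of real] by (simp add: KN_def L_def)
  show e: "epsN n = u ^ 3 / 2 ^ 30" by (simp add: epsN_def u power_divide flip: L_def)
  have "real (E1N n) / real (JN n) = 2 ^ 58 * L ^ 7 / (2 ^ 70 * (L ^ 7 * L))" by (simp add: E1N_def JN_def flip: L_def pw(1))
  also have "\<dots> = u / 2 ^ 12" using L unfolding u by (simp add: divide_simps)
  finally show "real (E1N n) / real (JN n) = u / 2 ^ 12" .
  have "real (E2N n) / real (JN n) = 2 ^ 53 * L ^ 6 / (2 ^ 70 * (L ^ 6 * L ^ 2))" by (simp add: E2N_def JN_def flip: L_def pw(2))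
  also have "\<dots> = u ^ 2 / 2 ^ 17" using L unfolding u by (simp add: divide_simps power_divide)
  finally show "real (E2N n) / real (JN n) = u ^ 2 / 2 ^ 17" .
  show "1 / 2 ^ kapN n = u ^ 2 / 2 ^ 18" unfolding K u by (simp add: power_divide)
  have "2 ^ kapN n * epsN n = 2 ^ 18 * L ^ 2 * (1 / (L ^ 2 * L) / 2 ^ 30)" unfolding K e u by (simp add: power_divide flip: pw(3))
  also have "\<dots> = u / 2 ^ 12" using L unfolding u by (simp add: divide_simps)
  finally show "2 ^ kapN n * epsN n = u / 2 ^ 12" .
  show "1 / real (QN n) = u / 2 ^ 12" by (simp add: QN_def u flip: L_def)
  have p6: "(L ^ 3) ^ 2 = L ^ 6" by (simp flip: power_mult)
  have "real (JN n) * (epsN n)\<^sup>2 = 2 ^ 70 * (L ^ 6 * L ^ 2) * (1 / (L ^ 6 * 2 ^ 60))"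
    by (simp add: JN_def epsN_def power_divide power_mult_distrib p6 flip: L_def pw(2))
  also have "\<dots> = 2 ^ 10 * L ^ 2" using L by (simp add: divide_simps)
  finally show "real (JN n) * (epsN n)\<^sup>2 = 2 ^ 10 * real (LamN n) ^ 2" by (simp add: L_def)
  show "0 < u" "u <= 1" "real (LamN n) * u = 1" using L unfolding u L_def[symmetric] by simp_all
qed

context seeded
begin

text \<open>All errors are expressed by \<open>u = 1 / LamN n\<close>, which is at most
  \<open>1 / log 2 n\<close>. A level costs at most \<open>u / 2 ^ 7\<close>, and
  \<open>tmax + 1\<close> is at most \<open>322 / \<tau>\<close>; the total
  \<open>322 / 128 * u / \<tau>\<close> is below the permitted
  \<open>5 / (\<tau> * log 2 n)\<close>.\<close>

theorem estimate_error:
  fixes \<tau> :: real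
  assumes n: "2 <= n" and \<tau>: "0 < \<tau>" "\<tau> < 1" "5 < real (lamN n) * \<tau>"
    and tmax: "320 / \<tau> <= real tmax" "real tmax <= 320 / \<tau> + 1"
    and lohi: "lo \<in> Vals" "hi \<in> Vals" "lo <= hi"
    and w: "\<omega> \<in> set_pmf (seed_pmf n tmax)" "counts_ok \<omega>" "levels_ok \<omega>"
  shows "\<bar>avw \<omega> tmax (0, int n, lo, hi) / real (JN n * QN n) - lisb F (0, int n, lo, hi)\<bar> \<le>
    \<tau> * (real (card (pts F (0, int n, lo, hi))) - lisb F (0, int n, lo, hi)) + 5 / (\<tau> * log 2 (real n)) * real n"
proof -
  note lam = real_lam_bounds[OF n]
  define u where "u = 1 / real (LamN n)"
  note r = param_ratios[of n, folded u_def]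
  have u2: "u ^ 2 <= u" "u ^ 3 <= u ^ 2" "u ^ 3 <= u" "0 <= u ^ 2" "0 <= u ^ 3"
    using r(8,9) power_decreasing[of 1 2 u] power_decreasing[of 2 3 u] power_decreasing[of 1 3 u] by simp_all
  have "320 / \<tau> <= 64 * real (lamN n)" using \<tau> by (simp add: field_simps)
  then have T: "real tmax <= 65 * real (LamN n)" using tmax(2) lam(2,3) by linarith
  have Tu: "real tmax * u <= 65" using mult_right_mono[OF T, of u] r(8,10) by (simp add: mult.assoc)
  interpret estimator F "seeds_of n \<omega> 0" "JN n" "kapN n" "int (E1N n)" "int (E2N n)" "int n" "epsN n" "QN n" "dN n" tmax Vals
      "\<lambda>t. seeds_of n \<omega> (Suc t)"
  proof unfold_locales
    show "0 < JN n" "0 < QN n" "0 <= int (E2N n)" by simp_all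
    show "0 < int (E1N n)" "0 < epsN n" using LamN_ge_1[of n] by (simp_all add: E1N_def epsN_def)
    show "F x \<in> Vals" if "0 < x" "x <= int n" for x using Vals that by auto
    have "(4 / 5 :: real) ^ dN n <= (4 / 5) ^ (4 * lamN n) * (4 / 5)" unfolding dN_def by simp
    also have "(4 / 5 :: real) ^ (4 * lamN n) = (256 / 625) ^ lamN n" by (simp add: power_mult power_divide)
    also have "(256 / 625 :: real) ^ lamN n * (4 / 5) <= (1 / 2) ^ lamN n * (4 / 5)"
      by (intro mult_right_mono power_mono) auto
    finally have "(4 / 5 :: real) ^ dN n <= (1 / 2) ^ lamN n * (4 / 5)" .
    then have "real n * (4 / 5) ^ dN n <= 2 ^ lamN n * ((1 / 2) ^ lamN n * (4 / 5))" using lam(4) by (intro mult_mono) auto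
    also have "\<dots> = 4 / 5" by (simp add: power_divide)
    finally show "real_of_int (int n) * (4 / 5) ^ dN n < 1" by simp
    show "\<bar>2 ^ clog (b - a) / real (JN n) * real (card {j. j < JN n \<and> a + 1 + seeds_of n \<omega> 0 (clog (b - a)) j \<in> pts F (l, r, u, v)})
       - real (card (pts F (l, r, u, v)))\<bar> <= epsN n * 2 ^ clog (b - a)"
      if "0 <= a" "a <= int n" "a <= l" "r <= b" "a <= b" "b <= int n" for a b l r u v
      using w(2) that unfolding counts_ok_def by blast
    show "0 <= seeds_of n \<omega> (Suc t) k j" for t k j by (rule seeds_of_nonneg[OF w(1)])
    show "\<bar>2 ^ clog (b - a) / real (JN n) * (\<Sum>j<JN n. if a + 1 + seeds_of n \<omega> (Suc t) (clog (b - a)) j <= b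
        then \<phi> (a + 1 + seeds_of n \<omega> (Suc t) (clog (b - a)) j) else 0) - (\<Sum>x\<in>{a<..b}. \<phi> x)\<bar> <= epsN n * 2 ^ clog (b - a)"
      if "t < tmax" "0 <= a" "a <= b" "b <= int n" "bl \<in> Vals" "bh \<in> Vals"
        and phi: "\<And>x. \<phi> x = real (grid.density F (seeds_of n \<omega> 0) (JN n) (kapN n) (QN n) (avw \<omega> t)
           (grid.leaf F (seeds_of n \<omega> 0) (JN n) (kapN n) (int (E1N n)) (int (E2N n)) (int t + 321) bl bh (dN n) x (a, b, bl, bh))) / (2 * QN n)"
        and le: "\<And>x. x \<in> {a<..b} ==> \<phi> x <= 1" for t a b bl bh \<phi>
    proof -
      have "\<phi> = phi \<omega> t a b bl bh" by (rule ext) (simp add: phi)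
      then show ?thesis using w(3) that(1-6) le unfolding levels_ok_def by blast
    qed
    have "(16 + 2 * (real tmax + 320)) * epsN n = (656 * u ^ 3 + 2 * (real tmax * u) * u ^ 2) / 2 ^ 30"
      unfolding r(1) by (simp add: power3_eq_cube power2_eq_square algebra_simps)
    also have "2 * (real tmax * u) * u ^ 2 <= 2 * 65 * u ^ 2" using Tu u2(4) by (intro mult_right_mono mult_left_mono) auto
    finally have "(16 + 2 * (real tmax + 320)) * epsN n <= (656 * u ^ 3 + 130 * u ^ 2) / 2 ^ 30" by (simp add: divide_right_mono)
    also have "\<dots> <= u ^ 2 / 2 ^ 17"
    proof -
      have "(656 * v + 130 * w) / 2 ^ 30 <= w / 2 ^ 17" if "v <= w" "0 <= w" for v w :: real using that by simp
      from this[OF u2(2,4)] show ?thesis .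
    qed
    finally show "(16 + 2 * (real tmax + 320)) * epsN n <= real_of_int (int (E2N n)) / real (JN n)" by (simp add: r(3))
    have "24 * epsN n <= u / 2 ^ 12" using u2 unfolding r(1) by simp
    then show "24 * epsN n <= real_of_int (int (E1N n)) / real (JN n)" by (simp add: r(2))
    have "8 * (1 / 2 ^ kapN n + epsN n) <= u / 2 ^ 12" using u2 r(8) unfolding r(4) unfolding r(1) by simp
    then show "8 * (1 / 2 ^ kapN n + epsN n) <= real_of_int (int (E1N n)) / real (JN n)" by (simp add: r(2))
  qed
  have "leaf_error = 4 * (2 ^ kapN n * epsN n) + 4 * (1 / 2 ^ kapN n) + 2 * (real (E1N n) / real (JN n)) + 2 * epsN n"
    unfolding leaf_error_def by simp
  also have "\<dots> <= u / 2 ^ 9" unfolding r(5) unfolding r(4) r(2) r(1) using u2 r(8) by simp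
  finally have leaf: "leaf_error <= u / 2 ^ 9" .
  have "dN n <= 5 * LamN n" using lamN_le[of n] LamN_ge_1[of n] unfolding dN_def by linarith
  then have "real (dN n) <= 5 * real (LamN n)" by (metis of_nat_le_iff of_nat_mult of_nat_numeral)
  from mult_right_mono[OF this, of u] have du: "real (dN n) * u <= 5" using r(8,10) by (simp add: mult.assoc)
  have "2 * (1 / 2 ^ kapN n) + 3 * epsN n + real (E2N n) / real (JN n) <= u ^ 2 / 2 ^ 15"
  proof -
    have "2 * (w / 2 ^ 18) + 3 * (v / 2 ^ 30) + w / 2 ^ 17 <= w / 2 ^ 15" if "v <= w" "0 <= w" for v w :: real using that by simp
    from this[OF u2(2,4)] show ?thesis unfolding r(4) r(3) r(1) .
  qed
  then have "16 * (2 * (1 / 2 ^ kapN n) + 3 * epsN n + real (E2N n) / real (JN n)) * real (dN n) <= 16 * (u ^ 2 / 2 ^ 15) * real (dN n)"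
    by (intro mult_right_mono mult_left_mono) auto
  also have "\<dots> = (real (dN n) * u) * u / 2 ^ 11" by (simp add: power2_eq_square)
  also have "\<dots> <= 5 * u / 2 ^ 11" using du r(8) by (intro divide_right_mono mult_right_mono) auto
  finally have mid: "16 * (2 / 2 ^ kapN n + 3 * epsN n + real (E2N n) / real (JN n)) * real (dN n) <= 5 * u / 2 ^ 11" by simp
  have "1 / real (QN n) + 4 * epsN n <= u / 2 ^ 11" unfolding r(6) r(1) using u2 r(8) by simp
  then have eta: "eta <= u / 2 ^ 7" unfolding eta_def using leaf mid r(8) by simp
  have "0 <= leaf_error" unfolding leaf_error_def using eps_pos by (intro add_nonneg_nonneg) auto
  then have eta0: "0 <= eta" unfolding eta_def using eps_pos by (intro add_nonneg_nonneg mult_nonneg_nonneg) auto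
  have "(real tmax + 1) * eta <= (real tmax + 1) * (u / 2 ^ 7)" using eta by (intro mult_left_mono) auto
  also have "\<dots> = (real tmax * u + u) / 2 ^ 7" by (simp add: distrib_right add_divide_distrib)
  finally have "(real tmax + 1) * eta + leaf_error <= 1" using Tu r(9) leaf by simp
  from av_approx[OF this, of tmax 0 "int n" lo hi] lohi
  have "\<bar>avw \<omega> tmax (0, int n, lo, hi) / real (JN n * QN n) - lisb F (0, int n, lo, hi)\<bar> \<le>
      320 / (real tmax + 320) * (real (card (pts F (0, int n, lo, hi))) - lisb F (0, int n, lo, hi)) + (real tmax + 1) * eta * real n"
    by simp
  moreover have "320 / (real tmax + 320) * (real (card (pts F (0, int n, lo, hi))) - lisb F (0, int n, lo, hi)) \<le>
      \<tau> * (real (card (pts F (0, int n, lo, hi))) - lisb F (0, int n, lo, hi))"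
  proof (rule mult_right_mono)
    have "320 <= \<tau> * (real tmax + 320)" using tmax(1) \<tau> by (simp add: field_simps)
    then show "320 / (real tmax + 320) <= \<tau>" by (simp add: field_simps)
    show "0 <= real (card (pts F (0, int n, lo, hi))) - lisb F (0, int n, lo, hi)"
      using lisb_le_card[of F "(0, int n, lo, hi)"] by simp
  qed
  moreover have "(real tmax + 1) * eta * real n <= 5 / (\<tau> * log 2 (real n)) * real n"
  proof (rule mult_right_mono)
    have "real tmax + 1 <= 322 / \<tau>" using tmax(2) \<tau> by (simp add: field_simps)
    then have "(real tmax + 1) * eta <= 322 / \<tau> * (u / 2 ^ 7)" using eta eta0 \<tau> by (intro mult_mono) auto
    also have "\<dots> <= 322 / \<tau> * (1 / log 2 (real n) / 2 ^ 7)"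
    proof (intro mult_left_mono divide_right_mono)
      show "u <= 1 / log 2 (real n)" unfolding u_def using lam by (intro divide_left_mono) auto
    qed (use \<tau> in auto)
    also have "\<dots> <= 5 / (\<tau> * log 2 (real n))" using \<tau> lam(5) by (simp add: field_simps)
    finally show "(real tmax + 1) * eta <= 5 / (\<tau> * log 2 (real n))" .
  qed simp
  ultimately show ?thesis by linarith
qed

text \<open>With \<open>E = exp L\<close>, which exceeds both \<open>n\<close> and \<open>L\<close>,
  the numbers of events are at most constant multiples of \<open>E ^ 6\<close>. Including constants
  they contribute \<open>exp (18 * L)\<close>, while every event has probability at most
  \<open>2 * exp (- 2048 * L ^ 2)\<close>. What remains is below \<open>exp (- L ^ 2)\<close>, and
  \<open>L ^ 2\<close> is at least \<open>log 2 n * ln n\<close>.\<close>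

theorem good_seeds:
  assumes n: "2 <= n" and V: "card Vals <= n + 2" and T: "tmax <= 65 * LamN n"
  shows "1 - real n powr (- log 2 (real n)) \<le>
    measure_pmf.prob (seed_pmf n tmax) ({\<omega>. counts_ok \<omega> \<and> levels_ok \<omega>} \<inter> set_pmf (seed_pmf n tmax))"
proof -
  let ?M = "seed_pmf n tmax"
  define L where "L = real (LamN n)"
  define E where "E = exp L"
  note lam = real_lam_bounds[OF n, folded L_def]
  have L: "L <= E" unfolding E_def using exp_ge_add_one_self[of L] by linarith
  have E2: "2 <= E" unfolding E_def using exp_ge_add_one_self[of L] lam(2) by linarith
  have "(2 :: real) ^ lamN n <= exp 1 ^ lamN n" using exp_ge_add_one_self[of "1 :: real"] by (intro power_mono) auto
  also have "\<dots> = exp (real (lamN n))" by (simp add: exp_of_nat_mult[of _ 1, simplified])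
  also have "\<dots> <= E" using lam(3) by (simp add: E_def)
  finally have nE: "real n <= E" using lam(4) by linarith
  let ?e = "2 * exp (- 2 * real J * (epsN n)\<^sup>2)"
  let ?X = "real ((lamN n + 1) * (n + 1) * (n ^ 4 + 1))" and ?Y = "real (tmax * (n + 1) * (n + 1) * card Vals * card Vals)"
  have "?X = (real (lamN n) + 1) * (real n + 1) * (real n ^ 4 + 1)"
    by (simp only: of_nat_mult of_nat_add of_nat_power of_nat_1)
  also have "\<dots> <= (2 * E) * (2 * E) * (2 * E ^ 4)"
  proof (intro mult_mono)
    show "real (lamN n) + 1 <= 2 * E" "real n + 1 <= 2 * E" using lam L E2 nE by linarith+
    have "real n ^ 4 <= E ^ 4" "1 <= E ^ 4" using nE E2 by (auto intro: power_mono one_le_power)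
    then show "real n ^ 4 + 1 <= 2 * E ^ 4" by linarith
  qed (use E2 in auto)
  also have "\<dots> = 8 * E ^ 6" by (simp add: power_numeral_reduce)
  finally have X: "?X <= 8 * E ^ 6" .
  have "?Y = real tmax * (real n + 1) * (real n + 1) * real (card Vals) * real (card Vals)"
    by (simp only: of_nat_mult of_nat_add of_nat_1)
  also have "\<dots> <= (65 * E) * (2 * E) * (2 * E) * (2 * E) * (2 * E)"
  proof (intro mult_mono)
    have "real tmax <= 65 * L" using T unfolding L_def by (metis of_nat_le_iff of_nat_mult of_nat_numeral)
    then show "real tmax <= 65 * E" using L by linarith
    show "real n + 1 <= 2 * E" "real n + 1 <= 2 * E" using E2 nE by linarith+
    have "real (card Vals) <= real (n + 2)" using V by (simp only: of_nat_le_iff)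
    then show "real (card Vals) <= 2 * E" "real (card Vals) <= 2 * E" using E2 nE by simp_all
  qed (use E2 in auto)
  also have "\<dots> = 1040 * E ^ 5" by (simp add: power_numeral_reduce)
  also have "\<dots> <= 1040 * E ^ 6" using E2 by (intro mult_left_mono power_increasing) auto
  finally have Y: "?Y <= 1040 * E ^ 6" .
  have e: "- 2 * real J * (epsN n)\<^sup>2 = - (2048 * L ^ 2)" using param_ratios(7)[of n] by (simp add: L_def mult.assoc)
  have "?X + ?Y <= 8 * E ^ 6 + 1040 * E ^ 6" by (rule add_mono[OF X Y])
  also have "\<dots> <= 2048 * E ^ 6" using E2 by simp
  finally have "(?X + ?Y) * ?e <= 2048 * E ^ 6 * ?e" by (rule mult_right_mono) simp
  also have "\<dots> = 2048 * E ^ 6 * (2 * exp (- (2048 * L ^ 2)))" unfolding e ..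
  also have "\<dots> = 2 ^ 12 * E ^ 6 * exp (- (2048 * L ^ 2))" by simp
  also have "\<dots> <= E ^ 12 * E ^ 6 * exp (- (2048 * L ^ 2))" using E2 by (intro mult_right_mono power_mono) auto
  also have "E ^ 12 * E ^ 6 = exp (18 * L)"
    using exp_of_nat_mult[of 18 L] power_add[of E 12 6] by (simp add: E_def)
  also have "exp (18 * L) * exp (- (2048 * L ^ 2)) = exp (18 * L - 2048 * L ^ 2)" by (simp flip: exp_add)
  also have "\<dots> <= exp (- (log 2 (real n) * ln (real n)))"
  proof -
    have "ln (real n) <= L" using nE n unfolding E_def using ln_le_cancel_iff[of "real n" "exp L"] by simp
    then have "log 2 (real n) * ln (real n) <= L * L" using lam n by (intro mult_mono) auto
    moreover have "L * 1 <= L * L" using lam by (intro mult_left_mono) auto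
    moreover have "0 <= L * L" by simp
    ultimately have "18 * L - 2048 * (L * L) <= - (log 2 (real n) * ln (real n))" by linarith
    then show ?thesis by (simp add: power2_eq_square)
  qed
  also have "\<dots> = real n powr (- log 2 (real n))" using n by (simp add: powr_def)
  finally have bound: "(?X + ?Y) * ?e <= real n powr (- log 2 (real n))" .
  let ?B = "{\<omega>. \<not> counts_ok \<omega>} \<union> ({\<omega>. \<not> levels_ok \<omega>} \<inter> set_pmf ?M)"
  have "measure_pmf.prob ?M ?B <= measure_pmf.prob ?M {\<omega>. \<not> counts_ok \<omega>} + measure_pmf.prob ?M ({\<omega>. \<not> levels_ok \<omega>} \<inter> set_pmf ?M)"
    by (rule measure_Un_le) auto
  also have "\<dots> <= (?X + ?Y) * ?e" using add_mono[OF prob_not_counts_ok prob_not_levels_ok] by (simp only: distrib_right)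
  finally have "measure_pmf.prob ?M ?B <= real n powr (- log 2 (real n))" using bound by linarith
  then have "1 - real n powr (- log 2 (real n)) <= measure_pmf.prob ?M (- ?B)"
    using measure_pmf.prob_compl[of ?B ?M] by (simp add: Compl_eq_Diff_UNIV)
  also have "\<dots> = measure_pmf.prob ?M (- ?B \<inter> set_pmf ?M)" by (simp add: measure_Int_set_pmf)
  also have "\<dots> <= measure_pmf.prob ?M ({\<omega>. counts_ok \<omega> \<and> levels_ok \<omega>} \<inter> set_pmf ?M)"
    by (rule measure_pmf.finite_measure_mono) auto
  finally show ?thesis .
qed

end

text \<open>The link between boxes and the original problem: all points of the array lie in the root
  box, so that its number of points minus \<open>lisb\<close> is the loss. Sorting turns an index
  set into a list of indices. The lower value bound is 0 because this is the initial content of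
  memory.\<close>

lemma lis_eq_lisb:
  assumes f: "is_array n vb f"
  shows "lisb (query n f) (0, int n, 0, int vb) = lis n f" "card (pts (query n f) (0, int n, 0, int vb)) = n"
proof -
  let ?F = "query n f" and ?B = "(0, int n, 0, int vb)"
  have q: "?F x = int (f (nat x))" if "1 <= x" "x <= int n" for x using that by (simp add: query_def)
  have p: "pts ?F ?B = {1..int n}"
  proof -
    have "int (f (nat x)) <= int vb" if "1 <= x" "x <= int n" for x
      using f that unfolding is_array_def by (force simp: image_subset_iff)
    then show ?thesis by (auto simp: pts_def q)
  qed
  show "card (pts ?F ?B) = n" by (simp add: p)
  let ?A = "{length js |js. increasing_subseq n f js}"
  have len: "length js <= n" if "increasing_subseq n f js" for js
  proof -
    have "distinct js" "set js \<subseteq> {1..n}" using that strict_sorted_iff unfolding increasing_subseq_def by auto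
    then show ?thesis using card_mono[of "{1..n}" "set js"] by (simp add: distinct_card)
  qed
  have fin: "finite ?A" by (rule finite_subset[of _ "{..n}"]) (use len in auto)
  have "increasing_subseq n f []" by (simp add: increasing_subseq_def)
  then have ne: "?A \<noteq> {}" by blast
  show "lisb ?F ?B = lis n f"
  proof (rule antisym)
    obtain S where S: "S \<subseteq> pts ?F ?B" "mono_on S ?F" "card S = lisb ?F ?B" by (rule lisb_attained)
    define js where "js = sorted_list_of_set (nat ` S)"
    have fS: "finite S" by (rule finite_subset[OF S(1) finite_pts])
    have S1: "1 <= x" "x <= int n" if "x \<in> S" for x using S(1) that unfolding p by auto
    have set: "set js = nat ` S" using fS by (simp add: js_def)
    have srt: "sorted_wrt (<) js" unfolding js_def by simp
    have "f y <= f z" if "y \<in> set js" "z \<in> set js" "y < z" for y z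
    proof -
      obtain a b where ab: "a \<in> S" "b \<in> S" "y = nat a" "z = nat b" using \<open>y \<in> set js\<close> \<open>z \<in> set js\<close> unfolding set by auto
      then have "?F a <= ?F b" using S(2) \<open>y < z\<close> by (intro mono_onD[OF S(2)]) auto
      then show ?thesis using ab S1[OF ab(1)] S1[OF ab(2)] by (simp add: q)
    qed
    then have "sorted_wrt (\<lambda>y z. f y <= f z) js" by (intro sorted_wrt_mono_rel[OF _ srt]) blast
    moreover have "set js \<subseteq> {1..n}" unfolding set using S1 by force
    ultimately have "increasing_subseq n f js" using srt by (simp add: increasing_subseq_def sorted_wrt_map)
    then have "length js \<in> ?A" by blast
    from Max_ge[OF fin this] have "length js <= lis n f" unfolding lis_def .
    moreover have "length js = card S"
    proof -
      have "inj_on nat S" by (rule inj_onI) (use S1 in force)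
      then show ?thesis by (simp add: js_def card_image)
    qed
    ultimately show "lisb ?F ?B <= lis n f" using S(3) by simp
  next
    have "lis n f \<in> ?A" unfolding lis_def by (rule Max_in[OF fin ne])
    then obtain js where js: "increasing_subseq n f js" "lis n f = length js" by blast
    have d: "distinct js" "set js \<subseteq> {1..n}" using js(1) strict_sorted_iff unfolding increasing_subseq_def by auto
    have "sorted_wrt (\<lambda>y z. y < z \<and> f y <= f z) js"
      using js(1) unfolding increasing_subseq_def by (auto simp: sorted_wrt_map sorted_wrt_iff_nth_less)
    then have lt: "js ! i < js ! j \<and> f (js ! i) <= f (js ! j)" if "i < j" "j < length js" for i j
      using that unfolding sorted_wrt_iff_nth_less by blast
    have m: "f y <= f z" if yz: "y \<in> set js" "z \<in> set js" "y <= z" for y z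
    proof -
      obtain i j where ij: "i < length js" "y = js ! i" "j < length js" "z = js ! j" using yz unfolding in_set_conv_nth by blast
      consider "i < j" | "i = j" | "j < i" by linarith
      then show ?thesis
      proof cases
        case 3
        then show ?thesis using lt[OF 3 ij(1)] yz(3) ij by simp
      qed (use ij lt[of i j] in auto)
    qed
    have "card (int ` set js) <= lisb ?F ?B"
    proof (rule lisb_ge)
      show "int ` set js \<subseteq> pts ?F ?B" using d(2) unfolding p by auto
      show "mono_on (int ` set js) ?F"
      proof (rule mono_onI)
        fix r s assume "r \<in> int ` set js" "s \<in> int ` set js" "r <= s"
        then obtain y z where "r = int y" "s = int z" "y \<in> set js" "z \<in> set js" "y <= z" by auto
        then show "?F r <= ?F s" using m d(2) by (auto simp: q subset_iff)
      qed
    qed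
    moreover have "card (int ` set js) = length js" using d(1) by (simp add: card_image distinct_card)
    ultimately show "lis n f <= lisb ?F ?B" using js(2) by simp
  qed
qed

lemma keeps_init_params: "keeps {1,5,7,8,15} m (init_params x m)"
  unfolding init_params_def by (intro keeps_upd keeps_refl; simp)

lemma keeps_put_seeds: "keeps {3,15} m (put_seeds n \<omega> m)"
  by (simp add: keeps_def ar_put_seeds)

definition start_mem :: "ctx => nat => mem" where "start_mem x vb = (\<lambda>_. 0)(0 := int (len x), 1 := int vb)"

definition out_com :: com where "out_com = Seq (Store (Num 0) (Load (Num 9))) (Store (Num 1) (Load (Num 47)))"

text \<open>If the test \<open>5 < lamN * \<tau>\<close> fails, the permitted additive error is at
  least \<open>n\<close>, and the answer 0 is good enough. The commands \<open>cB\<close> and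
  \<open>cC\<close> are parameters because the compiled parts are only known to exist.\<close>

definition lis_com :: "com => com => com" where
  "lis_com cB cC = Seq (Store (Num 17) (Load (Num 0))) (Seq log_com (If (Param_less (Num 5) (Load (Num 33)))
     (Seq cB (Seq seed_loop (Seq cC out_com))) (Seq (Store (Num 0) (Num 0)) (Store (Num 1) (Num 1)))))"

lemma ar_start_mem: "0 < r ==> r < 16 ==> ar (start_mem x vb) r i = (if r = 1 \<and> i = 0 then int vb else 0)"
proof -
  assume r: "0 < r" "r < 16"
  have "(16 * i + int r) mod 16 = int r" using r by simp
  then have z: "16 * i + int r = c ==> c mod 16 = int r" for c by (simp only:)
  have "16 * i + int r \<noteq> 0" using z[of 0] r by auto
  moreover have "16 * i + int r = 1 \<longleftrightarrow> r = 1 \<and> i = 0" using z[of 1] by auto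
  ultimately show ?thesis by (simp add: ar_def start_mem_def)
qed

lemma start_phase:
  obtains m where "\<And>T. csteps x (4 * lamN (len x) + 10 + T) ([lis_com cB cC], start_mem x vb) =
      csteps x T ([If (Param_less (Num 5) (Load (Num 33))) (Seq cB (Seq seed_loop (Seq cC out_com)))
        (Seq (Store (Num 0) (Num 0)) (Store (Num 1) (Num 1)))], m)"
    "m 33 = int (lamN (len x))" "ar m 1 0 = int vb" "ar m 1 1 = int (len x)"
    "\<And>r i. 1 < r ==> r < 16 ==> ar m r i = 0"
proof -
  let ?m1 = "upd 1 1 (int (len x)) (start_mem x vb)"
  have 1: "runs x (Store (Num 17) (Load (Num 0))) (start_mem x vb) 1 ?m1"
    using runs_Store[of x "Num 17" "Load (Num 0)" "start_mem x vb"] by (simp add: upd_def start_mem_def)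
  have "ar ?m1 1 1 = int (len x)" by (simp add: ar_upd)
  from runs_log_com[OF this] obtain m where m: "runs x log_com ?m1 (4 * lamN (len x) + 7) m"
    "agree 0 (upd 1 2 (int (lamN (len x))) ?m1) m" by blast
  have a: "ar m r i = ar (upd 1 2 (int (lamN (len x))) ?m1) r i" if "0 < r" "r < 16" for r i
    using agree_ar[OF m(2) that] by simp
  show ?thesis
  proof (rule that[of m])
    fix T
    have "4 * lamN (len x) + 10 + T = Suc 1 + (Suc (4 * lamN (len x) + 7) + T)" by simp
    then show "csteps x (4 * lamN (len x) + 10 + T) ([lis_com cB cC], start_mem x vb) =
      csteps x T ([If (Param_less (Num 5) (Load (Num 33))) (Seq cB (Seq seed_loop (Seq cC out_com)))
        (Seq (Store (Num 0) (Num 0)) (Store (Num 1) (Num 1)))], m)"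
      by (simp only: lis_com_def csteps_Seq[OF 1] csteps_Seq[OF m(1)])
    have "m 33 = ar m 1 2" by (simp add: ar_def)
    also have "\<dots> = int (lamN (len x))" using a[of 1 2] by (simp add: ar_upd)
    finally show "m 33 = int (lamN (len x))" .
    show "ar m 1 0 = int vb" "ar m 1 1 = int (len x)" using a[of 1] by (simp_all add: ar_upd ar_start_mem)
    show "ar m r i = 0" if "1 < r" "r < 16" for r i using a[of r i] that by (simp add: ar_upd ar_start_mem)
  qed
qed

lemma trivial_run:
  assumes "\<not> 5 < real (lamN (len x)) * par x"
  shows "\<exists>m. csteps x (4 * lamN (len x) + 20) ([lis_com cB cC], start_mem x vb) = return_pmf ([], m) \<and> output_value ([], m) = 0"
proof -
  obtain m where m: "\<And>T. csteps x (4 * lamN (len x) + 10 + T) ([lis_com cB cC], start_mem x vb) =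
      csteps x T ([If (Param_less (Num 5) (Load (Num 33))) (Seq cB (Seq seed_loop (Seq cC out_com)))
        (Seq (Store (Num 0) (Num 0)) (Store (Num 1) (Num 1)))], m)" "m 33 = int (lamN (len x))"
    by (rule start_phase[of x cB cC vb]) (rule that; assumption)
  have "runs x (Seq (Store (Num 0) (Num 0)) (Store (Num 1) (Num 1))) m (Suc (1 + 1)) (m(0 := 0, 1 := 1))"
    using runs_Seq[OF runs_Store[of x "Num 0" "Num 0" m] runs_Store[of x "Num 1" "Num 1"]] by simp
  then have "runs x (If (Param_less (Num 5) (Load (Num 33))) (Seq cB (Seq seed_loop (Seq cC out_com)))
        (Seq (Store (Num 0) (Num 0)) (Store (Num 1) (Num 1)))) m (Suc (Suc (1 + 1))) (m(0 := 0, 1 := 1))"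
    using assms m(2) by (intro runs_If) simp
  from runs_within[OF this, of 10] have "csteps x (4 * lamN (len x) + 10 + 10) ([lis_com cB cC], start_mem x vb) =
      return_pmf ([], m(0 := 0, 1 := 1))" unfolding m(1) by simp
  moreover have e: "4 * lamN (len x) + 20 = 4 * lamN (len x) + 10 + 10" by simp
  ultimately show ?thesis unfolding e by (intro exI[of _ "m(0 := 0, 1 := 1)"]) (simp only: output_value_def, simp)
qed

lemma finish_run:
  assumes C: "transforms okB 0 finish cC qC" and M: "okB x M"
  shows "\<exists>m. csteps x (timeN x ^ qC + 4) ([Seq cC out_com], M) = return_pmf ([], m) \<and>
    output_value ([], m) = real_of_int (ar (backward x (forward x M)) 9 0) / real (JN (len x) * QN (len x))"
proof -
  obtain t m where t: "t <= timeN x ^ qC" "runs x cC M t m" "agree 0 (finish x M) m"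
    using transformsD[OF C, OF M] by blast
  let ?m = "(m(0 := m 9))(1 := m 47)"
  have "runs x out_com m (Suc (1 + 1)) ?m" unfolding out_com_def
    using runs_Seq[OF runs_Store[of x "Num 0" "Load (Num 9)" m] runs_Store[of x "Num 1" "Load (Num 47)"]] by simp
  from runs_within[OF runs_Seq[OF t(2) this], of "timeN x ^ qC + 4"] t(1)
  have "csteps x (timeN x ^ qC + 4) ([Seq cC out_com], M) = return_pmf ([], ?m)" by simp
  moreover have "m 9 = ar (finish x M) 9 0" "m 47 = ar (finish x M) 15 2"
    using agree_ar[OF t(3), of 9 0] agree_ar[OF t(3), of 15 2] by (simp_all add: ar_def)
  then have "output_value ([], ?m) = real_of_int (ar (backward x (forward x M)) 9 0) / real (JN (len x) * QN (len x))"
    by (simp add: output_value_def finish_def ar_upd)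
  ultimately show ?thesis by blast
qed

lemma main_run:
  assumes B: "transforms prm 0 prepare cB qB" and C: "transforms okB 0 finish cC qC"
    and par: "0 < par x" "5 < real (lamN (len x)) * par x"
  shows "\<exists>t m. t <= 4 * lamN (len x) + timeN x ^ qB + 4 * seedN x + timeN x ^ qC + 20 \<and>
    csteps x t ([lis_com cB cC], start_mem x vb) = map_pmf (\<lambda>\<omega>. ([], m \<omega>)) (seed_pmf (len x) (levels x)) \<and>
    (\<forall>\<omega>\<in>set_pmf (seed_pmf (len x) (levels x)). output_value ([], m \<omega>) =
      real_of_int (grid.av (Fq x) (seeds_of (len x) \<omega> 0) (JN (len x)) (kapN (len x)) (int (E1N (len x))) (int (E2N (len x)))
        (\<lambda>t. seeds_of (len x) \<omega> (Suc t)) (QN (len x)) (dN (len x)) (levels x) (0, int (len x), 0, int vb)) / real (JN (len x) * QN (len x)))"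
proof -
  obtain m2 where 2: "\<And>T. csteps x (4 * lamN (len x) + 10 + T) ([lis_com cB cC], start_mem x vb) =
      csteps x T ([If (Param_less (Num 5) (Load (Num 33))) (Seq cB (Seq seed_loop (Seq cC out_com)))
        (Seq (Store (Num 0) (Num 0)) (Store (Num 1) (Num 1)))], m2)" "m2 33 = int (lamN (len x))"
    "ar m2 1 0 = int vb" "ar m2 1 1 = int (len x)" "\<And>r i. 1 < r ==> r < 16 ==> ar m2 r i = 0"
    by (rule start_phase[of x cB cC vb]) (rule that; assumption)
  have If: "csteps x (Suc T) ([If (Param_less (Num 5) (Load (Num 33))) (Seq cB (Seq seed_loop (Seq cC out_com)))
        (Seq (Store (Num 0) (Num 0)) (Store (Num 1) (Num 1)))], m2) = csteps x T ([Seq cB (Seq seed_loop (Seq cC out_com))], m2)" for T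
    using 2(2) par by (simp add: csteps_def bind_return_pmf)
  have prm: "prm x m2" using 2 par by (simp add: prm_def) (simp add: ar_def)
  obtain t3 m3 where 3: "t3 <= timeN x ^ qB" "runs x cB m2 t3 m3" "agree 0 (prepare x m2) m3"
    using transformsD[OF B, OF prm] by blast
  have m3: "ar m3 r i = ar (prepare x m2) r i" if "0 < r" "r < 16" for r i using agree_ar[OF 3(3) that] by simp
  note iv = init_params_val[OF prm] and sv = set_bounds_val[where x = x and m = "init_params x m2"]
  have p: "ar m3 r i = ar (init_params x m2) r i" if "0 < r" "r < 16" "r \<noteq> 2" "r \<noteq> 14" for r i
    using m3[OF that(1,2)] keepsD[OF sv(1) that(2)] that by (simp add: prepare_def)
  have okB3: "okB x m3"
  proof (rule local_predD[OF ok_local(2) _ 3(3)])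
    show "okB x (prepare x m2)" unfolding prepare_def using okB_keeps[OF sv(1) _ iv(1)] by simp
  qed
  let ?N = "seedN x"
  have N: "ar m3 15 0 = 0" "ar m3 15 1 = int ?N" using p iv by simp_all
  have "seed_pmf (len x) (levels x) = Pi_pmf {..<?N} 0 (\<lambda>i. uniform_below (ar m3 2 (int i)))"
    unfolding seed_pmf_def seedN_def[symmetric]
    by (rule Pi_pmf_cong) (auto simp: m3 prepare_def sv(2) boundN_def seed_bound_def)
  note pmf = this
  define R where "R \<omega> m \<longleftrightarrow> csteps x (timeN x ^ qC + 4) ([Seq cC out_com], put_seeds ?N \<omega> m3) = return_pmf ([], m) \<and>
     output_value ([], m) = real_of_int (grid.av (Fq x) (seeds_of (len x) \<omega> 0) (JN (len x)) (kapN (len x)) (int (E1N (len x))) (int (E2N (len x)))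
        (\<lambda>t. seeds_of (len x) \<omega> (Suc t)) (QN (len x)) (dN (len x)) (levels x) (0, int (len x), 0, int vb)) / real (JN (len x) * QN (len x))" for \<omega> and m :: mem
  have fin: "\<exists>m. R \<omega> m"
    if w: "\<omega> \<in> set_pmf (seed_pmf (len x) (levels x))" for \<omega>
  proof -
    let ?M = "put_seeds ?N \<omega> m3"
    have M: "ar ?M r i = ar (init_params x m2) r i" if "0 < r" "r < 16" "r \<notin> {2,3,14,15}" for r i
      using keepsD[OF keeps_put_seeds[of m3 ?N \<omega>], of r i] p[of r i] that by simp
    have ok: "okB x ?M" using okB_keeps[OF keeps_put_seeds _ okB3] by simp
    have root: "ar ?M 8 0 = int (levels x)" using M[of 8 0] iv(3) by simp
    have box: "bx ?M 0 = (0, int (len x), 0, int vb)"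
      using iv(2) 2(3) 2(5)[of 6 0] M[of 4 0] M[of 5 0] M[of 6 0] M[of 7 0] by (simp add: bx_def)
    \<comment> \<open>Beyond the seeds that are drawn, both the product distribution and array 3
      have the value 0. Hence the seeds in memory agree with \<open>\<omega>\<close> at all
      indices.\<close>
    have z: "\<omega> i = 0" if "\<not> i < ?N" for i
      using w that unfolding pmf by (subst (asm) set_Pi_pmf) (auto simp: PiE_dflt_def)
    have z3: "ar m3 3 i = 0" for i
      using p[of 3 i] keepsD[OF keeps_init_params[of m2 x], of 3 i] 2(5)[of 3 i] by simp
    have sd: "seeds x ?M l = seeds_of (len x) \<omega> l" for l
    proof (intro ext)
      fix k j
      let ?i = "(l * (lamN (len x) + 1) + k) * JN (len x) + j"
      have "ar ?M 3 (int i) = \<omega> i" for i by (cases "i < ?N") (simp_all add: ar_put_seeds z z3)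
      then show "seeds x ?M l k j = seeds_of (len x) \<omega> l k j" by (simp only: seeds_def seeds_of_def)
    qed
    show ?thesis using finish_run[OF C ok] unfolding estimate_val[OF root] box sd R_def .
  qed
  then have "\<forall>\<omega>\<in>set_pmf (seed_pmf (len x) (levels x)). \<exists>m. R \<omega> m" by blast
  from bchoice[OF this] obtain m where "\<forall>\<omega>\<in>set_pmf (seed_pmf (len x) (levels x)). R \<omega> (m \<omega>)" ..
  then have m: "R \<omega> (m \<omega>)" if "\<omega> \<in> set_pmf (seed_pmf (len x) (levels x))" for \<omega> using that by blast
  note m1 = conjunct1[OF m[unfolded R_def]] and m2 = conjunct2[OF m[unfolded R_def]]
  let ?t = "4 * lamN (len x) + 10 + Suc (Suc t3 + (4 * ?N + 2 + (timeN x ^ qC + 4)))"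
  have "csteps x ?t ([lis_com cB cC], start_mem x vb) =
    bind_pmf (seed_pmf (len x) (levels x)) (\<lambda>\<omega>. csteps x (timeN x ^ qC + 4) ([Seq cC out_com], put_seeds ?N \<omega> m3))"
    by (simp only: 2(1) If csteps_Seq[OF 3(2)] csteps_seed_loop[OF N] pmf)
  also have "\<dots> = map_pmf (\<lambda>\<omega>. ([], m \<omega>)) (seed_pmf (len x) (levels x))"
    unfolding map_pmf_def by (rule bind_pmf_cong) (simp_all add: m1)
  finally have "csteps x ?t ([lis_com cB cC], start_mem x vb) = map_pmf (\<lambda>\<omega>. ([], m \<omega>)) (seed_pmf (len x) (levels x))" .
  moreover have "?t <= 4 * lamN (len x) + timeN x ^ qB + 4 * seedN x + timeN x ^ qC + 20" using 3(1) by simp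
  ultimately show ?thesis by (intro exI[of _ ?t] exI[of _ m] conjI ballI m2)
qed

text \<open>For \<open>n\<close> at least 3, \<open>y = log 2 n\<close> is at least 3/2, so that
  \<open>y ^ 6\<close> exceeds 8 and \<open>2 * LamN n <= 8 * y <= y ^ 7\<close>. Since
  \<open>levels x + 1\<close> is at most \<open>322 / \<tau>\<close>, the exponent is at most
  \<open>7 * 322 * q / \<tau>\<close>, and 2254 is 7 * 322. The summand 1 makes the constant
  positive even for \<open>q = 0\<close>.\<close>

lemma timeN_le:
  assumes n: "3 <= len x" and par: "0 < par x" "par x < 1"
  shows "real (timeN x ^ q) <= log 2 (real (len x)) powr ((2254 * real q + 1) / par x)"
proof -
  let ?n = "len x"
  define y where "y = log 2 (real ?n)"
  have n0: "0 < real ?n" using n by simp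
  have "(8 :: real) <= real ?n ^ 2" using power_mono[of 3 "real ?n" 2] n by simp
  then have "log 2 8 <= log 2 (real ?n ^ 2)" using n0 by (subst log_le_cancel_iff) auto
  moreover have "log 2 (8 :: real) = 3" using log_pow_cancel[of "2 :: real" 3] by simp
  moreover have "log 2 (real ?n ^ 2) = 2 * y" using n0 by (simp add: y_def log_nat_power)
  ultimately have y: "3 / 2 <= y" by simp
  have "2 ^ lamN ?n <= 2 * int ?n" unfolding lamN_def by (rule two_power_clog_le) (use n in simp)
  then have "real_of_int (2 ^ lamN ?n) <= real_of_int (2 * int ?n)" by (simp only: of_int_le_iff)
  then have "(2 :: real) ^ lamN ?n <= 2 * real ?n" by simp
  then have "log 2 (2 ^ lamN ?n) <= log 2 (2 * real ?n)" using n0 by (subst log_le_cancel_iff) auto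
  then have lam: "real (lamN ?n) <= 1 + y" using n0 by (simp add: y_def log_mult)
  have "0 < lamN ?n" using real_lam_bounds(1,5)[of ?n] n by (intro ccontr[of "0 < lamN ?n"]) auto
  then have "2 ^ rhoN ?n <= 2 * int (lamN ?n)" unfolding rhoN_def by (intro two_power_clog_le) simp
  then have "real_of_int (2 ^ rhoN ?n) <= real_of_int (2 * int (lamN ?n))" by (simp only: of_int_le_iff)
  then have "real (LamN ?n) <= 2 * real (lamN ?n)" unfolding LamN_def by simp
  then have "real (2 * LamN ?n) <= y * 8" using lam y by simp
  also have "\<dots> <= y * y ^ 6" using power_mono[of "3 / 2" y 6] y by (intro mult_left_mono) (auto simp: power_divide)
  finally have Lam: "real (2 * LamN ?n) <= y ^ 7" by (simp flip: power_Suc)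
  have lv: "real (levels x + 1) <= 322 / par x"
  proof -
    have "real (nat \<lfloor>320 / par x\<rfloor>) <= 320 / par x" using par by simp
    moreover have "320 / par x + 2 <= 322 / par x" using par by (simp add: field_simps)
    ultimately show ?thesis by (simp add: levels_def)
  qed
  have "real (timeN x ^ q) = real (2 * LamN ?n) ^ ((levels x + 1) * q)" 
    by (simp only: timeN_def of_nat_power power_mult)
  also have "\<dots> <= (y ^ 7) ^ ((levels x + 1) * q)" using Lam by (intro power_mono) auto
  also have "\<dots> = y ^ (7 * ((levels x + 1) * q))" by (rule power_mult[symmetric])
  also have "\<dots> = y powr real (7 * ((levels x + 1) * q))" using y by (subst powr_realpow) auto
  also have "real (7 * ((levels x + 1) * q)) = 7 * real q * real (levels x + 1)"
    by (simp only: of_nat_mult of_nat_numeral mult_ac)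
  also have "y powr (7 * real q * real (levels x + 1)) <= y powr ((2254 * real q + 1) / par x)"
  proof (rule powr_mono)
    have "7 * real q * real (levels x + 1) <= 7 * real q * (322 / par x)" using lv by (intro mult_left_mono) auto
    also have "\<dots> <= (2254 * real q + 1) / par x" using par by (simp add: field_simps)
    finally show "7 * real q * real (levels x + 1) <= (2254 * real q + 1) / par x" .
  qed (use y in simp)
  finally show ?thesis by (simp add: y_def)
qed

lemma lis_le: "is_array n vb f ==> lis n f <= n"
  using lis_eq_lisb[of n vb f] lisb_le_card[of "query n f" "(0, int n, 0, int vb)"] by simp

text \<open>For \<open>n = 2\<close> the logarithm is 1 and so are all of its powers, which no
  running time could respect up to a constant in the exponent; the time bound therefore starts at
  3.\<close>

theorem theorem4p1:
  "\<exists>(P::com) (C::real) (c::real). C > 0 \<and> c > 0 \<and>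
     (\<forall>(n::nat) (vb::nat) (f::nat \<Rightarrow> nat) (\<tau>::real).
        n \<ge> 2 \<and> is_array n vb f \<and> 0 < \<tau> \<and> \<tau> < 1 \<longrightarrow>
        (\<exists>t::nat.
           halts_within P n vb f \<tau> t \<and>
           (n \<ge> 3 \<longrightarrow> real t \<le> log 2 (real n) powr (C / \<tau>)) \<and>
           measure_pmf.prob (output_dist P n vb f \<tau> t)
             {A. is_lis_approx n f \<tau> (5 / (\<tau> * log 2 (real n))) A}
             \<ge> 1 - real n powr (- (c * log 2 (real n)))))"
proof -
  obtain cB qB where B: "transforms prm 0 prepare cB qB" using prog_comp[OF prog_prepare order_refl] by blast
  obtain cC qC where C: "transforms okB 0 finish cC qC" using prog_comp[OF prog_finish order_refl] by blast
  obtain qN where qN: "\<And>x. seedN x <= timeN x ^ qN" using small_seedN[of "\<lambda>x m. True"] unfolding small_def by blast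
  have lamZ: "lamN (len x) <= timeN x ^ 1" for x by (rule polylog_bounded[OF params_le(1)])
  have "poly_le (\<lambda>x. 4 * timeN x ^ 1 + timeN x ^ qB + 4 * timeN x ^ qN + timeN x ^ qC + 20)" by (intro poly_intros)
  then obtain q where q: "\<And>x. 4 * timeN x ^ 1 + timeN x ^ qB + 4 * timeN x ^ qN + timeN x ^ qC + 20 <= timeN x ^ q"
    unfolding poly_le_def by blast
  let ?P = "lis_com cB cC"
  have main: "\<exists>t. halts_within ?P n vb f \<tau> t \<and> t <= timeN (Ctx n f \<tau>) ^ q \<and>
      1 - real n powr (- (1 * log 2 (real n))) <= measure_pmf.prob (output_dist ?P n vb f \<tau> t)
             {A. is_lis_approx n f \<tau> (5 / (\<tau> * log 2 (real n))) A}"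
    if n: "2 <= n" and f: "is_array n vb f" and \<tau>: "0 < \<tau>" "\<tau> < 1" for n vb f \<tau>
  proof -
    let ?x = "Ctx n f \<tau>"
    have run: "run ?P n vb f \<tau> t = csteps ?x t ([?P], start_mem ?x vb)" for t
      by (simp add: run_def csteps_def start_mem_def)
    note lam = real_lam_bounds[OF n]
    have loss: "real (loss n f) = real n - real (lis n f)" using lis_le[OF f] by (simp add: loss_def of_nat_diff)
    show ?thesis
    proof (cases "5 < real (lamN n) * \<tau>")
      case False
      then obtain m where m: "csteps ?x (4 * lamN n + 20) ([?P], start_mem ?x vb) = return_pmf ([], m)" "output_value ([], m) = 0"
        using trivial_run[of ?x cB cC vb, unfolded ctx.sel] by blast
      have "\<tau> * log 2 (real n) <= real (lamN n) * \<tau>" using lam(1) \<tau> by (simp add: mult.commute)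
      then have "\<tau> * log 2 (real n) <= 5" using False by linarith
      then have "1 <= 5 / (\<tau> * log 2 (real n))" using \<tau> lam(5) by (simp add: field_simps)
      then have "1 * real n <= 5 / (\<tau> * log 2 (real n)) * real n" by (intro mult_right_mono) auto
      moreover have "0 <= \<tau> * real (loss n f)" using \<tau> by simp
      moreover have "real (lis n f) <= real n" using lis_le[OF f] by simp
      ultimately have "is_lis_approx n f \<tau> (5 / (\<tau> * log 2 (real n))) 0" unfolding is_lis_approx_def by linarith
      then have "measure_pmf.prob (output_dist ?P n vb f \<tau> (4 * lamN n + 20)) {A. is_lis_approx n f \<tau> (5 / (\<tau> * log 2 (real n))) A} = 1"
        by (simp add: output_dist_def run m)
      moreover have "halts_within ?P n vb f \<tau> (4 * lamN n + 20)" by (simp add: halts_within_def run m)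
      moreover have "4 * lamN n + 20 <= timeN ?x ^ q" using q[of ?x] lamZ[of ?x] by simp
      ultimately show ?thesis by (intro exI[of _ "4 * lamN n + 20"]) simp
    next
      case True
      let ?T = "levels ?x" and ?F = "query n f"
      let ?A = "\<lambda>\<omega>. real_of_int (grid.av ?F (seeds_of n \<omega> 0) (JN n) (kapN n) (int (E1N n)) (int (E2N n))
        (\<lambda>t. seeds_of n \<omega> (Suc t)) (QN n) (dN n) ?T (0, int n, 0, int vb)) / real (JN n * QN n)"
      obtain t m where t: "t <= 4 * lamN n + timeN ?x ^ qB + 4 * seedN ?x + timeN ?x ^ qC + 20"
        "csteps ?x t ([?P], start_mem ?x vb) = map_pmf (\<lambda>\<omega>. ([], m \<omega>)) (seed_pmf n ?T)"
        "\<forall>\<omega>\<in>set_pmf (seed_pmf n ?T). output_value ([], m \<omega>) = ?A \<omega>"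
      proof -
        have "0 < par ?x" "5 < real (lamN (len ?x)) * par ?x" using \<tau> True by simp_all
        from main_run[OF B C this, of vb, unfolded ctx.sel] show ?thesis by (elim exE conjE) (rule that)
      qed
      \<comment> \<open>The values that can bound a box of the recursion: those of the array and the
        two bounds of the root box. There are at most \<open>n + 2\<close> of them, independently of
        \<open>vb\<close>.\<close>
      define Vals where "Vals = insert 0 (insert (int vb) (?F ` {1..int n}))"
      interpret seeded n ?F Vals ?T by unfold_locales (auto simp: Vals_def)
      have "card Vals <= card (?F ` {1..int n}) + 2" unfolding Vals_def by (simp add: card_insert_if)
      also have "card (?F ` {1..int n}) <= n" using card_image_le[of "{1..int n}" ?F] by simp
      finally have card: "card Vals <= n + 2" by simp
      have "?T <= 64 * lamN n + 1" using levels_le[of ?x] \<tau> True by simp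
      then have T65: "?T <= 65 * LamN n" using lamN_le[of n] LamN_ge_1[of n] by linarith
      have T: "320 / \<tau> <= real ?T" "real ?T <= 320 / \<tau> + 1"
      proof -
        have "real (nat \<lfloor>320 / \<tau>\<rfloor>) = real_of_int \<lfloor>320 / \<tau>\<rfloor>" using \<tau> by simp
        then show "320 / \<tau> <= real ?T" "real ?T <= 320 / \<tau> + 1" unfolding levels_def ctx.sel by linarith+
      qed
      let ?G = "{\<omega>. counts_ok \<omega> \<and> levels_ok \<omega>} \<inter> set_pmf (seed_pmf n ?T)"
      have good: "is_lis_approx n f \<tau> (5 / (\<tau> * log 2 (real n))) (output_value ([], m \<omega>))" if "\<omega> \<in> ?G" for \<omega>
      proof -
        have "\<bar>?A \<omega> - lisb ?F (0, int n, 0, int vb)\<bar> <= \<tau> * (real (card (pts ?F (0, int n, 0, int vb))) - lisb ?F (0, int n, 0, int vb))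
            + 5 / (\<tau> * log 2 (real n)) * real n"
          by (rule estimate_error[OF n \<tau> _ T]) (use that True in \<open>auto simp: Vals_def\<close>)
        then show ?thesis using t(3) that unfolding is_lis_approx_def loss by (simp add: lis_eq_lisb[OF f])
      qed
      have "1 - real n powr (- (1 * log 2 (real n))) <= measure_pmf.prob (seed_pmf n ?T) ?G"
        using good_seeds[OF n card T65] by simp
      also have "\<dots> <= measure_pmf.prob (seed_pmf n ?T) {\<omega>. is_lis_approx n f \<tau> (5 / (\<tau> * log 2 (real n))) (output_value ([], m \<omega>))}"
        by (rule measure_pmf.finite_measure_mono) (use good in auto)
      also have "\<dots> = measure_pmf.prob (output_dist ?P n vb f \<tau> t) {A. is_lis_approx n f \<tau> (5 / (\<tau> * log 2 (real n))) A}"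
        unfolding output_dist_def run t(2) by (simp add: vimage_def)
      finally have "1 - real n powr (- (1 * log 2 (real n))) <= \<dots>" .
      moreover have "halts_within ?P n vb f \<tau> t" unfolding halts_within_def run t(2) by auto
      moreover have "t <= timeN ?x ^ q" using t(1) q[of ?x] lamZ[of ?x] qN[of ?x] by simp
      ultimately show ?thesis by blast
    qed
  qed
  show ?thesis
  proof (rule exI[of _ ?P], rule exI[of _ "2254 * real q + 1"], rule exI[of _ 1], intro conjI allI impI)
    fix n vb :: nat and f :: "nat => nat" and \<tau> :: real
    assume *: "n \<ge> 2 \<and> is_array n vb f \<and> 0 < \<tau> \<and> \<tau> < 1"
    then obtain t where t: "halts_within ?P n vb f \<tau> t" "t <= timeN (Ctx n f \<tau>) ^ q"
      "1 - real n powr (- (1 * log 2 (real n))) <= measure_pmf.prob (output_dist ?P n vb f \<tau> t)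
             {A. is_lis_approx n f \<tau> (5 / (\<tau> * log 2 (real n))) A}" using main by blast
    have "real t <= log 2 (real n) powr ((2254 * real q + 1) / \<tau>)" if "3 <= n"
    proof -
      have "real t <= real (timeN (Ctx n f \<tau>) ^ q)" using t(2) by (simp only: of_nat_le_iff)
      also have "\<dots> <= log 2 (real n) powr ((2254 * real q + 1) / \<tau>)"
        using timeN_le[of "Ctx n f \<tau>" q, unfolded ctx.sel] that * by blast
      finally show ?thesis .
    qed
    then show "\<exists>t. halts_within ?P n vb f \<tau> t \<and> (n \<ge> 3 --> real t <= log 2 (real n) powr ((2254 * real q + 1) / \<tau>)) \<and>
        measure_pmf.prob (output_dist ?P n vb f \<tau> t) {A. is_lis_approx n f \<tau> (5 / (\<tau> * log 2 (real n))) A}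
             \<ge> 1 - real n powr (- (1 * log 2 (real n)))" using t by blast
  qed auto
qed

end
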